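(* Let $n \geq 5$ and $m \geq 3$, and let $g, h \geq 0$ be integers. If $n > m$, then there are no surjective homomorphisms $B_n(\Sigma_g) \to B_m(\Sigma_h)$.
   Context: $\Sigma_g$ is the closed oriented surface of genus $g$ (so $\Sigma_0 = S^2$), and $B_n(\Sigma_g) = \pi_1(\mathrm{UConf}_n(\Sigma_g))$ is the surface braid group, where $\mathrm{UConf}_n(\Sigma_g)$ is the configuration space of $n$ distinct unordered points of $\Sigma_g$. *)

theory Defs
  imports "HOL-Analysis.Analysis" "HOL-Homology.Homology"
begin

section \<open>The fundamental group of an abstract topological space\<close>

definition loops_at :: "'a topology \<Rightarrow> 'a \<Rightarrow> (real \<Rightarrow> 'a) set" where
  "loops_at X x = {p. pathin X p \<and> p 0 = x \<and> p 1 = x}"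

text \<open>Paths are functions on all of \<^typ>\<open>real\<close>, of which only the values on \<open>{0..1}\<close> matter:
  loops agreeing there are related by this relation.\<close>

definition loop_homotopy :: "'a topology \<Rightarrow> 'a \<Rightarrow> ((real \<Rightarrow> 'a) \<times> (real \<Rightarrow> 'a)) set" where
  "loop_homotopy X x =
     {(p, q). p \<in> loops_at X x \<and> q \<in> loops_at X x \<and>
              homotopic_with (\<lambda>r. r 0 = x \<and> r 1 = x) (top_of_set {0..1}) X p q}"

text \<open>The library's \<open>+++\<close> requires a type of class \<^class>\<open>topological_space\<close>; this is the same
  concatenation without the class constraint.\<close>

definition path_concat :: "(real \<Rightarrow> 'a) \<Rightarrow> (real \<Rightarrow> 'a) \<Rightarrow> real \<Rightarrow> 'a" where
  "path_concat p q = (\<lambda>t. if t \<le> 1/2 then p (2 * t) else q (2 * t - 1))"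

definition fundamental_group :: "'a topology \<Rightarrow> 'a \<Rightarrow> (real \<Rightarrow> 'a) set monoid" where
  "fundamental_group X x =
     \<lparr>carrier = loops_at X x // loop_homotopy X x,
      monoid.mult = (\<lambda>A B. \<Union>p\<in>A. \<Union>q\<in>B. loop_homotopy X x `` {path_concat p q}),
      one = loop_homotopy X x `` {\<lambda>_. x}\<rparr>"


section \<open>Configuration spaces and surface braid groups\<close>

definition ordered_conf :: "nat \<Rightarrow> 'a topology \<Rightarrow> (nat \<Rightarrow> 'a) topology" where
  "ordered_conf n X = subtopology (product_topology (\<lambda>_. X) {..<n}) {f. inj_on f {..<n}}"

definition quotient_topology :: "'a topology \<Rightarrow> ('a \<Rightarrow> 'b) \<Rightarrow> 'b topology" where
  "quotient_topology X f =
     topology (\<lambda>U. U \<subseteq> f ` topspace X \<and> openin X {x \<in> topspace X. f x \<in> U})"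

text \<open>Two ordered configurations have the same image exactly if they differ by a permutation of
  the labels, so the following is the quotient by the symmetric group.\<close>

definition uconf :: "nat \<Rightarrow> 'a topology \<Rightarrow> 'a set topology" where
  "uconf n X = quotient_topology (ordered_conf n X) (\<lambda>f. f ` {..<n})"

definition surface_braid_group :: "nat \<Rightarrow> 'a topology \<Rightarrow> 'a set \<Rightarrow> (real \<Rightarrow> 'a set) set monoid" where
  "surface_braid_group n X P = fundamental_group (uconf n X) P"

lemma openin_quotient_topology:
  "openin (quotient_topology X f) U \<longleftrightarrow>
     U \<subseteq> f ` topspace X \<and> openin X {x \<in> topspace X. f x \<in> U}"
proof -
  have "istopology (\<lambda>U. U \<subseteq> f ` topspace X \<and> openin X {x \<in> topspace X. f x \<in> U})"
    unfolding istopology_def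
  proof (intro conjI allI impI)
    fix S T
    assume S: "S \<subseteq> f ` topspace X \<and> openin X {x \<in> topspace X. f x \<in> S}"
      and T: "T \<subseteq> f ` topspace X \<and> openin X {x \<in> topspace X. f x \<in> T}"
    have "{x \<in> topspace X. f x \<in> S \<inter> T} =
        {x \<in> topspace X. f x \<in> S} \<inter> {x \<in> topspace X. f x \<in> T}"
      by auto
    then show "openin X {x \<in> topspace X. f x \<in> S \<inter> T}"
      using S T by (simp only: openin_Int)
    show "S \<inter> T \<subseteq> f ` topspace X" using S by blast
  next
    fix K
    assume K: "\<forall>S\<in>K. S \<subseteq> f ` topspace X \<and> openin X {x \<in> topspace X. f x \<in> S}"
    have "{x \<in> topspace X. f x \<in> \<Union>K} = (\<Union>S\<in>K. {x \<in> topspace X. f x \<in> S})"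
      by auto
    then show "openin X {x \<in> topspace X. f x \<in> \<Union>K}"
      using K by auto
    show "\<Union>K \<subseteq> f ` topspace X" using K by blast
  qed
  then show ?thesis
    by (simp add: quotient_topology_def)
qed

lemma topspace_quotient_topology: "topspace (quotient_topology X f) = f ` topspace X"
proof
  show "topspace (quotient_topology X f) \<subseteq> f ` topspace X"
    using openin_topspace[of "quotient_topology X f"]
    unfolding openin_quotient_topology by (rule conjunct1)
  have "{x \<in> topspace X. f x \<in> f ` topspace X} = topspace X" by auto
  then have "openin (quotient_topology X f) (f ` topspace X)"
    by (simp add: openin_quotient_topology)
  then show "f ` topspace X \<subseteq> topspace (quotient_topology X f)"
    by (rule openin_subset)
qed

lemma quotient_map_quotient_topology: "quotient_map X (quotient_topology X f) f"
  unfolding quotient_map_def topspace_quotient_topology openin_quotient_topology by blast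

lemma topspace_ordered_conf:
  "topspace (ordered_conf n X) = {f \<in> {..<n} \<rightarrow>\<^sub>E topspace X. inj_on f {..<n}}"
  unfolding ordered_conf_def topspace_subtopology topspace_product_topology by blast

lemma topspace_uconf:
  "topspace (uconf n X) = {A. A \<subseteq> topspace X \<and> finite A \<and> card A = n}"
proof (rule subset_antisym; rule subsetI)
  fix A assume "A \<in> topspace (uconf n X)"
  then obtain f where "f \<in> {..<n} \<rightarrow>\<^sub>E topspace X" "inj_on f {..<n}" "A = f ` {..<n}"
    unfolding uconf_def topspace_quotient_topology topspace_ordered_conf by blast
  then show "A \<in> {A. A \<subseteq> topspace X \<and> finite A \<and> card A = n}"
    using card_image[of f "{..<n}"] PiE_mem[of f "{..<n}"] by fastforce
next
  fix A assume "A \<in> {A. A \<subseteq> topspace X \<and> finite A \<and> card A = n}"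
  then have A: "A \<subseteq> topspace X" "finite A" "card A = n" by blast+
  then obtain f where f: "bij_betw f {..<n} A"
    using ex_bij_betw_nat_finite[OF A(2)] by (metis atLeast0LessThan)
  define e where "e = restrict f {..<n}"
  have im: "e ` {..<n} = A" and inj: "inj_on e {..<n}"
    using f unfolding e_def bij_betw_def inj_on_def by simp_all
  have "e \<in> {..<n} \<rightarrow>\<^sub>E topspace X"
    unfolding e_def using A(1) f bij_betwE[OF f] by (intro restrict_PiE_iff[THEN iffD2]) blast
  then show "A \<in> topspace (uconf n X)"
    unfolding uconf_def topspace_quotient_topology topspace_ordered_conf
    using im inj by blast
qed


section \<open>Closed oriented surfaces\<close>

definition two_manifold :: "'a topology \<Rightarrow> bool" where
  "two_manifold X \<longleftrightarrow>
     Hausdorff_space X \<and> second_countable X \<and>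
     (\<forall>x \<in> topspace X. \<exists>U. openin X U \<and> x \<in> U \<and>
        subtopology X U homeomorphic_space (euclidean :: (real^2) topology))"

text \<open>An orientation is a choice of a generator of the local homology group
  \<open>H\<^sub>2(X, X - {x})\<close> at every point, such that near every point the chosen generators
  are the restrictions of one class in \<open>H\<^sub>2(X, X - U)\<close>.\<close>

definition orientation :: "'a topology \<Rightarrow> ('a \<Rightarrow> 'a chain set) \<Rightarrow> bool" where
  "orientation X \<mu> \<longleftrightarrow>
     (\<forall>x \<in> topspace X.
        \<mu> x \<in> carrier (relative_homology_group 2 X (topspace X - {x})) \<and>
        generate (relative_homology_group 2 X (topspace X - {x})) {\<mu> x} =
          carrier (relative_homology_group 2 X (topspace X - {x}))) \<and>
     (\<forall>x \<in> topspace X. \<exists>U. openin X U \<and> x \<in> U \<and>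
        (\<exists>c \<in> carrier (relative_homology_group 2 X (topspace X - U)).
           \<forall>y \<in> U. hom_induced 2 X (topspace X - U) X (topspace X - {y}) id c = \<mu> y))"

definition simple_closed_curve_in :: "'a topology \<Rightarrow> 'a set \<Rightarrow> bool" where
  "simple_closed_curve_in X C \<longleftrightarrow>
     C \<subseteq> topspace X \<and>
     subtopology X C homeomorphic_space top_of_set (sphere (0::complex) 1)"

definition nonseparating_curves :: "'a topology \<Rightarrow> 'a set set \<Rightarrow> bool" where
  "nonseparating_curves X \<C> \<longleftrightarrow>
     finite \<C> \<and> disjoint \<C> \<and> (\<forall>C \<in> \<C>. simple_closed_curve_in X C) \<and>
     connectedin X (topspace X - \<Union>\<C>)"

text \<open>The genus of a closed oriented surface is the maximal number of pairwise disjoint simple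
  closed curves whose union does not separate it.\<close>

definition has_genus :: "'a topology \<Rightarrow> nat \<Rightarrow> bool" where
  "has_genus X g \<longleftrightarrow>
     (\<exists>\<C>. nonseparating_curves X \<C> \<and> card \<C> = g) \<and>
     (\<forall>\<C>. nonseparating_curves X \<C> \<longrightarrow> card \<C> \<le> g)"

text \<open>Surfaces are connected and nonempty. The orientation itself is not recorded, since
  configuration spaces do not depend on it.\<close>

definition closed_oriented_surface :: "nat \<Rightarrow> 'a topology \<Rightarrow> bool" where
  "closed_oriented_surface g X \<longleftrightarrow>
     two_manifold X \<and> topspace X \<noteq> {} \<and> compact_space X \<and> connected_space X \<and>
     (\<exists>\<mu>. orientation X \<mu>) \<and> has_genus X g"

end

theory Submission
  imports Defs
begin

text \<open>The action on the \<open>m\<close> points turns a surjection into one from the braid group of the first surface onto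
  the symmetric group on \<open>m\<close> points, of order at most \<open>(n - 1)!\<close>. The \<open>n - 1 \<ge> 4\<close> half twists in a disc satisfy
  the braid relations, and counting conjugates and centralizers shows that in a group of this order they
  have one common image \<open>s\<close>. Up to powers of \<open>s\<close> every braid is a product of pushes, which move one point around
  a loop; a push of the first point commutes with \<open>s\<close>, because \<open>s\<close> is the image of half twists in two disjoint
  discs and the moving point is never in both. Hence \<open>s\<close> is central, and so trivial as \<open>m \<ge> 3\<close>. This holds in
  every disc of the surface, so moving points can be made to pass through each other without changing
  images. Now every element is the image both of a push of the first point and of a push of the second one,
  and these commute. So the symmetric group would be abelian, which it is not.\<close>


section \<open>Braid relations in finite groups\<close>

text \<open>The homomorphism is extended to a map \<open>\<Phi>\<close> on all paths of
  configurations, so that the motion of one point between different configurations has a value.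
  Relations come from convex parameter spaces, where only the ends of a path count, and from
  squares, in which two motions that never collide are interchanged. For N = n - 1 half twists that
  are not all equal, the count gives order at least N!, and the image may have exactly this order;
  one further conjugate makes the inequality strict if N is at least 4. For N = 3 this fails: the
  braid group on 4 strands maps onto the symmetric group on 3 letters with distinct images of half
  twists. The bound 5 on n also provides two disjoint pairs of points besides the pushed one. The
  obstacle at the end is that two colliding points form no configuration, so passing through needs a
  meaning. In a small disc a path can be replaced by one that avoids the other point, with the same
  value because half twists are trivial. Globally one of the two loops is made nowhere dense, so
  that the other point always has free positions nearby.\<close>

definition add_subgroup :: "'f::group_add set \<Rightarrow> bool" where
  "add_subgroup S \<longleftrightarrow> 0 \<in> S \<and> (\<forall>x\<in>S. \<forall>y\<in>S. x + y \<in> S) \<and> (\<forall>x\<in>S. - x \<in> S)"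

definition center_in :: "'f::group_add set \<Rightarrow> 'f set" where
  "center_in S = {z \<in> S. \<forall>x\<in>S. z + x = x + z}"

definition centralizer_in :: "'f::group_add set \<Rightarrow> 'f \<Rightarrow> 'f set" where
  "centralizer_in S t = {c \<in> S. c + t = t + c}"

lemma add_subgroup_diff: "add_subgroup S \<Longrightarrow> x \<in> S \<Longrightarrow> y \<in> S \<Longrightarrow> x - y \<in> S"
  unfolding add_subgroup_def by (metis diff_conv_add_uminus)

lemma add_conj_conv: "(x::'f::group_add) + y - x = z \<longleftrightarrow> x + y = z + x"
  by (metis diff_add_cancel add_diff_cancel)

lemma add_commute_uminus: "(x::'f::group_add) + y = y + x \<Longrightarrow> - x + y = y + - x"
  by (metis add.assoc add.left_inverse add.right_inverse add.left_neutral add.right_neutral)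

lemma add_commute_add:
  "(x::'f::group_add) + z = z + x \<Longrightarrow> y + z = z + y \<Longrightarrow> (x + y) + z = z + (x + y)"
  by (metis add.assoc)

lemma add_commute_conj:
  "(x::'f::group_add) + z = z + x \<Longrightarrow> y + z = z + y \<Longrightarrow> (x + y - x) + z = z + (x + y - x)"
  using add_commute_add[OF add_commute_add, of x z y "- x"] add_commute_uminus[of x z]
  by simp

lemma add_conj_conj: "(a::'f::group_add) + (g + t - g) - a = (a + g) + t - (a + g)"
  by (simp only: diff_conv_add_uminus minus_add add.assoc)

lemma add_conj_cancel: "(p::'f::group_add) + x - p = p + y - p \<longleftrightarrow> x = y"
  by (simp only: diff_conv_add_uminus add_right_cancel add_left_cancel)

lemma add_subgroup_centralizer:
  assumes "add_subgroup S" shows "add_subgroup (centralizer_in S t)"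
  using assms unfolding add_subgroup_def centralizer_in_def
  by (auto intro: add_commute_add simp: add_commute_uminus[unfolded add_uminus_conv_diff])

lemma add_subgroup_center:
  assumes S: "add_subgroup S" shows "add_subgroup (center_in S)"
proof -
  have S': "0 \<in> S" "\<And>x y. x \<in> S \<Longrightarrow> y \<in> S \<Longrightarrow> x + y \<in> S" "\<And>x. x \<in> S \<Longrightarrow> - x \<in> S"
    using S unfolding add_subgroup_def by blast+
  have "0 \<in> center_in S" using S' unfolding center_in_def by simp
  moreover have "x + y \<in> center_in S" if "x \<in> center_in S" "y \<in> center_in S" for x y
    using that S'(2) add_commute_add[of x _ y] unfolding center_in_def by blast
  moreover have "- x \<in> center_in S" if "x \<in> center_in S" for x
    using that S'(3) add_commute_uminus[of x] unfolding center_in_def by blast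
  ultimately show ?thesis unfolding add_subgroup_def by blast
qed

text \<open>Orbit and stabilizer as an inequality: each conjugate \<open>a\<close> gets a chosen
  conjugator \<open>g a\<close>, and \<open>(a, c) \<mapsto> g a + c\<close> is injective because
  conjugating \<open>t\<close> by \<open>g a + c\<close> gives back \<open>a\<close>. The set
  \<open>A\<close> may be only a part of the conjugacy class.\<close>

lemma card_conj_class_mult_centralizer:
  assumes S: "add_subgroup S" "finite S" and A: "A \<subseteq> (\<lambda>g. g + t - g) ` S"
  shows "card A * card (centralizer_in S t) \<le> card S"
proof -
  have "\<exists>g. g \<in> S \<and> g + t - g = a" if "a \<in> A" for a
    using A that by fastforce
  then have "\<forall>a\<in>A. \<exists>g. g \<in> S \<and> g + t - g = a" by simp
  from bchoice[OF this] obtain g where g': "\<forall>a\<in>A. g a \<in> S \<and> g a + t - g a = a" ..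
  have g: "g a \<in> S" "g a + t - g a = a" if "a \<in> A" for a using g' that by simp_all
  have "inj_on (\<lambda>(a, c). g a + c) (A \<times> centralizer_in S t)"
  proof (rule inj_onI, clarify)
    fix a c a' c'
    assume a: "a \<in> A" "a' \<in> A" and c: "c \<in> centralizer_in S t" "c' \<in> centralizer_in S t"
      and eq: "g a + c = g a' + c'"
    have conj: "g b + d + t - (g b + d) = b" if "b \<in> A" "d \<in> centralizer_in S t" for b d
    proof -
      have "d + t = t + d" using that(2) by (simp add: centralizer_in_def)
      then have "g b + d + t = g b + t + d" by (simp add: add.assoc)
      also have "g b + t = b + g b" using g(2)[OF that(1)] by (simp add: add_conj_conv)
      finally have "g b + d + t = b + (g b + d)" by (simp add: add.assoc)
      then show ?thesis by (simp add: add_conj_conv)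
    qed
    have "a = a'" using conj[OF a(1) c(1)] conj[OF a(2) c(2)] eq by simp
    then show "a = a' \<and> c = c'" using eq by simp
  qed
  moreover have "(\<lambda>(a, c). g a + c) ` (A \<times> centralizer_in S t) \<subseteq> S"
    using g(1) S(1) unfolding centralizer_in_def add_subgroup_def by auto
  ultimately show ?thesis
    using card_inj_on_le[OF _ _ S(2)] by (metis card_cartesian_product)
qed

text \<open>The Artin relations of the braid group on \<open>N + 1\<close> strands. Values of
  \<open>s\<close> from the index \<open>N\<close> on are unconstrained.\<close>

locale braid_relations =
  fixes s :: "nat \<Rightarrow> 'f::group_add" and N :: nat
  assumes braid: "Suc i < N \<Longrightarrow> s i + s (Suc i) + s i = s (Suc i) + s i + s (Suc i)"
    and far: "i + 2 \<le> j \<Longrightarrow> j < N \<Longrightarrow> s i + s j = s j + s i"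
begin

lemma braid_commute_imp_eq:
  assumes "Suc i < N" "s i + s (Suc i) = s (Suc i) + s i" shows "s i = s (Suc i)"
  using braid[OF assms(1)] assms(2) by (metis add.assoc add_left_cancel)

text \<open>Equality spreads: the next generator commutes with one of two equal generators, hence
  also with the other, to which it is adjacent; and adjacent generators that commute
  coincide.\<close>

lemma adjacent_eq_imp_all_eq:
  assumes i: "Suc i < N" "s i = s (Suc i)" and j: "j < N"
  shows "s j = s i"
proof -
  have up: "s (Suc (i + k)) = s i" if "Suc (i + k) < N" for k using that
  proof (induction k)
    case 0 then show ?case using i by simp
  next
    case (Suc k)
    have "s (Suc (i + k)) = s i" using Suc by simp
    moreover have "s i + s (Suc (Suc (i + k))) = s (Suc (Suc (i + k))) + s i"
      using far[of i "Suc (Suc (i + k))"] Suc.prems by simp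
    ultimately show ?case
      using braid_commute_imp_eq[of "Suc (i + k)"] Suc.prems by simp
  qed
  have down: "k \<le> i \<Longrightarrow> s (i - k) = s i" for k
  proof (induction k)
    case 0 then show ?case by simp
  next
    case (Suc k)
    have e: "Suc (i - Suc k) = i - k" using Suc.prems by simp
    have "s (i - k) = s (Suc i)" using Suc i by simp
    moreover have "s (i - Suc k) + s (Suc i) = s (Suc i) + s (i - Suc k)"
      using far[of "i - Suc k" "Suc i"] Suc.prems i by simp
    ultimately show ?case
      using braid_commute_imp_eq[of "i - Suc k"] Suc e i by simp
  qed
  show ?thesis
  proof (cases "j \<le> i")
    case True then show ?thesis using down[of "i - j"] by simp
  next
    case False
    then obtain k where "j = Suc (i + k)" using less_imp_Suc_add[of i j] by auto
    then show ?thesis using up j by simp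
  qed
qed

text \<open>The half twist exchanging strands \<open>i\<close> and \<open>i + d + 1\<close> behind the strands in between.\<close>

fun band :: "nat \<Rightarrow> nat \<Rightarrow> 'f" where
  "band i 0 = s i"
| "band i (Suc d) = s (Suc (i + d)) + band i d - s (Suc (i + d))"

lemma band_far: "i + d + 2 \<le> l \<Longrightarrow> l < N \<Longrightarrow> band i d + s l = s l + band i d"
proof (induction d)
  case 0 then show ?case using far by simp
next
  case (Suc d)
  have "s (Suc (i + d)) + s l = s l + s (Suc (i + d))" using far Suc.prems by simp
  moreover have "band i d + s l = s l + band i d" using Suc by simp
  ultimately show ?case unfolding band.simps by (rule add_commute_conj)
qed

lemma gen_conj_gen:
  assumes S: "add_subgroup S" "\<And>k. l \<le> k \<Longrightarrow> k < N \<Longrightarrow> s k \<in> S" and "l \<le> i" "i < N"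
  shows "\<exists>g\<in>S. g + s l - g = s i"
  using assms(3,4)
proof (induction i rule: dec_induct)
  case base show ?case using S(1) unfolding add_subgroup_def by (intro bexI[of _ 0]) auto
next
  case (step i)
  then obtain g where g: "g \<in> S" "g + s l - g = s i" by auto
  \<comment> \<open>The braid relation says that \<open>s i + s (Suc i)\<close> conjugates
    \<open>s i\<close> to \<open>s (Suc i)\<close>.\<close>
  let ?h = "s i + s (Suc i)"
  have "?h + s i - ?h = s (Suc i)" unfolding add_conj_conv using braid[of i] step by (simp add: add.assoc)
  then have h: "?h + s i = s (Suc i) + ?h" by (simp only: add_conj_conv)
  have "?h + g + s l = ?h + (s i + g)" using g(2) by (simp add: add_conj_conv add.assoc)
  also have "\<dots> = s (Suc i) + (?h + g)" using h by (simp add: add.assoc[symmetric])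
  finally have "(?h + g) + s l - (?h + g) = s (Suc i)" by (subst add_conj_conv)
  moreover have "?h + g \<in> S" using S step g unfolding add_subgroup_def by simp
  ultimately show ?case by blast
qed

lemma band_conj_gen:
  assumes S: "add_subgroup S" "\<And>k. l \<le> k \<Longrightarrow> k < N \<Longrightarrow> s k \<in> S" and "l \<le> i" "i + d < N"
  shows "band i d \<in> (\<lambda>g. g + s l - g) ` S"
  using assms(4)
proof (induction d)
  case 0
  then show ?case using gen_conj_gen[OF S assms(3)] by force
next
  case (Suc d)
  then obtain g where g: "g \<in> S" "band i d = g + s l - g" by auto
  then have "s (Suc (i + d)) + g \<in> S" using S assms Suc.prems unfolding add_subgroup_def by simp
  moreover have "band i (Suc d) = (s (Suc (i + d)) + g) + s l - (s (Suc (i + d)) + g)"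
    using g(2) by (simp only: band.simps add_conj_conj)
  ultimately show ?case by blast
qed

end

locale noncyclic_braid_relations = braid_relations +
  assumes adjacent_neq: "Suc i < N \<Longrightarrow> s i \<noteq> s (Suc i)"
begin

text \<open>If the conjugate of the shorter band \<open>x\<close> by \<open>p\<close> commuted with
  the next generator \<open>q\<close>, then \<open>x\<close> would commute with
  \<open>- p + q + p = q + p - q\<close>. As \<open>x\<close> commutes with \<open>q\<close>, it
  would commute with \<open>p\<close>, against the induction hypothesis.\<close>

lemma band_not_commute:
  "i + d + 1 < N \<Longrightarrow> band i d + s (i + d + 1) \<noteq> s (i + d + 1) + band i d"
proof (induction d)
  case 0
  then show ?case using braid_commute_imp_eq[of i] adjacent_neq[of i] by auto
next
  case (Suc d)
  let ?p = "s (Suc (i + d))" and ?q = "s (Suc (Suc (i + d)))" and ?x = "band i d"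
  have br: "?p + ?q + ?p = ?q + ?p + ?q" using braid Suc.prems by simp
  have xq: "?x + ?q = ?q + ?x" using band_far Suc.prems by simp
  show ?case
  proof
    assume "band i (Suc d) + s (i + Suc d + 1) = s (i + Suc d + 1) + band i (Suc d)"
    then have c: "(?p + ?x - ?p) + ?q = ?q + (?p + ?x - ?p)" by simp
    have "- ?p + ?q + ?p = (- ?p + (?q + ?p + ?q)) - ?q"
      by (simp only: diff_conv_add_uminus add.assoc add.right_inverse add_0_right)
    also have "\<dots> = ?q + ?p - ?q"
      unfolding br[symmetric] by (simp only: add.assoc[symmetric] add.left_inverse add_0_left)
    finally have pq: "- ?p + ?q + ?p = ?q + ?p - ?q" .
    have "?x + (- ?p + ?q + ?p) = - ?p + ((?p + ?x - ?p) + ?q) + ?p"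
      by (simp only: diff_conv_add_uminus add.assoc minus_add_cancel)
    also have "\<dots> = (- ?p + ?q + ?p) + ?x"
      unfolding c by (simp only: diff_conv_add_uminus add.assoc add.left_inverse add_0_right)
    finally have "?x + (?q + ?p - ?q) = (?q + ?p - ?q) + ?x" unfolding pq .
    then have "- ?q + (?x + (?q + ?p - ?q)) + ?q = - ?q + ((?q + ?p - ?q) + ?x) + ?q" by simp
    also have "- ?q + (?x + (?q + ?p - ?q)) + ?q = - ?q + (?x + ?q) + ?p"
      by (simp only: diff_conv_add_uminus add.assoc add.left_inverse add_0_right)
    also have "- ?q + ((?q + ?p - ?q) + ?x) + ?q = ?p + (- ?q + (?x + ?q))"
      by (simp only: diff_conv_add_uminus add.assoc minus_add_cancel)
    finally have "?x + ?p = ?p + ?x" unfolding xq by simp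
    then show False using Suc by simp
  qed
qed

text \<open>The generator just past the later end commutes with the band that ends earlier and not
  with the other.\<close>

lemma band_neq_of_less:
  assumes "k + e + 1 < N" "i + d < k + e"
  shows "band i d \<noteq> band k e"
  using band_far[of i d "k + e + 1"] band_not_commute[of k e] assms by auto

text \<open>Both bands are conjugates of shorter ones by their common last generator. The induction
  strips it off until one band is a single generator, where \<open>band_neq_of_less\<close>
  applies.\<close>

lemma band_neq_of_eq:
  assumes "k + e + 1 < N" "i + d = k + e" "i < k"
  shows "band i d \<noteq> band k e"
  using assms
proof (induction e arbitrary: d)
  case 0
  then obtain d' where d: "d = Suc d'" by (cases d) auto
  then have k: "k = Suc (i + d')" using 0 by simp
  have "band i d' \<noteq> band k 0" using band_neq_of_less[of k 0 i d'] 0 k by simp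
  then show ?case using d k add_conj_conv[of "s k" "band i d'" "s k"] by simp
next
  case (Suc e)
  then obtain d' where d: "d = Suc d'" by (cases d) auto
  then have "band i d' \<noteq> band k e" "i + d' = k + e" using Suc by auto
  then show ?case using d by (simp add: add_conj_cancel)
qed

text \<open>The pair \<open>(i, j)\<close> stands for the band on the generators \<open>i\<close> to
  \<open>j - 1\<close>; since \<open>j < N\<close> there is a further generator \<open>s j\<close>,
  on which the two preceding lemmas rely.\<close>

lemma band_inj:
  "inj_on (\<lambda>(i, j). band i (j - Suc i)) {(i, j). l \<le> i \<and> i < j \<and> j < N}"
proof (rule inj_onI, clarify)
  fix i j i' j'
  assume *: "i < j" "j < N" "i' < j'" "j' < N" 
    and eq: "band i (j - Suc i) = band i' (j' - Suc i')"
  define d d' where "d = j - Suc i" "d' = j' - Suc i'"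
  then have j: "j = Suc (i + d)" "j' = Suc (i' + d')" using * by auto
  have eq': "band i d = band i' d'" using eq d_d'_def by simp
  have N: "i' + d' + 1 < N" "i + d + 1 < N" using j * by simp_all
  have "\<not> i + d < i' + d'" "\<not> i' + d' < i + d"
    using band_neq_of_less[OF N(1), of i d] band_neq_of_less[OF N(2), of i' d'] eq' by metis+
  then have e: "i + d = i' + d'" by simp
  have "\<not> i < i'" "\<not> i' < i"
    using band_neq_of_eq[OF N(1) e] band_neq_of_eq[OF N(2) e[symmetric]] eq' by metis+
  then have "i = i'" by simp
  moreover have "j = j'" using e j by simp
  ultimately show "i = i' \<and> j = j'" by simp
qed

lemma card_pairs: "card {(i, j). l \<le> i \<and> i < j \<and> j < (m::nat)} = (m - l) * (m - l - 1) div 2"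
proof (induction m)
  case 0 then show ?case by simp
next
  case (Suc m)
  have e: "{(i, j). l \<le> i \<and> i < j \<and> j < Suc m} = {(i, j). l \<le> i \<and> i < j \<and> j < m} \<union> (\<lambda>i. (i, m)) ` {l..<m}"
    by (auto simp: less_Suc_eq)
  have "finite {(i, j). l \<le> i \<and> i < j \<and> j < m}"
    by (rule finite_subset[of _ "{..m} \<times> {..m}"]) auto
  then have "card {(i, j). l \<le> i \<and> i < j \<and> j < Suc m} = (m - l) * (m - l - 1) div 2 + (m - l)"
    unfolding e using Suc by (subst card_Un_disjoint) (auto simp: card_image inj_on_def)
  also have "\<dots> = (Suc m - l) * (Suc m - l - 1) div 2"
  proof (cases "l \<le> m")
    case True
    then obtain r where "m = l + r" by (metis le_add_diff_inverse)
    then show ?thesis by (cases r) (auto simp: algebra_simps)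
  qed auto
  finally show ?case .
qed

lemma finite_pairs: "finite {(i, j). l \<le> i \<and> i < j \<and> j < (m::nat)}"
  by (rule finite_subset[of _ "{..m} \<times> {..m}"]) auto

text \<open>\<open>s l\<close> is not central, as it would otherwise commute with its neighbour.
  Hence the centre of \<open>S\<close> and its translate by \<open>s l\<close> are disjoint, and
  both are central in the centralizer of \<open>s l\<close>.\<close>

lemma card_center_centralizer:
  assumes S: "add_subgroup S" "finite S" and l: "Suc l < N" "s l \<in> S" "s (Suc l) \<in> S"
  shows "2 * card (center_in S) \<le> card (center_in (centralizer_in S (s l)))"
proof -
  let ?C = "centralizer_in S (s l)" and ?Z = "center_in S"
  have notin: "s l \<notin> ?Z"
    using braid_commute_imp_eq[OF l(1)] adjacent_neq[OF l(1)] l(3) unfolding center_in_def by blast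
  have Zsub: "?Z \<union> (\<lambda>z. s l + z) ` ?Z \<subseteq> center_in ?C"
  proof -
    have "s l \<in> center_in ?C" using l unfolding center_in_def centralizer_in_def by auto
    moreover have "?Z \<subseteq> center_in ?C" using l unfolding center_in_def centralizer_in_def by auto
    moreover have "x + y \<in> center_in ?C" if "x \<in> center_in ?C" "y \<in> center_in ?C" for x y
      using that add_subgroup_center[OF add_subgroup_centralizer[OF S(1)]]
      unfolding add_subgroup_def by blast
    ultimately show ?thesis by blast
  qed
  have "?Z \<inter> (\<lambda>z. s l + z) ` ?Z = {}"
  proof (rule ccontr)
    assume "?Z \<inter> (\<lambda>z. s l + z) ` ?Z \<noteq> {}"
    then obtain z z' where z: "z \<in> ?Z" "z' \<in> ?Z" "z = s l + z'" by blast
    then have "s l = z - z'" by (simp only: add_diff_cancel)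
    moreover have "z - z' \<in> ?Z"
      using z(1,2) add_subgroup_diff[OF add_subgroup_center[OF S(1)]] by blast
    ultimately show False using notin by simp
  qed
  moreover have "finite ?Z" using S unfolding center_in_def by simp
  moreover have "card ((\<lambda>z. s l + z) ` ?Z) = card ?Z" by (intro card_image) (auto simp: inj_on_def)
  ultimately have "card (?Z \<union> (\<lambda>z. s l + z) ` ?Z) = 2 * card ?Z"
    by (subst card_Un_disjoint) auto
  moreover have "finite (center_in ?C)" using S unfolding center_in_def centralizer_in_def by simp
  ultimately show ?thesis using card_mono[OF _ Zsub] by simp
qed

text \<open>Put \<open>k = N - l\<close>. The \<open>k * (k - 1) / 2\<close> bands are conjugates of
  \<open>s l\<close>, and the centralizer of \<open>s l\<close> contains the generators from
  \<open>l + 2\<close> on, to which the induction applies with \<open>k - 2\<close>. The factor for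
  the centre is carried along because its doubling supplies the missing 2.\<close>

lemma card_ge_fact_mult_center:
  assumes "add_subgroup S" "finite S" "\<And>k. l \<le> k \<Longrightarrow> k < N \<Longrightarrow> s k \<in> S"
  shows "fact (N - l) * card (center_in S) \<le> card S"
  using assms
proof (induction "N - l" arbitrary: l S rule: less_induct)
  case less
  show ?case
  proof (cases "N - l < 2")
    case True
    then have "fact (N - l) = (1::nat)" by (metis One_nat_def fact_0 fact_1 less_2_cases)
    then show ?thesis using card_mono[of S "center_in S"] less.prems unfolding center_in_def by auto
  next
    case False
    let ?C = "centralizer_in S (s l)"
    let ?A = "(\<lambda>(i, j). band i (j - Suc i)) ` {(i, j). l \<le> i \<and> i < j \<and> j < N}"
    define r where "r = N - l - 2"
    have N: "N - l = Suc (Suc r)" "N - (l + 2) = r" using False unfolding r_def by auto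
    have "fact (N - (l + 2)) * card (center_in ?C) \<le> card ?C"
    proof (rule less.hyps)
      show "N - (l + 2) < N - l" using False by simp
      show "add_subgroup ?C" using less.prems add_subgroup_centralizer by blast
      show "finite ?C" using less.prems unfolding centralizer_in_def by simp
      show "s k \<in> ?C" if "l + 2 \<le> k" "k < N" for k
        using less.prems(3)[of k] that far unfolding centralizer_in_def by simp
    qed
    moreover have "2 * card (center_in S) \<le> card (center_in ?C)"
      using False by (intro card_center_centralizer less.prems) auto
    ultimately have C: "fact r * (2 * card (center_in S)) \<le> card ?C"
      unfolding N by (meson le_trans mult_le_mono2)
    have "card ?A = (N - l) * (N - l - 1) div 2"
      using card_image[OF band_inj] card_pairs by simp
    then have A: "2 * card ?A = Suc (Suc r) * Suc r" unfolding N by simp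
    have "?A \<subseteq> (\<lambda>g. g + s l - g) ` S"
      using band_conj_gen[OF less.prems(1,3)] by auto
    then have "card ?A * card ?C \<le> card S"
      using card_conj_class_mult_centralizer less.prems by blast
    then have "card ?A * (fact r * (2 * card (center_in S))) \<le> card S"
      using C by (meson le_trans mult_le_mono2)
    moreover have "card ?A * (fact r * (2 * card (center_in S))) = (2 * card ?A) * fact r * card (center_in S)"
      by simp
    ultimately show ?thesis unfolding A N by (simp add: algebra_simps)
  qed
qed

text \<open>This adds one conjugate to the bands counted above. A band that ends at
  \<open>N - 2\<close> does not commute with \<open>s (N - 1)\<close>; one that ends at
  \<open>N - 4\<close> or earlier does not commute with its next generator, which is far from
  \<open>s (N - 1)\<close>; one that ends at \<open>N - 3\<close> is reduced to a shorter band or to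
  a single generator.\<close>

lemma last_gen_neq_band:
  assumes N: "4 \<le> N" and ij: "i < j" "j < N"
  shows "s (N - 1) \<noteq> band i (j - Suc i)"
proof
  assume eq: "s (N - 1) = band i (j - Suc i)"
  have low: False if "i + d + 4 \<le> N" "s (N - 1) = band i d" for d
  proof -
    have "i + d + 1 + 2 \<le> N - 1" "N - 1 < N" using that(1) by simp_all
    from far[OF this] show False using band_not_commute[of i d] that by simp
  qed
  consider "j + 3 \<le> N" | "j + 2 = N" | "j + 1 = N" using ij by linarith
  then show False
  proof cases
    case 1 then show ?thesis using low[of "j - Suc i"] eq ij by simp
  next
    case 3
    then have *: "i + (j - Suc i) + 1 = N - 1" "N - 1 < N" using ij by simp_all
    from band_not_commute[of i "j - Suc i", unfolded *(1), OF *(2)] show ?thesis using eq by simp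
  next
    case 2
    show ?thesis
    proof (cases "j - Suc i")
      case 0
      then have j: "i = N - 3" using 2 ij by simp
      \<comment> \<open>By \<open>4 \<le> N\<close> there is a generator \<open>s (N - 4)\<close>,
        adjacent to \<open>s (N - 3)\<close> and far from \<open>s (N - 1)\<close>.\<close>
      have "s (N - 4) + s (N - 1) = s (N - 1) + s (N - 4)" using far N by simp
      then have "s (N - 4) + s (N - 3) = s (N - 3) + s (N - 4)" using eq 0 j by simp
      moreover have "Suc (N - 4) = N - 3" using N by simp
      ultimately show ?thesis
        using braid_commute_imp_eq[of "N - 4"] adjacent_neq[of "N - 4"] N by simp
    next
      case (Suc d)
      then have p: "Suc (i + d) = N - 3" using 2 ij by simp
      have "s (N - 3) + s (N - 1) = s (N - 1) + s (N - 3)" using far N by simp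
      moreover have "s (N - 3) + band i d = s (N - 1) + s (N - 3)"
        using eq Suc p add_conj_conv[of "s (N - 3)" "band i d" "s (N - 1)"] by simp
      ultimately have "band i d = s (N - 1)" by (metis add_left_cancel)
      moreover have "i + d + 4 \<le> N" using p N by linarith
      ultimately show ?thesis using low[of d] by metis
    qed
  qed
qed

text \<open>The induction step of \<open>card_ge_fact_mult_center\<close> is repeated at
  \<open>l = 0\<close> with the additional conjugate \<open>s (N - 1)\<close> of \<open>s 0\<close>;
  it contributes a surplus of \<open>2 * fact (N - 2)\<close>.\<close>

theorem card_gt_fact:
  assumes S: "add_subgroup S" "finite S" "\<And>k. k < N \<Longrightarrow> s k \<in> S" and N: "4 \<le> N"
  shows "fact N < card S"
proof -
  let ?C = "centralizer_in S (s 0)"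
  let ?A = "(\<lambda>(i, j). band i (j - Suc i)) ` {(i, j). 0 \<le> i \<and> i < j \<and> j < N}"
  define r where "r = N - 2"
  have Nr: "N = Suc (Suc r)" using N unfolding r_def by simp
  have "fact (N - 2) * card (center_in ?C) \<le> card ?C"
  proof (rule card_ge_fact_mult_center)
    show "add_subgroup ?C" using S add_subgroup_centralizer by blast
    show "finite ?C" using S unfolding centralizer_in_def by simp
    show "s k \<in> ?C" if "2 \<le> k" "k < N" for k
      using S(3)[of k] far[of 0 k] that unfolding centralizer_in_def by simp
  qed
  moreover have "2 * card (center_in S) \<le> card (center_in ?C)"
    using N by (intro card_center_centralizer S) auto
  moreover have "1 \<le> card (center_in S)"
  proof -
    have "0 \<in> center_in S" using S(1) unfolding center_in_def add_subgroup_def by simp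
    moreover have "finite (center_in S)" using S(2) unfolding center_in_def by simp
    ultimately have "0 < card (center_in S)" using card_gt_0_iff by blast
    then show ?thesis by simp
  qed
  ultimately have C: "fact r * 2 \<le> card ?C"
  proof -
    assume "fact (N - 2) * card (center_in ?C) \<le> card ?C" "2 * card (center_in S) \<le> card (center_in ?C)"
      and "1 \<le> card (center_in S)"
    then have "2 \<le> card (center_in ?C)" by linarith
    then have "fact r * 2 \<le> fact r * card (center_in ?C)" by (rule mult_le_mono2)
    also have "\<dots> \<le> card ?C" using \<open>fact (N - 2) * card (center_in ?C) \<le> card ?C\<close> Nr by simp
    finally show ?thesis .
  qed
  have fin: "finite ?A" using finite_pairs by (rule finite_imageI)
  have notin: "s (N - 1) \<notin> ?A" using last_gen_neq_band[OF N] by auto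
  have "card ?A = N * (N - 1) div 2"
    using card_image[OF band_inj, of 0] card_pairs[of 0 N] by simp
  then have A: "2 * card ?A = Suc (Suc r) * Suc r" unfolding Nr by simp
  have "?A \<subseteq> (\<lambda>g. g + s 0 - g) ` S"
    using band_conj_gen[OF S(1), of 0] S(3) by auto
  moreover have "s (N - 1) \<in> (\<lambda>g. g + s 0 - g) ` S"
    using band_conj_gen[OF S(1), of 0 "N - 1" 0] S(3) N by auto
  ultimately have "card (insert (s (N - 1)) ?A) * card ?C \<le> card S"
    by (intro card_conj_class_mult_centralizer S) auto
  then have "Suc (card ?A) * card ?C \<le> card S"
    using fin notin by simp
  then have "Suc (card ?A) * (fact r * 2) \<le> card S"
    using C by (meson le_trans mult_le_mono2)
  moreover have "Suc (card ?A) * (fact r * 2) = Suc (Suc r) * Suc r * fact r + 2 * fact r"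
    using A by (simp add: algebra_simps)
  ultimately have "fact N + 2 * fact r \<le> card S"
    unfolding Nr by (simp add: algebra_simps)
  moreover have "0 < (2 * fact r :: nat)" by simp
  ultimately show ?thesis by linarith
qed

end

lemma (in braid_relations) all_eq_of_card_le_fact:
  assumes S: "add_subgroup S" "finite S" "\<And>k. k < N \<Longrightarrow> s k \<in> S" and N: "4 \<le> N"
    and card: "card S \<le> fact N" and ij: "i < N" "j < N"
  shows "s i = s j"
proof (cases "\<exists>k. Suc k < N \<and> s k = s (Suc k)")
  case True
  then show ?thesis using adjacent_eq_imp_all_eq ij by metis
next
  case False
  then interpret noncyclic_braid_relations s N by unfold_locales auto
  show ?thesis using card_gt_fact[OF S N] card by simp
qed

section \<open>Path functors\<close>

definition path_homotopic :: "'a topology \<Rightarrow> (real \<Rightarrow> 'a) \<Rightarrow> (real \<Rightarrow> 'a) \<Rightarrow> bool" where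
  "path_homotopic X p q \<longleftrightarrow>
     homotopic_with (\<lambda>r. r 0 = p 0 \<and> r 1 = p 1) (top_of_set {0..1}) X p q"

abbreviation "unit_square \<equiv> {0..1::real} \<times> {0..1::real}"

lemma path_homotopic_iff:
  "path_homotopic X p q \<longleftrightarrow>
     (\<exists>h. continuous_map (top_of_set unit_square) X h \<and>
          (\<forall>t\<in>{0..1}. h (0, t) = p t \<and> h (1, t) = q t) \<and>
          (\<forall>s\<in>{0..1}. h (s, 0) = p 0 \<and> h (s, 1) = p 1))"
proof -
  have "path_homotopic X p q \<longleftrightarrow>
     (\<exists>h. continuous_map (prod_topology (top_of_set {0..1::real}) (top_of_set {0..1})) X h \<and>
          (\<forall>x\<in>topspace (top_of_set {0..1}). h (0, x) = p x) \<and>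
          (\<forall>x\<in>topspace (top_of_set {0..1}). h (1, x) = q x) \<and>
          (\<forall>t\<in>{0..1}. h (t, 0) = p 0 \<and> h (t, 1) = p 1))"
    unfolding path_homotopic_def by (subst homotopic_with) auto
  then show ?thesis by auto
qed

lemma path_homotopic_imp:
  assumes "path_homotopic X p q"
  shows "pathin X p" "pathin X q" "p 0 = q 0" "p 1 = q 1"
  using assms homotopic_with_imp_continuous_maps[of _ _ X p q] homotopic_with_imp_property[of _ _ X p q]
  unfolding path_homotopic_def pathin_def by fastforce+

lemma path_homotopic_equal:
  assumes "pathin X p" "\<And>t. t \<in> {0..1} \<Longrightarrow> p t = q t" shows "path_homotopic X p q"
  using assms unfolding path_homotopic_def pathin_def by (intro homotopic_with_equal) auto

lemma path_homotopic_refl: "pathin X p \<Longrightarrow> path_homotopic X p p"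
  by (simp add: path_homotopic_equal)

lemma path_homotopic_sym: "path_homotopic X p q \<Longrightarrow> path_homotopic X q p"
  using path_homotopic_imp[of X p q] homotopic_with_symD unfolding path_homotopic_def by fastforce

lemma path_homotopic_trans:
  "path_homotopic X p q \<Longrightarrow> path_homotopic X q r \<Longrightarrow> path_homotopic X p r"
  using path_homotopic_imp[of X p q] homotopic_with_trans unfolding path_homotopic_def by fastforce

text \<open>The straight-line homotopy takes place in the parameter space \<open>K\<close> and not
  in \<open>X\<close>. Most relations below arise from a suitable convex \<open>K\<close>.\<close>

lemma path_homotopic_convex:
  fixes K :: "'e::real_normed_vector set"
  assumes K: "convex K" and k: "continuous_map (top_of_set K) X k"
    and p: "path p" "path_image p \<subseteq> K" and q: "path q" "path_image q \<subseteq> K"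
    and ends: "p 0 = q 0" "p 1 = q 1"
  shows "path_homotopic X (k \<circ> p) (k \<circ> q)"
proof -
  have "homotopic_paths K p q"
  proof (rule homotopic_paths_linear)
    show "closed_segment (p t) (q t) \<subseteq> K" if "t \<in> {0..1}" for t
      using K p q that by (intro closed_segment_subset) (auto simp: path_image_def)
  qed (use p q ends in \<open>auto simp: pathstart_def pathfinish_def\<close>)
  then have "homotopic_with (\<lambda>r. pathstart r = pathstart p \<and> pathfinish r = pathfinish p)
      (top_of_set {0..1}) (top_of_set K) p q"
    unfolding homotopic_paths_def .
  then show ?thesis unfolding path_homotopic_def
    by (rule homotopic_with_compose_continuous_map_left[OF _ k])
       (auto simp: pathstart_def pathfinish_def)
qed

lemma pathin_iff: "pathin X p \<longleftrightarrow> continuous_map (top_of_set {0..1}) X p"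
  by (simp add: pathin_def)

lemma pathin_compose_path:
  assumes "continuous_map (top_of_set K) X k" "path p" "path_image p \<subseteq> K"
  shows "pathin X (k \<circ> p)"
  unfolding pathin_iff
  by (rule continuous_map_compose[OF _ assms(1)])
     (use assms(2,3) in \<open>auto simp: path_def path_image_def\<close>)

lemma pathin_in: "pathin X p \<Longrightarrow> t \<in> {0..1} \<Longrightarrow> p t \<in> topspace X"
  unfolding pathin_iff continuous_map_def by (auto simp: Pi_iff)

lemma path_homotopic_reparam:
  assumes "pathin X p" "continuous_on {0..1} f" "\<And>t. t \<in> {0..1} \<Longrightarrow> f t \<in> {0..1}" "f 0 = 0" "f 1 = 1"
  shows "path_homotopic X (p \<circ> f) p"
proof -
  have "path_homotopic X (p \<circ> f) (p \<circ> id)"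
    by (rule path_homotopic_convex[where K="{0..1}"])
       (use assms in \<open>auto simp: pathin_iff path_def path_image_def\<close>)
  then show ?thesis by simp
qed

lemma continuous_map_path_concat_family:
  fixes h k :: "real \<times> real \<Rightarrow> 'a"
  assumes h: "continuous_map (top_of_set (S \<times> {0..1})) X h" 
    and k: "continuous_map (top_of_set (S \<times> {0..1})) X k"
    and hk: "\<And>s. s \<in> S \<Longrightarrow> h (s, 1) = k (s, 0)"
  shows "continuous_map (top_of_set (S \<times> {0..1})) X
           (\<lambda>z. if snd z \<le> 1/2 then h (fst z, 2 * snd z) else k (fst z, 2 * snd z - 1))"
proof (rule continuous_map_cases_le)
  let ?T = "top_of_set (S \<times> {0..1::real})"
  show "continuous_map ?T euclideanreal snd" "continuous_map ?T euclideanreal (\<lambda>z. 1/2)"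
    by (auto intro!: continuous_intros)
  have "continuous_map (subtopology ?T {z \<in> topspace ?T. snd z \<le> 1/2}) ?T (\<lambda>z. (fst z, 2 * snd z))"
    by (auto simp: subtopology_subtopology intro!: continuous_intros)
  from continuous_map_compose[OF this h]
  show "continuous_map (subtopology ?T {z \<in> topspace ?T. snd z \<le> 1/2}) X (\<lambda>z. h (fst z, 2 * snd z))"
    by (simp add: o_def)
  have "continuous_map (subtopology ?T {z \<in> topspace ?T. 1/2 \<le> snd z}) ?T (\<lambda>z. (fst z, 2 * snd z - 1))"
    by (auto simp: subtopology_subtopology intro!: continuous_intros)
  from continuous_map_compose[OF this k]
  show "continuous_map (subtopology ?T {z \<in> topspace ?T. 1/2 \<le> snd z}) X (\<lambda>z. k (fst z, 2 * snd z - 1))"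
    by (simp add: o_def)
  show "h (fst z, 2 * snd z) = k (fst z, 2 * snd z - 1)" if "z \<in> topspace ?T" "snd z = 1/2" for z
  proof -
    have "2 * snd z = 1" "fst z \<in> S" using that by (auto simp: mem_Times_iff)
    then show ?thesis using hk by simp
  qed
qed

lemma continuous_map_from_snd:
  assumes "pathin X p" shows "continuous_map (top_of_set (S \<times> {0..1})) X (\<lambda>z. p (snd z))"
proof -
  have "continuous_map (top_of_set (S \<times> {0..1::real})) (top_of_set {0..1}) snd"
    by (auto intro!: continuous_intros)
  from continuous_map_compose[OF this] show ?thesis using assms by (auto simp: pathin_iff o_def)
qed

lemma pathin_path_concat:
  assumes "pathin X p" "pathin X q" "p 1 = q 0" shows "pathin X (path_concat p q)"
proof -
  have e: "continuous_map (top_of_set {0..1}) (top_of_set ({0::real} \<times> {0..1})) (\<lambda>t. (0, t))"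
    by (auto intro!: continuous_intros)
  have c: "continuous_map (top_of_set ({0::real} \<times> {0..1})) X
      (\<lambda>z. if snd z \<le> 1/2 then p (snd (fst z, 2 * snd z)) else q (snd (fst z, 2 * snd z - 1)))"
    by (rule continuous_map_path_concat_family[OF continuous_map_from_snd[OF assms(1)]
          continuous_map_from_snd[OF assms(2)]]) (use assms(3) in simp)
  show ?thesis
    using continuous_map_compose[OF e c] unfolding pathin_iff path_concat_def o_def fst_conv snd_conv .
qed

lemma path_homotopic_concat:
  assumes "path_homotopic X p p'" "path_homotopic X q q'" "p 1 = q 0"
  shows "path_homotopic X (path_concat p q) (path_concat p' q')"
proof -
  obtain h where h: "continuous_map (top_of_set unit_square) X h"
    "\<And>t. t\<in>{0..1} \<Longrightarrow> h (0, t) = p t \<and> h (1, t) = p' t" "\<And>s. s\<in>{0..1} \<Longrightarrow> h (s, 0) = p 0 \<and> h (s, 1) = p 1"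
    using assms(1) unfolding path_homotopic_iff by blast
  obtain k where k: "continuous_map (top_of_set unit_square) X k"
    "\<And>t. t\<in>{0..1} \<Longrightarrow> k (0, t) = q t \<and> k (1, t) = q' t" "\<And>s. s\<in>{0..1} \<Longrightarrow> k (s, 0) = q 0 \<and> k (s, 1) = q 1"
    using assms(2) unfolding path_homotopic_iff by blast
  show ?thesis unfolding path_homotopic_iff
    by (rule exI, rule conjI, rule continuous_map_path_concat_family[OF h(1) k(1)])
       (use h k assms(3) in \<open>auto simp: path_concat_def\<close>)
qed

definition path_reverse :: "(real \<Rightarrow> 'a) \<Rightarrow> real \<Rightarrow> 'a" where
  "path_reverse p = p \<circ> (\<lambda>t. 1 - t)"

lemma path_concat_ends [simp]: "path_concat p q 0 = p 0" "path_concat p q 1 = q 1"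
  by (simp_all add: path_concat_def)

lemma path_reverse_ends [simp]: "path_reverse p 0 = p 1" "path_reverse p 1 = p 0"
  by (simp_all add: path_reverse_def)

lemma pathin_reverse: "pathin X p \<Longrightarrow> pathin X (path_reverse p)"
  unfolding path_reverse_def
  by (rule pathin_compose_path[where K="{0..1}"]) (auto simp: pathin_iff path_def path_image_def intro!: continuous_intros)

lemma path_homotopic_assoc:
  assumes "pathin X p" "pathin X q" "pathin X r" "p 1 = q 0" "q 1 = r 0"
  shows "path_homotopic X (path_concat (path_concat p q) r) (path_concat p (path_concat q r))"
proof -
  \<comment> \<open>The piecewise linear reparametrisation that takes the break points 1/4 and 1/2
    of the left bracketing to 1/2 and 3/4.\<close>
  let ?f = "\<lambda>t::real. min (2 * t) (min (t + 1/4) (t/2 + 1/2))"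
  have "path_homotopic X (path_concat p (path_concat q r) \<circ> ?f) (path_concat p (path_concat q r))"
  proof (rule path_homotopic_reparam)
    show "continuous_on {0..1} ?f" by (intro continuous_intros) auto
    show "pathin X (path_concat p (path_concat q r))" using assms by (simp add: pathin_path_concat)
  qed (auto simp: min_def)
  moreover have "path_concat p (path_concat q r) \<circ> ?f = path_concat (path_concat p q) r"
  proof
    fix t :: real
    consider "t \<le> 1/4" | "1/4 < t" "t \<le> 1/2" | "1/2 < t" by linarith
    then show "(path_concat p (path_concat q r) \<circ> ?f) t = path_concat (path_concat p q) r t"
    proof cases
      case 1 then show ?thesis by (simp add: path_concat_def min_def)
    next
      case 2
      then have "?f t = t + 1/4" by (simp add: min_def)
      moreover have "2 * (t + 1/4) - 1 = 2 * t - 1/2" by simp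
      moreover have "2 * (2 * (t + 1/4) - 1) = 2 * (2 * t) - 1" by simp
      ultimately show ?thesis using 2 unfolding path_concat_def o_def by (simp only:) simp
    next
      case 3
      then have "?f t = t/2 + 1/2" by (simp add: min_def)
      moreover have "2 * (2 * (t/2 + 1/2) - 1) - 1 = 2 * t - 1" by simp
      ultimately show ?thesis using 3 unfolding path_concat_def o_def by (simp only:) simp
    qed
  qed
  ultimately show ?thesis by simp
qed

lemma path_homotopic_const_left:
  assumes "pathin X p" shows "path_homotopic X (path_concat (\<lambda>_. p 0) p) p"
proof -
  have "path_homotopic X (p \<circ> (\<lambda>t. max 0 (2 * t - 1))) p"
    using assms by (intro path_homotopic_reparam) (auto intro!: continuous_intros)
  moreover have "p \<circ> (\<lambda>t. max 0 (2 * t - 1)) = path_concat (\<lambda>_. p 0) p"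
  proof
    fix t :: real
    have "max 0 (2 * t - 1) = (if t \<le> 1/2 then 0 else 2 * t - 1)" by auto
    then show "(p \<circ> (\<lambda>t. max 0 (2 * t - 1))) t = path_concat (\<lambda>_. p 0) p t"
      by (simp add: path_concat_def)
  qed
  ultimately show ?thesis by simp
qed

lemma path_homotopic_const_right:
  assumes "pathin X p" shows "path_homotopic X (path_concat p (\<lambda>_. p 1)) p"
proof -
  have "path_homotopic X (p \<circ> (\<lambda>t. min (2 * t) 1)) p"
    using assms by (intro path_homotopic_reparam) (auto intro!: continuous_intros)
  moreover have "p \<circ> (\<lambda>t. min (2 * t) 1) = path_concat p (\<lambda>_. p 1)"
    by (auto simp: path_concat_def fun_eq_iff min_def)
  ultimately show ?thesis by simp
qed

lemma path_homotopic_reverse: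
  assumes "pathin X p" shows "path_homotopic X (path_concat p (path_reverse p)) (\<lambda>_. p 0)"
proof -
  have "path_homotopic X (p \<circ> (\<lambda>t. min (2 * t) (2 - 2 * t))) (p \<circ> (\<lambda>t. 0))"
    using assms
    by (intro path_homotopic_convex[where K="{0..1}"])
       (auto simp: pathin_iff path_def path_image_def intro!: continuous_intros)
  moreover have "p \<circ> (\<lambda>t. min (2 * t) (2 - 2 * t)) = path_concat p (path_reverse p)"
    by (auto simp: path_concat_def path_reverse_def fun_eq_iff min_def)
  ultimately show ?thesis by (simp add: o_def)
qed

lemma path_reverse_reverse [simp]: "path_reverse (path_reverse p) = p"
  by (simp add: path_reverse_def o_def)

lemma path_homotopic_concat_left:
  "pathin X r \<Longrightarrow> r 1 = p 0 \<Longrightarrow> path_homotopic X p q \<Longrightarrow> path_homotopic X (path_concat r p) (path_concat r q)"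
  by (simp add: path_homotopic_concat path_homotopic_refl)

lemma path_homotopic_concat_right:
  "pathin X r \<Longrightarrow> p 1 = r 0 \<Longrightarrow> path_homotopic X p q \<Longrightarrow> path_homotopic X (path_concat p r) (path_concat q r)"
  by (simp add: path_homotopic_concat path_homotopic_refl)

lemma joinpaths_ends': "(p +++ q) 0 = p 0" "(p +++ q) 1 = q 1"
  by (simp_all add: joinpaths_def)

text \<open>A functor from the fundamental groupoid of \<open>X\<close> to a group, regarded as a
  category with one object.\<close>

locale path_functor =
  fixes X :: "'x topology" and \<Phi> :: "(real \<Rightarrow> 'x) \<Rightarrow> 'f::group_add"
  assumes concat: "pathin X p \<Longrightarrow> pathin X q \<Longrightarrow> p 1 = q 0 \<Longrightarrow> \<Phi> (path_concat p q) = \<Phi> p + \<Phi> q"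
    and homotopic: "path_homotopic X p q \<Longrightarrow> \<Phi> p = \<Phi> q"
begin

lemma cong: "pathin X p \<Longrightarrow> (\<And>t. t \<in> {0..1} \<Longrightarrow> p t = q t) \<Longrightarrow> \<Phi> p = \<Phi> q"
  by (rule homotopic[OF path_homotopic_equal])

lemma const: "x \<in> topspace X \<Longrightarrow> \<Phi> (\<lambda>_. x) = 0"
  using concat[of "\<lambda>_. x" "\<lambda>_. x"] add_left_cancel[of "\<Phi> (\<lambda>_. x)" "\<Phi> (\<lambda>_. x)" 0]
  by (simp add: pathin_iff path_concat_def)

lemma reverse:
  assumes "pathin X p" shows "\<Phi> (path_reverse p) = - \<Phi> p"
proof -
  have "\<Phi> p + \<Phi> (path_reverse p) = \<Phi> (\<lambda>_. p 0)"
    using concat[OF assms pathin_reverse[OF assms]] homotopic[OF path_homotopic_reverse[OF assms]] by simp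
  also have "\<dots> = 0" using const pathin_in[OF assms, of 0] by simp
  finally show ?thesis by (metis add.inverse_unique)
qed

lemma convex:
  fixes K :: "'e::real_normed_vector set"
  assumes "convex K" "continuous_map (top_of_set K) X k"
    and "path p" "path_image p \<subseteq> K" "path q" "path_image q \<subseteq> K" "p 0 = q 0" "p 1 = q 1"
  shows "\<Phi> (k \<circ> p) = \<Phi> (k \<circ> q)"
  using assms by (intro homotopic path_homotopic_convex)

lemma line_add:
  fixes K :: "'e::real_normed_vector set"
  assumes K: "convex K" "continuous_map (top_of_set K) X k" and abc: "a \<in> K" "b \<in> K" "c \<in> K"
  shows "\<Phi> (k \<circ> linepath a b) + \<Phi> (k \<circ> linepath b c) = \<Phi> (k \<circ> linepath a c)"
proof -
  have sub: "closed_segment a b \<subseteq> K" "closed_segment b c \<subseteq> K" "closed_segment a c \<subseteq> K"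
    using K abc by (simp_all add: closed_segment_subset)
  have "\<Phi> (k \<circ> linepath a b) + \<Phi> (k \<circ> linepath b c) = \<Phi> (path_concat (k \<circ> linepath a b) (k \<circ> linepath b c))"
    by (rule concat[symmetric]) (use K sub in \<open>auto intro!: pathin_compose_path simp: linepath_0' linepath_1'\<close>)
  also have "path_concat (k \<circ> linepath a b) (k \<circ> linepath b c) = k \<circ> (linepath a b +++ linepath b c)"
    by (auto simp: path_concat_def joinpaths_def)
  also have "\<Phi> \<dots> = \<Phi> (k \<circ> linepath a c)"
    using K sub subset_path_image_join[of "linepath a b" K "linepath b c"]
    by (intro convex[where K=K]) (auto simp: linepath_0' linepath_1' joinpaths_ends')
  finally show ?thesis .
qed

lemma line_refl: 
  assumes "continuous_map (top_of_set K) X k" "a \<in> K" shows "\<Phi> (k \<circ> linepath a a) = 0"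
proof -
  have "k a \<in> topspace X" using assms unfolding continuous_map_def by auto
  then show ?thesis using const[of "k a"] by (simp add: o_def)
qed

text \<open>The interchange law for two independent motions: the two coordinates of the square are
  their times.\<close>

lemma square:
  assumes h: "continuous_map (top_of_set unit_square) X h"
  shows "\<Phi> (\<lambda>s. h (s, 0)) + \<Phi> (\<lambda>t. h (1, t)) = \<Phi> (\<lambda>t. h (0, t)) + \<Phi> (\<lambda>s. h (s, 1))"
proof -
  have K: "convex unit_square" by (intro convex_Times) auto
  have e: "(\<lambda>s. h (s, 0)) = h \<circ> linepath (0, 0) (1, 0)" "(\<lambda>t. h (1, t)) = h \<circ> linepath (1, 0) (1, 1)"
    "(\<lambda>t. h (0, t)) = h \<circ> linepath (0, 0) (0, 1)" "(\<lambda>s. h (s, 1)) = h \<circ> linepath (0, 1) (1, 1)"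
    by (auto simp: linepath_def fun_eq_iff)
  show ?thesis unfolding e using line_add[OF K h] by simp
qed

end

section \<open>Subpaths, and extension from loops to all paths\<close>

definition subpath_of :: "(real \<Rightarrow> 'a) \<Rightarrow> real \<Rightarrow> real \<Rightarrow> real \<Rightarrow> 'a" where
  "subpath_of p a b = p \<circ> linepath a b"

lemma subpath_of_ends [simp]: "subpath_of p a b 0 = p a" "subpath_of p a b 1 = p b"
  by (simp_all add: subpath_of_def linepath_def)

lemma subpath_of_whole [simp]: "subpath_of p 0 1 = p"
  by (auto simp: subpath_of_def linepath_def)

lemma linepath_in: "a \<in> {l..u} \<Longrightarrow> b \<in> {l..u} \<Longrightarrow> t \<in> {0..1} \<Longrightarrow> linepath a b t \<in> {l..u::real}"
  using closed_segment_subset[OF _ _ convex_closed_interval, of a l u b]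
  by (metis box_real(2) linepath_in_path subset_iff)

lemma subpath_of_in:
  "a \<in> {l..u} \<Longrightarrow> b \<in> {l..u} \<Longrightarrow> t \<in> {0..1} \<Longrightarrow> \<exists>s\<in>{l..u}. subpath_of p a b t = p s"
  using linepath_in[of a l u b t] by (auto simp: subpath_of_def)

lemma subpath_of_near:
  assumes "a \<in> {0..1}" "b \<in> {0..1}" "a \<le> t" "t \<le> b" "\<bar>a - t\<bar> < d" "\<bar>b - t\<bar> < d" "s \<in> {0..1}"
  obtains q where "q \<in> {0..1}" "\<bar>q - t\<bar> < d" "subpath_of p a b s = p q"
proof -
  obtain q where q: "q \<in> {a..b}" "subpath_of p a b s = p q" using subpath_of_in[of a a b b s p] assms by auto
  have "\<bar>q - t\<bar> < d" "q \<in> {0..1}" using q assms by (auto simp: abs_less_iff)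
  then show ?thesis using that q(2) by blast
qed

lemma pathin_subpath_of:
  "pathin X p \<Longrightarrow> a \<in> {0..1} \<Longrightarrow> b \<in> {0..1} \<Longrightarrow> pathin X (subpath_of p a b)"
  unfolding subpath_of_def
  by (rule pathin_compose_path[where K="{0..1}"])
     (auto simp: pathin_iff path_image_def intro: linepath_in)

lemma (in path_functor) subpath_add:
  assumes "pathin X p" "a \<in> {0..1}" "b \<in> {0..1}" "c \<in> {0..1}"
  shows "\<Phi> (subpath_of p a b) + \<Phi> (subpath_of p b c) = \<Phi> (subpath_of p a c)"
  unfolding subpath_of_def using assms by (intro line_add[where K="{0..1}"]) (auto simp: pathin_iff)

text \<open>The passage from a vertex group to the groupoid: a path is closed up to a loop by the
  chosen paths \<open>\<tau> y\<close> from \<open>x\<close> to its ends. \<open>\<tau> x\<close> is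
  constant, so that loops keep their values. By the last conclusion no new values arise.\<close>

lemma path_functor_extension:
  fixes \<phi> :: "(real \<Rightarrow> 'x) \<Rightarrow> 'f::group_add"
  assumes X: "path_connected_space X" "x \<in> topspace X"
    and add: "\<And>p q. p \<in> loops_at X x \<Longrightarrow> q \<in> loops_at X x \<Longrightarrow> \<phi> (path_concat p q) = \<phi> p + \<phi> q"
    and hom: "\<And>p q. p \<in> loops_at X x \<Longrightarrow> path_homotopic X p q \<Longrightarrow> \<phi> p = \<phi> q"
  obtains \<Phi> where "path_functor X \<Phi>" "\<And>p. p \<in> loops_at X x \<Longrightarrow> \<Phi> p = \<phi> p"
    "\<And>p. pathin X p \<Longrightarrow> \<exists>q\<in>loops_at X x. \<Phi> p = \<phi> q"
proof -
  have "\<exists>g. pathin X g \<and> g 0 = x \<and> g 1 = y \<and> (y = x \<longrightarrow> g = (\<lambda>_. x))" if "y \<in> topspace X" for y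
    using X that by (cases "y = x") (auto simp: path_connected_space_def pathin_iff)
  then obtain \<tau> where \<tau>: "\<And>y. y \<in> topspace X \<Longrightarrow> pathin X (\<tau> y) \<and> \<tau> y 0 = x \<and> \<tau> y 1 = y"
      "\<tau> x = (\<lambda>_. x)" using X(2) by metis
  let ?c = path_concat
  define \<Phi> where "\<Phi> p = \<phi> (?c (\<tau> (p 0)) (?c p (path_reverse (\<tau> (p 1)))))" for p
  note conc = path_homotopic_concat_left path_homotopic_concat_right
  have inl: "?c (\<tau> (p 0)) (?c p (path_reverse (\<tau> (p 1)))) \<in> loops_at X x" if "pathin X p" for p
  proof -
    have "pathin X (\<tau> (p 0))" "\<tau> (p 0) 1 = p 0" "\<tau> (p 0) 0 = x" 
      "pathin X (path_reverse (\<tau> (p 1)))" "path_reverse (\<tau> (p 1)) 0 = p 1" "path_reverse (\<tau> (p 1)) 1 = x"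
      using \<tau>(1)[of "p 0"] \<tau>(1)[of "p 1"] pathin_in[OF that] by (auto simp: pathin_reverse)
    then show ?thesis using that by (simp add: loops_at_def pathin_path_concat)
  qed
  have "path_functor X \<Phi>"
  proof
    fix p q assume p: "pathin X p" and q: "pathin X q" and pq: "p 1 = q 0"
    let ?a = "\<tau> (p 0)" and ?b = "\<tau> (p 1)" and ?d = "path_reverse (\<tau> (q 1))"
    have t: "pathin X ?a" "?a 0 = x" "?a 1 = p 0" "pathin X ?b" "?b 0 = x" "?b 1 = p 1"
      "pathin X ?d" "?d 1 = x" "?d 0 = q 1"
      using \<tau>(1)[of "p 0"] \<tau>(1)[of "p 1"] \<tau>(1)[of "q 1"] pathin_in[OF p] pathin_in[OF q] pathin_reverse by auto
    have tb: "pathin X (path_reverse ?b)" using t by (intro pathin_reverse)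
    have rev: "path_homotopic X (?c (path_reverse ?b) ?b) (\<lambda>_. (?c q ?d) 0)"
      using path_homotopic_reverse[OF tb] t pq by simp
    \<comment> \<open>The chosen path to the common end \<open>p 1\<close> is brought next to its
      reverse by rebracketing, and the two cancel.\<close>
    have "path_homotopic X (?c (?c ?a (?c p (path_reverse ?b))) (?c ?b (?c q ?d)))
            (?c ?a (?c (?c p (path_reverse ?b)) (?c ?b (?c q ?d))))"
      using p q pq t tb by (intro path_homotopic_assoc) (simp_all add: pathin_path_concat)
    moreover have "path_homotopic X (?c ?a (?c (?c p (path_reverse ?b)) (?c ?b (?c q ?d))))
            (?c ?a (?c p (?c (path_reverse ?b) (?c ?b (?c q ?d)))))"
      using p q pq t tb by (intro conc path_homotopic_assoc) (simp_all add: pathin_path_concat)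
    moreover have "path_homotopic X (?c ?a (?c p (?c (path_reverse ?b) (?c ?b (?c q ?d)))))
            (?c ?a (?c p (?c (?c (path_reverse ?b) ?b) (?c q ?d))))"
      using p q pq t tb
      by (intro conc path_homotopic_sym[OF path_homotopic_assoc]) (simp_all add: pathin_path_concat)
    moreover have "path_homotopic X (?c ?a (?c p (?c (?c (path_reverse ?b) ?b) (?c q ?d))))
            (?c ?a (?c p (?c (\<lambda>_. (?c q ?d) 0) (?c q ?d))))"
      using p q pq t tb by (intro conc rev) (simp_all add: pathin_path_concat)
    moreover have "path_homotopic X (?c ?a (?c p (?c (\<lambda>_. (?c q ?d) 0) (?c q ?d)))) (?c ?a (?c p (?c q ?d)))"
      using p q pq t tb by (intro conc path_homotopic_const_left) (simp_all add: pathin_path_concat)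
    moreover have "path_homotopic X (?c ?a (?c p (?c q ?d))) (?c ?a (?c (?c p q) ?d))"
      using p q pq t tb by (intro conc path_homotopic_sym[OF path_homotopic_assoc]) (simp_all add: pathin_path_concat)
    ultimately have "path_homotopic X (?c (?c ?a (?c p (path_reverse ?b))) (?c ?b (?c q ?d)))
        (?c ?a (?c (?c p q) ?d))" using path_homotopic_trans by meson
    moreover have "?c (?c ?a (?c p (path_reverse ?b))) (?c ?b (?c q ?d)) \<in> loops_at X x"
      using p q pq t tb by (simp add: loops_at_def pathin_path_concat)
    ultimately have "\<phi> (?c (?c ?a (?c p (path_reverse ?b))) (?c ?b (?c q ?d))) = \<phi> (?c ?a (?c (?c p q) ?d))"
      by (intro hom)
    then show "\<Phi> (?c p q) = \<Phi> p + \<Phi> q"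
      unfolding \<Phi>_def using add[OF inl[OF p] inl[OF q]] pq by simp
  next
    fix p q assume pq: "path_homotopic X p q"
    note i = path_homotopic_imp[OF pq]
    have t: "pathin X (\<tau> (p 0))" "\<tau> (p 0) 1 = p 0" "pathin X (\<tau> (p 1))" "\<tau> (p 1) 1 = p 1"
      using \<tau>(1)[of "p 0"] \<tau>(1)[of "p 1"] pathin_in[OF i(1)] by auto
    show "\<Phi> p = \<Phi> q"
      unfolding \<Phi>_def i(3,4)[symmetric]
      using pq t i inl[OF i(1)] by (intro hom conc) (auto simp: pathin_reverse)
  qed
  moreover have "\<Phi> p = \<phi> p" if "p \<in> loops_at X x" for p
  proof -
    have p: "pathin X p" "p 0 = x" "p 1 = x" using that by (auto simp: loops_at_def)
    have e: "path_reverse (\<lambda>_. x) = (\<lambda>_. x)" by (auto simp: path_reverse_def)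
    have c: "pathin X (\<lambda>_. x)" using X by (simp add: pathin_iff)
    have "path_homotopic X (?c (\<lambda>_. x) (?c p (\<lambda>_. x))) (?c (\<lambda>_. x) p)"
      using path_homotopic_concat_left[OF c _ path_homotopic_const_right[OF p(1)]] p by simp
    moreover have "path_homotopic X (?c (\<lambda>_. x) p) p" using path_homotopic_const_left[OF p(1)] p by simp
    ultimately have "path_homotopic X (?c (\<lambda>_. x) (?c p (\<lambda>_. x))) p" using path_homotopic_trans by blast
    then have "\<phi> (?c (\<lambda>_. x) (?c p (\<lambda>_. x))) = \<phi> p"
      by (intro hom) (use p c in \<open>auto simp: loops_at_def pathin_path_concat\<close>)
    then show ?thesis unfolding \<Phi>_def using p \<tau>(2) e by simp
  qed
  moreover have "\<exists>q\<in>loops_at X x. \<Phi> p = \<phi> q" if "pathin X p" for p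
    using inl[OF that] unfolding \<Phi>_def by blast
  ultimately show ?thesis using that by blast
qed

section \<open>Paths of configurations\<close>

text \<open>Bisection for statements about the two ends of an interval. The local claim concerns
  short intervals that contain \<open>t\<close>, so one chart or one neighbourhood at time
  \<open>t\<close> can be fixed for it.\<close>

lemma interval_induct:
  fixes P :: "real \<Rightarrow> real \<Rightarrow> bool"
  assumes trans: "\<And>a b c. P a b \<Longrightarrow> P b c \<Longrightarrow> 0 \<le> a \<Longrightarrow> a \<le> b \<Longrightarrow> b \<le> c \<Longrightarrow> c \<le> 1 \<Longrightarrow> P a c"
    and loc: "\<And>t. t \<in> {0..1} \<Longrightarrow> \<exists>d>0. \<forall>a\<in>{0..1}. \<forall>b\<in>{0..1}. a \<le> t \<longrightarrow> t \<le> b \<longrightarrow>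
               \<bar>a - t\<bar> < d \<longrightarrow> \<bar>b - t\<bar> < d \<longrightarrow> P a b"
  shows "P 0 1"
proof -
  have "0 \<le> (0::real) \<and> (1::real) \<le> 1 \<longrightarrow> P 0 1"
  proof (rule Bolzano[where P="\<lambda>a b. 0 \<le> a \<and> b \<le> 1 \<longrightarrow> P a b"])
    fix t :: real assume t: "0 \<le> t" "t \<le> 1"
    then obtain d where d: "d > 0" "\<And>a b. a\<in>{0..1} \<Longrightarrow> b\<in>{0..1} \<Longrightarrow> a \<le> t \<Longrightarrow> t \<le> b \<Longrightarrow>
               \<bar>a - t\<bar> < d \<Longrightarrow> \<bar>b - t\<bar> < d \<Longrightarrow> P a b" using loc[of t] by auto
    show "\<exists>d>0. \<forall>a b. a \<le> t \<and> t \<le> b \<and> b - a < d \<longrightarrow> 0 \<le> a \<and> b \<le> 1 \<longrightarrow> P a b"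
    proof (intro exI[of _ d] conjI allI impI, fact)
      fix a b assume "a \<le> t \<and> t \<le> b \<and> b - a < d" "0 \<le> a \<and> b \<le> 1"
      then show "P a b" by (intro d(2)) auto
    qed
  next
    fix a b c assume "0 \<le> a \<and> b \<le> 1 \<longrightarrow> P a b" "0 \<le> b \<and> c \<le> 1 \<longrightarrow> P b c" "a \<le> b" "b \<le> (c::real)"
    then show "0 \<le> a \<and> c \<le> 1 \<longrightarrow> P a c" using trans[of a b c] by auto
  qed simp
  then show ?thesis by simp
qed

lemma pathin_local:
  assumes "pathin X p" "t \<in> {0..1}" "openin X U" "p t \<in> U"
  obtains d where "d > 0" "\<And>s. s \<in> {0..1} \<Longrightarrow> \<bar>s - t\<bar> < d \<Longrightarrow> p s \<in> U"
proof -
  have "openin (top_of_set {0..1}) {s \<in> {0..1}. p s \<in> U}"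
    using assms(1,3) unfolding pathin_iff continuous_map_def by auto
  then obtain d where "d > 0" "\<And>s. s \<in> {0..1} \<Longrightarrow> dist s t < d \<Longrightarrow> s \<in> {s \<in> {0..1}. p s \<in> U}"
    using assms(2,4) unfolding openin_euclidean_subtopology_iff by blast
  then show ?thesis using that[of d] by (auto simp: dist_real_def)
qed

text \<open>A numbering of the index set lifts the map to the ordered configuration space, whose
  projection is continuous. Arbitrary index sets spare renumberings later.\<close>

lemma conf_continuous:
  fixes g :: "'i \<Rightarrow> 'z \<Rightarrow> 'a"
  assumes I: "finite I" "card I = n" and g: "\<And>i. i \<in> I \<Longrightarrow> continuous_map Z M (g i)"
    and inj: "\<And>z. z \<in> topspace Z \<Longrightarrow> inj_on (\<lambda>i. g i z) I"
  shows "continuous_map Z (uconf n M) (\<lambda>z. (\<lambda>i. g i z) ` I)"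
proof -
  obtain b where b: "bij_betw b {..<n} I"
    using ex_bij_betw_nat_finite[OF I(1)] I(2) by (metis atLeast0LessThan)
  define F where "F z = restrict (\<lambda>k. g (b k) z) {..<n}" for z
  have "continuous_map Z (product_topology (\<lambda>_. M) {..<n}) F"
    unfolding continuous_map_componentwise F_def using g bij_betwE[OF b] by auto
  moreover have "inj_on (F z) {..<n}" if "z \<in> topspace Z" for z
  proof -
    have "inj_on ((\<lambda>i. g i z) \<circ> b) {..<n}"
      using b inj[OF that] unfolding bij_betw_def by (simp add: comp_inj_on)
    then show ?thesis unfolding F_def by (simp add: inj_on_def)
  qed
  ultimately have "continuous_map Z (ordered_conf n M) F"
    unfolding ordered_conf_def continuous_map_in_subtopology by auto
  moreover have "continuous_map (ordered_conf n M) (uconf n M) (\<lambda>f. f ` {..<n})"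
    unfolding uconf_def by (rule quotient_imp_continuous_map[OF quotient_map_quotient_topology])
  ultimately have "continuous_map Z (uconf n M) ((\<lambda>f. f ` {..<n}) \<circ> F)"
    by (rule continuous_map_compose)
  moreover have "F z ` {..<n} = (\<lambda>i. g i z) ` I" for z
    using b unfolding F_def bij_betw_def by auto
  ultimately show ?thesis by (simp add: o_def)
qed

lemma conf_continuous_const:
  fixes g :: "'i \<Rightarrow> 'z \<Rightarrow> 'a"
  assumes I: "finite I" and C: "finite C" "C \<subseteq> topspace M" and n: "card I + card C = n"
    and g: "\<And>i. i \<in> I \<Longrightarrow> continuous_map Z M (g i)"
    and inj: "\<And>z. z \<in> topspace Z \<Longrightarrow> inj_on (\<lambda>i. g i z) I"
    and disj: "\<And>z i. z \<in> topspace Z \<Longrightarrow> i \<in> I \<Longrightarrow> g i z \<notin> C"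
  shows "continuous_map Z (uconf n M) (\<lambda>z. (\<lambda>i. g i z) ` I \<union> C)"
proof -
  let ?J = "Inl ` I \<union> Inr ` C :: ('i + 'a) set"
  define G where "G k z = (case k of Inl i \<Rightarrow> g i z | Inr c \<Rightarrow> c)" for k z
  have G: "G (Inl i) z = g i z" "G (Inr c) z = c" for i c z by (simp_all add: G_def)
  have "continuous_map Z (uconf n M) (\<lambda>z. (\<lambda>k. G k z) ` ?J)"
  proof (rule conf_continuous)
    show "finite ?J" using I C by simp
    have "card ?J = card (Inl ` I :: ('i + 'a) set) + card (Inr ` C :: ('i + 'a) set)"
      using I C by (intro card_Un_disjoint) auto
    then show "card ?J = n" using n by (simp add: card_image)
    show "continuous_map Z M (G k)" if "k \<in> ?J" for k
    proof (cases k)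
      case (Inl i)
      then have "G k = g i" using G by auto
      then show ?thesis using g that Inl by auto
    next
      case (Inr c)
      then have "G k = (\<lambda>_. c)" using G by auto
      then show ?thesis using C(2) that Inr by auto
    qed
    show "inj_on (\<lambda>k. G k z) ?J" if "z \<in> topspace Z" for z
    proof (rule inj_onI)
      fix k l assume "k \<in> ?J" "l \<in> ?J" "G k z = G l z"
      then show "k = l"
        using inj_onD[OF inj[OF that]] disj[OF that]
        by (cases k; cases l) (auto simp: G)
    qed
  qed
  moreover have "(\<lambda>k. G k z) ` ?J = (\<lambda>i. g i z) ` I \<union> C" for z
    unfolding image_Un image_image G by simp
  ultimately show ?thesis by simp
qed

lemma insert_continuous:
  assumes "finite C" "C \<subseteq> topspace M" "Suc (card C) = n" "continuous_map Z M f"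
    and "\<And>z. z \<in> topspace Z \<Longrightarrow> f z \<notin> C"
  shows "continuous_map Z (uconf n M) (\<lambda>z. insert (f z) C)"
  using conf_continuous_const[of "{()}" C M n Z "\<lambda>_. f"] assms by simp

lemma insert2_continuous:
  assumes "finite C" "C \<subseteq> topspace M" "Suc (Suc (card C)) = n" "continuous_map Z M f" "continuous_map Z M g"
    and "\<And>z. z \<in> topspace Z \<Longrightarrow> f z \<notin> C \<and> g z \<notin> C \<and> f z \<noteq> g z"
  shows "continuous_map Z (uconf n M) (\<lambda>z. insert (f z) (insert (g z) C))"
proof -
  have "\<And>z. z \<in> topspace Z \<Longrightarrow> g z \<noteq> f z" using assms(6) by metis
  note ne = this
  have "continuous_map Z (uconf n M) (\<lambda>z. (\<lambda>b. if b then f z else g z) ` UNIV \<union> C)"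
    by (rule conf_continuous_const) (use assms ne in \<open>auto simp: inj_on_def\<close>)
  moreover have "(\<lambda>b. if b then f z else g z) ` UNIV \<union> C = insert (f z) (insert (g z) C)" for z
    by (auto simp: UNIV_bool)
  ultimately show ?thesis by simp
qed

section \<open>Separating neighbourhoods in configuration spaces, and strands\<close>

lemma openin_uconf_meets:
  assumes "openin M V" shows "openin (uconf n M) {A \<in> topspace (uconf n M). A \<inter> V \<noteq> {}}"
proof -
  let ?A = "{A \<in> topspace (uconf n M). A \<inter> V \<noteq> {}}" and ?P = "product_topology (\<lambda>_. M) {..<n}"
  have "openin ?P {f \<in> topspace ?P. f i \<in> V}" if "i < n" for i
    using continuous_map_product_projection[of i "{..<n}" "\<lambda>_. M"] that assms
    unfolding continuous_map_def by auto
  then have "openin ?P (\<Union>i<n. {f \<in> topspace ?P. f i \<in> V})" by (intro openin_Union) auto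
  then have "openin (ordered_conf n M) ((\<Union>i<n. {f \<in> topspace ?P. f i \<in> V}) \<inter> {f. inj_on f {..<n}})"
    unfolding ordered_conf_def openin_subtopology by blast
  moreover have "(\<Union>i<n. {f \<in> topspace ?P. f i \<in> V}) \<inter> {f. inj_on f {..<n}} =
      {f \<in> topspace (ordered_conf n M). f ` {..<n} \<in> ?A}"
    unfolding uconf_def topspace_quotient_topology unfolding ordered_conf_def by auto
  ultimately show ?thesis
    unfolding uconf_def openin_quotient_topology topspace_quotient_topology by auto
qed

text \<open>For a \<open>box_family\<close> there are as many points as disjoint sets
  \<open>V c\<close>, so each set contains exactly one point. These are evenly covered
  neighbourhoods for the projection from ordered configurations.\<close>

definition conf_box :: "'a set \<Rightarrow> ('a \<Rightarrow> 'a set) \<Rightarrow> 'a topology \<Rightarrow> 'a set set" where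
  "conf_box C V M = {A \<in> topspace (uconf (card C) M). \<forall>c\<in>C. A \<inter> V c \<noteq> {}}"

definition box_family :: "'a topology \<Rightarrow> 'a set \<Rightarrow> ('a \<Rightarrow> 'a set) \<Rightarrow> bool" where
  "box_family M C V \<longleftrightarrow> finite C \<and> C \<subseteq> topspace M \<and> (\<forall>c\<in>C. openin M (V c) \<and> c \<in> V c) \<and>
     (\<forall>c\<in>C. \<forall>d\<in>C. c \<noteq> d \<longrightarrow> V c \<inter> V d = {})"

lemma box_family_exists:
  assumes "Hausdorff_space M" "finite C" "C \<subseteq> topspace M"
  obtains V where "box_family M C V"
proof -
  have "\<exists>U. openin M U \<and> c \<in> U \<and> (\<exists>U'. openin M U' \<and> d \<in> U' \<and> U \<inter> U' = {})" if "c \<in> C" "d \<in> C" "c \<noteq> d" for c d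
    using assms that unfolding Hausdorff_space_def disjnt_def by (metis subsetD)
  then have "\<exists>U U'. openin M U \<and> c \<in> U \<and> openin M U' \<and> d \<in> U' \<and> U \<inter> U' = {}" if "c \<in> C" "d \<in> C" "c \<noteq> d" for c d
    using that by metis
  then obtain U U' where U: "\<And>c d. c \<in> C \<Longrightarrow> d \<in> C \<Longrightarrow> c \<noteq> d \<Longrightarrow>
      openin M (U c d) \<and> c \<in> U c d \<and> openin M (U' c d) \<and> d \<in> U' c d \<and> U c d \<inter> U' c d = {}" by metis
  define V where "V c = topspace M \<inter> (\<Inter>d\<in>C - {c}. U c d \<inter> U' d c)" for c
  have "openin M (V c)" if "c \<in> C" for c
    using U that assms(2) openin_INT[of "C - {c}" M "\<lambda>d. U c d \<inter> U' d c"]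
    unfolding V_def by (auto simp: Int_commute)
  moreover have "c \<in> V c" if "c \<in> C" for c using U that assms unfolding V_def by auto
  moreover have "V c \<inter> V d = {}" if "c \<in> C" "d \<in> C" "c \<noteq> d" for c d
  proof -
    have "V c \<subseteq> U c d" "V d \<subseteq> U' c d" using that unfolding V_def by blast+
    then show ?thesis using U[OF that] by blast
  qed
  ultimately have "box_family M C V" using assms unfolding box_family_def by blast
  then show ?thesis using that by blast
qed

lemma openin_conf_box:
  assumes "box_family M C V" shows "openin (uconf (card C) M) (conf_box C V M)"
proof (cases "C = {}")
  case True
  then show ?thesis unfolding conf_box_def by simp
next
  case False
  have "conf_box C V M = (\<Inter>c\<in>C. {A \<in> topspace (uconf (card C) M). A \<inter> V c \<noteq> {}})"
    unfolding conf_box_def using False by auto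
  moreover have "openin (uconf (card C) M) \<dots>"
    using assms False unfolding box_family_def by (intro openin_INT2 openin_uconf_meets) auto
  ultimately show ?thesis by simp
qed

lemma center_in_conf_box: "box_family M C V \<Longrightarrow> C \<in> conf_box C V M"
  unfolding box_family_def conf_box_def topspace_uconf by auto

lemma conf_box_unique:
  assumes V: "box_family M C V" and A: "A \<in> conf_box C V M"
  shows "c \<in> C \<Longrightarrow> \<exists>!x. x \<in> A \<and> x \<in> V c" "x \<in> A \<Longrightarrow> \<exists>c\<in>C. x \<in> V c"
proof -
  have "\<forall>c\<in>C. \<exists>x. x \<in> A \<inter> V c" using A unfolding conf_box_def by auto
  from bchoice[OF this] obtain f where f: "\<And>c. c \<in> C \<Longrightarrow> f c \<in> A \<inter> V c" by blast
  have disj: "c = d" if "x \<in> V c" "x \<in> V d" "c \<in> C" "d \<in> C" for x c d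
    using V that unfolding box_family_def by blast
  have "inj_on f C" using disj f by (metis IntE inj_onI)
  then have "card (f ` C) = card C" by (rule card_image)
  moreover have "f ` C \<subseteq> A" using f by auto
  moreover have "finite A" "card A = card C" using A unfolding conf_box_def topspace_uconf by auto
  ultimately have fC: "f ` C = A" by (metis card_subset_eq)
  show "x \<in> A \<Longrightarrow> \<exists>c\<in>C. x \<in> V c" using f fC by blast
  show "\<exists>!x. x \<in> A \<and> x \<in> V c" if "c \<in> C"
    using f disj fC that by (metis (no_types, lifting) IntD1 IntD2 imageE)
qed

definition box_point :: "('a \<Rightarrow> 'a set) \<Rightarrow> 'a \<Rightarrow> 'a set \<Rightarrow> 'a" where
  "box_point V c A = (THE x. x \<in> A \<and> x \<in> V c)"

lemma box_point:
  assumes "box_family M C V" "A \<in> conf_box C V M" "c \<in> C"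
  shows "box_point V c A \<in> A" "box_point V c A \<in> V c"
    and "x \<in> A \<Longrightarrow> x \<in> V c \<Longrightarrow> box_point V c A = x"
  using theI'[OF conf_box_unique(1)[OF assms]] conf_box_unique(1)[OF assms]
  unfolding box_point_def by (auto intro: the1_equality)

lemma box_point_image:
  assumes "box_family M C V" "A \<in> conf_box C V M"
  shows "(\<lambda>c. box_point V c A) ` C = A"
  using box_point[OF assms] conf_box_unique(2)[OF assms] by (auto; metis image_eqI)

lemma box_point_continuous:
  assumes V: "box_family M C V" and c: "c \<in> C"
  shows "continuous_map (subtopology (uconf (card C) M) (conf_box C V M)) M (box_point V c)"
  unfolding continuous_map_def
proof (intro conjI allI impI)
  let ?X = "uconf (card C) M" let ?B = "conf_box C V M"
  have B: "?B \<subseteq> topspace ?X" unfolding conf_box_def by auto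
  then have top: "topspace (subtopology ?X ?B) = ?B" by auto
  show "box_point V c \<in> topspace (subtopology ?X ?B) \<rightarrow> topspace M"
    using box_point(2)[OF V _ c] V c openin_subset unfolding top box_family_def by fastforce
  fix U assume U: "openin M U"
  have "{A \<in> ?B. box_point V c A \<in> U} = {A \<in> topspace ?X. A \<inter> (U \<inter> V c) \<noteq> {}} \<inter> ?B"
    using box_point[OF V _ c] B by (auto; blast)
  moreover have "openin ?X {A \<in> topspace ?X. A \<inter> (U \<inter> V c) \<noteq> {}}"
    using U V c unfolding box_family_def by (intro openin_uconf_meets) auto
  ultimately show "openin (subtopology ?X ?B) {A \<in> topspace (subtopology ?X ?B). box_point V c A \<in> U}"
    unfolding top openin_subtopology by blast
qed

definition strand :: "'a topology \<Rightarrow> (real \<Rightarrow> 'a set) \<Rightarrow> (real \<Rightarrow> 'a) \<Rightarrow> bool" where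
  "strand M \<gamma> p \<longleftrightarrow> pathin M p \<and> (\<forall>t\<in>{0..1}. p t \<in> \<gamma> t)"

lemma box_strand:
  assumes V: "box_family M C V" and \<gamma>: "pathin (uconf (card C) M) \<gamma>"
    and c: "c \<in> C" and ab: "a \<in> {0..1}" "b \<in> {0..1}" and box: "\<And>t. t \<in> {a..b} \<Longrightarrow> \<gamma> t \<in> conf_box C V M"
  shows "continuous_map (top_of_set {a..b}) M (\<lambda>t. box_point V c (\<gamma> t))"
proof -
  have "continuous_map (top_of_set {a..b}) (top_of_set {0..1}) (\<lambda>t. t)" using ab by auto
  from continuous_map_compose[OF this \<gamma>[unfolded pathin_iff]]
  have "continuous_map (top_of_set {a..b}) (uconf (card C) M) \<gamma>" by (simp add: o_def)
  then have "continuous_map (top_of_set {a..b}) (subtopology (uconf (card C) M) (conf_box C V M)) \<gamma>"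
    using box unfolding continuous_map_in_subtopology by auto
  from continuous_map_compose[OF this box_point_continuous[OF V c]] show ?thesis by (simp add: o_def)
qed

lemma continuous_map_glue_interval:
  assumes f: "continuous_map (top_of_set {a..b::real}) M f" and g: "continuous_map (top_of_set {b..c}) M g"
    and fg: "f b = g b" and ab: "a \<le> b" "b \<le> c"
  shows "continuous_map (top_of_set {a..c}) M (\<lambda>t. if t \<le> b then f t else g t)"
proof (rule continuous_map_cases_le)
  have 1: "{t \<in> topspace (top_of_set {a..c}). t \<le> b} = {a..b}" 
    "{t \<in> topspace (top_of_set {a..c}). b \<le> t} = {b..c}" using ab by auto
  have 2: "{a..c} \<inter> {a..b} = {a..b}" "{a..c} \<inter> {b..c} = {b..c}" using ab by auto
  show "continuous_map (subtopology (top_of_set {a..c}) {t \<in> topspace (top_of_set {a..c}). t \<le> b}) M f"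
    unfolding 1 subtopology_subtopology 2 by (rule f)
  show "continuous_map (subtopology (top_of_set {a..c}) {t \<in> topspace (top_of_set {a..c}). b \<le> t}) M g"
    unfolding 1 subtopology_subtopology 2 by (rule g)
qed (use fg in auto)

text \<open>Path lifting to ordered configurations, with strands indexed by their starting points:
  short pieces stay in one box, where \<open>box_point\<close> follows each point, and the pieces
  are glued end to end.\<close>

lemma uconf_path_strands:
  assumes M: "Hausdorff_space M" and \<gamma>: "pathin (uconf n M) \<gamma>"
  obtains g where "\<And>x. x \<in> \<gamma> 0 \<Longrightarrow> pathin M (g x) \<and> g x 0 = x"
    "\<And>t. t \<in> {0..1} \<Longrightarrow> (\<lambda>x. g x t) ` \<gamma> 0 = \<gamma> t"
proof -
  define P where "P a b \<longleftrightarrow> (\<exists>g. (\<forall>x\<in>\<gamma> a. continuous_map (top_of_set {a..b}) M (g x) \<and> g x a = x) \<and>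
      (\<forall>t\<in>{a..b}. (\<lambda>x. g x t) ` \<gamma> a = \<gamma> t))" for a b
  have "P 0 1"
  proof (rule interval_induct)
    fix a b c :: real assume "P a b" "P b c" and abc: "a \<le> b" "b \<le> c"
    then obtain g h where g: "\<And>x. x\<in>\<gamma> a \<Longrightarrow> continuous_map (top_of_set {a..b}) M (g x) \<and> g x a = x"
      "\<And>t. t\<in>{a..b} \<Longrightarrow> (\<lambda>x. g x t) ` \<gamma> a = \<gamma> t"
      and h: "\<And>x. x\<in>\<gamma> b \<Longrightarrow> continuous_map (top_of_set {b..c}) M (h x) \<and> h x b = x"
      "\<And>t. t\<in>{b..c} \<Longrightarrow> (\<lambda>x. h x t) ` \<gamma> b = \<gamma> t" unfolding P_def by metis
    let ?k = "\<lambda>x t. if t \<le> b then g x t else h (g x b) t"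
    have gb: "(\<lambda>x. g x b) ` \<gamma> a = \<gamma> b" using g(2)[of b] abc by simp
    have "continuous_map (top_of_set {a..c}) M (?k x) \<and> ?k x a = x" if "x \<in> \<gamma> a" for x
    proof -
      have "g x b \<in> \<gamma> b" using gb that by blast
      then show ?thesis
        using g(1)[OF that] h(1)[of "g x b"] abc by (auto intro!: continuous_map_glue_interval)
    qed
    moreover have "(\<lambda>x. ?k x t) ` \<gamma> a = \<gamma> t" if "t \<in> {a..c}" for t
    proof (cases "t \<le> b")
      case True then show ?thesis using g(2) that by simp
    next
      case False
      then have "(\<lambda>x. ?k x t) ` \<gamma> a = (\<lambda>x. h x t) ` ((\<lambda>x. g x b) ` \<gamma> a)" by (simp add: image_image)
      then show ?thesis using False that h(2)[of t] gb by simp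
    qed
    ultimately show "P a c" unfolding P_def by (intro exI[of _ ?k]) blast
  next
    fix t :: real assume t: "t \<in> {0..1}"
    have \<gamma>t: "\<gamma> t \<in> topspace (uconf n M)" using pathin_in[OF \<gamma> t] .
    then have C: "finite (\<gamma> t)" "\<gamma> t \<subseteq> topspace M" "card (\<gamma> t) = n" by (auto simp: topspace_uconf)
    obtain V where V: "box_family M (\<gamma> t) V" using box_family_exists[OF M C(1,2)] .
    have \<gamma>': "pathin (uconf (card (\<gamma> t)) M) \<gamma>" using \<gamma> C by simp
    obtain d where d: "d > 0" "\<And>s. s \<in> {0..1} \<Longrightarrow> \<bar>s - t\<bar> < d \<Longrightarrow> \<gamma> s \<in> conf_box (\<gamma> t) V M"
      using pathin_local[OF \<gamma>' t openin_conf_box[OF V] center_in_conf_box[OF V]] by blast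
    have "P a b" if ab: "a\<in>{0..1}" "b\<in>{0..1}" "a \<le> t" "t \<le> b" "\<bar>a - t\<bar> < d" "\<bar>b - t\<bar> < d" for a b
    proof -
      have box: "\<gamma> s \<in> conf_box (\<gamma> t) V M" if "s \<in> {a..b}" for s using that ab d(2)[of s] by auto
      have boxa: "\<gamma> a \<in> conf_box (\<gamma> t) V M" using box ab by auto
      have "\<forall>x\<in>\<gamma> a. \<exists>c. c \<in> \<gamma> t \<and> x \<in> V c"
        using conf_box_unique(2)[OF V box[of a]] ab by auto
      from bchoice[OF this] obtain c where c0: "\<forall>x\<in>\<gamma> a. c x \<in> \<gamma> t \<and> x \<in> V (c x)" ..
      have c: "\<And>x. x \<in> \<gamma> a \<Longrightarrow> c x \<in> \<gamma> t \<and> x \<in> V (c x)" using c0 by simp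
      have ca: "c ` \<gamma> a = \<gamma> t"
      proof
        show "\<gamma> t \<subseteq> c ` \<gamma> a"
        proof
          fix y assume y: "y \<in> \<gamma> t"
          let ?x = "box_point V y (\<gamma> a)"
          have x: "?x \<in> \<gamma> a" "?x \<in> V y" by (rule box_point(1,2)[OF V boxa y])+
          have "c ?x = y"
          proof (rule ccontr)
            assume "c ?x \<noteq> y"
            then have "V (c ?x) \<inter> V y = {}" using V y c[OF x(1)] unfolding box_family_def by blast
            then show False using c[OF x(1)] x(2) by blast
          qed
          then show "y \<in> c ` \<gamma> a" using imageI[OF x(1), of c] by simp
        qed
      qed (use c in auto)
      let ?g = "\<lambda>x s. box_point V (c x) (\<gamma> s)"
      have "continuous_map (top_of_set {a..b}) M (?g x) \<and> ?g x a = x" if "x \<in> \<gamma> a" for x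
        using box_strand[OF V \<gamma>' _ ab(1,2) box] box_point(3)[OF V boxa] c[OF that] that by blast
      moreover have "(\<lambda>x. ?g x s) ` \<gamma> a = \<gamma> s" if "s \<in> {a..b}" for s
      proof -
        have "(\<lambda>x. ?g x s) ` \<gamma> a = (\<lambda>y. box_point V y (\<gamma> s)) ` (c ` \<gamma> a)" by (simp add: image_image)
        then show ?thesis unfolding ca using box_point_image[OF V box[OF that]] by simp
      qed
      ultimately show ?thesis unfolding P_def by (intro exI[of _ ?g]) blast
    qed
    then show "\<exists>d>0. \<forall>a\<in>{0..1}. \<forall>b\<in>{0..1}. a \<le> t \<longrightarrow> t \<le> b \<longrightarrow> \<bar>a - t\<bar> < d \<longrightarrow> \<bar>b - t\<bar> < d \<longrightarrow> P a b"
      using d(1) by blast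
  qed
  then obtain g where g: "\<forall>x\<in>\<gamma> 0. continuous_map (top_of_set {0..1}) M (g x) \<and> g x 0 = x"
      "\<forall>t\<in>{0..1}. (\<lambda>x. g x t) ` \<gamma> 0 = \<gamma> t" unfolding P_def by blast
  show ?thesis by (rule that[of g]) (use g in \<open>auto simp: pathin_iff\<close>)
qed

text \<open>Strands that agree at the beginning of a short interval stay in the same set
  \<open>V c\<close> during all of it, and that set contains a single point of the
  configuration.\<close>

lemma strand_unique:
  assumes M: "Hausdorff_space M" and \<gamma>: "pathin (uconf n M) \<gamma>"
    and p: "strand M \<gamma> p" and q: "strand M \<gamma> q" and "p 0 = q 0" and "t \<in> {0..1}"
  shows "p t = q t"
proof -
  define P where "P a b \<longleftrightarrow> (p a = q a \<longrightarrow> (\<forall>t\<in>{a..b}. p t = q t))" for a b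
  have "P 0 1"
  proof (rule interval_induct)
    fix a b c :: real assume "P a b" "P b c" "a \<le> b" "b \<le> c"
    then show "P a c" unfolding P_def by (metis atLeastAtMost_iff linorder_le_cases order_refl)
  next
    fix t :: real assume t: "t \<in> {0..1}"
    have "\<gamma> t \<in> topspace (uconf n M)" using pathin_in[OF \<gamma> t] .
    then have C: "finite (\<gamma> t)" "\<gamma> t \<subseteq> topspace M" "card (\<gamma> t) = n" by (auto simp: topspace_uconf)
    obtain V where V: "box_family M (\<gamma> t) V" using box_family_exists[OF M C(1,2)] .
    have \<gamma>': "pathin (uconf (card (\<gamma> t)) M) \<gamma>" using \<gamma> C by simp
    obtain d0 where d0: "d0 > 0" "\<And>s. s \<in> {0..1} \<Longrightarrow> \<bar>s - t\<bar> < d0 \<Longrightarrow> \<gamma> s \<in> conf_box (\<gamma> t) V M"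
      using pathin_local[OF \<gamma>' t openin_conf_box[OF V] center_in_conf_box[OF V]] by blast
    have pq: "pathin M p" "pathin M q" "p t \<in> \<gamma> t" "q t \<in> \<gamma> t"
      "\<And>s. s \<in> {0..1} \<Longrightarrow> p s \<in> \<gamma> s" "\<And>s. s \<in> {0..1} \<Longrightarrow> q s \<in> \<gamma> s"
      using p q t unfolding strand_def by auto
    have Vt: "openin M (V (p t))" "p t \<in> V (p t)" "openin M (V (q t))" "q t \<in> V (q t)"
      using V pq unfolding box_family_def by auto
    obtain d1 where d1: "d1 > 0" "\<And>s. s \<in> {0..1} \<Longrightarrow> \<bar>s - t\<bar> < d1 \<Longrightarrow> p s \<in> V (p t)"
      using pathin_local[OF pq(1) t Vt(1,2)] by blast
    obtain d2 where d2: "d2 > 0" "\<And>s. s \<in> {0..1} \<Longrightarrow> \<bar>s - t\<bar> < d2 \<Longrightarrow> q s \<in> V (q t)"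
      using pathin_local[OF pq(2) t Vt(3,4)] by blast
    let ?d = "min d0 (min d1 d2)"
    have "P a b" if ab: "a\<in>{0..1}" "b\<in>{0..1}" "a \<le> t" "t \<le> b" "\<bar>a - t\<bar> < ?d" "\<bar>b - t\<bar> < ?d" for a b
      unfolding P_def
    proof (intro impI ballI)
      fix s assume e: "p a = q a" and s: "s \<in> {a..b}"
      have "p a \<in> V (p t)" "q a \<in> V (q t)" using d1 d2 ab by auto
      then have "p t = q t" using e V pq unfolding box_family_def by (metis IntI empty_iff)
      moreover have "p s \<in> V (p t)" "q s \<in> V (q t)" "\<gamma> s \<in> conf_box (\<gamma> t) V M" "s \<in> {0..1}"
        using s ab d0(2)[of s] d1(2)[of s] d2(2)[of s] by auto
      ultimately show "p s = q s"
        using conf_box_unique(1)[OF V, of "\<gamma> s" "p t"] pq by auto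
    qed
    then show "\<exists>d>0. \<forall>a\<in>{0..1}. \<forall>b\<in>{0..1}. a \<le> t \<longrightarrow> t \<le> b \<longrightarrow> \<bar>a - t\<bar> < d \<longrightarrow> \<bar>b - t\<bar> < d \<longrightarrow> P a b"
      using d0(1) d1(1) d2(1) by (intro exI[of _ ?d]) auto
  qed
  then show ?thesis using assms(5,6) unfolding P_def by auto
qed

section \<open>Monodromy\<close>

lemma strandD: "strand M \<gamma> p \<Longrightarrow> t \<in> {0..1} \<Longrightarrow> p t \<in> \<gamma> t"
  unfolding strand_def by blast

lemma strand_exists:
  assumes "Hausdorff_space M" "pathin (uconf n M) \<gamma>" "x \<in> \<gamma> 0"
  obtains p where "strand M \<gamma> p" "p 0 = x"
proof -
  obtain g where g: "\<And>x. x \<in> \<gamma> 0 \<Longrightarrow> pathin M (g x) \<and> g x 0 = x"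
    "\<And>t. t \<in> {0..1} \<Longrightarrow> (\<lambda>x. g x t) ` \<gamma> 0 = \<gamma> t"
    by (rule uconf_path_strands[OF assms(1,2)]) blast
  have "strand M \<gamma> (g x)" unfolding strand_def using g assms(3) by blast
  then show ?thesis using g(1)[OF assms(3)] that by blast
qed

lemma strand_subpath_of:
  assumes "strand M \<gamma> p" "a \<in> {0..1}" "b \<in> {0..1}"
  shows "strand M (subpath_of \<gamma> a b) (subpath_of p a b)"
  using assms pathin_subpath_of[of M p a b] linepath_in[of a 0 1 b]
  unfolding strand_def by (auto simp: subpath_of_def)

lemma strand_concat:
  assumes "strand M \<gamma> p" "strand M \<delta> q" "p 1 = q 0"
  shows "strand M (path_concat \<gamma> \<delta>) (path_concat p q)"
  using assms pathin_path_concat[of M p q] unfolding strand_def by (auto simp: path_concat_def)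

lemma strand_in_box:
  assumes M: "Hausdorff_space M" and V: "box_family M C V" and \<gamma>: "pathin (uconf (card C) M) \<gamma>"
    and box: "\<And>t. t \<in> {0..1} \<Longrightarrow> \<gamma> t \<in> conf_box C V M"
    and p: "strand M \<gamma> p" and c: "c \<in> C" "p 0 \<in> V c"
  shows "p 1 \<in> V c"
proof -
  let ?q = "\<lambda>t. box_point V c (\<gamma> t)"
  have "strand M \<gamma> ?q"
    using box_strand[OF V \<gamma> c(1), of 0 1] box box_point(1)[OF V box c(1)]
    unfolding strand_def pathin_iff by auto
  moreover have "p 0 = ?q 0"
    using box_point(3)[OF V box c(1), of 0 "p 0"] p c(2) unfolding strand_def by simp
  ultimately have "p 1 = ?q 1" using strand_unique[OF M \<gamma> p] by simp
  then show ?thesis using box_point(2)[OF V box c(1)] by simp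
qed

lemma square_row: 
  assumes "continuous_map (top_of_set unit_square) X h" "s \<in> {0..1}"
  shows "pathin X (\<lambda>t. h (s, t))"
proof -
  have "continuous_map (top_of_set {0..1}) (top_of_set unit_square) (\<lambda>t. (s, t))"
    using assms(2) by (auto intro!: continuous_intros)
  from continuous_map_compose[OF this assms(1)] show ?thesis by (simp add: pathin_iff o_def)
qed

lemma square_column: 
  assumes "continuous_map (top_of_set unit_square) X h" "t \<in> {0..1}"
  shows "pathin X (\<lambda>s. h (s, t))"
proof -
  have "continuous_map (top_of_set {0..1}) (top_of_set unit_square) (\<lambda>s. (s, t))"
    using assms(2) by (auto intro!: continuous_intros)
  from continuous_map_compose[OF this assms(1)] show ?thesis by (simp add: pathin_iff o_def)
qed

lemma square_local:
  assumes "continuous_map (top_of_set unit_square) X h" "s0 \<in> {0..1}" "t0 \<in> {0..1}"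
    and "openin X U" "h (s0, t0) \<in> U"
  obtains d where "d > 0" "\<And>s t. s \<in> {0..1} \<Longrightarrow> t \<in> {0..1} \<Longrightarrow> \<bar>s - s0\<bar> < d \<Longrightarrow> \<bar>t - t0\<bar> < d \<Longrightarrow> h (s, t) \<in> U"
proof -
  have "openin (top_of_set unit_square) {z \<in> unit_square. h z \<in> U}"
    using assms(1,4) unfolding continuous_map_def by auto
  moreover have "(s0, t0) \<in> {z \<in> unit_square. h z \<in> U}" using assms(2,3,5) by simp
  ultimately have "\<exists>e>0. \<forall>z\<in>unit_square. dist z (s0, t0) < e \<longrightarrow> z \<in> {z \<in> unit_square. h z \<in> U}"
    unfolding openin_euclidean_subtopology_iff by (elim conjE) (erule bspec)
  then obtain e where e: "e > 0" 
    "\<forall>z\<in>unit_square. dist z (s0, t0) < e \<longrightarrow> z \<in> {z \<in> unit_square. h z \<in> U}" by (elim exE conjE)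
  have "h (s, t) \<in> U" if "s \<in> {0..1}" "t \<in> {0..1}" "\<bar>s - s0\<bar> < e/2" "\<bar>t - t0\<bar> < e/2" for s t
  proof -
    have "dist (s, t) (s0, t0) \<le> \<bar>s - s0\<bar> + \<bar>t - t0\<bar>"
      unfolding dist_Pair_Pair dist_real_def by (rule sqrt_sum_squares_le_sum_abs[THEN order_trans]) simp
    then have "dist (s, t) (s0, t0) < e" using that by simp
    then show ?thesis using e(2) that(1,2) by simp
  qed
  then show ?thesis using e(1) that[of "e/2"] by simp
qed

text \<open>Rows of the homotopy are paths of configurations. Strands of nearby rows that start at
  the same point remain joined by strands of the columns (\<open>link\<close>), and the columns over
  both ends are constant.\<close>

lemma strand_end_homotopic:
  assumes M: "Hausdorff_space M" and hom: "path_homotopic (uconf n M) \<gamma> \<delta>"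
    and p: "strand M \<gamma> p" and q: "strand M \<delta> q" and pq: "p 0 = q 0"
  shows "p 1 = q 1"
proof -
  let ?X = "uconf n M"
  obtain h where h: "continuous_map (top_of_set unit_square) ?X h"
    "\<forall>t\<in>{0..1}. h (0, t) = \<gamma> t \<and> h (1, t) = \<delta> t" "\<forall>s\<in>{0..1}. h (s, 0) = \<gamma> 0 \<and> h (s, 1) = \<gamma> 1"
    using hom unfolding path_homotopic_iff by blast
  define row where "row s = (\<lambda>t. h (s, t))" for s
  define col where "col t = (\<lambda>s. h (s, t))" for t
  have row: "pathin ?X (row s)" if "s \<in> {0..1}" for s unfolding row_def by (rule square_row[OF h(1) that])
  have col: "pathin ?X (col t)" if "t \<in> {0..1}" for t unfolding col_def by (rule square_column[OF h(1) that])
  define P where "P a b \<longleftrightarrow> (\<forall>p q. strand M (row a) p \<longrightarrow> strand M (row b) q \<longrightarrow> p 0 = q 0 \<longrightarrow> p 1 = q 1)" for a b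
  have Psym: "P b a" if "P a b" for a b using that unfolding P_def by metis
  have Ptrans: "P a c" if tr: "P a b" "P b c" "a \<in> {0..1}" "b \<in> {0..1}" for a b c
    unfolding P_def
  proof (intro allI impI)
    fix p q assume *: "strand M (row a) p" "strand M (row c) q" "p 0 = q 0"
    have "p 0 \<in> h (a, 0)" using *(1) unfolding strand_def row_def by simp
    also have "h (a, 0) = row b 0" using tr(3,4) h(3) unfolding row_def by simp
    finally have "p 0 \<in> row b 0" .
    then obtain r where r: "strand M (row b) r" "r 0 = p 0" using strand_exists[OF M row] tr(4) by blast
    then show "p 1 = q 1" using tr(1,2) * unfolding P_def by metis
  qed
  have local: "\<exists>d>0. \<forall>s\<in>{0..1}. \<bar>s - s0\<bar> < d \<longrightarrow> P s0 s" if s0: "s0 \<in> {0..1}" for s0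
  proof -
    define link where "link s t x y \<longleftrightarrow> (\<exists>r. strand M (subpath_of (col t) s0 s) r \<and> r 0 = x \<and> r 1 = y)" for s t x y
    define R where "R c d \<longleftrightarrow> (\<exists>e>0. \<forall>s\<in>{0..1}. \<bar>s - s0\<bar> < e \<longrightarrow>
      (\<forall>p q. strand M (row s0) p \<longrightarrow> strand M (row s) q \<longrightarrow> link s c (p c) (q c) \<longrightarrow> link s d (p d) (q d)))" for c d
    have "R 0 1"
    proof (rule interval_induct)
      fix a b c assume "R a b" "R b c"
      then obtain e e' where e: "e > 0" "\<forall>s\<in>{0..1}. \<bar>s - s0\<bar> < e \<longrightarrow>
      (\<forall>p q. strand M (row s0) p \<longrightarrow> strand M (row s) q \<longrightarrow> link s a (p a) (q a) \<longrightarrow> link s b (p b) (q b))"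
        and e': "e' > 0" "\<forall>s\<in>{0..1}. \<bar>s - s0\<bar> < e' \<longrightarrow>
      (\<forall>p q. strand M (row s0) p \<longrightarrow> strand M (row s) q \<longrightarrow> link s b (p b) (q b) \<longrightarrow> link s c (p c) (q c))"
        unfolding R_def by blast
      show "R a c" unfolding R_def by (rule exI[of _ "min e e'"]) (use e e' in simp)
    next
      fix t0 :: real assume t0: "t0 \<in> {0..1}"
      let ?C = "h (s0, t0)"
      have "?C \<in> topspace ?X" using pathin_in[OF row[OF s0] t0] unfolding row_def .
      then have C: "finite ?C" "?C \<subseteq> topspace M" "card ?C = n" by (auto simp: topspace_uconf)
      obtain V where V: "box_family M ?C V" using box_family_exists[OF M C(1,2)] .
      have X: "uconf (card ?C) M = ?X" using C by simp
      obtain d where d: "d > 0" "\<And>s t. s \<in> {0..1} \<Longrightarrow> t \<in> {0..1} \<Longrightarrow> \<bar>s - s0\<bar> < d \<Longrightarrow> \<bar>t - t0\<bar> < d \<Longrightarrow> h (s, t) \<in> conf_box ?C V M"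
        using square_local[OF h(1) s0 t0 openin_conf_box[OF V, unfolded X] center_in_conf_box[OF V]] by blast
      have seg: "linepath x y u \<in> {0..1} \<and> \<bar>linepath x y u - z\<bar> < d" 
        if "x \<in> {0..1}" "y \<in> {0..1}" "\<bar>x - z\<bar> < d" "\<bar>y - z\<bar> < d" "u \<in> {0..1}" for x y z u :: real
      proof -
        have "closed_segment x y \<subseteq> ball z d" using that by (intro closed_segment_subset) (auto simp: dist_real_def)
        then have "linepath x y u \<in> ball z d" using that linepath_in_path by blast
        then show ?thesis using linepath_in[OF that(1,2,5)] by (auto simp: dist_real_def)
      qed
      have "R a b" if ab: "a\<in>{0..1}" "b\<in>{0..1}" "\<bar>a - t0\<bar> < d" "\<bar>b - t0\<bar> < d" for a b
        unfolding R_def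
      proof (intro exI[of _ d] conjI ballI impI allI, fact)
        fix s p q assume s: "s \<in> {0..1}" "\<bar>s - s0\<bar> < d" and p: "strand M (row s0) p" and q: "strand M (row s) q"
          and "link s a (p a) (q a)"
        then obtain r where r: "strand M (subpath_of (col a) s0 s) r" "r 0 = p a" "r 1 = q a"
          unfolding link_def by blast
        have colbox: "subpath_of (col t) s0 s u \<in> conf_box ?C V M" 
          if "t \<in> {0..1}" "\<bar>t - t0\<bar> < d" "u \<in> {0..1}" for t u
          using d seg[OF s0 s(1) _ s(2) that(3)] that(1,2) unfolding subpath_of_def col_def by simp
        have rowbox: "subpath_of (row t) a b u \<in> conf_box ?C V M" 
          if "t \<in> {0..1}" "\<bar>t - s0\<bar> < d" "u \<in> {0..1}" for t u
          using d seg[OF ab(1,2,3,4) that(3)] that(1,2) unfolding subpath_of_def row_def by simp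
        have pathcol: "pathin ?X (subpath_of (col t) s0 s)" if "t \<in> {0..1}" for t
          using pathin_subpath_of[OF col[OF that] s0 s(1)] .
        have pathrow: "pathin ?X (subpath_of (row t) a b)" if "t \<in> {0..1}" for t
          using pathin_subpath_of[OF row[OF that] ab(1,2)] .
        have pa: "p a \<in> h (s0, a)" "h (s0, a) \<in> conf_box ?C V M"
          using p ab d s0 unfolding strand_def row_def by auto
        then obtain c where c: "c \<in> ?C" "p a \<in> V c" using conf_box_unique(2)[OF V] by blast
        have "subpath_of p a b 1 \<in> V c"
          by (rule strand_in_box[OF M V, unfolded X, OF pathrow[OF s0] rowbox strand_subpath_of[OF p ab(1,2)] c(1)])
             (use c d(1) s0 in auto)
        then have pb: "p b \<in> V c" by simp
        have "r 1 \<in> V c"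
          by (rule strand_in_box[OF M V, unfolded X, OF pathcol[OF ab(1)] colbox r(1) c(1)])
             (use c ab r in auto)
        then have "subpath_of q a b 0 \<in> V c" using r by simp
        then have "subpath_of q a b 1 \<in> V c"
          by (intro strand_in_box[OF M V, unfolded X, OF pathrow[OF s(1)] rowbox strand_subpath_of[OF q ab(1,2)] c(1)])
             (use s in auto)
        then have qb: "q b \<in> V c" by simp
        have "p b \<in> subpath_of (col b) s0 s 0" using p ab unfolding strand_def row_def col_def by simp
        then obtain r' where r': "strand M (subpath_of (col b) s0 s) r'" "r' 0 = p b"
          using strand_exists[OF M pathcol[OF ab(2)]] by blast
        have "r' 1 \<in> V c"
          by (rule strand_in_box[OF M V, unfolded X, OF pathcol[OF ab(2)] colbox r'(1) c(1)])
             (use pb ab r' in auto)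
        moreover have "r' 1 \<in> h (s, b)"
          using strandD[OF r'(1), of 1] by (simp add: col_def)
        moreover have "q b \<in> h (s, b)" using q ab unfolding strand_def row_def by simp
        moreover have "h (s, b) \<in> conf_box ?C V M" using d s ab by simp
        ultimately have "r' 1 = q b" using conf_box_unique(1)[OF V, of "h (s, b)" c] c qb by auto
        then show "link s b (p b) (q b)" unfolding link_def using r' by blast
      qed
      then show "\<exists>d>0. \<forall>a\<in>{0..1}. \<forall>b\<in>{0..1}. a \<le> t0 \<longrightarrow> t0 \<le> b \<longrightarrow> \<bar>a - t0\<bar> < d \<longrightarrow> \<bar>b - t0\<bar> < d \<longrightarrow> R a b"
        using d(1) by blast
    qed
    then obtain e where e: "e > 0" "\<And>s p q. s\<in>{0..1} \<Longrightarrow> \<bar>s - s0\<bar> < e \<Longrightarrow> strand M (row s0) p \<Longrightarrow> strand M (row s) q \<Longrightarrow>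
        link s 0 (p 0) (q 0) \<Longrightarrow> link s 1 (p 1) (q 1)" unfolding R_def by blast
    have "P s0 s" if s: "s \<in> {0..1}" "\<bar>s - s0\<bar> < e" for s
      unfolding P_def
    proof (intro allI impI)
      fix p q assume pq: "strand M (row s0) p" "strand M (row s) q" "p 0 = q 0"
      \<comment> \<open>At both ends the column is a constant configuration, whose strands are
        constant; a link there is an equality.\<close>
      have const: "subpath_of (col t) s0 s u = h (s0, t)" if "t \<in> {0, 1}" "u \<in> {0..1}" for t u
        using h(3) that s0 linepath_in[OF s0 s(1) that(2)] unfolding subpath_of_def col_def by auto
      have cstrand: "strand M (subpath_of (col t) s0 s) (\<lambda>_. p t)" if "t \<in> {0, 1}" for t
        using const[OF that] pq(1) that pathin_in[of M p t] unfolding strand_def row_def by (auto simp: pathin_iff)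
      have "link s 0 (p 0) (q 0)" unfolding link_def using cstrand[of 0] pq(3) by auto
      then have "link s 1 (p 1) (q 1)" by (rule e(2)[OF s pq(1,2)])
      then obtain r where r: "strand M (subpath_of (col 1) s0 s) r" "r 0 = p 1" "r 1 = q 1"
        unfolding link_def by blast
      have pc: "pathin ?X (subpath_of (col 1) s0 s)" using pathin_subpath_of[OF col _ s(1)] s0 by simp
      have "r 1 = p 1" using strand_unique[OF M pc r(1) cstrand[of 1], of 1] r(2) by simp
      then show "p 1 = q 1" using r(3) by simp
    qed
    then show ?thesis using e(1) by blast
  qed
  have "P 0 1"
  proof (rule interval_induct)
    fix t :: real assume t: "t \<in> {0..1}"
    from local[OF t] obtain d where d: "d > 0" "\<forall>s\<in>{0..1}. \<bar>s - t\<bar> < d \<longrightarrow> P t s" by (elim exE conjE)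
    show "\<exists>d>0. \<forall>a\<in>{0..1}. \<forall>b\<in>{0..1}. a \<le> t \<longrightarrow> t \<le> b \<longrightarrow> \<bar>a - t\<bar> < d \<longrightarrow> \<bar>b - t\<bar> < d \<longrightarrow> P a b"
    proof (intro exI[of _ d] conjI ballI impI)
      fix a b :: real assume ab: "a \<in> {0..1}" "b \<in> {0..1}" "\<bar>a - t\<bar> < d" "\<bar>b - t\<bar> < d"
      have "P a t" "P t b" using Psym d(2) ab by simp_all
      then show "P a b" using Ptrans ab(1) t by blast
    qed (fact d(1))
  next
    fix a b c :: real assume "P a b" "P b c" "0 \<le> a" "a \<le> b" "b \<le> c" "c \<le> 1"
    then show "P a c" using Ptrans[of a b c] by simp
  qed
  moreover have "strand M (row 0) p" "strand M (row 1) q"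
    using p q h(2) unfolding strand_def row_def by auto
  ultimately show ?thesis using pq unfolding P_def by blast
qed

section \<open>Permutations as a group, and monodromy\<close>

typedef 'b sym = "{f :: 'b \<Rightarrow> 'b. bij f}"
  morphisms sym_apply Sym by (rule exI[of _ id]) simp

setup_lifting type_definition_sym

text \<open>\<^class>\<open>group_add\<close> is the library's class of noncommutative groups. Addition composes in the
  order in which paths are concatenated: \<open>a + b\<close> applies \<open>a\<close> first.\<close>

instantiation sym :: (type) group_add
begin

lift_definition zero_sym :: "'a sym" is id by simp
lift_definition plus_sym :: "'a sym \<Rightarrow> 'a sym \<Rightarrow> 'a sym" is "\<lambda>f g. g \<circ> f" by (simp add: bij_comp)
lift_definition uminus_sym :: "'a sym \<Rightarrow> 'a sym" is "inv_into UNIV" by (simp add: bij_imp_bij_inv)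
lift_definition minus_sym :: "'a sym \<Rightarrow> 'a sym \<Rightarrow> 'a sym" is "\<lambda>f g. inv_into UNIV g \<circ> f"
  by (simp add: bij_comp bij_imp_bij_inv)

instance
proof
  fix a b c :: "'a sym"
  show "a + b + c = a + (b + c)" by transfer (simp add: o_assoc)
  show "0 + a = a" "a + 0 = a" by (transfer; simp)+
  show "- a + a = 0" by transfer (metis bij_is_surj surj_iff)
  show "a + - b = a - b" by transfer simp
qed

end

text \<open>The type \<open>'b sym\<close> carries the group structure, while \<open>Q\<close>
  remains a set: its symmetric group consists of the permutations of the whole type that fix all
  points outside \<open>Q\<close>.\<close>

definition sym_on :: "'b set \<Rightarrow> 'b sym set" where
  "sym_on Q = {a. sym_apply a permutes Q}"

lemma sym_on_card:
  assumes "finite Q" shows "finite (sym_on Q)" "card (sym_on Q) = fact (card Q)"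
proof -
  have "bij_betw sym_apply (sym_on Q) {f. f permutes Q}"
  proof (rule bij_betwI')
    show "\<exists>a\<in>sym_on Q. f = sym_apply a" if "f \<in> {f. f permutes Q}" for f
      using that by (intro bexI[of _ "Sym f"]) (auto simp: sym_on_def Sym_inverse permutes_bij)
  qed (auto simp: sym_on_def sym_apply_inject)
  then show "finite (sym_on Q)" "card (sym_on Q) = fact (card Q)"
    using finite_permutations[OF assms] card_permutations[OF refl assms] 
      bij_betw_finite bij_betw_same_card by metis+
qed

text \<open>The value \<open>x\<close> outside \<open>Q\<close> makes this a permutation in the
  sense of \<open>permutes\<close>.\<close>

definition monodromy_fun :: "'a topology \<Rightarrow> 'a set \<Rightarrow> (real \<Rightarrow> 'a set) \<Rightarrow> 'a \<Rightarrow> 'a" where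
  "monodromy_fun M Q \<gamma> x = (if x \<in> Q then THE y. \<exists>p. strand M \<gamma> p \<and> p 0 = x \<and> p 1 = y else x)"

definition monodromy :: "'a topology \<Rightarrow> 'a set \<Rightarrow> (real \<Rightarrow> 'a set) \<Rightarrow> 'a sym" where
  "monodromy M Q \<gamma> = Sym (monodromy_fun M Q \<gamma>)"

context
  fixes M :: "'a topology" and n :: nat and Q :: "'a set"
  assumes M: "Hausdorff_space M"
begin

lemma monodromy_fun_strand:
  assumes "pathin (uconf n M) \<gamma>" "\<gamma> 0 = Q" "strand M \<gamma> p"
  shows "monodromy_fun M Q \<gamma> (p 0) = p 1"
proof -
  have "p 0 \<in> Q" using assms unfolding strand_def by auto
  moreover have "(THE y. \<exists>q. strand M \<gamma> q \<and> q 0 = p 0 \<and> q 1 = y) = p 1"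
  proof (rule the_equality)
    show "\<exists>q. strand M \<gamma> q \<and> q 0 = p 0 \<and> q 1 = p 1" using assms(3) by blast
    fix y assume "\<exists>q. strand M \<gamma> q \<and> q 0 = p 0 \<and> q 1 = y"
    then obtain q where "strand M \<gamma> q" "q 0 = p 0" "q 1 = y" by blast
    then show "y = p 1" using strand_unique[OF M assms(1) _ assms(3), of q 1] by simp
  qed
  ultimately show ?thesis unfolding monodromy_fun_def by simp
qed

lemma monodromy_fun_permutes:
  assumes \<gamma>: "\<gamma> \<in> loops_at (uconf n M) Q"
  shows "monodromy_fun M Q \<gamma> permutes Q"
proof -
  have p: "pathin (uconf n M) \<gamma>" "\<gamma> 0 = Q" "\<gamma> 1 = Q" using \<gamma> unfolding loops_at_def by auto
  then have Q: "finite Q" using pathin_in[OF p(1), of 0] by (auto simp: topspace_uconf)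
  obtain g where g: "\<And>x. x \<in> \<gamma> 0 \<Longrightarrow> pathin M (g x) \<and> g x 0 = x"
    "\<And>t. t \<in> {0..1} \<Longrightarrow> (\<lambda>x. g x t) ` \<gamma> 0 = \<gamma> t" by (rule uconf_path_strands[OF M p(1)]) blast
  have "monodromy_fun M Q \<gamma> x = g x 1" if "x \<in> Q" for x
  proof -
    have "strand M \<gamma> (g x)" using g that p unfolding strand_def by blast
    then show ?thesis using monodromy_fun_strand[OF p(1,2), of "g x"] g(1)[of x] that p(2) by simp
  qed
  then have "monodromy_fun M Q \<gamma> ` Q = (\<lambda>x. g x 1) ` Q" by (rule image_cong[OF refl])
  also have "\<dots> = Q" using g(2)[of 1] p by simp
  finally have im: "monodromy_fun M Q \<gamma> ` Q = Q" .
  then have "inj_on (monodromy_fun M Q \<gamma>) Q" using Q by (simp add: eq_card_imp_inj_on)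
  then have "bij_betw (monodromy_fun M Q \<gamma>) Q Q" using im unfolding bij_betw_def by simp
  then show ?thesis by (rule bij_imp_permutes) (simp add: monodromy_fun_def)
qed

lemma sym_apply_monodromy:
  "\<gamma> \<in> loops_at (uconf n M) Q \<Longrightarrow> sym_apply (monodromy M Q \<gamma>) = monodromy_fun M Q \<gamma>"
  unfolding monodromy_def using permutes_bij[OF monodromy_fun_permutes] by (simp add: Sym_inverse)

lemma monodromy_in: "\<gamma> \<in> loops_at (uconf n M) Q \<Longrightarrow> monodromy M Q \<gamma> \<in> sym_on Q"
  unfolding sym_on_def using sym_apply_monodromy monodromy_fun_permutes by simp

lemma monodromy_homotopic:
  assumes \<gamma>: "\<gamma> \<in> loops_at (uconf n M) Q" and hom: "path_homotopic (uconf n M) \<gamma> \<delta>"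
  shows "monodromy M Q \<gamma> = monodromy M Q \<delta>"
proof -
  have p: "pathin (uconf n M) \<gamma>" "\<gamma> 0 = Q" "\<gamma> 1 = Q" using \<gamma> unfolding loops_at_def by auto
  then have d: "pathin (uconf n M) \<delta>" "\<delta> 0 = Q" using path_homotopic_imp[OF hom] by auto
  have "monodromy_fun M Q \<gamma> x = monodromy_fun M Q \<delta> x" for x
  proof (cases "x \<in> Q")
    case True
    obtain p' where p': "strand M \<gamma> p'" "p' 0 = x" using strand_exists[OF M p(1)] True p(2) by blast
    obtain q where q: "strand M \<delta> q" "q 0 = x" using strand_exists[OF M d(1)] True d(2) by blast
    have "p' 1 = q 1" using strand_end_homotopic[OF M hom p'(1) q(1)] p' q by simp
    then show ?thesis using monodromy_fun_strand[OF p(1,2) p'(1)] monodromy_fun_strand[OF d q(1)] p' q by simp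
  qed (simp add: monodromy_fun_def)
  then show ?thesis unfolding monodromy_def by presburger
qed

lemma monodromy_concat:
  assumes \<gamma>: "\<gamma> \<in> loops_at (uconf n M) Q" and \<delta>: "\<delta> \<in> loops_at (uconf n M) Q"
  shows "monodromy M Q (path_concat \<gamma> \<delta>) = monodromy M Q \<gamma> + monodromy M Q \<delta>"
proof -
  have p: "pathin (uconf n M) \<gamma>" "\<gamma> 0 = Q" "\<gamma> 1 = Q" "pathin (uconf n M) \<delta>" "\<delta> 0 = Q" "\<delta> 1 = Q"
    using \<gamma> \<delta> unfolding loops_at_def by auto
  have c: "path_concat \<gamma> \<delta> \<in> loops_at (uconf n M) Q" 
    using p by (simp add: loops_at_def pathin_path_concat)
  then have pc: "pathin (uconf n M) (path_concat \<gamma> \<delta>)" unfolding loops_at_def by simp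
  have "monodromy_fun M Q (path_concat \<gamma> \<delta>) x = monodromy_fun M Q \<delta> (monodromy_fun M Q \<gamma> x)" for x
  proof (cases "x \<in> Q")
    case True
    obtain p' where p': "strand M \<gamma> p'" "p' 0 = x" using strand_exists[OF M p(1)] True p(2) by blast
    have "p' 1 \<in> \<gamma> 1" using p'(1) unfolding strand_def by simp
    then obtain q where q: "strand M \<delta> q" "q 0 = p' 1" using strand_exists[OF M p(4)] p by metis
    have "strand M (path_concat \<gamma> \<delta>) (path_concat p' q)" using strand_concat[OF p'(1) q(1)] q by simp
    from monodromy_fun_strand[OF pc _ this] show ?thesis
      using monodromy_fun_strand[OF p(1,2) p'(1)] monodromy_fun_strand[OF p(4,5) q(1)] p' q p by simp
  qed (simp add: monodromy_fun_def)
  then have "sym_apply (monodromy M Q (path_concat \<gamma> \<delta>)) = sym_apply (monodromy M Q \<gamma> + monodromy M Q \<delta>)"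
    unfolding plus_sym.rep_eq sym_apply_monodromy[OF c] sym_apply_monodromy[OF \<gamma>] sym_apply_monodromy[OF \<delta>]
    by auto
  then show ?thesis by (simp add: sym_apply_inject)
qed

end

section \<open>Charts of surfaces\<close>

text \<open>The inverse of a usual chart, defined on the whole plane. Complex coordinates make
  \<open>exp\<close> and \<open>Ln\<close> available later.\<close>

definition plane_chart :: "'a topology \<Rightarrow> (complex \<Rightarrow> 'a) \<Rightarrow> bool" where
  "plane_chart M \<kappa> \<longleftrightarrow> continuous_map euclidean M \<kappa> \<and> open_map euclidean M \<kappa> \<and> inj \<kappa>"

text \<open>\<open>W\<close> is the room left for a moving point. Charts are demanded around the
  points of \<open>M\<close>, so that after removing points or discs from \<open>W\<close> only
  openness, nonemptiness and connectedness have to be checked.\<close>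

definition subsurface :: "'a topology \<Rightarrow> 'a set \<Rightarrow> bool" where
  "subsurface M W \<longleftrightarrow> Hausdorff_space M \<and> openin M W \<and> W \<noteq> {} \<and> connectedin M W \<and>
     (\<forall>x\<in>topspace M. \<exists>\<kappa>. plane_chart M \<kappa> \<and> x \<in> range \<kappa>)"

lemma plane_chartD:
  assumes "plane_chart M \<kappa>"
  shows "continuous_map euclidean M \<kappa>" "open U \<Longrightarrow> openin M (\<kappa> ` U)" "inj \<kappa>" "\<kappa> z \<in> topspace M"
  using assms unfolding plane_chart_def open_map_def continuous_map_def by auto

lemma plane_chart_open_vimage:
  assumes "plane_chart M \<kappa>" "openin M W" shows "open {z. \<kappa> z \<in> W}"
  using assms unfolding plane_chart_def continuous_map_def by auto

lemma plane_chart_compose: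
  assumes \<kappa>: "plane_chart M \<kappa>" and f: "continuous_on UNIV f" "inj f" "\<And>U. open U \<Longrightarrow> open (f ` U)"
  shows "plane_chart M (\<kappa> \<circ> f)"
  unfolding plane_chart_def
proof (intro conjI)
  show "continuous_map euclidean M (\<kappa> \<circ> f)"
    using f(1) plane_chartD(1)[OF \<kappa>] by (intro continuous_map_compose[of _ euclidean]) auto
  show "open_map euclidean M (\<kappa> \<circ> f)"
    unfolding open_map_def
  proof (intro allI impI)
    fix U :: "complex set" assume "openin euclidean U"
    then have "openin M (\<kappa> ` (f ` U))" using plane_chartD(2)[OF \<kappa>] f(3) by simp
    then show "openin M ((\<kappa> \<circ> f) ` U)" by (simp only: image_comp)
  qed
  show "inj (\<kappa> \<circ> f)" using plane_chartD(3)[OF \<kappa>] f(2) by (rule inj_compose)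
qed

lemma open_image_bij_inverse:
  assumes "open T" "continuous_on T g" "f ` UNIV \<subseteq> T" "\<And>x. g (f x) = x" "\<And>y. y \<in> T \<Longrightarrow> f (g y) = y" "open U"
  shows "open (f ` U)"
proof -
  have "f ` U = T \<inter> g -` U" using assms(3-5) by (auto; metis image_eqI)
  then show ?thesis using assms(1,2,6) continuous_on_open_vimage by (metis Int_commute)
qed

text \<open>The map \<open>w / (1 + |w|)\<close> from the plane to the unit disc, with inverse
  \<open>v / (1 - |v|)\<close>, rescaled to \<open>ball z r\<close>. It shrinks charts into given
  open sets while keeping the plane as their domain.\<close>

lemma squeeze_plane:
  fixes z :: complex assumes "r > 0"
  defines "f \<equiv> \<lambda>w. z + (r / (1 + cmod w)) *\<^sub>R w"
  shows "continuous_on UNIV f" "inj f" "\<And>U. open U \<Longrightarrow> open (f ` U)" "range f \<subseteq> ball z r" "f 0 = z"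
proof -
  have pos: "1 + cmod w > 0" for w by (smt (verit) norm_ge_zero)
  define g where "g v = (1 / (r - cmod (v - z))) *\<^sub>R (v - z)" for v
  have nf: "cmod (f w - z) = r * cmod w / (1 + cmod w)" for w
    using pos[of w] assms(1) by (simp add: f_def)
  have lt: "cmod (f w - z) < r" for w
    unfolding nf using pos[of w] assms(1) by (simp add: field_simps)
  have gf: "g (f w) = w" for w
  proof -
    have "r - cmod (f w - z) = r / (1 + cmod w)" unfolding nf using pos[of w] by (simp add: field_simps)
    then have "g (f w) = (1 / (r / (1 + cmod w))) *\<^sub>R (f w - z)" unfolding g_def by simp
    also have "\<dots> = w" unfolding f_def using pos[of w] assms(1) by simp
    finally show ?thesis .
  qed
  have fg: "f (g v) = v" if "v \<in> ball z r" for v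
  proof -
    have d: "r - cmod (v - z) > 0" using that by (simp add: dist_norm norm_minus_commute)
    have "cmod (g v) = cmod (v - z) / (r - cmod (v - z))" using d unfolding g_def by simp
    then have "1 + cmod (g v) = r / (r - cmod (v - z))" using d by (simp add: field_simps)
    then have "r / (1 + cmod (g v)) = r - cmod (v - z)" using assms(1) by simp
    then have "f (g v) = z + (r - cmod (v - z)) *\<^sub>R g v" unfolding f_def by simp
    also have "\<dots> = v" using d unfolding g_def by simp
    finally show ?thesis .
  qed
  have "1 + cmod w \<noteq> 0" for w using pos[of w] by simp
  then show "continuous_on UNIV f" unfolding f_def by (intro continuous_intros) auto
  show "inj f" using gf by (rule inj_on_inverseI)
  show sub: "range f \<subseteq> ball z r" using lt by (auto simp: dist_norm norm_minus_commute)
  have "continuous_on (ball z r) g" unfolding g_def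
    by (intro continuous_intros) (auto simp: dist_norm norm_minus_commute)
  then show "open (f ` U)" if "open U" for U
    using open_image_bij_inverse[OF open_ball _ sub gf fg that] by blast
  show "f 0 = z" unfolding f_def by simp
qed

lemma plane_chart_shrink:
  assumes "plane_chart M \<kappa>" "openin M W" "\<kappa> z \<in> W"
  obtains \<kappa>' where "plane_chart M \<kappa>'" "\<kappa>' 0 = \<kappa> z" "range \<kappa>' \<subseteq> W" "range \<kappa>' \<subseteq> range \<kappa>"
proof -
  obtain r where r: "r > 0" "ball z r \<subseteq> {z. \<kappa> z \<in> W}"
    using plane_chart_open_vimage[OF assms(1,2)] assms(3) unfolding open_contains_ball by auto
  let ?f = "\<lambda>w. z + (r / (1 + cmod w)) *\<^sub>R w"
  note f = squeeze_plane[OF r(1), where z=z]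
  show ?thesis
  proof (rule that[of "\<kappa> \<circ> ?f"])
    show "plane_chart M (\<kappa> \<circ> ?f)" by (rule plane_chart_compose[OF assms(1) f(1,2,3)])
    show "(\<kappa> \<circ> ?f) 0 = \<kappa> z" by simp
    show "range (\<kappa> \<circ> ?f) \<subseteq> W" using order_trans[OF f(4) r(2)] by auto
    show "range (\<kappa> \<circ> ?f) \<subseteq> range \<kappa>" by auto
  qed
qed

lemma subsurface_chart:
  assumes "subsurface M W" "openin M U" "x \<in> U"
  obtains \<kappa> where "plane_chart M \<kappa>" "\<kappa> 0 = x" "range \<kappa> \<subseteq> U"
proof -
  have "x \<in> topspace M" using assms(2,3) openin_subset by blast
  then obtain \<kappa> where k: "plane_chart M \<kappa>" "x \<in> range \<kappa>" using assms(1) unfolding subsurface_def by blast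
  then obtain z where "x = \<kappa> z" by blast
  then show ?thesis using plane_chart_shrink[OF k(1) assms(2), of z] assms(3) that by metis
qed

lemma subsurface_path:
  assumes W: "subsurface M W" and xy: "x \<in> W" "y \<in> W"
  obtains p where "pathin M p" "p 0 = x" "p 1 = y" "\<And>t. t \<in> {0..1} \<Longrightarrow> p t \<in> W"
proof -
  let ?S = "subtopology M W"
  have op: "openin M W" and sub: "W \<subseteq> topspace M" and conn: "connectedin M W"
    using W openin_subset unfolding subsurface_def by auto
  have "neighbourhood_base_of (path_connectedin ?S) ?S"
    unfolding neighbourhood_base_of
  proof (intro allI impI)
    fix V x assume "openin ?S V \<and> x \<in> V"
    then have V: "openin M V" "V \<subseteq> W" "x \<in> V" using openin_open_subtopology[OF op] by auto
    obtain \<kappa> where k: "plane_chart M \<kappa>" "\<kappa> 0 = x" "range \<kappa> \<subseteq> V"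
      using subsurface_chart[OF W V(1,3)] .
    have "path_connectedin M (\<kappa> ` UNIV)"
      by (rule path_connectedin_continuous_map_image[OF plane_chartD(1)[OF k(1)]]) simp
    then have "path_connectedin ?S (range \<kappa>)" using k V by (simp add: path_connectedin_subtopology)
    moreover have "openin ?S (range \<kappa>)"
      using plane_chartD(2)[OF k(1) open_UNIV] k V openin_open_subtopology[OF op] by auto
    ultimately show "\<exists>U Va. openin ?S U \<and> path_connectedin ?S Va \<and> x \<in> U \<and> U \<subseteq> Va \<and> Va \<subseteq> V"
      using k by blast
  qed
  then have "locally_path_connected_space ?S" unfolding locally_path_connected_space_def .
  moreover have "connected_space ?S" using conn unfolding connectedin_def by simp
  ultimately have "path_connected_space ?S" using path_connected_eq_connected_space by blast
  moreover have "topspace ?S = W" using sub by auto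
  ultimately obtain p where "pathin ?S p" "p 0 = x" "p 1 = y"
    using xy unfolding path_connected_space_def by blast
  then show ?thesis using that[of p] pathin_in[of ?S p] \<open>topspace ?S = W\<close>
    by (auto simp: pathin_subtopology)
qed

text \<open>If \<open>W - K\<close> split into two open parts, the connected collar
  \<open>U - K\<close> would lie in one of them, and adding \<open>U\<close> to that part would
  split \<open>W\<close>.\<close>

lemma subsurface_remove:
  assumes W: "subsurface M W" and U: "openin M U" "U \<subseteq> W" and K: "closedin M K" "K \<subseteq> U"
    and UK: "connectedin M (U - K)" "U - K \<noteq> {}"
  shows "subsurface M (W - K)"
proof -
  have op: "openin M W" and conn: "connectedin M W" using W unfolding subsurface_def by auto
  have opK: "openin M (W - K)" using op K(1) by (simp add: openin_diff)
  have "connectedin M (W - K)"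
    unfolding connectedin
  proof (intro conjI notI)
    show "W - K \<subseteq> topspace M" using openin_subset[OF opK] .
    assume "\<exists>E1 E2. openin M E1 \<and> openin M E2 \<and> W - K \<subseteq> E1 \<union> E2 \<and> E1 \<inter> E2 \<inter> (W - K) = {} \<and>
        E1 \<inter> (W - K) \<noteq> {} \<and> E2 \<inter> (W - K) \<noteq> {}"
    then obtain E1 E2 where E: "openin M E1" "openin M E2" "W - K \<subseteq> E1 \<union> E2" "E1 \<inter> E2 \<inter> (W - K) = {}"
        "E1 \<inter> (W - K) \<noteq> {}" "E2 \<inter> (W - K) \<noteq> {}" by blast
    have *: False if E: "openin M A" "openin M B" "W - K \<subseteq> A \<union> B" "A \<inter> B \<inter> (W - K) = {}"
        "B \<inter> (W - K) \<noteq> {}" and UA: "U - K \<subseteq> A" for A B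
    proof -
      have "openin M (A \<union> U)" "openin M (B \<inter> (W - K))" using E U opK by auto
      moreover have "W \<subseteq> (A \<union> U) \<union> (B \<inter> (W - K))" using E(3) K(2) by blast
      moreover have "(A \<union> U) \<inter> (B \<inter> (W - K)) \<inter> W = {}" using E(4) UA by blast
      moreover have "(A \<union> U) \<inter> W \<noteq> {}" using UK(2) U(2) by blast
      moreover have "(B \<inter> (W - K)) \<inter> W \<noteq> {}" using E(5) by blast
      ultimately show False using conn unfolding connectedin by blast
    qed
    have "E1 \<inter> E2 \<inter> (U - K) = {}" "U - K \<subseteq> E1 \<union> E2" using E U(2) by blast+
    then have "E1 \<inter> (U - K) = {} \<or> E2 \<inter> (U - K) = {}"
      using UK(1) E(1,2) unfolding connectedin by blast
    then have "U - K \<subseteq> E2 \<or> U - K \<subseteq> E1" using E(3) U(2) by blast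
    then show False using *[of E1 E2] *[of E2 E1] E by blast
  qed
  moreover have "W - K \<noteq> {}" using UK(2) U(2) by blast
  ultimately show ?thesis using W opK unfolding subsurface_def by blast
qed

lemma subsurface_remove_point:
  assumes W: "subsurface M W" shows "subsurface M (W - {x})"
proof (cases "x \<in> W")
  case True
  have op: "openin M W" and H: "Hausdorff_space M" using W unfolding subsurface_def by auto
  obtain \<kappa> where k: "plane_chart M \<kappa>" "\<kappa> 0 = x" "range \<kappa> \<subseteq> W" using subsurface_chart[OF W op True] .
  have e: "range \<kappa> - {x} = \<kappa> ` (UNIV - {0})" using k(2) plane_chartD(3)[OF k(1)] by (auto simp: inj_def)
  have "connectedin M (\<kappa> ` (UNIV - {0}))"
    by (rule connectedin_continuous_map_image[OF plane_chartD(1)[OF k(1)]])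
       (simp add: connected_punctured_universe Compl_eq_Diff_UNIV[symmetric])
  moreover have "\<kappa> 1 \<in> range \<kappa> - {x}" unfolding e by auto
  ultimately show ?thesis
    using plane_chartD(2)[OF k(1) open_UNIV] k H True openin_subset[OF op] e
    by (intro subsurface_remove[OF W, of "range \<kappa>"]) (auto simp: closedin_Hausdorff_singleton)
qed (use W in simp)

lemma subsurface_remove_finite:
  assumes "finite C" "subsurface M W" shows "subsurface M (W - C)"
  using assms
proof (induction C)
  case (insert x C)
  have "W - insert x C = (W - C) - {x}" by auto
  then show ?case using insert subsurface_remove_point by metis
qed simp

lemma plane_chart_compact_closedin:
  assumes "Hausdorff_space M" "plane_chart M \<kappa>" "compact K" shows "closedin M (\<kappa> ` K)"
proof -
  have "compactin M (\<kappa> ` K)"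
    using assms(3) by (intro image_compactin[OF _ plane_chartD(1)[OF assms(2)]]) simp
  then show ?thesis using assms(1) by (rule compactin_imp_closedin[rotated])
qed

text \<open>The collar is the annulus between the radii \<open>r\<close> and
  \<open>R\<close>.\<close>

lemma subsurface_remove_cball:
  assumes W: "subsurface M W" and k: "plane_chart M \<kappa>" "\<kappa> ` ball z R \<subseteq> W" and r: "0 \<le> r" "r < R"
  shows "subsurface M (W - \<kappa> ` cball z r)"
proof -
  have H: "Hausdorff_space M" using W unfolding subsurface_def by auto
  have e: "\<kappa> ` ball z R - \<kappa> ` cball z r = \<kappa> ` (ball z R - cball z r)"
    using plane_chartD(3)[OF k(1)] by (simp add: image_set_diff)
  have "ball z R - cball z r = {x. r < norm (x - z) \<and> norm (x - z) < R}"
    by (auto simp: dist_norm norm_minus_commute)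
  then have "connected (ball z R - cball z r)"
    using connected_annulus(1)[of r z R] by simp
  then have "connectedin M (\<kappa> ` (ball z R - cball z r))"
    by (intro connectedin_continuous_map_image[OF plane_chartD(1)[OF k(1)]]) simp
  moreover have "z + complex_of_real ((r + R) / 2) \<in> ball z R - cball z r"
  proof -
    have "cmod (complex_of_real ((r + R) / 2)) = (r + R) / 2" using r by (simp only: norm_of_real) simp
    then show ?thesis using r by (simp add: dist_norm del: of_real_divide of_real_add)
  qed
  then have "\<kappa> ` ball z R - \<kappa> ` cball z r \<noteq> {}" unfolding e by blast
  ultimately show ?thesis
    using plane_chart_compact_closedin[OF H k(1) compact_cball] plane_chartD(2)[OF k(1) open_ball] r k e
    by (intro subsurface_remove[OF W, of "\<kappa> ` ball z R"]) (auto intro!: image_mono)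
qed

lemma plane_homeomorphic_complex:
  "(euclidean :: (real^2) topology) homeomorphic_space (euclidean :: complex topology)"
proof -
  have "(UNIV :: (real^2) set) homeomorphic (UNIV :: complex set)"
    by (rule homeomorphic_subspaces) (auto simp: dim_UNIV)
  then show ?thesis
    unfolding homeomorphic_space_def homeomorphic_maps_def homeomorphic_def homeomorphism_def
    by (auto; metis UNIV_I)
qed

lemma closed_oriented_surface_subsurface:
  assumes "closed_oriented_surface g M" shows "subsurface M (topspace M)"
proof -
  have M: "two_manifold M" "topspace M \<noteq> {}" "connected_space M"
    using assms unfolding closed_oriented_surface_def by auto
  have "\<exists>\<kappa>. plane_chart M \<kappa> \<and> x \<in> range \<kappa>" if x: "x \<in> topspace M" for x
  proof -
    obtain U where U: "openin M U" "x \<in> U" "subtopology M U homeomorphic_space (euclidean :: (real^2) topology)"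
      using M(1) x unfolding two_manifold_def by blast
    then have "(euclidean :: complex topology) homeomorphic_space subtopology M U"
      using plane_homeomorphic_complex homeomorphic_space_trans homeomorphic_space_sym by blast
    then obtain \<kappa> where k: "homeomorphic_map (euclidean :: complex topology) (subtopology M U) \<kappa>"
      using homeomorphic_space by blast
    have sub: "U \<subseteq> topspace M" using openin_subset[OF U(1)] .
    have "continuous_map euclidean M \<kappa>"
      using homeomorphic_imp_continuous_map[OF k] by (simp add: continuous_map_in_subtopology)
    moreover have "open_map euclidean M \<kappa>"
      using homeomorphic_imp_open_map[OF k] openin_trans_full[OF _ U(1)] unfolding open_map_def by blast
    moreover have "inj \<kappa>" using homeomorphic_imp_injective_map[OF k] by simp
    moreover have "range \<kappa> = U" using homeomorphic_imp_surjective_map[OF k] sub by auto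
    ultimately show ?thesis using U(2) unfolding plane_chart_def by blast
  qed
  then show ?thesis using M unfolding subsurface_def two_manifold_def connectedin_topspace by auto
qed

section \<open>Moves of a single point\<close>

lemma plane_chart_inverse:
  assumes "plane_chart M \<kappa>"
  shows "continuous_map (subtopology M (range \<kappa>)) euclidean (inv_into UNIV \<kappa>)"
  unfolding continuous_map_def
proof (intro conjI allI impI)
  have sub: "range \<kappa> \<subseteq> topspace M" using plane_chartD(4)[OF assms] by auto
  fix U :: "complex set" assume U: "openin euclidean U"
  have "{x \<in> topspace (subtopology M (range \<kappa>)). inv_into UNIV \<kappa> x \<in> U} = \<kappa> ` U"
    using sub plane_chartD(3)[OF assms] by auto
  moreover have "openin M (\<kappa> ` U)" using plane_chartD(2)[OF assms] U by simp
  ultimately show "openin (subtopology M (range \<kappa>)) {x \<in> topspace (subtopology M (range \<kappa>)). inv_into UNIV \<kappa> x \<in> U}"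
    unfolding openin_subtopology by (intro exI[of _ "\<kappa> ` U"]) auto
qed auto

text \<open>The path is expanded along the rays from \<open>z\<close>, by a factor that grows from 1
  to \<open>max 1 (r / |w - z|)\<close>. Points at distance at least \<open>r\<close> stay, so the
  deformation extends by the identity outside the chart. The centre lies in \<open>C\<close> and is
  never met by the path.\<close>

lemma radial_push:
  assumes H: "Hausdorff_space M" and \<kappa>: "plane_chart M \<kappa>" and r: "r > 0"
    and \<alpha>: "pathin M \<alpha>" "\<And>t. t \<in> {0..1} \<Longrightarrow> \<alpha> t \<notin> C" "\<alpha> 0 \<notin> range \<kappa>" "\<alpha> 1 \<notin> range \<kappa>"
    and C: "C \<inter> range \<kappa> \<subseteq> {\<kappa> z}" "\<kappa> z \<in> C"
  obtains \<alpha>' where "path_homotopic (subtopology M (topspace M - C)) \<alpha> \<alpha>'"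
    "\<And>t. t \<in> {0..1} \<Longrightarrow> \<alpha>' t \<notin> \<kappa> ` ball z r"
proof -
  let ?N = "subtopology M (topspace M - C)" and ?sq = "top_of_set unit_square"
  define W where "W x = inv_into UNIV \<kappa> (\<alpha> (snd x))" for x :: "real \<times> real"
  define g where "g w s = z + (1 - s + s * max 1 (r / cmod (w - z))) *\<^sub>R (w - z)" for w :: complex and s :: real
  define h where "h x = (if \<alpha> (snd x) \<in> range \<kappa> then \<kappa> (g (W x) (fst x)) else \<alpha> (snd x))" for x
  \<comment> \<open>Two open sets cover the square: the times at which the path is in the chart, and
    those at which it is outside the closed disc. On their overlap the expansion is the
    identity.\<close>
  define T where "T b = {x \<in> unit_square. if b then \<alpha> (snd x) \<in> range \<kappa> else \<alpha> (snd x) \<notin> \<kappa> ` cball z r}" for b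
  note inj = plane_chartD(3)[OF \<kappa>]
  have \<alpha>_snd: "continuous_map ?sq M (\<lambda>x. \<alpha> (snd x))" using continuous_map_from_snd[OF \<alpha>(1)] .
  have W: "\<kappa> (W x) = \<alpha> (snd x)" if "\<alpha> (snd x) \<in> range \<kappa>" for x
    unfolding W_def using that by (simp add: f_inv_into_f)
  have Wz: "W x \<noteq> z" if "x \<in> T True" for x
    using W[of x] that \<alpha>(2)[of "snd x"] C(2) unfolding T_def by (auto simp: mem_Times_iff)
  have pos: "1 - s + s * max 1 (r / cmod (w - z)) > 0" if "0 \<le> s" "s \<le> 1" for s w
  proof -
    have "1 - s + s * max 1 (r / cmod (w - z)) \<ge> 1 - s + s * 1"
      using that by (intro add_left_mono mult_left_mono) auto
    then show ?thesis by simp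
  qed
  have gz: "g w s \<noteq> z" if "w \<noteq> z" "0 \<le> s" "s \<le> 1" for w s
    unfolding g_def using pos[OF that(2,3), of w] that(1) by simp
  have g0: "g w 0 = w" for w unfolding g_def by simp
  have g_out: "g w s = w" if "r \<le> cmod (w - z)" for w s
  proof -
    have "r / cmod (w - z) \<le> 1" using that r by (simp add: divide_le_eq)
    then have "max 1 (r / cmod (w - z)) = 1" by simp
    then show ?thesis unfolding g_def by simp
  qed
  have g1: "r \<le> cmod (g w 1 - z)" if "w \<noteq> z" for w
  proof -
    have "cmod (g w 1 - z) = max 1 (r / cmod (w - z)) * cmod (w - z)"
      unfolding g_def by (simp add: abs_of_pos)
    moreover have "r / cmod (w - z) * cmod (w - z) \<le> max 1 (r / cmod (w - z)) * cmod (w - z)"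
      by (intro mult_right_mono) auto
    ultimately show ?thesis using that by simp
  qed
  have cont: "continuous_map ?sq M h"
  proof (rule pasting_lemma[where I="UNIV" and T=T and f="\<lambda>b x. if b then \<kappa> (g (W x) (fst x)) else \<alpha> (snd x)"])
    show "openin ?sq (T b)" for b
    proof (cases b)
      case True
      have "openin M (range \<kappa>)" using plane_chartD(2)[OF \<kappa> open_UNIV] .
      then show ?thesis using \<alpha>_snd True unfolding T_def continuous_map_def by auto
    next
      case False
      have op: "openin M (topspace M - \<kappa> ` cball z r)"
        using plane_chart_compact_closedin[OF H \<kappa> compact_cball] by (simp add: openin_diff)
      have "T b = {x \<in> topspace ?sq. \<alpha> (snd x) \<in> topspace M - \<kappa> ` cball z r}"
        using False pathin_in[OF \<alpha>(1)] unfolding T_def by auto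
      then show ?thesis using \<alpha>_snd op unfolding continuous_map_def by auto
    qed
    show "continuous_map (subtopology ?sq (T b)) M (\<lambda>x. if b then \<kappa> (g (W x) (fst x)) else \<alpha> (snd x))" for b
    proof (cases b)
      case False
      then show ?thesis using continuous_map_from_subtopology[OF \<alpha>_snd] by simp
    next
      case True
      have sub: "T True \<subseteq> unit_square" unfolding T_def by auto
      then have e: "subtopology ?sq (T b) = top_of_set (T True)"
        using True by (simp add: subtopology_subtopology Int_absorb1)
      have "continuous_map (top_of_set (T True)) (subtopology M (range \<kappa>)) (\<lambda>x. \<alpha> (snd x))"
        unfolding continuous_map_in_subtopology
        using continuous_map_from_subtopology[OF \<alpha>_snd, of "T True"] e True by (auto simp: T_def)
      from continuous_map_compose[OF this plane_chart_inverse[OF \<kappa>]]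
      have "continuous_on (T True) W" unfolding W_def by (simp add: o_def)
      then have "continuous_on (T True) (\<lambda>x. g (W x) (fst x))"
        unfolding g_def using Wz by (intro continuous_intros) auto
      then have "continuous_map (top_of_set (T True)) euclidean (\<lambda>x. g (W x) (fst x))" by simp
      from continuous_map_compose[OF this plane_chartD(1)[OF \<kappa>]]
      show ?thesis unfolding e using True by (simp add: o_def)
    qed
    fix b c x assume "x \<in> topspace ?sq \<inter> T b \<inter> T c"
    then show "(if b then \<kappa> (g (W x) (fst x)) else \<alpha> (snd x)) =
        (if c then \<kappa> (g (W x) (fst x)) else \<alpha> (snd x))"
    proof -
      have "\<kappa> (g (W x) (fst x)) = \<alpha> (snd x)" if "\<alpha> (snd x) \<in> range \<kappa>" "\<alpha> (snd x) \<notin> \<kappa> ` cball z r"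
      proof -
        have "W x \<notin> cball z r" using W[OF that(1)] that(2) by (metis image_eqI)
        then have "g (W x) (fst x) = W x" by (intro g_out) (simp add: dist_norm norm_minus_commute)
        then show ?thesis using W[OF that(1)] by simp
      qed
      then show ?thesis using \<open>x \<in> topspace ?sq \<inter> T b \<inter> T c\<close> unfolding T_def by (cases b; cases c) auto
    qed
  next
    fix x assume "x \<in> topspace ?sq"
    then show "\<exists>b. b \<in> UNIV \<and> x \<in> T b \<and> h x = (if b then \<kappa> (g (W x) (fst x)) else \<alpha> (snd x))"
      unfolding T_def h_def by (intro exI[of _ "\<alpha> (snd x) \<in> range \<kappa>"]) auto
  qed
  have notC: "h x \<notin> C" if x: "x \<in> unit_square" for x
  proof (cases "\<alpha> (snd x) \<in> range \<kappa>")
    case True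
    then have "W x \<noteq> z" using Wz[of x] x unfolding T_def by auto
    then have "\<kappa> (g (W x) (fst x)) \<noteq> \<kappa> z" using gz[of "W x" "fst x"] x inj by (auto simp: mem_Times_iff inj_eq)
    then show ?thesis using True C(1) unfolding h_def by auto
  next
    case False
    then show ?thesis using \<alpha>(2)[of "snd x"] x unfolding h_def by (auto simp: mem_Times_iff)
  qed
  have cont': "continuous_map ?sq ?N h"
    using cont notC continuous_map_image_subset_topspace[OF cont]
    unfolding continuous_map_in_subtopology by auto
  define \<alpha>' where "\<alpha>' t = h (1, t)" for t
  have "path_homotopic ?N \<alpha> \<alpha>'"
    unfolding path_homotopic_iff
  proof (intro exI[of _ h] conjI ballI cont')
    fix t :: real assume "t \<in> {0..1}"
    show "h (0, t) = \<alpha> t" unfolding h_def using g0 W[of "(0, t)"] by simp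
    show "h (1, t) = \<alpha>' t" unfolding \<alpha>'_def by simp
  next
    fix s :: real 
    show "h (s, 0) = \<alpha> 0" "h (s, 1) = \<alpha> 1" unfolding h_def using \<alpha>(3,4) by auto
  qed
  moreover have "\<alpha>' t \<notin> \<kappa> ` ball z r" if t: "t \<in> {0..1}" for t
  proof (cases "\<alpha> t \<in> range \<kappa>")
    case True
    then have "W (1, t) \<noteq> z" using Wz[of "(1,t)"] t unfolding T_def by auto
    then have "g (W (1, t)) 1 \<notin> ball z r" using g1 by (auto simp: dist_norm norm_minus_commute not_less)
    then show ?thesis using True inj unfolding \<alpha>'_def h_def by (auto simp: inj_eq)
  qed (auto simp: \<alpha>'_def h_def)
  ultimately show ?thesis using that by blast
qed

text \<open>In the main application \<open>\<Phi>\<close> is a surjection onto a symmetric group,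
  extended to all paths of configurations. The points of a configuration are called tokens.\<close>

locale surface_conf = path_functor "uconf n M" \<Phi> 
  for M :: "'a topology" and n :: nat and \<Phi> :: "(real \<Rightarrow> 'a set) \<Rightarrow> 'f::group_add" +
  assumes surface: "subsurface M (topspace M)"
begin

lemma Hausdorff: "Hausdorff_space M" using surface unfolding subsurface_def by simp

definition move :: "'a set \<Rightarrow> (real \<Rightarrow> 'a) \<Rightarrow> 'f" where
  "move C \<alpha> = \<Phi> (\<lambda>t. insert (\<alpha> t) C)"

text \<open>\<open>tokens k C\<close>: a configuration from which \<open>k\<close> points are missing.\<close>

definition tokens :: "nat \<Rightarrow> 'a set \<Rightarrow> bool" where
  "tokens k C \<longleftrightarrow> finite C \<and> C \<subseteq> topspace M \<and> card C + k = n"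

definition track :: "'a set \<Rightarrow> (real \<Rightarrow> 'a) \<Rightarrow> bool" where
  "track C \<alpha> \<longleftrightarrow> pathin M \<alpha> \<and> (\<forall>t\<in>{0..1}. \<alpha> t \<notin> C)"

lemma tokens_insert: "tokens (Suc k) C \<Longrightarrow> x \<in> topspace M \<Longrightarrow> x \<notin> C \<Longrightarrow> tokens k (insert x C)"
  unfolding tokens_def by auto

lemma track_in: "track C \<alpha> \<Longrightarrow> t \<in> {0..1} \<Longrightarrow> \<alpha> t \<in> topspace M - C"
  unfolding track_def using pathin_in by fast

lemma track_path: "track C \<alpha> \<Longrightarrow> pathin M \<alpha>" unfolding track_def by simp

lemma track_mono: "track C \<alpha> \<Longrightarrow> D \<subseteq> C \<Longrightarrow> track D \<alpha>" unfolding track_def by blast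

lemma track_insert: "track (insert x B) \<alpha> \<longleftrightarrow> (\<forall>t\<in>{0..1}. \<alpha> t \<noteq> x) \<and> track B \<alpha>" unfolding track_def by blast

lemma track_subpath: "track C \<alpha> \<Longrightarrow> a \<in> {0..1} \<Longrightarrow> b \<in> {0..1} \<Longrightarrow> track C (subpath_of \<alpha> a b)"
  unfolding track_def using pathin_subpath_of[of M \<alpha> a b] subpath_of_in[of a 0 1 b] by metis

lemma track_concat: "track C \<alpha> \<Longrightarrow> track C \<mu> \<Longrightarrow> \<alpha> 1 = \<mu> 0 \<Longrightarrow> track C (path_concat \<alpha> \<mu>)"
  unfolding track_def using pathin_path_concat[of M \<alpha> \<mu>] by (auto simp: path_concat_def)

lemma track_reverse: "track C \<alpha> \<Longrightarrow> track C (path_reverse \<alpha>)"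
  unfolding track_def using pathin_reverse by (auto simp: path_reverse_def)

lemma track_homotopic:
  assumes "path_homotopic (subtopology M (topspace M - C)) \<alpha> \<mu>" shows "track C \<alpha>" "track C \<mu>"
  using path_homotopic_imp(1,2)[OF assms] pathin_in[of "subtopology M (topspace M - C)"]
  unfolding track_def by (auto simp: pathin_subtopology)

lemma track_exists:
  assumes "finite C" "x \<in> topspace M - C" "y \<in> topspace M - C"
  obtains \<alpha> where "track C \<alpha>" "\<alpha> 0 = x" "\<alpha> 1 = y"
proof -
  obtain p where p: "pathin M p" "p 0 = x" "p 1 = y" "\<And>t. t \<in> {0..1} \<Longrightarrow> p t \<in> topspace M - C"
    by (rule subsurface_path[OF subsurface_remove_finite[OF assms(1) surface] assms(2,3)]) blast
  show ?thesis by (rule that[of p]) (use p in \<open>auto simp: track_def\<close>)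
qed

lemma fresh_point:
  assumes "finite C" obtains x where "x \<in> topspace M - C"
  using subsurface_remove_finite[OF assms surface] unfolding subsurface_def by blast

lemma move_pathin:
  assumes "tokens 1 C" "track C \<alpha>" shows "pathin (uconf n M) (\<lambda>t. insert (\<alpha> t) C)"
  unfolding pathin_iff
  by (rule insert_continuous) (use assms in \<open>auto simp: tokens_def track_def pathin_iff\<close>)

lemma move_convex:
  fixes K :: "'e::real_normed_vector set"
  assumes C: "tokens 1 C" and K: "convex K" "continuous_map (top_of_set K) M k" "\<And>x. x \<in> K \<Longrightarrow> k x \<notin> C"
    and "path p" "path_image p \<subseteq> K" "path q" "path_image q \<subseteq> K" "p 0 = q 0" "p 1 = q 1"
  shows "move C (k \<circ> p) = move C (k \<circ> q)"
proof -
  have "continuous_map (top_of_set K) (uconf n M) (\<lambda>x. insert (k x) C)"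
    by (rule insert_continuous) (use C K in \<open>auto simp: tokens_def\<close>)
  from convex[OF K(1) this assms(5-)] show ?thesis unfolding move_def by (simp add: o_def)
qed

lemma move_homotopic:
  assumes C: "tokens 1 C" and hom: "path_homotopic (subtopology M (topspace M - C)) \<alpha> \<mu>"
  shows "move C \<alpha> = move C \<mu>"
proof -
  obtain h where h: "continuous_map (top_of_set unit_square) (subtopology M (topspace M - C)) h"
    "\<forall>t\<in>{0..1}. h (0, t) = \<alpha> t \<and> h (1, t) = \<mu> t" "\<forall>s\<in>{0..1}. h (s, 0) = \<alpha> 0 \<and> h (s, 1) = \<alpha> 1"
    using hom unfolding path_homotopic_iff by blast
  have "h x \<notin> C" if "x \<in> unit_square" for x using h(1) that unfolding continuous_map_def by auto
  moreover have "continuous_map (top_of_set unit_square) M h"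
    using h(1) by (simp add: continuous_map_in_subtopology)
  ultimately have "continuous_map (top_of_set unit_square) (uconf n M) (\<lambda>x. insert (h x) C)"
    using C by (intro insert_continuous) (auto simp: tokens_def)
  then have "path_homotopic (uconf n M) (\<lambda>t. insert (\<alpha> t) C) (\<lambda>t. insert (\<mu> t) C)"
    unfolding path_homotopic_iff using h(2,3) by (intro exI[of _ "\<lambda>x. insert (h x) C"]) auto
  then show ?thesis unfolding move_def by (rule homotopic)
qed

lemma move_cong: 
  assumes "tokens 1 C" "track C \<alpha>" "\<And>t. t \<in> {0..1} \<Longrightarrow> \<alpha> t = \<mu> t" shows "move C \<alpha> = move C \<mu>"
  unfolding move_def by (rule cong[OF move_pathin[OF assms(1,2)]]) (use assms in auto)

lemma move_subpath_add:
  assumes "tokens 1 C" "track C \<alpha>" "a \<in> {0..1}" "b \<in> {0..1}" "c \<in> {0..1}"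
  shows "move C (subpath_of \<alpha> a b) + move C (subpath_of \<alpha> b c) = move C (subpath_of \<alpha> a c)"
  using subpath_add[OF move_pathin[OF assms(1,2)] assms(3-5)] unfolding move_def by (simp add: subpath_of_def o_def)

lemma move_concat:
  assumes "tokens 1 C" "track C \<alpha>" "track C \<mu>" "\<alpha> 1 = \<mu> 0"
  shows "move C (path_concat \<alpha> \<mu>) = move C \<alpha> + move C \<mu>"
proof -
  have "(\<lambda>t. insert (path_concat \<alpha> \<mu> t) C) = path_concat (\<lambda>t. insert (\<alpha> t) C) (\<lambda>t. insert (\<mu> t) C)"
    by (rule ext) (simp add: path_concat_def)
  then show ?thesis unfolding move_def using concat[OF move_pathin[OF assms(1,2)] move_pathin[OF assms(1,3)]] assms(4) by simp
qed

lemma move_reverse: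
  assumes "tokens 1 C" "track C \<alpha>" shows "move C (path_reverse \<alpha>) = - move C \<alpha>"
  using reverse[OF move_pathin[OF assms]] unfolding move_def by (simp add: path_reverse_def o_def)

lemma move_const:
  assumes "tokens 1 C" "x \<in> topspace M - C" shows "move C (\<lambda>_. x) = 0"
  unfolding move_def by (rule const) (use assms in \<open>auto simp: tokens_def topspace_uconf\<close>)

lemma move_commute:
  assumes C: "tokens 2 C" and \<alpha>: "track C \<alpha>" and \<mu>: "track C \<mu>"
    and disj: "\<And>s t. s \<in> {0..1} \<Longrightarrow> t \<in> {0..1} \<Longrightarrow> \<alpha> s \<noteq> \<mu> t"
  shows "move (insert (\<mu> 0) C) \<alpha> + move (insert (\<alpha> 1) C) \<mu> = move (insert (\<alpha> 0) C) \<mu> + move (insert (\<mu> 1) C) \<alpha>"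
proof -
  have "continuous_map (top_of_set unit_square) (uconf n M) (\<lambda>x. insert (\<alpha> (fst x)) (insert (\<mu> (snd x)) C))"
  proof (rule insert2_continuous)
    have "continuous_map (top_of_set unit_square) (top_of_set {0..1}) fst" by (auto intro!: continuous_intros)
    from continuous_map_compose[OF this, of M \<alpha>] \<alpha>
    show "continuous_map (top_of_set unit_square) M (\<lambda>x. \<alpha> (fst x))" by (simp add: track_def pathin_iff o_def)
    show "continuous_map (top_of_set unit_square) M (\<lambda>x. \<mu> (snd x))"
      using \<mu> by (intro continuous_map_from_snd) (simp add: track_def)
  qed (use C \<alpha> \<mu> disj in \<open>auto simp: tokens_def track_def\<close>)
  from square[OF this] show ?thesis unfolding move_def by (simp add: insert_commute)
qed

text \<open>While \<open>e\<close> makes a short step inside a disc, \<open>\<alpha>\<close> is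
  first expanded out of that disc; then the two motions are independent and can be interchanged.
  \<open>\<alpha>'\<close> results from all these expansions. The ends \<open>u\<close> and
  \<open>v\<close> are kept, and \<open>e\<close> has to avoid them.\<close>

lemma push_past:
  assumes C: "tokens 2 C" and e: "track (insert u (insert v C)) e" and \<alpha>: "track (insert (e 0) C) \<alpha>" "\<alpha> 0 = u" "\<alpha> 1 = v"
  obtains \<alpha>' where "track (insert (e 1) C) \<alpha>'" "\<alpha>' 0 = u" "\<alpha>' 1 = v"
    "move (insert (e 0) C) \<alpha> + move (insert v C) e = move (insert u C) e + move (insert (e 1) C) \<alpha>'"
proof -
  define P where "P a b \<longleftrightarrow> (\<forall>\<alpha>. track (insert (e a) C) \<alpha> \<and> \<alpha> 0 = u \<and> \<alpha> 1 = v \<longrightarrow> 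
     (\<exists>\<alpha>'. track (insert (e b) C) \<alpha>' \<and> \<alpha>' 0 = u \<and> \<alpha>' 1 = v \<and>
      move (insert (e a) C) \<alpha> + move (insert v C) (subpath_of e a b) =
      move (insert u C) (subpath_of e a b) + move (insert (e b) C) \<alpha>'))" for a b
  have uv: "u \<in> topspace M - C" "v \<in> topspace M - C"
    using track_in[OF \<alpha>(1), of 0] track_in[OF \<alpha>(1), of 1] \<alpha> by auto
  have tu: "tokens 1 (insert u C)" "tokens 1 (insert v C)"
    using C uv by (auto simp: numeral_2_eq_2 intro: tokens_insert)
  have eu: "track (insert u C) e" "track (insert v C) e" "track C e" using e unfolding track_def by auto
  have ein: "e t \<in> topspace M - insert u (insert v C)" if "t \<in> {0..1}" for t using track_in[OF e that] .
  have te: "tokens 1 (insert (e t) C)" if "t \<in> {0..1}" for t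
    using C ein[OF that] by (auto simp: numeral_2_eq_2 intro: tokens_insert)
  have "P 0 1"
  proof (rule interval_induct)
    fix a b c :: real assume ab: "P a b" and bc: "P b c" and abc: "0 \<le> a" "a \<le> b" "b \<le> c" "c \<le> 1"
    show "P a c" unfolding P_def
    proof (intro allI impI)
      fix \<alpha> assume "track (insert (e a) C) \<alpha> \<and> \<alpha> 0 = u \<and> \<alpha> 1 = v"
      then obtain \<mu> where m: "track (insert (e b) C) \<mu>" "\<mu> 0 = u" "\<mu> 1 = v"
        "move (insert (e a) C) \<alpha> + move (insert v C) (subpath_of e a b) =
         move (insert u C) (subpath_of e a b) + move (insert (e b) C) \<mu>"
        using ab unfolding P_def by blast
      then obtain \<nu> where n: "track (insert (e c) C) \<nu>" "\<nu> 0 = u" "\<nu> 1 = v"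
        "move (insert (e b) C) \<mu> + move (insert v C) (subpath_of e b c) =
         move (insert u C) (subpath_of e b c) + move (insert (e c) C) \<nu>"
        using bc unfolding P_def by blast
      have in01: "a \<in> {0..1}" "b \<in> {0..1}" "c \<in> {0..1}" using abc by auto
      have "move (insert (e a) C) \<alpha> + move (insert v C) (subpath_of e a c) =
        move (insert u C) (subpath_of e a c) + move (insert (e c) C) \<nu>"
        unfolding move_subpath_add[OF tu(1) eu(1) in01, symmetric] move_subpath_add[OF tu(2) eu(2) in01, symmetric]
        unfolding add.assoc[symmetric] m(4) unfolding add.assoc n(4) ..
      then show "\<exists>\<alpha>'. track (insert (e c) C) \<alpha>' \<and> \<alpha>' 0 = u \<and> \<alpha>' 1 = v \<and>
        move (insert (e a) C) \<alpha> + move (insert v C) (subpath_of e a c) =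
        move (insert u C) (subpath_of e a c) + move (insert (e c) C) \<alpha>'" using n by blast
    qed
  next
    fix t :: real assume t: "t \<in> {0..1}"
    let ?O = "topspace M - insert u (insert v C)"
    have "openin M ?O"
      using C subsurface_remove_finite[OF _ surface, of "insert u (insert v C)"]
      unfolding tokens_def subsurface_def by auto
    then obtain \<kappa> where k: "plane_chart M \<kappa>" "\<kappa> 0 = e t" "range \<kappa> \<subseteq> ?O"
      using subsurface_chart[OF surface _ ein[OF t]] by blast
    have "openin M (\<kappa> ` ball 0 1)" "e t \<in> \<kappa> ` ball 0 1"
      using plane_chartD(2)[OF k(1) open_ball] k(2) by (auto intro!: rev_image_eqI[of 0])
    then obtain d where d: "d > 0" "\<And>s. s \<in> {0..1} \<Longrightarrow> \<bar>s - t\<bar> < d \<Longrightarrow> e s \<in> \<kappa> ` ball 0 1"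
      using pathin_local[OF track_path[OF e] t] by blast
    have "P a b" if ab: "a\<in>{0..1}" "b\<in>{0..1}" "a \<le> t" "t \<le> b" "\<bar>a - t\<bar> < d" "\<bar>b - t\<bar> < d" for a b
      unfolding P_def
    proof (intro allI impI)
      fix \<alpha> assume \<alpha>: "track (insert (e a) C) \<alpha> \<and> \<alpha> 0 = u \<and> \<alpha> 1 = v"
      obtain z where z: "e a = \<kappa> z" "cmod z < 1" using d(2)[OF ab(1,5)] by auto
      \<comment> \<open>The chart is centred at \<open>e t\<close> and \<open>e\<close> stays in
        \<open>ball 0 1\<close>, but the expansion is centred at the token's actual position
        \<open>z\<close> in that ball; radius 3 is enough to clear all of
        \<open>ball 0 1\<close>.\<close>
      obtain \<alpha>' where l': "path_homotopic (subtopology M (topspace M - insert (e a) C)) \<alpha> \<alpha>'"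
        "\<And>s. s \<in> {0..1} \<Longrightarrow> \<alpha>' s \<notin> \<kappa> ` ball z 3"
      proof (rule radial_push[OF Hausdorff k(1), of 3 \<alpha> "insert (e a) C" z])
        show "pathin M \<alpha>" "\<And>t. t \<in> {0..1} \<Longrightarrow> \<alpha> t \<notin> insert (e a) C" using \<alpha> unfolding track_def by auto
        show "\<alpha> 0 \<notin> range \<kappa>" "\<alpha> 1 \<notin> range \<kappa>" using \<alpha> k(3) by auto
        show "insert (e a) C \<inter> range \<kappa> \<subseteq> {\<kappa> z}" "\<kappa> z \<in> insert (e a) C" using k(3) z by auto
      qed auto
      note l'ends = path_homotopic_imp(3,4)[OF l'(1)]
      have esub: "subpath_of e a b s \<in> \<kappa> ` ball z 3" if s: "s \<in> {0..1}" for s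
      proof -
        obtain r where r: "r \<in> {a..b}" "subpath_of e a b s = e r"
          using subpath_of_in[of a a b b s e] s ab by auto
        then have "e r \<in> \<kappa> ` ball 0 1" using ab by (intro d(2)) auto
        moreover have "ball 0 1 \<subseteq> ball z 3"
        proof
          fix w :: complex assume "w \<in> ball 0 1"
          then show "w \<in> ball z 3" using z(2) norm_triangle_ineq4[of z w] by (simp add: dist_norm)
        qed
        ultimately show ?thesis using r by auto
      qed
      have tr: "track C \<alpha>'" "track (insert (e a) C) \<alpha>'"
        using track_homotopic(2)[OF l'(1)] by (auto simp: track_def)
      have trb: "track (insert (e b) C) \<alpha>'"
      proof -
        have "e b \<in> \<kappa> ` ball z 3" using esub[of 1] by simp
        then show ?thesis unfolding track_insert using tr(1) l'(2) by metis
      qed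
      have disj: "\<alpha>' s \<noteq> subpath_of e a b r" if "s \<in> {0..1}" "r \<in> {0..1}" for s r
        using l'(2)[OF that(1)] esub[OF that(2)] by metis
      have "move (insert (subpath_of e a b 0) C) \<alpha>' + move (insert (\<alpha>' 1) C) (subpath_of e a b) =
          move (insert (\<alpha>' 0) C) (subpath_of e a b) + move (insert (subpath_of e a b 1) C) \<alpha>'"
        by (rule move_commute[OF C tr(1) track_subpath[OF eu(3) ab(1,2)] disj])
      moreover have "move (insert (e a) C) \<alpha> = move (insert (e a) C) \<alpha>'"
        by (rule move_homotopic[OF te[OF ab(1)] l'(1)])
      ultimately show "\<exists>\<alpha>'. track (insert (e b) C) \<alpha>' \<and> \<alpha>' 0 = u \<and> \<alpha>' 1 = v \<and>
        move (insert (e a) C) \<alpha> + move (insert v C) (subpath_of e a b) =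
        move (insert u C) (subpath_of e a b) + move (insert (e b) C) \<alpha>'"
        using trb l'ends \<alpha> by (intro exI[of _ \<alpha>']) simp
    qed
    then show "\<exists>d>0. \<forall>a\<in>{0..1}. \<forall>b\<in>{0..1}. a \<le> t \<longrightarrow> t \<le> b \<longrightarrow> \<bar>a - t\<bar> < d \<longrightarrow> \<bar>b - t\<bar> < d \<longrightarrow> P a b"
      using d(1) by blast
  qed
  then obtain \<alpha>' where "track (insert (e 1) C) \<alpha>'" "\<alpha>' 0 = u" "\<alpha>' 1 = v"
    "move (insert (e 0) C) \<alpha> + move (insert v C) e = move (insert u C) e + move (insert (e 1) C) \<alpha>'"
    using \<alpha> unfolding P_def subpath_of_whole by blast
  then show ?thesis using that by blast
qed

end

section \<open>Words and pushes\<close>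

context surface_conf
begin

definition labelled :: "(nat \<Rightarrow> 'a) \<Rightarrow> bool" where
  "labelled f \<longleftrightarrow> inj_on f {..<n} \<and> f ` {..<n} \<subseteq> topspace M"

definition others :: "(nat \<Rightarrow> 'a) \<Rightarrow> nat \<Rightarrow> 'a set" where
  "others f i = f ` ({..<n} - {i})"

text \<open>Labels are recorded, so a word from \<open>f\<close> to \<open>f\<close> returns each
  token to its own place and represents a pure braid. Labels from \<open>n\<close> on are never
  changed.\<close>

inductive word :: "(nat \<Rightarrow> 'a) \<Rightarrow> 'f \<Rightarrow> (nat \<Rightarrow> 'a) \<Rightarrow> bool" where
  nil: "labelled f \<Longrightarrow> word f 0 f"
| snoc: "word f v g \<Longrightarrow> i < n \<Longrightarrow> track (others g i) \<alpha> \<Longrightarrow> \<alpha> 0 = g i \<Longrightarrow>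
    word f (v + move (others g i) \<alpha>) (g(i := \<alpha> 1))"

lemma others_upd [simp]: "others (f(i := x)) i = others f i"
  unfolding others_def by auto

lemma conf_eq: "i < n \<Longrightarrow> f ` {..<n} = insert (f i) (others f i)"
  unfolding others_def by auto

lemma labelled_upd:
  assumes "labelled f" "x \<in> topspace M - others f i"
  shows "labelled (f(i := x))"
  unfolding labelled_def
proof
  show "inj_on (f(i := x)) {..<n}"
    using assms unfolding labelled_def others_def inj_on_def by (auto simp: image_iff)
  show "(f(i := x)) ` {..<n} \<subseteq> topspace M"
    using assms unfolding labelled_def by auto
qed

lemma labelled_in: "labelled f \<Longrightarrow> i < n \<Longrightarrow> f i \<in> topspace M - others f i"
  unfolding labelled_def others_def inj_on_def by auto

lemma tokens_others: "labelled f \<Longrightarrow> i < n \<Longrightarrow> tokens 1 (others f i)"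
  unfolding labelled_def others_def tokens_def
  by (auto simp: card_image inj_on_diff)

definition others2 :: "(nat \<Rightarrow> 'a) \<Rightarrow> nat \<Rightarrow> nat \<Rightarrow> 'a set" where
  "others2 f i j = f ` ({..<n} - {i, j})"

lemma others2_comm: "others2 f i j = others2 f j i"
  unfolding others2_def by (simp add: insert_commute)

lemma others2_upd [simp]: "others2 (f(j := x)) i j = others2 f i j"
  unfolding others2_def by auto

lemma others_split: "i < n \<Longrightarrow> j < n \<Longrightarrow> i \<noteq> j \<Longrightarrow> others f i = insert (f j) (others2 f i j)"
  unfolding others_def others2_def by auto

lemma others_split_upd: "i < n \<Longrightarrow> j < n \<Longrightarrow> i \<noteq> j \<Longrightarrow> others (f(j := x)) i = insert x (others2 f i j)"
  unfolding others_def others2_def by auto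

lemma tokens_others2:
  assumes "labelled f" "i < n" "j < n" "i \<noteq> j" shows "tokens 2 (others2 f i j)"
proof -
  have "card (others2 f i j) = card ({..<n} - {i, j})"
    using assms unfolding labelled_def others2_def by (intro card_image) (auto simp: inj_on_diff)
  moreover have "card ({..<n} - {i, j}) = n - 2" using assms by (subst card_Diff_subset) auto
  moreover have "2 \<le> n" using assms by auto
  ultimately show ?thesis using assms unfolding labelled_def others2_def tokens_def by auto
qed

lemma word_labelled: "word f v g \<Longrightarrow> labelled f \<and> labelled g"
proof (induction rule: word.induct)
  case (snoc f v g i \<alpha>)
  then show ?case using track_in[of "others g i" \<alpha> 1] by (auto intro!: labelled_upd simp del: fun_upd_apply)
qed simp

lemma word_step:
  assumes "labelled f" "i < n" "track (others f i) \<alpha>" "\<alpha> 0 = f i"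
  shows "word f (move (others f i) \<alpha>) (f(i := \<alpha> 1))"
  using word.snoc[OF word.nil[OF assms(1)] assms(2-4)] by simp

lemma word_trans:
  assumes "word g w h" "word f v g" shows "word f (v + w) h"
  using assms
proof (induction rule: word.induct)
  case (snoc g w h i \<alpha>)
  then have "word f (v + w + move (others h i) \<alpha>) (h(i := \<alpha> 1))" by (intro word.snoc) auto
  then show ?case by (simp add: add.assoc del: fun_upd_apply)
qed simp

lemma word_reverse:
  assumes "word f v g" shows "word g (- v) f"
  using assms
proof (induction rule: word.induct)
  case (snoc f v g i \<alpha>)
  let ?h = "g(i := \<alpha> 1)"
  have lg: "labelled g" using snoc.hyps(1) word_labelled by blast
  have lh: "labelled ?h" using lg track_in[OF snoc.hyps(3), of 1] by (intro labelled_upd) auto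
  have "word ?h (move (others ?h i) (path_reverse \<alpha>)) (?h(i := path_reverse \<alpha> 1))"
    using snoc.hyps track_reverse by (intro word_step lh) auto
  then have "word ?h (- move (others g i) \<alpha>) g"
    using move_reverse[OF tokens_others[OF lg snoc.hyps(2)] snoc.hyps(3)] snoc.hyps(4) by simp
  from word_trans[OF snoc.IH this] show ?case by (simp add: minus_add del: fun_upd_apply)
qed (auto intro: word.nil)

section \<open>Pushes of single tokens and their conjugates\<close>

inductive_set pushes :: "(nat \<Rightarrow> 'a) \<Rightarrow> 'f set" for f where
  zero: "0 \<in> pushes f"
| add: "x \<in> pushes f \<Longrightarrow> i < n \<Longrightarrow> track (others f i) \<alpha> \<Longrightarrow> \<alpha> 0 = f i \<Longrightarrow> \<alpha> 1 = f i \<Longrightarrow>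
    x + move (others f i) \<alpha> \<in> pushes f"

lemma push_in: "i < n \<Longrightarrow> track (others f i) \<alpha> \<Longrightarrow> \<alpha> 0 = f i \<Longrightarrow> \<alpha> 1 = f i \<Longrightarrow> move (others f i) \<alpha> \<in> pushes f"
  using pushes.add[OF pushes.zero] by simp

lemma pushes_add: 
  assumes "y \<in> pushes f" "x \<in> pushes f" shows "x + y \<in> pushes f"
  using assms
proof (induction rule: pushes.induct)
  case (add y i \<alpha>)
  then show ?case using pushes.add[of "x + y"] by (simp add: add.assoc)
qed simp

lemma pushes_uminus: 
  assumes "y \<in> pushes f" "labelled f" shows "- y \<in> pushes f"
  using assms
proof (induction rule: pushes.induct)
  case (add y i \<alpha>)
  have "move (others f i) (path_reverse \<alpha>) \<in> pushes f"
    using add track_reverse by (intro push_in) auto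
  then have "- move (others f i) \<alpha> \<in> pushes f"
    using move_reverse[OF tokens_others[OF add.prems add.hyps(2)] add.hyps(3)] by simp
  then show ?case using pushes_add[OF add.IH[OF add.prems]] by (simp add: minus_add)
qed (simp add: pushes.zero)

definition push_set :: "(nat \<Rightarrow> 'a) \<Rightarrow> nat \<Rightarrow> 'f set" where
  "push_set f i = {move (others f i) \<alpha> |\<alpha>. track (others f i) \<alpha> \<and> \<alpha> 0 = f i \<and> \<alpha> 1 = f i}"

text \<open>For \<open>i = j\<close> the loop is transported along the move of its own base point;
  for different tokens \<open>push_past\<close> carries token \<open>j\<close> across the loop of
  token \<open>i\<close>.\<close>

lemma push_set_conj_step:
  assumes f: "labelled f" and j: "j < n" and e: "track (others f j) e" "e 0 = f j"
    and i: "i < n" and m: "m \<in> push_set f i"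
  shows "- move (others f j) e + m + move (others f j) e \<in> push_set (f(j := e 1)) i"
proof -
  let ?E = "move (others f j) e" and ?g = "f(j := e 1)"
  obtain \<alpha> where \<alpha>: "track (others f i) \<alpha>" "\<alpha> 0 = f i" "\<alpha> 1 = f i" "m = move (others f i) \<alpha>"
    using m unfolding push_set_def by blast
  show ?thesis
  proof (cases "i = j")
    case True
    have t: "track (others f j) \<alpha>" using \<alpha> True by simp
    have 1: "track (others f j) (path_concat \<alpha> e)"
      using t e \<alpha> True by (intro track_concat) auto
    have tr: "track (others f j) (path_concat (path_reverse e) (path_concat \<alpha> e))"
      using 1 e \<alpha> True track_reverse by (intro track_concat) auto
    have "move (others f j) (path_concat (path_reverse e) (path_concat \<alpha> e)) = - ?E + (m + ?E)"
      using tokens_others[OF f j] t 1 e \<alpha> True track_reverse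
      by (simp add: move_concat move_reverse)
    moreover have "move (others ?g j) (path_concat (path_reverse e) (path_concat \<alpha> e)) \<in> push_set ?g j"
      using tr e unfolding push_set_def by fastforce
    ultimately show ?thesis using True by (simp add: add.assoc del: fun_upd_apply)
  next
    case False
    let ?C = "others2 f i j"
    have oi: "others f i = insert (e 0) ?C" using others_split[OF i j False] e by simp
    have oj: "others f j = insert (f i) ?C" using others_split[OF j i] False others2_comm by metis
    obtain \<alpha>' where a: "track (insert (e 1) ?C) \<alpha>'" "\<alpha>' 0 = f i" "\<alpha>' 1 = f i"
      "move (insert (e 0) ?C) \<alpha> + move (insert (f i) ?C) e = move (insert (f i) ?C) e + move (insert (e 1) ?C) \<alpha>'"
      using push_past[OF tokens_others2[OF f i j False], of "f i" "f i" e \<alpha>] e \<alpha> oi oj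
      by auto
    have og: "others ?g i = insert (e 1) ?C" using others_split_upd[OF i j False] .
    have "m + ?E = ?E + move (others ?g i) \<alpha>'" using a(4) \<alpha>(4) oi oj og by simp
    then have "- ?E + m + ?E = move (others ?g i) \<alpha>'" by (simp add: add.assoc)
    moreover have "move (others ?g i) \<alpha>' \<in> push_set ?g i"
      using a og False unfolding push_set_def by auto
    ultimately show ?thesis by simp
  qed
qed

lemma push_set_conj:
  assumes "word f v g" "i < n" "x \<in> push_set f i" shows "- v + x + v \<in> push_set g i"
  using assms
proof (induction rule: word.induct)
  case (snoc f v g j \<alpha>)
  have "- move (others g j) \<alpha> + (- v + x + v) + move (others g j) \<alpha> \<in> push_set (g(j := \<alpha> 1)) i"
    using snoc word_labelled by (intro push_set_conj_step) auto
  then show ?case by (simp add: add.assoc minus_add diff_conv_add_uminus del: fun_upd_apply add_uminus_conv_diff)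
qed simp

lemma push_set_in_pushes: "i < n \<Longrightarrow> push_set f i \<subseteq> pushes f"
  unfolding push_set_def using push_in by auto

lemma pushes_conj_step:
  assumes f: "labelled f" and j: "j < n" and e: "track (others f j) e" "e 0 = f j"
    and x: "x \<in> pushes f"
  shows "- move (others f j) e + x + move (others f j) e \<in> pushes (f(j := e 1))"
  using x
proof (induction rule: pushes.induct)
  case zero
  then show ?case by (simp add: pushes.zero)
next
  case (add x i \<alpha>)
  let ?E = "move (others f j) e" and ?m = "move (others f i) \<alpha>" and ?g = "f(j := e 1)"
  have "?m \<in> push_set f i" using add.hyps unfolding push_set_def by blast
  from push_set_conj_step[OF f j e add.hyps(2) this]
  have "- ?E + ?m + ?E \<in> pushes ?g" using push_set_in_pushes[OF add.hyps(2)] by blast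
  then have "(- ?E + x + ?E) + (- ?E + ?m + ?E) \<in> pushes ?g" using add.IH by (rule pushes_add)
  then show ?case by (simp add: add.assoc del: fun_upd_apply)
qed

text \<open>Normality in the sense of groupoids: words transport the pushes at their first
  configuration to pushes at their last one.\<close>

lemma pushes_conj:
  assumes "word f v g" "x \<in> pushes f" shows "- v + x + v \<in> pushes g"
  using assms
proof (induction rule: word.induct)
  case (snoc f v g i \<alpha>)
  have "- move (others g i) \<alpha> + (- v + x + v) + move (others g i) \<alpha> \<in> pushes (g(i := \<alpha> 1))"
    using snoc word_labelled by (intro pushes_conj_step) auto
  then show ?case by (simp add: add.assoc minus_add diff_conv_add_uminus del: fun_upd_apply add_uminus_conv_diff)
qed simp

section \<open>Congruence modulo pushes\<close>

definition push_equiv :: "(nat \<Rightarrow> 'a) \<Rightarrow> 'f \<Rightarrow> 'f \<Rightarrow> bool" where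
  "push_equiv f a b \<longleftrightarrow> a - b \<in> pushes f"

lemma push_equiv_refl: "push_equiv f a a" by (simp add: push_equiv_def pushes.zero)

lemma push_equiv_sym: "labelled f \<Longrightarrow> push_equiv f a b \<Longrightarrow> push_equiv f b a"
  unfolding push_equiv_def using pushes_uminus[of "a - b" f] by simp

lemma push_equiv_trans [trans]: "push_equiv f a b \<Longrightarrow> push_equiv f b c \<Longrightarrow> push_equiv f a c"
  unfolding push_equiv_def using pushes_add[of "b - c" f "a - b"]
  by (simp add: diff_conv_add_uminus add.assoc del: add_uminus_conv_diff)

lemma push_equiv_right: "push_equiv f a b \<Longrightarrow> push_equiv f (a + c) (b + c)"
  unfolding push_equiv_def by (simp add: diff_add_eq_diff_diff_swap)

text \<open>The classes are right cosets of \<open>pushes f\<close>, so a summand on the left has to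
  be carried past the pushes by conjugation.\<close>

lemma push_equiv_left: "word f v g \<Longrightarrow> push_equiv g a b \<Longrightarrow> push_equiv f (v + a) (v + b)"
  unfolding push_equiv_def using pushes_conj[OF word_reverse, of f v g "a - b"]
  by (simp add: diff_add_eq_diff_diff_swap add.assoc diff_conv_add_uminus minus_add del: add_uminus_conv_diff)

lemma move_push_equiv:
  assumes f: "labelled f" "i < n" and \<alpha>: "track (others f i) \<alpha>" "\<alpha> 0 = f i"
    and \<beta>: "track (others f i) \<beta>" "\<beta> 0 = f i" "\<beta> 1 = \<alpha> 1"
  shows "push_equiv f (move (others f i) \<alpha>) (move (others f i) \<beta>)"
proof -
  have "move (others f i) (path_concat \<alpha> (path_reverse \<beta>)) \<in> pushes f"
    using assms track_reverse by (intro push_in track_concat) auto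
  moreover have "move (others f i) (path_concat \<alpha> (path_reverse \<beta>)) = move (others f i) \<alpha> - move (others f i) \<beta>"
    using assms track_reverse tokens_others[OF f] by (simp add: move_concat move_reverse)
  ultimately show ?thesis unfolding push_equiv_def by simp
qed

text \<open>A chosen way to bring token \<open>i\<close> to \<open>y\<close>. Modulo pushes the
  choice does not matter, by \<open>move_push_equiv\<close>.\<close>

definition step :: "(nat \<Rightarrow> 'a) \<Rightarrow> nat \<Rightarrow> 'a \<Rightarrow> 'f" where
  "step f i y = move (others f i) (SOME \<alpha>. track (others f i) \<alpha> \<and> \<alpha> 0 = f i \<and> \<alpha> 1 = y)"

lemma step_eq:
  assumes "labelled f" "i < n" "y \<in> topspace M - others f i"
  obtains \<alpha> where "track (others f i) \<alpha>" "\<alpha> 0 = f i" "\<alpha> 1 = y" "step f i y = move (others f i) \<alpha>"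
proof -
  have "finite (others f i)" unfolding others_def by simp
  then have "\<exists>\<alpha>. track (others f i) \<alpha> \<and> \<alpha> 0 = f i \<and> \<alpha> 1 = y"
    using track_exists[of "others f i" "f i" y] labelled_in[OF assms(1,2)] assms(3) by metis
  from someI_ex[OF this] show ?thesis using that unfolding step_def by blast
qed

lemma step_word:
  assumes "labelled f" "i < n" "y \<in> topspace M - others f i"
  shows "word f (step f i y) (f(i := y))"
  using step_eq[OF assms] word_step[OF assms(1,2)] by metis

lemma move_equiv_step:
  assumes "labelled f" "i < n" "track (others f i) \<alpha>" "\<alpha> 0 = f i"
  shows "push_equiv f (move (others f i) \<alpha>) (step f i (\<alpha> 1))"
proof -
  have "\<alpha> 1 \<in> topspace M - others f i" using track_in[OF assms(3), of 1] by simp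
  then show ?thesis using step_eq[OF assms(1,2)] move_push_equiv[OF assms] by metis
qed

lemma step_step:
  assumes f: "labelled f" "i < n" and y: "y \<in> topspace M - others f i" and z: "z \<in> topspace M - others f i"
  shows "push_equiv f (step f i y + step (f(i := y)) i z) (step f i z)"
proof -
  obtain \<alpha> where a: "track (others f i) \<alpha>" "\<alpha> 0 = f i" "\<alpha> 1 = y" "step f i y = move (others f i) \<alpha>"
    using step_eq[OF f y] .
  obtain \<beta> where b: "track (others f i) \<beta>" "\<beta> 0 = y" "\<beta> 1 = z" "step (f(i := y)) i z = move (others f i) \<beta>"
    using step_eq[OF labelled_upd[OF f(1) y] f(2), of z] z by auto
  have "track (others f i) (path_concat \<alpha> \<beta>)" using a b by (intro track_concat) auto
  from move_equiv_step[OF f this] show ?thesis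
    using a b move_concat[OF tokens_others[OF f] a(1) b(1)] by simp
qed

text \<open>Modulo pushes the path \<open>e\<close> of token \<open>i\<close> may be chosen to avoid
  \<open>z\<close> as well. It then misses both ends of the path of token \<open>j\<close>, as
  \<open>push_past\<close> demands.\<close>

lemma step_commute:
  assumes f: "labelled f" and ij: "i < n" "j < n" "i \<noteq> j"
    and y: "y \<in> topspace M - others f i" and z: "z \<in> topspace M - f ` {..<n}" "y \<noteq> z"
  shows "push_equiv f (step f i y + step (f(i := y)) j z) (step f j z + step (f(j := z)) i y)"
proof -
  let ?C = "others2 f i j"
  have oi: "others f i = insert (f j) ?C" using others_split[OF ij] .
  have oj: "others f j = insert (f i) ?C" using others_split[OF ij(2,1)] ij(3) others2_comm by metis
  have zj: "z \<in> topspace M - others f j" using z conf_eq[OF ij(2), of f] by auto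
  obtain \<beta> where b: "track (others f j) \<beta>" "\<beta> 0 = f j" "\<beta> 1 = z" "step f j z = move (others f j) \<beta>"
    using step_eq[OF f ij(2) zj] .
  have "finite (insert z (others f i))" unfolding others_def by simp
  then obtain e where e: "track (insert z (others f i)) e" "e 0 = f i" "e 1 = y"
    using track_exists[of "insert z (others f i)" "f i" y] labelled_in[OF f ij(1)] y z conf_eq[OF ij(1), of f] by auto
  have ei: "track (others f i) e" using e(1) unfolding track_insert by simp
  obtain \<beta>' where b': "track (insert (e 1) ?C) \<beta>'" "\<beta>' 0 = f j" "\<beta>' 1 = z"
      "move (insert (e 0) ?C) \<beta> + move (insert z ?C) e = move (insert (f j) ?C) e + move (insert (e 1) ?C) \<beta>'"
  proof (rule push_past[OF tokens_others2[OF f ij]])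
    show "track (insert (f j) (insert z ?C)) e" using e(1) oi by (simp add: insert_commute)
    show "track (insert (e 0) ?C) \<beta>" using b(1) oj e by simp
  qed (use b in auto)
  have fy: "labelled (f(i := y))" and fz: "labelled (f(j := z))"
    using labelled_upd[OF f y] labelled_upd[OF f zj] by auto
  have ojy: "others (f(i := y)) j = insert (e 1) ?C"
    using others_split_upd[OF ij(2,1), of f y] ij(3) e(3) others2_comm by metis
  have oiz: "others (f(j := z)) i = insert z ?C" using others_split_upd[OF ij] .
  have "push_equiv f (step f i y) (move (others f i) e)"
    using push_equiv_sym[OF f move_equiv_step[OF f ij(1) ei e(2)]] e(3) by simp
  then have "push_equiv f (step f i y + step (f(i := y)) j z) (move (others f i) e + step (f(i := y)) j z)"
    by (rule push_equiv_right)
  also have "push_equiv f \<dots> (move (others f i) e + move (others (f(i := y)) j) \<beta>')"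
  proof (rule push_equiv_left)
    show "word f (move (others f i) e) (f(i := y))" using word_step[OF f ij(1) ei e(2)] e(3) by simp
    show "push_equiv (f(i := y)) (step (f(i := y)) j z) (move (others (f(i := y)) j) \<beta>')"
      using push_equiv_sym[OF fy move_equiv_step[OF fy ij(2), of \<beta>']] b' ojy ij(3) by simp
  qed
  also have "move (others f i) e + move (others (f(i := y)) j) \<beta>' = move (others f j) \<beta> + move (others (f(j := z)) i) e"
    using b'(4) oi oj ojy oiz e by simp
  also have "push_equiv f \<dots> (step f j z + step (f(j := z)) i y)"
    unfolding b(4)[symmetric]
  proof (rule push_equiv_left[OF step_word[OF f ij(2) zj]])
    have "track (others (f(j := z)) i) e" using e(1) unfolding oiz oi track_insert by simp
    then show "push_equiv (f(j := z)) (move (others (f(j := z)) i) e) (step (f(j := z)) i y)"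
      using move_equiv_step[OF fz ij(1), of e] e ij(3) by simp
  qed
  finally show ?thesis .
qed

text \<open>Two words with the same endpoints are compared by letting all tokens escape, one after the other, to
  positions met by neither word.\<close>

definition mixed :: "(nat \<Rightarrow> 'a) \<Rightarrow> (nat \<Rightarrow> 'a) \<Rightarrow> nat \<Rightarrow> nat \<Rightarrow> 'a" where
  "mixed f g k i = (if i < k then g i else f i)"

fun evacuation :: "(nat \<Rightarrow> 'a) \<Rightarrow> (nat \<Rightarrow> 'a) \<Rightarrow> nat \<Rightarrow> 'f" where
  "evacuation f g 0 = 0"
| "evacuation f g (Suc k) = evacuation f g k + step (mixed f g k) k (g k)"

lemma mixed_Suc: "mixed f g (Suc k) = (mixed f g k)(k := g k)"
  unfolding mixed_def by auto

lemma mixed_labelled: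
  assumes "labelled f" "labelled g" "f ` {..<n} \<inter> g ` {..<n} = {}"
  shows "labelled (mixed f g k)"
proof -
  have "f i \<noteq> g j" if "i < n" "j < n" for i j using assms(3) that by auto
  moreover have "g j \<noteq> f i" if "i < n" "j < n" for i j using assms(3) that by auto
  ultimately show ?thesis
    using assms(1,2) unfolding labelled_def mixed_def inj_on_def by (auto simp: image_subset_iff)
qed

lemma mixed_fresh:
  assumes "labelled g" "f ` {..<n} \<inter> g ` {..<n} = {}" "k < n"
  shows "g k \<in> topspace M - mixed f g k ` {..<n}"
proof -
  have ne: "g k \<noteq> mixed f g k i" if "i < n" for i
  proof (cases "i < k")
    case True
    then show ?thesis using assms(1,3) that inj_onD[of g "{..<n}" k i] unfolding labelled_def mixed_def by auto
  next
    case False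
    have "g k \<in> g ` {..<n}" "f i \<in> f ` {..<n}" using assms(3) that by auto
    then have "g k \<noteq> f i" using assms(2) by (metis IntI empty_iff)
    then show ?thesis using False unfolding mixed_def by simp
  qed
  have "g k \<notin> mixed f g k ` {..<n}"
  proof
    assume "g k \<in> mixed f g k ` {..<n}"
    then obtain i where "i < n" "g k = mixed f g k i" by auto
    then show False using ne by blast
  qed
  moreover have "g k \<in> topspace M" using assms(1,3) unfolding labelled_def by auto
  ultimately show ?thesis by simp
qed

lemma evacuation_word:
  assumes "labelled f" "labelled g" "f ` {..<n} \<inter> g ` {..<n} = {}" "k \<le> n"
  shows "word f (evacuation f g k) (mixed f g k)"
  using assms(4)
proof (induction k)
  case 0
  have "mixed f g 0 = f" by (auto simp: mixed_def)
  then show ?case using assms word.nil by simp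
next
  case (Suc k)
  have "g k \<in> topspace M - others (mixed f g k) k"
    using mixed_fresh[OF assms(2,3), of k] Suc.prems unfolding others_def by auto
  then have "word (mixed f g k) (step (mixed f g k) k (g k)) (mixed f g (Suc k))"
    unfolding mixed_Suc using Suc.prems by (intro step_word mixed_labelled assms) auto
  then show ?case using word_trans Suc by simp
qed

text \<open>The place of token \<open>i\<close> matters only until that token is itself evacuated:
  \<open>before\<close> carries its move past the evacuation of the tokens below \<open>i\<close>,
  \<open>step_step\<close> absorbs it into the evacuation of token \<open>i\<close>, and in
  \<open>after\<close> the remaining steps are the same on both sides.\<close>

lemma evacuation_step:
  assumes f: "labelled f" and g: "labelled g" and i: "i < n" and \<alpha>: "track (others f i) \<alpha>" "\<alpha> 0 = f i"
    and disj: "f ` {..<n} \<inter> g ` {..<n} = {}" "\<alpha> 1 \<notin> g ` {..<n}"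
  shows "push_equiv f (move (others f i) \<alpha> + evacuation (f(i := \<alpha> 1)) g n) (evacuation f g n)"
proof -
  define y where "y = \<alpha> 1"
  let ?f' = "f(i := y)" and ?w = "move (others f i) \<alpha>" and ?h = "mixed f g"
  have y: "y \<in> topspace M - others f i" using track_in[OF \<alpha>(1), of 1] unfolding y_def by simp
  have f': "labelled ?f'" using labelled_upd[OF f y] .
  have disj': "?f' ` {..<n} \<inter> g ` {..<n} = {}"
  proof -
    have "?f' ` {..<n} \<subseteq> insert y (f ` {..<n})" by auto
    moreover have "disjnt (insert y (f ` {..<n})) (g ` {..<n})" using disj by (simp add: disjnt_def y_def)
    ultimately show ?thesis using disjnt_subset1 unfolding disjnt_def by metis
  qed
  note lh = mixed_labelled[OF f g disj(1)]
  note lh' = mixed_labelled[OF f' g disj']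
  have mixed': "mixed ?f' g k = (?h k)(i := y)" if "k \<le> i" for k
    using that unfolding mixed_def by auto
  have yh: "y \<in> topspace M - others (?h k) i" for k
  proof -
    have "others (?h k) i \<subseteq> others f i \<union> g ` {..<n}" unfolding others_def mixed_def by auto
    moreover have "y \<notin> others f i \<union> g ` {..<n}" using y disj(2) unfolding y_def by simp
    ultimately show ?thesis using y by (metis DiffD1 DiffI subsetD)
  qed
  have gh: "g k \<in> topspace M - others (?h k) k" if "k < n" for k
    using mixed_fresh[OF g disj(1) that] unfolding others_def by auto
  have before: "push_equiv f (?w + evacuation ?f' g k) (evacuation f g k + step (?h k) i y)" if "k \<le> i" for k
    using that
  proof (induction k)
    case 0
    have "?h 0 = f" by (auto simp: mixed_def)
    then show ?case using move_equiv_step[OF f i \<alpha>] unfolding y_def by simp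
  next
    case (Suc k)
    have kn: "k < n" using Suc.prems i by simp
    have "push_equiv f (?w + evacuation ?f' g k + step ((?h k)(i := y)) k (g k))
            (evacuation f g k + step (?h k) i y + step ((?h k)(i := y)) k (g k))"
      using Suc.IH Suc.prems by (intro push_equiv_right) (simp del: fun_upd_apply)
    also have "evacuation f g k + step (?h k) i y + step ((?h k)(i := y)) k (g k) =
        evacuation f g k + (step (?h k) i y + step ((?h k)(i := y)) k (g k))" by (simp add: add.assoc)
    also have "push_equiv f \<dots> (evacuation f g k + (step (?h k) k (g k) + step ((?h k)(k := g k)) i y))"
    proof (rule push_equiv_left[OF evacuation_word[OF f g disj(1)]])
      show "k \<le> n" using kn by simp
      show "push_equiv (?h k) (step (?h k) i y + step ((?h k)(i := y)) k (g k))
         (step (?h k) k (g k) + step ((?h k)(k := g k)) i y)"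
      proof (rule step_commute[OF lh i kn _ yh mixed_fresh[OF g disj(1) kn]])
        show "i \<noteq> k" using Suc.prems by simp
        have "g k \<in> g ` {..<n}" using kn by simp
        then show "y \<noteq> g k" using disj(2) unfolding y_def by metis
      qed
    qed
    finally show ?case using mixed'[of k] Suc.prems by (simp add: add.assoc mixed_Suc del: fun_upd_apply)
  qed
  have after: "push_equiv f (?w + evacuation ?f' g (Suc i + k)) (evacuation f g (Suc i + k))" if "Suc i + k \<le> n" for k
    using that
  proof (induction k)
    case 0
    have "push_equiv f (?w + evacuation ?f' g i + step ((?h i)(i := y)) i (g i))
            (evacuation f g i + step (?h i) i y + step ((?h i)(i := y)) i (g i))"
      by (rule push_equiv_right[OF before[OF order_refl]])
    also have "evacuation f g i + step (?h i) i y + step ((?h i)(i := y)) i (g i) =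
        evacuation f g i + (step (?h i) i y + step ((?h i)(i := y)) i (g i))" by (simp add: add.assoc)
    also have "push_equiv f \<dots> (evacuation f g i + step (?h i) i (g i))"
      using i by (intro push_equiv_left[OF evacuation_word[OF f g disj(1)]] step_step lh yh gh) auto
    finally show ?case using mixed'[of i] by (simp add: add.assoc del: fun_upd_apply)
  next
    case (Suc k)
    have "mixed ?f' g (Suc i + k) = ?h (Suc i + k)" unfolding mixed_def by auto
    then show ?case using push_equiv_right[OF Suc.IH, of "step (?h (Suc i + k)) (Suc i + k) (g (Suc i + k))"] Suc.prems
      by (simp add: add.assoc del: fun_upd_apply)
  qed
  obtain k where "n = Suc i + k" using i less_imp_Suc_add by auto
  then show ?thesis using after[of k] unfolding y_def by simp
qed

text \<open>\<open>Z\<close> collects the places at which moves of the word start and end; the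
  evacuation must not lead to any of them.\<close>

lemma word_evacuation:
  assumes "word f v h"
  shows "\<exists>Z. finite Z \<and> (\<forall>g. labelled g \<and> g ` {..<n} \<inter> Z = {} \<longrightarrow>
     push_equiv f (v + evacuation h g n) (evacuation f g n))"
  using assms
proof (induction rule: word.induct)
  case (nil f)
  then show ?case by (intro exI[of _ "{}"]) (simp add: push_equiv_refl)
next
  case (snoc f v h i \<alpha>)
  then obtain Z where Z: "finite Z" "\<And>g. labelled g \<Longrightarrow> g ` {..<n} \<inter> Z = {} \<Longrightarrow>
     push_equiv f (v + evacuation h g n) (evacuation f g n)" by blast
  have lh: "labelled h" using snoc.hyps(1) word_labelled by blast
  show ?case
  proof (intro exI[of _ "insert (\<alpha> 1) (Z \<union> h ` {..<n})"] conjI allI impI)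
    fix g assume g: "labelled g \<and> g ` {..<n} \<inter> insert (\<alpha> 1) (Z \<union> h ` {..<n}) = {}"
    have "v + move (others h i) \<alpha> + evacuation (h(i := \<alpha> 1)) g n =
        v + (move (others h i) \<alpha> + evacuation (h(i := \<alpha> 1)) g n)" by (simp add: add.assoc)
    also have "push_equiv f \<dots> (v + evacuation h g n)"
      using g snoc.hyps by (intro push_equiv_left[OF snoc.hyps(1)] evacuation_step lh) auto
    also have "push_equiv f \<dots> (evacuation f g n)" using g by (intro Z) auto
    finally show "push_equiv f (v + move (others h i) \<alpha> + evacuation (h(i := \<alpha> 1)) g n) (evacuation f g n)" .
  qed (use Z in auto)
qed

lemma labelled_avoiding:
  assumes "finite Z" obtains g where "labelled g" "g ` {..<n} \<inter> Z = {}"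
proof -
  have "infinite (topspace M - Z)"
  proof
    assume "finite (topspace M - Z)"
    then obtain x where "x \<in> topspace M - (Z \<union> (topspace M - Z))"
      using fresh_point[of "Z \<union> (topspace M - Z)"] assms by blast
    then show False by blast
  qed
  then obtain g :: "nat \<Rightarrow> 'a" where "inj g" "range g \<subseteq> topspace M - Z"
    using infinite_countable_subset by blast
  then have "labelled g" "g ` {..<n} \<inter> Z = {}"
    unfolding labelled_def using inj_on_subset[of g UNIV "{..<n}"] by blast+
  then show ?thesis by (rule that)
qed

text \<open>The evacuation from \<open>f\<close> has congruent values with and without the word in
  front of it, and it cancels.\<close>

theorem pure_word_in_pushes:
  assumes "word f v f" shows "v \<in> pushes f"
proof -
  obtain Z where Z: "finite Z" "\<And>g. labelled g \<Longrightarrow> g ` {..<n} \<inter> Z = {} \<Longrightarrow>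
     push_equiv f (v + evacuation f g n) (evacuation f g n)" using word_evacuation[OF assms] by blast
  obtain g where "labelled g" "g ` {..<n} \<inter> Z = {}" using labelled_avoiding[OF Z(1)] .
  from Z(2)[OF this] show ?thesis unfolding push_equiv_def by simp
qed

end

section \<open>Decomposition of a path of configurations into moves\<close>

context surface_conf
begin

text \<open>On a short interval the strands stay in disjoint neighbourhoods, so the tokens can make
  their motions one after the other instead of simultaneously.\<close>

lemma path_word:
  assumes \<gamma>: "pathin (uconf n M) \<gamma>" and f: "labelled f" "f ` {..<n} = \<gamma> 0"
  obtains g where "word f (\<Phi> \<gamma>) g" "g ` {..<n} = \<gamma> 1"
proof -
  obtain S where S: "\<And>x. x \<in> \<gamma> 0 \<Longrightarrow> pathin M (S x) \<and> S x 0 = x"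
    "\<And>t. t \<in> {0..1} \<Longrightarrow> (\<lambda>x. S x t) ` \<gamma> 0 = \<gamma> t"
    by (rule uconf_path_strands[OF Hausdorff \<gamma>]) blast
  define G where "G i t = (if i < n then S (f i) t else f i)" for i t
  have fin: "f i \<in> \<gamma> 0" if "i < n" for i using f(2) that by blast
  have Gp: "pathin M (G i)" if "i < n" for i
    using S(1)[OF fin[OF that]] that by (simp add: G_def[abs_def])
  have Gim: "(\<lambda>i. G i t) ` {..<n} = \<gamma> t" if "t \<in> {0..1}" for t
  proof -
    have "(\<lambda>i. G i t) ` {..<n} = (\<lambda>x. S x t) ` (f ` {..<n})" by (simp add: G_def image_image)
    then show ?thesis using S(2)[OF that] f(2) by simp
  qed
  have Ginj: "inj_on (\<lambda>i. G i t) {..<n}" if "t \<in> {0..1}" for t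
    using Gim[OF that] pathin_in[OF \<gamma> that] by (intro eq_card_imp_inj_on) (auto simp: topspace_uconf)
  have G0: "(\<lambda>i. G i 0) = f" using S(1)[OF fin] by (auto simp: G_def fun_eq_iff)
  have Gl: "labelled (\<lambda>i. G i t)" if "t \<in> {0..1}" for t
    using Ginj[OF that] Gim[OF that] pathin_in[OF \<gamma> that] unfolding labelled_def by (auto simp: topspace_uconf)
  define P where "P a b \<longleftrightarrow> word (\<lambda>i. G i a) (\<Phi> (subpath_of \<gamma> a b)) (\<lambda>i. G i b)" for a b
  have "P 0 1"
  proof (rule interval_induct)
    fix a b c :: real assume *: "P a b" "P b c" "0 \<le> a" "a \<le> b" "b \<le> c" "c \<le> 1"
    then have "\<Phi> (subpath_of \<gamma> a b) + \<Phi> (subpath_of \<gamma> b c) = \<Phi> (subpath_of \<gamma> a c)"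
      by (intro subpath_add[OF \<gamma>]) auto
    then show "P a c" using word_trans[OF *(2)[unfolded P_def] *(1)[unfolded P_def]] unfolding P_def by simp
  next
    fix t :: real assume t: "t \<in> {0..1}"
    have "finite (\<gamma> t)" "\<gamma> t \<subseteq> topspace M" using pathin_in[OF \<gamma> t] by (auto simp: topspace_uconf)
    from box_family_exists[OF Hausdorff this] obtain V where V: "box_family M (\<gamma> t) V" .
    have "\<forall>i\<in>{..<n}. \<exists>d>0. \<forall>s\<in>{0..1}. \<bar>s - t\<bar> < d \<longrightarrow> G i s \<in> V (G i t)"
    proof
      fix i assume i: "i \<in> {..<n}"
      then have "G i t \<in> \<gamma> t" using Gim[OF t] by blast
      then have "openin M (V (G i t))" "G i t \<in> V (G i t)" using V unfolding box_family_def by auto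
      from pathin_local[OF Gp t this] i obtain d where "d > 0"
        "\<And>s. s \<in> {0..1} \<Longrightarrow> \<bar>s - t\<bar> < d \<Longrightarrow> G i s \<in> V (G i t)" by blast
      then show "\<exists>d>0. \<forall>s\<in>{0..1}. \<bar>s - t\<bar> < d \<longrightarrow> G i s \<in> V (G i t)" by blast
    qed
    from bchoice[OF this] obtain d' where d': "\<forall>i\<in>{..<n}. d' i > 0 \<and> (\<forall>s\<in>{0..1}. \<bar>s - t\<bar> < d' i \<longrightarrow> G i s \<in> V (G i t))" ..
    define d where "d = Min (insert 1 (d' ` {..<n}))"
    have d: "d > 0" unfolding d_def using d' by (subst Min_gr_iff) auto
    have dG: "G i s \<in> V (G i t)" if "i < n" "s \<in> {0..1}" "\<bar>s - t\<bar> < d" for i s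
    proof -
      have "d \<le> d' i" unfolding d_def using that(1) by (intro Min_le) auto
      then show ?thesis using d' that by auto
    qed
    have sep: "G i s \<noteq> G j r" if "i < n" "j < n" "i \<noteq> j" "s \<in> {0..1}" "r \<in> {0..1}" "\<bar>s - t\<bar> < d" "\<bar>r - t\<bar> < d" for i j s r
    proof -
      have "G i t \<noteq> G j t" using Ginj[OF t] that(1-3) by (auto simp: inj_on_def)
      moreover have "G i t \<in> \<gamma> t" "G j t \<in> \<gamma> t" using Gim[OF t] that(1,2) by blast+
      ultimately have "V (G i t) \<inter> V (G j t) = {}" using V unfolding box_family_def by blast
      moreover have "G i s \<in> V (G i t)" "G j r \<in> V (G j t)" using dG that by auto
      ultimately show ?thesis by (metis IntI empty_iff)
    qed
    have "P a b" if ab: "a\<in>{0..1}" "b\<in>{0..1}" "a \<le> t" "t \<le> b" "\<bar>a - t\<bar> < d" "\<bar>b - t\<bar> < d" for a b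
    proof -
      have lp: "linepath a b u \<in> {0..1} \<and> \<bar>linepath a b u - t\<bar> < d" if "u \<in> {0..1}" for u
        using linepath_in[of a a b b u] that ab by auto
      have lpc: "continuous_map (top_of_set unit_square) M (\<lambda>z. G i (linepath a b (p z)))"
        if "i < n" "p = fst \<or> p = snd" for i p
      proof -
        have "continuous_map (top_of_set unit_square) (top_of_set {0..1}) p"
          using that(2) by (auto intro!: continuous_intros)
        moreover have "continuous_map (top_of_set {0..1}) M (subpath_of (G i) a b)"
          using pathin_subpath_of[OF Gp[OF that(1)] ab(1,2)] unfolding pathin_iff .
        ultimately have "continuous_map (top_of_set unit_square) M (subpath_of (G i) a b \<circ> p)"
          by (rule continuous_map_compose)
        then show ?thesis by (simp add: subpath_of_def o_def)
      qed
      define H where "H j i = (if i < j then G i b else G i a)" for j i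
      \<comment> \<open>In \<open>q j\<close> the tokens below \<open>j\<close> move and the others
        wait: \<open>q 0\<close> is constant and \<open>q n\<close> is the given motion.\<close>
      define q where "q j u = (\<lambda>i. if i < j then G i (linepath a b u) else G i a) ` {..<n}" for j u
      have "word (\<lambda>i. G i a) (\<Phi> (q j)) (H j)" if "j \<le> n" for j using that
      proof (induction j)
        case 0
        have "q 0 = (\<lambda>_. \<gamma> a)" using Gim[OF ab(1)] unfolding q_def by (auto simp: fun_eq_iff)
        then have "\<Phi> (q 0) = 0" using const[OF pathin_in[OF \<gamma> ab(1)]] by simp
        moreover have "H 0 = (\<lambda>i. G i a)" unfolding H_def by auto
        ultimately show ?case using word.nil[OF Gl[OF ab(1)]] by simp
      next
        case (Suc j)
        then have j: "j < n" by simp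
        \<comment> \<open>The first coordinate is the time of the tokens below \<open>j\<close>, the
          second that of token \<open>j\<close>. The diagonal of the square is
          \<open>q (Suc j)\<close>; the two sides below it are \<open>q j\<close> and a move of
          token \<open>j\<close>.\<close>
        define K where "K i z = (if i < j then G i (linepath a b (fst z)) else if i = j then G j (linepath a b (snd z)) else G i a)"
          for i and z :: "real \<times> real"
        define k where "k z = (\<lambda>i. K i z) ` {..<n}" for z
        have "continuous_map (top_of_set unit_square) (uconf n M) k"
          unfolding k_def
        proof (rule conf_continuous)
          show "continuous_map (top_of_set unit_square) M (K i)" if "i \<in> {..<n}" for i
            using that lpc[of i fst] lpc[of j snd] j pathin_in[OF Gp ab(1)]
            unfolding K_def[abs_def] by (cases "i < j"; cases "i = j") auto
          show "inj_on (\<lambda>i. K i z) {..<n}" if "z \<in> topspace (top_of_set unit_square)" for z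
          proof -
            have z: "fst z \<in> {0..1}" "snd z \<in> {0..1}" using that by (auto simp: mem_Times_iff)
            have "\<exists>s. K i z = G i s \<and> s \<in> {0..1} \<and> \<bar>s - t\<bar> < d" for i
              unfolding K_def using lp[OF z(1)] lp[OF z(2)] ab by auto
            then show ?thesis using sep by (metis inj_onI lessThan_iff)
          qed
        qed auto
        from line_add[OF _ this, of "(0,0)" "(1,0)" "(1,1)"]
        have "\<Phi> (k \<circ> linepath (0,0) (1,0)) + \<Phi> (k \<circ> linepath (1,0) (1,1)) = \<Phi> (k \<circ> linepath (0,0) (1,1))"
          by (simp add: convex_Times)
        moreover have "k \<circ> linepath (0,0) (1,0) = q j"
          unfolding k_def K_def q_def o_def by (rule ext, rule image_cong) (auto simp: linepath_def)
        moreover have "k \<circ> linepath (0,0) (1,1) = q (Suc j)"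
          unfolding k_def K_def q_def o_def by (rule ext, rule image_cong) (auto simp: linepath_def less_Suc_eq)
        moreover have "k \<circ> linepath (1,0) (1,1) = (\<lambda>u. insert (subpath_of (G j) a b u) (others (H j) j))"
        proof
          fix u :: real
          let ?z = "linepath (1,0) (1,1) u :: real \<times> real"
          have z: "fst ?z = 1" "snd ?z = u" by (auto simp: linepath_def)
          have "k ?z = insert (K j ?z) ((\<lambda>i. K i ?z) ` ({..<n} - {j}))" unfolding k_def using j by auto
          moreover have "(\<lambda>i. K i ?z) ` ({..<n} - {j}) = others (H j) j"
            unfolding others_def H_def K_def z by (rule image_cong) (auto simp: linepath_1')
          moreover have "K j ?z = subpath_of (G j) a b u" unfolding K_def z by (simp add: subpath_of_def)
          ultimately show "(k \<circ> linepath (1,0) (1,1)) u = insert (subpath_of (G j) a b u) (others (H j) j)" by simp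
        qed
        ultimately have e: "\<Phi> (q (Suc j)) = \<Phi> (q j) + move (others (H j) j) (subpath_of (G j) a b)"
          unfolding move_def by simp
        have "track (others (H j) j) (subpath_of (G j) a b)"
          unfolding track_def
        proof (intro conjI ballI)
          show "pathin M (subpath_of (G j) a b)" using pathin_subpath_of[OF Gp[OF j] ab(1,2)] .
          fix u :: real assume u: "u \<in> {0..1}"
          show "subpath_of (G j) a b u \<notin> others (H j) j"
          proof
            assume "subpath_of (G j) a b u \<in> others (H j) j"
            then obtain i where "i < n" "i \<noteq> j" "G j (linepath a b u) = H j i"
              unfolding others_def subpath_of_def by auto
            moreover have "\<exists>s. H j i = G i s \<and> s \<in> {0..1} \<and> \<bar>s - t\<bar> < d"
              unfolding H_def using ab by auto
            ultimately show False using sep[of j i "linepath a b u"] lp[OF u] j by metis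
          qed
        qed
        moreover have "subpath_of (G j) a b 0 = H j j" unfolding H_def by simp
        ultimately have "word (\<lambda>i. G i a) (\<Phi> (q j) + move (others (H j) j) (subpath_of (G j) a b))
            ((H j)(j := subpath_of (G j) a b 1))"
          using word.snoc[OF Suc.IH j, of "subpath_of (G j) a b"] Suc.prems
          by (simp del: subpath_of_ends fun_upd_apply)
        moreover have "(H j)(j := subpath_of (G j) a b 1) = H (Suc j)" unfolding H_def by auto
        ultimately show ?case unfolding e by simp
      qed
      then have "word (\<lambda>i. G i a) (\<Phi> (q n)) (H n)" by simp
      moreover have "\<Phi> (q n) = \<Phi> (subpath_of \<gamma> a b)"
      proof (rule cong[symmetric, OF pathin_subpath_of[OF \<gamma> ab(1,2)]])
        fix u :: real assume "u \<in> {0..1}"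
        then have "\<gamma> (linepath a b u) = (\<lambda>i. G i (linepath a b u)) ` {..<n}" using Gim lp by simp
        then show "subpath_of \<gamma> a b u = q n u" unfolding q_def subpath_of_def by auto
      qed
      moreover have "H n = (\<lambda>i. G i b)" unfolding H_def G_def by auto
      ultimately show ?thesis unfolding P_def by simp
    qed
    then show "\<exists>d>0. \<forall>a\<in>{0..1}. \<forall>b\<in>{0..1}. a \<le> t \<longrightarrow> t \<le> b \<longrightarrow> \<bar>a - t\<bar> < d \<longrightarrow> \<bar>b - t\<bar> < d \<longrightarrow> P a b"
      using d by blast
  qed
  then have "word f (\<Phi> \<gamma>) (\<lambda>i. G i 1)" unfolding P_def G0 by simp
  moreover have "(\<lambda>i. G i 1) ` {..<n} = \<gamma> 1" using Gim[of 1] by simp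
  ultimately show ?thesis by (rule that)
qed

end

section \<open>Half twists\<close>

text \<open>The tokens are placed on a parabola: a chord meets no third point of it, and its epigraph with
  points of the parabola removed remains convex.\<close>

definition parabola :: "real \<Rightarrow> complex" where
  "parabola x = Complex x (x\<^sup>2)"

lemma parabola_inj [simp]: "parabola x = parabola y \<longleftrightarrow> x = y"
  by (auto simp: parabola_def)

lemma parabola_chord:
  "Re (linepath (parabola a) (parabola b) t) = linepath a b t"
  "Im (linepath (parabola a) (parabola b) t) =
     (linepath a b t)\<^sup>2 + (linepath a b t - a) * (b - linepath a b t)"
  by (simp_all add: parabola_def linepath_def power2_eq_square algebra_simps)

lemma linepath_real_between:
  assumes "t \<in> {0..1}" "a \<le> b" shows "a \<le> linepath a b t" "linepath a b t \<le> (b::real)"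
  using linepath_in[of a a b b t] assms by auto

text \<open>Above \<open>x\<close> the chord exceeds the parabola by
  \<open>(x - a) * (b - x)\<close>, which vanishes only at the ends.\<close>

lemma chord_not_parabola:
  assumes t: "t \<in> {0..1}" and c: "c \<noteq> a" "c \<noteq> b"
  shows "linepath (parabola a) (parabola b) t \<noteq> parabola c"
proof
  assume eq: "linepath (parabola a) (parabola b) t = parabola c"
  then have l: "linepath a b t = c" using parabola_chord(1)[of a b t] by (simp add: parabola_def)
  have "c\<^sup>2 = c\<^sup>2 + (c - a) * (b - c)"
    using parabola_chord(2)[of a b t] unfolding l eq by (simp add: parabola_def)
  then show False using c by simp
qed

text \<open>At every \<open>x\<close> between \<open>c\<close> and \<open>d\<close> the outer chord
  has the strictly larger excess over the parabola.\<close>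

lemma chords_nested:
  assumes "a < c" "c < d" "d < b" "s \<in> {0..1}" "t \<in> {0..1}"
  shows "linepath (parabola a) (parabola b) s \<noteq> linepath (parabola c) (parabola d) t"
proof
  assume eq: "linepath (parabola a) (parabola b) s = linepath (parabola c) (parabola d) t"
  define l where "l = linepath c d t"
  have l: "linepath a b s = l" using eq parabola_chord(1) unfolding l_def by metis
  have "(l - a) * (b - l) = (l - c) * (d - l)"
    using eq parabola_chord(2)[of a b s] parabola_chord(2)[of c d t] unfolding l l_def[symmetric] by simp
  moreover have "c \<le> l" "l \<le> d" using linepath_real_between[of t c d] assms unfolding l_def by auto
  then have "(l - c) * (d - l) \<le> (l - c) * (b - l)" "(l - c) * (b - l) < (l - a) * (b - l)"
    using assms by (auto intro: mult_left_mono mult_strict_right_mono)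
  ultimately show False by simp
qed

lemma chords_separated:
  assumes "a < b" "b < c" "c < d" "s \<in> {0..1}" "t \<in> {0..1}"
  shows "linepath (parabola a) (parabola b) s \<noteq> linepath (parabola c) (parabola d) t"
proof
  assume eq: "linepath (parabola a) (parabola b) s = linepath (parabola c) (parabola d) t"
  have "linepath a b s = linepath c d t" using eq parabola_chord(1) by metis
  then show False using linepath_real_between[of s a b] linepath_real_between[of t c d] assms by auto
qed

text \<open>Points of the parabola are extreme points of its epigraph, so removing them preserves
  convexity. This gives a convex parameter space for one token moving past the others.\<close>

lemma convex_epigraph_minus:
  "convex {w. (Re w)\<^sup>2 \<le> Im w \<and> w \<notin> parabola ` A}"
  unfolding convex_alt
proof (intro ballI allI impI)
  fix a b :: complex and u :: real
  assume a: "a \<in> {w. (Re w)\<^sup>2 \<le> Im w \<and> w \<notin> parabola ` A}" and b: "b \<in> {w. (Re w)\<^sup>2 \<le> Im w \<and> w \<notin> parabola ` A}"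
    and u: "0 \<le> u \<and> u \<le> 1"
  define w where "w = (1 - u) *\<^sub>R a + u *\<^sub>R b"
  let ?A = "Im a - (Re a)\<^sup>2" and ?B = "Im b - (Re b)\<^sup>2"
  have e: "Im w - (Re w)\<^sup>2 = (1 - u) * ?A + u * ?B + u * (1 - u) * (Re a - Re b)\<^sup>2"
    unfolding w_def by (simp add: power2_eq_square algebra_simps)
  have nonneg: "0 \<le> (1 - u) * ?A" "0 \<le> u * ?B" "0 \<le> u * (1 - u) * (Re a - Re b)\<^sup>2"
    using a b u by (auto intro!: mult_nonneg_nonneg)
  have "w \<notin> parabola ` A"
  proof
    assume "w \<in> parabola ` A"
    then have "Im w - (Re w)\<^sup>2 = 0" and w: "w \<in> parabola ` A" by (auto simp: parabola_def)
    then have z: "(1 - u) * ?A = 0" "u * ?B = 0" "u * (1 - u) * (Re a - Re b)\<^sup>2 = 0"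
      using e nonneg by linarith+
    have "w = a \<or> w = b"
    proof (cases "u = 0 \<or> u = 1")
      case True then show ?thesis unfolding w_def by auto
    next
      case False
      then have "Re a = Re b" "Im a = Im b" using z by auto
      then have "a = b" by (simp add: complex_eq_iff)
      then show ?thesis unfolding w_def by (simp add: scaleR_left_distrib[symmetric])
    qed
    then show False using w a b by auto
  qed
  moreover have "(Re w)\<^sup>2 \<le> Im w" using e nonneg by linarith
  ultimately show "(1 - u) *\<^sub>R a + u *\<^sub>R b \<in> {w. (Re w)\<^sup>2 \<le> Im w \<and> w \<notin> parabola ` A}"
    unfolding w_def by simp
qed

section \<open>Increasing positions and ranks\<close>

definition increasing :: "nat \<Rightarrow> (nat \<Rightarrow> real) \<Rightarrow> bool" where
  "increasing k x \<longleftrightarrow> (\<forall>i j. i < j \<longrightarrow> j < k \<longrightarrow> x i < x j)"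

lemma increasing_inj: "increasing k x \<Longrightarrow> inj_on x {..<k}"
  unfolding increasing_def inj_on_def by (metis lessThan_iff less_irrefl linorder_neqE_nat)

lemma increasing_combination:
  assumes "increasing k x" "increasing k y" "0 \<le> a" "0 \<le> b" "a + b > 0"
  shows "increasing k (\<lambda>i. a * x i + b * y i)"
  unfolding increasing_def
proof (intro allI impI)
  fix i j assume "i < j" "j < k"
  then have *: "x i < x j" "y i < y j" using assms unfolding increasing_def by auto
  have le: "a * x i \<le> a * x j" "b * y i \<le> b * y j"
    using * assms(3,4) by (simp_all add: mult_left_mono)
  consider "a > 0" | "b > 0" using assms by linarith
  then show "a * x i + b * y i < a * x j + b * y j"
  proof cases
    case 1
    then have "a * x i < a * x j" using * by simp
    then show ?thesis using le by linarith
  next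
    case 2
    then have "b * y i < b * y j" using * by simp
    then show ?thesis using le by linarith
  qed
qed

lemma increasing_mix:
  assumes "increasing k x" "increasing k y" "t \<in> {0..1}"
  shows "increasing k (\<lambda>i. linepath (x i) (y i) t)"
  using increasing_combination[OF assms(1,2), of "1 - t" t] assms(3) by (simp add: linepath_def)

lemma sorted_list_of_set_increasing:
  assumes "increasing k x" "i < k" shows "sorted_list_of_set (x ` {..<k}) ! i = x i"
proof -
  have "sorted (map x [0..<k])" "distinct (map x [0..<k])"
    using assms(1) increasing_inj[OF assms(1)] unfolding increasing_def
    by (auto simp: sorted_iff_nth_mono_less distinct_map atLeast0LessThan less_imp_le)
  then have "sorted_list_of_set (set (map x [0..<k])) = map x [0..<k]"
    by (rule sorted_list_of_set.idem_if_sorted_distinct)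
  then have "sorted_list_of_set (x ` {..<k}) = map x [0..<k]" by (simp add: atLeast0LessThan)
  then show ?thesis using assms(2) by simp
qed

text \<open>The increasing enumeration of the numbers other than \<open>h\<close>. Conversely
  \<open>unskip h i\<close> is the rank of \<open>i\<close> once \<open>h\<close> is left
  out.\<close>

definition skip :: "nat \<Rightarrow> nat \<Rightarrow> nat" where
  "skip h i = (if i < h then i else Suc i)"

definition unskip :: "nat \<Rightarrow> nat \<Rightarrow> nat" where
  "unskip h i = (if i < h then i else i - 1)"

lemma skip_image: "h \<le> k \<Longrightarrow> skip h ` {..<k} = {..k} - {h}"
proof
  assume h: "h \<le> k"
  show "{..k} - {h} \<subseteq> skip h ` {..<k}"
  proof
    fix i assume i: "i \<in> {..k} - {h}"
    then have "skip h (unskip h i) = i" "unskip h i < k" using h unfolding skip_def unskip_def by auto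
    then show "i \<in> skip h ` {..<k}" by (metis imageI lessThan_iff)
  qed
qed (auto simp: skip_def)

lemma skip_unskip: "i \<noteq> h \<Longrightarrow> skip h (unskip h i) = i"
  unfolding skip_def unskip_def by auto

lemma increasing_skip: "increasing (Suc k) x \<Longrightarrow> increasing k (x \<circ> skip h)"
  unfolding increasing_def skip_def by auto

locale surface_chart = surface_conf M n \<Phi> 
  for M :: "'a topology" and n :: nat and \<Phi> :: "(real \<Rightarrow> 'a set) \<Rightarrow> 'f::group_add" +
  fixes \<kappa> :: "complex \<Rightarrow> 'a"
  assumes chart: "plane_chart M \<kappa>"
begin

definition pt :: "real \<Rightarrow> 'a" where "pt x = \<kappa> (parabola x)"

lemma \<kappa>_eq [simp]: "\<kappa> z = \<kappa> w \<longleftrightarrow> z = w"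
  using plane_chartD(3)[OF chart] by (rule inj_eq)

lemma pt_eq [simp]: "pt x = pt y \<longleftrightarrow> x = y"
  unfolding pt_def by simp

lemma pt_in: "pt x \<in> topspace M" unfolding pt_def by (rule plane_chartD(4)[OF chart])

lemma tokens_pt:
  assumes "finite A" "card A + k = n" shows "tokens k (pt ` A)"
  using assms pt_in unfolding tokens_def by (auto simp: card_image inj_on_def)

lemma continuous_parabola: "continuous_on S parabola"
proof -
  have e: "parabola = (\<lambda>x. complex_of_real x + \<i> * complex_of_real (x\<^sup>2))"
    by (auto simp: parabola_def complex_eq_iff)
  show ?thesis unfolding e by (intro continuous_intros)
qed

lemma continuous_chart:
  assumes "continuous_on S f" shows "continuous_map (top_of_set S) M (\<lambda>z. \<kappa> (f z))"
proof -
  have "continuous_map (top_of_set S) euclidean f" using assms by simp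
  from continuous_map_compose[OF this plane_chartD(1)[OF chart]] show ?thesis by (simp add: o_def)
qed

lemma continuous_pt: "continuous_on S f \<Longrightarrow> continuous_map (top_of_set S) M (\<lambda>z. pt (f z))"
  unfolding pt_def by (rule continuous_chart) (auto intro: continuous_on_compose2[OF continuous_parabola])

text \<open>Configurations on the parabola are identified with each other by moving their points along it.
  After this identification the value of a jump along a chord depends only on ranks.\<close>

definition slide :: "(nat \<Rightarrow> real) \<Rightarrow> (nat \<Rightarrow> real) \<Rightarrow> 'f" where
  "slide x y = \<Phi> (\<lambda>t. (\<lambda>i. pt (linepath (x i) (y i) t)) ` {..<n})"

definition gauge :: "real set \<Rightarrow> 'f" where
  "gauge A = slide real (\<lambda>i. sorted_list_of_set A ! i)"

lemma increasing_real: "increasing k real" unfolding increasing_def by simp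

text \<open>Increasing sequences form a convex set, so the triangle with corners \<open>x\<close>,
  \<open>y\<close>, \<open>z\<close> parametrises configurations on the parabola.\<close>

lemma slide_triangle:
  assumes "increasing n x" "increasing n y" "increasing n z"
  shows "slide x y + slide y z = slide x z"
proof -
  define K where "K = {(a, b). 0 \<le> a \<and> 0 \<le> b \<and> a + b \<le> (1::real)}"
  define k where "k w = (\<lambda>i. pt ((1 - fst w - snd w) * x i + fst w * y i + snd w * z i)) ` {..<n}" for w
  have K: "convex K"
  proof -
    have "K = {w. (1, 0) \<bullet> w \<ge> 0} \<inter> {w. (0, 1) \<bullet> w \<ge> 0} \<inter> {w. (1, 1) \<bullet> w \<le> (1::real)}"
      unfolding K_def by auto
    then show ?thesis by (simp add: convex_Int convex_halfspace_ge convex_halfspace_le)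
  qed
  have "continuous_map (top_of_set K) (uconf n M) k"
    unfolding k_def
  proof (rule conf_continuous)
    show "continuous_map (top_of_set K) M (\<lambda>w. pt ((1 - fst w - snd w) * x i + fst w * y i + snd w * z i))" for i
      by (intro continuous_pt continuous_intros)
    fix w assume "w \<in> topspace (top_of_set K)"
    then have w: "0 \<le> fst w" "0 \<le> snd w" "fst w + snd w \<le> 1" unfolding K_def by auto
    have "increasing n (\<lambda>i. (1 - fst w - snd w) * x i + fst w * y i + snd w * z i)"
    proof (cases "snd w = 1")
      case True
      then have "fst w = 0" using w by simp
      then show ?thesis using True assms by simp
    next
      case False
      then have "increasing n (\<lambda>i. (1 - fst w - snd w) * x i + fst w * y i)"
        using w by (intro increasing_combination assms) auto
      from increasing_combination[OF this assms(3), of 1 "snd w"] w show ?thesis by simp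
    qed
    from increasing_inj[OF this]
    show "inj_on (\<lambda>i. pt ((1 - fst w - snd w) * x i + fst w * y i + snd w * z i)) {..<n}"
      by (simp add: inj_on_def)
  qed auto
  from line_add[OF K this, of "(0,0)" "(1,0)" "(0,1)"]
  have "\<Phi> (k \<circ> linepath (0,0) (1,0)) + \<Phi> (k \<circ> linepath (1,0) (0,1)) = \<Phi> (k \<circ> linepath (0,0) (0,1))"
    unfolding K_def by simp
  then show ?thesis unfolding slide_def k_def by (simp add: o_def linepath_def add.commute)
qed

lemma slide_cong: "(\<And>i. i < n \<Longrightarrow> x i = x' i) \<Longrightarrow> (\<And>i. i < n \<Longrightarrow> y i = y' i) \<Longrightarrow> slide x y = slide x' y'"
  unfolding slide_def by (intro arg_cong[of _ _ \<Phi>] ext image_cong) auto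

lemma gauge_increasing: "increasing n x \<Longrightarrow> gauge (x ` {..<n}) = slide real x"
  unfolding gauge_def by (rule slide_cong) (auto simp: sorted_list_of_set_increasing)

lemma slide_eq: "increasing n x \<Longrightarrow> increasing n y \<Longrightarrow> slide x y = - gauge (x ` {..<n}) + gauge (y ` {..<n})"
  using slide_triangle[of real x y] by (simp add: gauge_increasing increasing_real minus_add_cancel flip: slide_triangle[of real x y])

lemma gauge_base: "gauge (real ` {..<n}) = 0"
proof -
  have "slide real real = 0"
    using slide_triangle[OF increasing_real increasing_real increasing_real]
      add_left_cancel[of "slide real real" "slide real real" 0] by simp
  then show ?thesis using gauge_increasing[OF increasing_real] by simp
qed

section \<open>Jumps along chords\<close>

definition chord :: "real \<Rightarrow> real \<Rightarrow> real \<Rightarrow> 'a" where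
  "chord a b = \<kappa> \<circ> linepath (parabola a) (parabola b)"

text \<open>The gauges turn the move into a loop at the standard configuration, so jumps between
  different configurations can be compared.\<close>

definition jump :: "real set \<Rightarrow> real \<Rightarrow> real \<Rightarrow> 'f" where
  "jump A a b = gauge (insert a A) + move (pt ` A) (chord a b) - gauge (insert b A)"

lemma chord_ends [simp]: "chord a b 0 = pt a" "chord a b 1 = pt b"
  by (simp_all add: chord_def pt_def linepath_0' linepath_1')

lemma pathin_chord: "pathin M (chord a b)"
  unfolding chord_def pathin_iff using continuous_chart[of "{0..1}" "linepath (parabola a) (parabola b)"]
  by (simp add: o_def continuous_on_linepath)

lemma track_chord: "a \<notin> A \<Longrightarrow> b \<notin> A \<Longrightarrow> track (pt ` A) (chord a b)"
  unfolding track_def using pathin_chord chord_not_parabola by (auto simp: chord_def pt_def) metis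

lemma chord_reverse: "path_reverse (chord a b) = chord b a"
  unfolding path_reverse_def chord_def by (auto simp: linepath_def algebra_simps)

lemma jump_reverse:
  assumes "finite A" "card A + 1 = n" "a \<notin> A" "b \<notin> A"
  shows "jump A b a = - jump A a b"
proof -
  have "move (pt ` A) (chord b a) = - move (pt ` A) (chord a b)"
    using move_reverse[OF tokens_pt[OF assms(1,2)] track_chord[OF assms(3,4)]] by (simp add: chord_reverse)
  then show ?thesis unfolding jump_def by (simp add: diff_conv_add_uminus minus_add add.assoc del: add_uminus_conv_diff)
qed

text \<open>The moving token stays in the convex region of
  \<open>convex_epigraph_minus\<close>.\<close>

lemma jump_triangle:
  assumes A: "finite A" "card A + 1 = n" "a \<notin> A" "b \<notin> A" "c \<notin> A"
  shows "jump A a b + jump A b c = jump A a c"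
proof -
  let ?K = "{w. (Re w)\<^sup>2 \<le> Im w \<and> w \<notin> parabola ` A}"
  let ?k = "\<lambda>w. insert (\<kappa> w) (pt ` A)"
  have t: "tokens 1 (pt ` A)" using tokens_pt[OF A(1,2)] .
  have "continuous_map (top_of_set ?K) (uconf n M) ?k"
  proof (rule insert_continuous)
    show "continuous_map (top_of_set ?K) M \<kappa>" using continuous_chart[of ?K "\<lambda>z. z"] by simp
  qed (use t in \<open>auto simp: tokens_def pt_def\<close>)
  moreover have "parabola a \<in> ?K" "parabola b \<in> ?K" "parabola c \<in> ?K"
    using A by (auto simp: parabola_def)
  ultimately have "move (pt ` A) (chord a b) + move (pt ` A) (chord b c) = move (pt ` A) (chord a c)"
    using line_add[OF convex_epigraph_minus, of A ?k "parabola a" "parabola b" "parabola c"]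
    unfolding move_def chord_def by (simp add: o_def)
  then show ?thesis unfolding jump_def
    by (simp add: diff_conv_add_uminus add.assoc del: add_uminus_conv_diff flip: \<open>_ = move (pt ` A) (chord a c)\<close>)
qed

lemma jump_commute:
  assumes A: "finite A" "card A + 2 = n"
    and disj: "a < c \<and> c < d \<and> d < b \<or> a < b \<and> b < c \<and> c < d" and notin: "a \<notin> A" "b \<notin> A" "c \<notin> A" "d \<notin> A"
  shows "jump (insert c A) a b + jump (insert b A) c d = jump (insert a A) c d + jump (insert d A) a b"
proof -
  have "move (insert (chord c d 0) (pt ` A)) (chord a b) + move (insert (chord a b 1) (pt ` A)) (chord c d) =
    move (insert (chord a b 0) (pt ` A)) (chord c d) + move (insert (chord c d 1) (pt ` A)) (chord a b)"
  proof (rule move_commute[OF tokens_pt[OF A] track_chord track_chord])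
    fix s t :: real assume st: "s \<in> {0..1}" "t \<in> {0..1}"
    show "chord a b s \<noteq> chord c d t"
      using disj chords_nested[OF _ _ _ st, of a c d b] chords_separated[OF _ _ _ st, of a b c d]
      unfolding chord_def by auto
  qed (use notin in auto)
  then have m: "move (pt ` insert c A) (chord a b) + move (pt ` insert b A) (chord c d) =
    move (pt ` insert a A) (chord c d) + move (pt ` insert d A) (chord a b)" by simp
  have "jump (insert c A) a b + jump (insert b A) c d = gauge (insert a (insert c A)) +
     (move (pt ` insert c A) (chord a b) + move (pt ` insert b A) (chord c d)) - gauge (insert d (insert b A))"
    unfolding jump_def insert_commute[of c b A]
    by (simp add: diff_conv_add_uminus add.assoc del: add_uminus_conv_diff image_insert)
  also have "\<dots> = jump (insert a A) c d + jump (insert d A) a b"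
    unfolding m jump_def insert_commute[of a c A] insert_commute[of a d A] insert_commute[of b d A]
    by (simp add: diff_conv_add_uminus add.assoc del: add_uminus_conv_diff image_insert)
  finally show ?thesis .
qed

lemma del_image:
  assumes "h \<le> n" shows "(x \<circ> skip h) ` {..<n} = x ` ({..n} - {h})"
  unfolding image_comp[symmetric] skip_image[OF assms] ..

text \<open>The \<open>n + 1\<close> positions are deformed linearly from \<open>x\<close> to
  \<open>y\<close>, and at each stage a token jumps from position \<open>p\<close> to position
  \<open>h\<close>. Two sides of the resulting square are jumps; the other two are slides, which the
  gauges absorb.\<close>

lemma jump_increasing:
  assumes x: "increasing (Suc n) x" and y: "increasing (Suc n) y" and ph: "p \<le> n" "h \<le> n" "p \<noteq> h"
  shows "jump (x ` ({..n} - {p, h})) (x p) (x h) = jump (y ` ({..n} - {p, h})) (y p) (y h)"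
proof -
  define w where "w s i = linepath (x i) (y i) s" for s i
  have w: "increasing (Suc n) (w s)" if "s \<in> {0..1}" for s
    unfolding w_def using increasing_mix[OF x y that] .
  let ?I = "{..n} - {p, h}"
  have w01: "w 0 = x" "w 1 = y" unfolding w_def by (auto simp: linepath_0' linepath_1')
  have Ip: "insert p ?I = {..n} - {h}" "insert h ?I = {..n} - {p}" using ph by auto
  define H where "H z = insert (chord (w (fst z) p) (w (fst z) h) (snd z)) (pt ` w (fst z) ` ?I)" for z
  define K where "K i z = (if i = p then chord (w (fst z) p) (w (fst z) h) (snd z) else pt (w (fst z) i))" for i z
  have cw: "continuous_on S (\<lambda>z. w (fst z) i)" for S :: "(real \<times> real) set" and i
    unfolding w_def linepath_def by (intro continuous_intros)
  have "continuous_map (top_of_set unit_square) (uconf n M) (\<lambda>z. (\<lambda>i. K i z) ` ({..n} - {h}))"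
  proof (rule conf_continuous)
    show "card ({..n} - {h}) = n" using ph by simp
    show "continuous_map (top_of_set unit_square) M (K i)" for i
    proof (cases "i = p")
      case True
      then have e: "K i = (\<lambda>z. \<kappa> ((1 - snd z) *\<^sub>R parabola (w (fst z) p) + snd z *\<^sub>R parabola (w (fst z) h)))"
        unfolding K_def chord_def linepath_def by auto
      show ?thesis unfolding e
        by (intro continuous_chart continuous_intros continuous_on_compose2[OF continuous_parabola cw]) auto
    next
      case False
      then have "K i = (\<lambda>z. pt (w (fst z) i))" unfolding K_def by auto
      then show ?thesis using continuous_pt[OF cw] by simp
    qed
    fix z assume "z \<in> topspace (top_of_set unit_square)"
    then have z: "fst z \<in> {0..1}" "snd z \<in> {0..1}" by (auto simp: mem_Times_iff)
    have inj: "w (fst z) i \<noteq> w (fst z) j" if "i \<le> n" "j \<le> n" "i \<noteq> j" for i j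
      using inj_onD[OF increasing_inj[OF w[OF z(1)]], of i j] that by auto
    have "chord (w (fst z) p) (w (fst z) h) (snd z) \<noteq> pt (w (fst z) i)" if "i \<le> n" "i \<noteq> p" "i \<noteq> h" for i
      unfolding chord_def pt_def using chord_not_parabola[OF z(2)] inj[of i p] inj[of i h] that ph by simp
    then show "inj_on (\<lambda>i. K i z) ({..n} - {h})"
      using inj unfolding inj_on_def K_def by (auto split: if_splits) metis+
  qed simp
  moreover have "(\<lambda>i. K i z) ` ({..n} - {h}) = H z" for z
    unfolding H_def Ip(1)[symmetric] K_def using ph by (auto simp: image_image)
  ultimately have "continuous_map (top_of_set unit_square) (uconf n M) H" by simp
  from square[OF this]
  have sq: "\<Phi> (\<lambda>s. H (s, 0)) + \<Phi> (\<lambda>t. H (1, t)) = \<Phi> (\<lambda>t. H (0, t)) + \<Phi> (\<lambda>s. H (s, 1))" .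
  have side: "\<Phi> (\<lambda>s. pt ` w s ` ({..n} - {k})) = - gauge (x ` ({..n} - {k})) + gauge (y ` ({..n} - {k}))" if k: "k \<le> n" for k
  proof -
    have "(\<lambda>s. pt ` w s ` ({..n} - {k})) = (\<lambda>s. (\<lambda>i. pt (linepath ((x \<circ> skip k) i) ((y \<circ> skip k) i) s)) ` {..<n})"
      unfolding skip_image[OF k, symmetric] w_def by (simp add: image_image)
    then have "\<Phi> (\<lambda>s. pt ` w s ` ({..n} - {k})) = slide (x \<circ> skip k) (y \<circ> skip k)"
      unfolding slide_def by (rule arg_cong)
    then show ?thesis
      using slide_eq[OF increasing_skip[OF x] increasing_skip[OF y], of k k] unfolding del_image[OF k] by simp
  qed
  have "(\<lambda>s. H (s, 0)) = (\<lambda>s. pt ` w s ` ({..n} - {h}))" "(\<lambda>s. H (s, 1)) = (\<lambda>s. pt ` w s ` ({..n} - {p}))"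
    unfolding H_def Ip[symmetric] by auto
  moreover have "\<Phi> (\<lambda>t. H (1, t)) = move (pt ` y ` ?I) (chord (y p) (y h))"
    "\<Phi> (\<lambda>t. H (0, t)) = move (pt ` x ` ?I) (chord (x p) (x h))"
    unfolding H_def move_def w01[symmetric] by simp_all
  ultimately have e: "- gauge (x ` ({..n} - {h})) + gauge (y ` ({..n} - {h})) + move (pt ` y ` ?I) (chord (y p) (y h)) =
    move (pt ` x ` ?I) (chord (x p) (x h)) + (- gauge (x ` ({..n} - {p})) + gauge (y ` ({..n} - {p})))"
    using sq side ph by simp
  have "gauge (x ` ({..n} - {h})) + (- gauge (x ` ({..n} - {h})) + gauge (y ` ({..n} - {h})) + move (pt ` y ` ?I) (chord (y p) (y h)))
        - gauge (y ` ({..n} - {p})) = gauge (y ` ({..n} - {h})) + move (pt ` y ` ?I) (chord (y p) (y h)) - gauge (y ` ({..n} - {p}))"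
    by (simp add: add.assoc)
  moreover have "gauge (x ` ({..n} - {h})) + (move (pt ` x ` ?I) (chord (x p) (x h)) + (- gauge (x ` ({..n} - {p})) + gauge (y ` ({..n} - {p}))))
        - gauge (y ` ({..n} - {p})) = gauge (x ` ({..n} - {h})) + move (pt ` x ` ?I) (chord (x p) (x h)) - gauge (x ` ({..n} - {p}))"
    by (simp add: diff_conv_add_uminus add.assoc del: add_uminus_conv_diff)
  moreover have "insert (x p) (x ` ?I) = x ` ({..n} - {h})" "insert (x h) (x ` ?I) = x ` ({..n} - {p})"
    "insert (y p) (y ` ?I) = y ` ({..n} - {h})" "insert (y h) (y ` ?I) = y ` ({..n} - {p})"
    unfolding Ip[symmetric] by auto
  ultimately show ?thesis unfolding jump_def e by simp
qed

text \<open>There are \<open>n + 1\<close> positions for \<open>n\<close> tokens: \<open>h\<close>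
  is free before the jump and \<open>p\<close> after it.\<close>

definition rank_jump :: "nat \<Rightarrow> nat \<Rightarrow> 'f" where
  "rank_jump p h = jump (real ` ({..n} - {p, h})) p h"

lemma jump_eq_rank_jump:
  assumes "increasing (Suc n) x" "p \<le> n" "h \<le> n" "p \<noteq> h"
  shows "jump (x ` ({..n} - {p, h})) (x p) (x h) = rank_jump p h"
  unfolding rank_jump_def using jump_increasing[OF assms(1) increasing_real assms(2-4)] .

text \<open>Among \<open>n + 2\<close> positions the position \<open>k\<close> stays free during the
  jump and is left out when ranks are counted.\<close>

lemma jump_eq_rank_jump_unskip:
  assumes "k \<le> Suc n" "p \<le> Suc n" "h \<le> Suc n" "p \<noteq> h" "p \<noteq> k" "h \<noteq> k"
  shows "jump (real ` ({..Suc n} - {k, p, h})) p h = rank_jump (unskip k p) (unskip k h)"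
proof -
  let ?x = "real \<circ> skip k" and ?p = "unskip k p" and ?h = "unskip k h"
  have "increasing (Suc n) ?x" by (intro increasing_skip increasing_real)
  moreover have "?p \<le> n" "?h \<le> n" "?p \<noteq> ?h" using assms unfolding unskip_def by auto
  ultimately have "jump (?x ` ({..n} - {?p, ?h})) (?x ?p) (?x ?h) = rank_jump ?p ?h"
    by (rule jump_eq_rank_jump)
  moreover have "?x ?p = p" "?x ?h = h" using skip_unskip assms by auto
  moreover have "skip k ` ({..n} - {?p, ?h}) = {..Suc n} - {k, p, h}"
  proof -
    have "inj (skip k)" unfolding inj_def skip_def by auto
    then have "skip k ` ({..n} - {?p, ?h}) = skip k ` {..<Suc n} - {skip k ?p, skip k ?h}"
      by (simp add: image_set_diff lessThan_Suc_atMost)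
    then show ?thesis using skip_image[OF assms(1)] skip_unskip assms by auto
  qed
  ultimately show ?thesis by (simp only: image_comp[symmetric])
qed

text \<open>A vertical strip between neighbouring positions contains no standing token, so the chord
  can be flattened in it to the arc of the parabola. Moving along the arc is a slide, which the
  gauges cancel.\<close>

lemma rank_jump_adjacent:
  assumes "p < n" shows "rank_jump p (Suc p) = 0"
proof -
  let ?A = "{..n} - {p, Suc p}"
  let ?K = "{w. real p \<le> Re w \<and> Re w \<le> real (Suc p)}"
  have card: "card (real ` ?A) + 1 = n"
    using assms by (simp add: card_image card_Diff_subset)
  have t: "tokens 1 (pt ` real ` ?A)" by (rule tokens_pt[OF _ card]) simp
  have K: "convex ?K"
  proof -
    have "?K = {w. Re w \<ge> real p} \<inter> {w. Re w \<le> real (Suc p)}" by auto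
    then show ?thesis by (simp only: convex_Int convex_halfspace_Re_ge convex_halfspace_Re_le)
  qed
  let ?q = "\<lambda>t. parabola (linepath p (Suc p) t)"
  have "move (pt ` real ` ?A) (\<kappa> \<circ> linepath (parabola p) (parabola (Suc p))) = move (pt ` real ` ?A) (\<kappa> \<circ> ?q)"
  proof (rule move_convex[OF t K])
    show "continuous_map (top_of_set ?K) M \<kappa>" using continuous_chart[of ?K "\<lambda>z. z"] by simp
    show "\<kappa> w \<notin> pt ` real ` ?A" if "w \<in> ?K" for w
    proof
      assume "\<kappa> w \<in> pt ` real ` ?A"
      then obtain i where i: "i \<noteq> p" "i \<noteq> Suc p" "\<kappa> w = pt (real i)" by blast
      then have "Re w = real i" by (simp add: pt_def parabola_def)
      then show False using that i by auto
    qed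
    show "path_image (linepath (parabola p) (parabola (Suc p))) \<subseteq> ?K"
    proof -
      have "closed_segment (parabola p) (parabola (Suc p)) \<subseteq> ?K"
        by (rule closed_segment_subset[OF _ _ K]) (auto simp: parabola_def)
      then show ?thesis by simp
    qed
    show "path ?q" unfolding path_def
      by (rule continuous_on_compose2[OF continuous_parabola[of UNIV] continuous_on_linepath]) auto
    show "path_image ?q \<subseteq> ?K"
      using linepath_real_between[of _ "real p" "real (Suc p)"] by (auto simp: path_image_def parabola_def)
  qed (auto simp: linepath_0' linepath_1')
  moreover have "move (pt ` real ` ?A) (\<kappa> \<circ> ?q) = slide (real \<circ> skip (Suc p)) (real \<circ> skip p)"
    unfolding move_def slide_def
  proof (rule arg_cong[of _ _ \<Phi>], rule ext)
    fix t :: real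
    let ?F = "\<lambda>i. pt (linepath ((real \<circ> skip (Suc p)) i) ((real \<circ> skip p) i) t)"
    have A: "skip (Suc p) ` ({..<n} - {p}) = ?A"
    proof -
      have "inj (skip (Suc p))" unfolding inj_def skip_def by auto
      then have "skip (Suc p) ` ({..<n} - {p}) = skip (Suc p) ` {..<n} - {skip (Suc p) p}"
        by (simp add: image_set_diff)
      then show ?thesis using skip_image[of "Suc p" n] assms by (auto simp: skip_def)
    qed
    have "?F ` ({..<n} - {p}) = (\<lambda>i. pt (real (skip (Suc p) i))) ` ({..<n} - {p})"
      by (rule image_cong) (auto simp: skip_def linepath_def algebra_simps)
    also have "\<dots> = pt ` real ` ?A" unfolding A[symmetric] by (simp only: image_image)
    finally have "?F ` ({..<n} - {p}) = pt ` real ` ?A" .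
    moreover have "?F p = (\<kappa> \<circ> ?q) t" unfolding pt_def skip_def by simp
    moreover have "?F ` {..<n} = insert (?F p) (?F ` ({..<n} - {p}))"
      using assms by (subst image_insert[symmetric]) (simp add: insert_absorb)
    ultimately show "insert ((\<kappa> \<circ> ?q) t) (pt ` real ` ?A) = ?F ` {..<n}" by simp
  qed
  moreover have "slide (real \<circ> skip (Suc p)) (real \<circ> skip p) =
      - gauge (real ` ({..n} - {Suc p})) + gauge (real ` ({..n} - {p}))"
    using slide_eq[OF increasing_skip[OF increasing_real] increasing_skip[OF increasing_real], of "Suc p" p]
      del_image[of "Suc p" real] del_image[of p real] assms by simp
  moreover have "insert p ?A = {..n} - {Suc p}" "insert (Suc p) ?A = {..n} - {p}" using assms by auto
  then have "insert (real p) (real ` ?A) = real ` ({..n} - {Suc p})"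
    "insert (real (Suc p)) (real ` ?A) = real ` ({..n} - {p})"
    by (metis image_insert)+
  ultimately show ?thesis unfolding rank_jump_def jump_def chord_def
    by (simp add: add.assoc[symmetric])
qed

lemma rank_jump_reverse:
  assumes "p \<le> n" "h \<le> n" "p \<noteq> h" shows "rank_jump h p = - rank_jump p h"
proof -
  have "card (real ` ({..n} - {p, h})) + 1 = n" using assms by (simp add: card_image card_Diff_subset)
  moreover have "real p \<notin> real ` ({..n} - {p, h})" "real h \<notin> real ` ({..n} - {p, h})" by auto
  ultimately show ?thesis
    using jump_reverse[of "real ` ({..n} - {p, h})" p h] unfolding rank_jump_def by (simp add: insert_commute)
qed

text \<open>The token of rank \<open>p\<close> jumps over its right neighbour.\<close>

definition half_twist :: "nat \<Rightarrow> 'f" where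
  "half_twist p = rank_jump p (p + 2)"

text \<open>Each of the three jumps leaves one of the positions \<open>p\<close>, \<open>h\<close>,
  \<open>k\<close> untouched and free; leaving it out shifts the ranks above it.\<close>

lemma rank_jump_triangle:
  assumes "p \<le> Suc n" "h \<le> Suc n" "k \<le> Suc n" "p \<noteq> h" "h \<noteq> k" "p \<noteq> k"
  shows "rank_jump (unskip k p) (unskip k h) + rank_jump (unskip p h) (unskip p k) = rank_jump (unskip h p) (unskip h k)"
proof -
  let ?A = "real ` ({..Suc n} - {p, h, k})"
  have sub: "{p, h, k} \<subseteq> {..Suc n}" "card {p, h, k} = 3" using assms by auto
  then have "card ({..Suc n} - {p, h, k}) = Suc (Suc n) - 3" by (subst card_Diff_subset) auto
  moreover have "3 \<le> Suc (Suc n)" using card_mono[OF _ sub(1)] sub(2) by simp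
  ultimately have "card ?A + 1 = n" by (simp add: card_image)
  then have "jump ?A p h + jump ?A h k = jump ?A p k"
    by (rule jump_triangle[rotated]) auto
  moreover have "jump ?A p h = rank_jump (unskip k p) (unskip k h)"
  proof -
    have e: "{p, h, k} = {k, p, h}" by auto
    show ?thesis unfolding e using assms by (intro jump_eq_rank_jump_unskip) auto
  qed
  moreover have "jump ?A h k = rank_jump (unskip p h) (unskip p k)"
    using assms by (intro jump_eq_rank_jump_unskip) auto
  moreover have "jump ?A p k = rank_jump (unskip h p) (unskip h k)"
  proof -
    have e: "{p, h, k} = {h, p, k}" by auto
    show ?thesis unfolding e using assms by (intro jump_eq_rank_jump_unskip) auto
  qed
  ultimately show ?thesis by simp
qed

lemma rank_jump_commute:
  assumes "a \<le> Suc n" "b \<le> Suc n" "c \<le> Suc n" "d \<le> Suc n"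
    and disj: "a < c \<and> c < d \<and> d < b \<or> a < b \<and> b < c \<and> c < d"
  shows "rank_jump (unskip d a) (unskip d b) + rank_jump (unskip a c) (unskip a d) =
    rank_jump (unskip b c) (unskip b d) + rank_jump (unskip c a) (unskip c b)"
proof -
  let ?A = "real ` ({..Suc n} - {a, b, c, d})"
  have sub: "{a, b, c, d} \<subseteq> {..Suc n}" "card {a, b, c, d} = 4" using assms by auto
  then have "card ({..Suc n} - {a, b, c, d}) = Suc (Suc n) - 4" by (subst card_Diff_subset) auto
  moreover have "4 \<le> Suc (Suc n)" using card_mono[OF _ sub(1)] sub(2) by simp
  ultimately have card: "card ?A + 2 = n" by (simp add: card_image)
  have "jump (insert (real c) ?A) a b + jump (insert (real b) ?A) c d = jump (insert (real a) ?A) c d + jump (insert (real d) ?A) a b"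
    by (rule jump_commute[OF _ card]) (use disj in auto)
  moreover have "insert (real c) ?A = real ` ({..Suc n} - {d, a, b})" "insert (real b) ?A = real ` ({..Suc n} - {a, c, d})"
    "insert (real a) ?A = real ` ({..Suc n} - {b, c, d})" "insert (real d) ?A = real ` ({..Suc n} - {c, a, b})"
    using disj assms by auto
  ultimately have "jump (real ` ({..Suc n} - {d, a, b})) a b + jump (real ` ({..Suc n} - {a, c, d})) c d =
      jump (real ` ({..Suc n} - {b, c, d})) c d + jump (real ` ({..Suc n} - {c, a, b})) a b"
    by (simp only:)
  moreover have "jump (real ` ({..Suc n} - {d, a, b})) a b = rank_jump (unskip d a) (unskip d b)"
    "jump (real ` ({..Suc n} - {a, c, d})) c d = rank_jump (unskip a c) (unskip a d)"
    "jump (real ` ({..Suc n} - {b, c, d})) c d = rank_jump (unskip b c) (unskip b d)"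
    "jump (real ` ({..Suc n} - {c, a, b})) a b = rank_jump (unskip c a) (unskip c b)"
    using assms by (intro jump_eq_rank_jump_unskip; auto)+
  ultimately show ?thesis by (simp only:)
qed

text \<open>A jump over \<open>k + 1\<close> tokens can pause before the last of them; what remains
  is a half twist.\<close>

lemma rank_jump_Suc:
  assumes "p + k + 2 \<le> n" shows "rank_jump p (p + k + 1) + half_twist (p + k) = rank_jump p (p + k + 2)"
  using rank_jump_triangle[of p "p + k + 1" "p + k + 3"] assms unfolding half_twist_def unskip_def by simp

lemma braid_relations_half_twist: "braid_relations half_twist (n - 1)"
proof
  fix i assume i: "Suc i < n - 1"
  \<comment> \<open>Nested chords: the token on the inner one has rank \<open>i + 1\<close> before
    the outer token has jumped over it and rank \<open>i\<close> afterwards.\<close>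
  have "rank_jump i (i + 3) + half_twist i = half_twist (Suc i) + rank_jump i (i + 3)"
    using rank_jump_commute[of i "i + 4" "i + 1" "i + 3"] i unfolding half_twist_def unskip_def
    by (simp add: eval_nat_numeral)
  moreover have "half_twist i + half_twist (Suc i) = rank_jump i (i + 3)"
    using rank_jump_Suc[of i 1] i unfolding half_twist_def by (simp add: eval_nat_numeral)
  ultimately show "half_twist i + half_twist (Suc i) + half_twist i = half_twist (Suc i) + half_twist i + half_twist (Suc i)"
    by (simp add: add.assoc)
next
  fix i j assume ij: "i + 2 \<le> j" "j < n - 1"
  show "half_twist i + half_twist j = half_twist j + half_twist i"
    using rank_jump_commute[of i "i + 2" "j + 1" "j + 3"] ij unfolding half_twist_def unskip_def
    by (simp add: eval_nat_numeral)
qed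

end

section \<open>Permutations by half twists\<close>

text \<open>The subgroup of all powers of \<open>s\<close>, described as the least one containing
  it, so that membership is inherited through closure properties.\<close>

definition gen_subgroup :: "'f::group_add \<Rightarrow> 'f set" where
  "gen_subgroup s = \<Inter>{S. add_subgroup S \<and> s \<in> S}"

lemma gen_subgroup_subgroup: "add_subgroup (gen_subgroup s)"
  unfolding gen_subgroup_def add_subgroup_def by blast

lemma gen_subgroup_base: "s \<in> gen_subgroup s"
  unfolding gen_subgroup_def by blast

lemma gen_subgroup_least: "add_subgroup S \<Longrightarrow> s \<in> S \<Longrightarrow> gen_subgroup s \<subseteq> S"
  unfolding gen_subgroup_def by blast

lemma gen_subgroup_add: "x \<in> gen_subgroup s \<Longrightarrow> y \<in> gen_subgroup s \<Longrightarrow> x + y \<in> gen_subgroup s"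
  using gen_subgroup_subgroup unfolding add_subgroup_def by blast

lemma gen_subgroup_uminus: "x \<in> gen_subgroup s \<Longrightarrow> - x \<in> gen_subgroup s"
  using gen_subgroup_subgroup unfolding add_subgroup_def by blast

lemma gen_subgroup_zero [simp]: "0 \<in> gen_subgroup s"
  using gen_subgroup_subgroup unfolding add_subgroup_def by blast

lemma gen_subgroup_of_zero: "gen_subgroup 0 = {0}"
  using gen_subgroup_least[of "{0}" 0] by (auto simp: add_subgroup_def)

lemma gen_subgroup_commute:
  assumes "x \<in> gen_subgroup s" "s + y = y + s" shows "x + y = y + x"
proof -
  have "add_subgroup (centralizer_in UNIV y)"
    by (rule add_subgroup_centralizer) (simp add: add_subgroup_def)
  moreover have "s \<in> centralizer_in UNIV y" using assms(2) by (simp add: centralizer_in_def)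
  ultimately show ?thesis using gen_subgroup_least assms(1) unfolding centralizer_in_def by blast
qed

context surface_chart
begin

lemma labelled_pt: "inj_on u {..<n} \<Longrightarrow> labelled (pt \<circ> u)"
  unfolding labelled_def using pt_in by (auto simp: inj_on_def)

text \<open>The gauges of the two configurations are stripped off, so that a move along a chord
  contributes exactly its jump.\<close>

definition gauged_word :: "(nat \<Rightarrow> real) \<Rightarrow> 'f \<Rightarrow> (nat \<Rightarrow> real) \<Rightarrow> bool" where
  "gauged_word u v w \<longleftrightarrow> word (pt \<circ> u) (- gauge (u ` {..<n}) + v + gauge (w ` {..<n})) (pt \<circ> w)"

lemma gauged_word_trans:
  assumes "gauged_word u v w" "gauged_word w v' x" shows "gauged_word u (v + v') x"
proof -
  have "word (pt \<circ> u) ((- gauge (u ` {..<n}) + v + gauge (w ` {..<n})) + (- gauge (w ` {..<n}) + v' + gauge (x ` {..<n}))) (pt \<circ> x)"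
    by (rule word_trans[OF assms(2)[unfolded gauged_word_def] assms(1)[unfolded gauged_word_def]])
  then show ?thesis unfolding gauged_word_def by (simp add: add.assoc)
qed

lemma gauged_word_refl: "inj_on u {..<n} \<Longrightarrow> gauged_word u 0 u"
  unfolding gauged_word_def using word.nil[OF labelled_pt] by simp

lemma gauged_word_jump:
  assumes u: "inj_on u {..<n}" and i: "i < n" and b: "b \<notin> u ` ({..<n} - {i})"
  shows "gauged_word u (jump (u ` ({..<n} - {i})) (u i) b) (u(i := b))"
proof -
  let ?A = "u ` ({..<n} - {i})"
  have o: "others (pt \<circ> u) i = pt ` ?A" unfolding others_def by (simp add: image_comp)
  have ui: "u i \<notin> ?A" using u i by (auto simp: inj_on_def)
  have "word (pt \<circ> u) (move (others (pt \<circ> u) i) (chord (u i) b)) ((pt \<circ> u)(i := chord (u i) b 1))"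
    using track_chord[OF ui b] o i by (intro word_step labelled_pt u) auto
  moreover have "(pt \<circ> u)(i := chord (u i) b 1) = pt \<circ> (u(i := b))" by auto
  moreover have "insert (u i) ?A = u ` {..<n}" using i by auto
  moreover have "insert b ?A = (u(i := b)) ` {..<n}" using i by auto
  moreover have "move (pt ` ?A) (chord (u i) b) =
     - gauge (insert (u i) ?A) + jump ?A (u i) b + gauge (insert b ?A)"
    unfolding jump_def by (simp add: add.assoc)
  ultimately show ?thesis unfolding gauged_word_def o by (simp del: fun_upd_apply)
qed

lemma jump_is_rank_jump:
  assumes A: "finite A" "card A + 1 = n" "a \<notin> A" "b \<notin> A" "a \<noteq> b"
  obtains p h where "p \<le> n" "h \<le> n" "p \<noteq> h" "jump A a b = rank_jump p h"
proof -
  let ?S = "insert a (insert b A)"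
  define x where "x i = sorted_list_of_set ?S ! i" for i
  have card: "card ?S = Suc n" using A by simp
  have len: "length (sorted_list_of_set ?S) = Suc n" using card by (simp del: insert_iff)
  have inc: "increasing (Suc n) x"
    unfolding increasing_def x_def
    using strict_sorted_list_of_set[of ?S] len sorted_wrt_nth_less by (metis (no_types, lifting))
  have im: "x ` {..n} = ?S"
  proof -
    have "x ` {..n} = set (sorted_list_of_set ?S)"
      unfolding set_conv_nth len x_def by (auto simp: less_Suc_eq_le)
    also have "\<dots> = ?S" by (rule set_sorted_list_of_set) (simp add: A(1))
    finally show ?thesis .
  qed
  then have "a \<in> x ` {..n}" "b \<in> x ` {..n}" by auto
  then obtain p h where ph: "p \<le> n" "x p = a" "h \<le> n" "x h = b" by blast
  have inj: "inj_on x {..n}" using increasing_inj[OF inc] by (simp add: lessThan_Suc_atMost)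
  have "x ` ({..n} - {p, h}) = x ` {..n} - x ` {p, h}"
    using ph by (intro inj_on_image_set_diff[OF inj]) auto
  then have "x ` ({..n} - {p, h}) = A" unfolding im using ph A by auto
  then show ?thesis using jump_eq_rank_jump[OF inc, of p h] ph A(5) that[of p h] by auto
qed

context
  fixes s assumes s: "\<And>i. i < n - 1 \<Longrightarrow> half_twist i = s"
begin

text \<open>A jump over \<open>k\<close> tokens is a sum of \<open>k\<close> half twists, all equal
  to \<open>s\<close>.\<close>

lemma rank_jump_in_gen: 
  assumes "p \<le> n" "h \<le> n" "p \<noteq> h" shows "rank_jump p h \<in> gen_subgroup s"
proof -
  have up: "rank_jump p (p + k + 1) \<in> gen_subgroup s" if "p + k + 1 \<le> n" for p k
    using that
  proof (induction k)
    case 0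
    then show ?case using rank_jump_adjacent[of p] by simp
  next
    case (Suc k)
    have "half_twist (p + k) = s" using Suc.prems by (intro s) simp
    then have "rank_jump p (p + k + 1) + s = rank_jump p (p + Suc k + 1)"
      using rank_jump_Suc[of p k] Suc.prems by simp
    moreover have "rank_jump p (p + k + 1) \<in> gen_subgroup s" using Suc by simp
    ultimately show ?case using gen_subgroup_add[OF _ gen_subgroup_base] by metis
  qed
  show ?thesis
  proof (cases "p < h")
    case True
    then obtain k where "h = p + k + 1" using less_imp_Suc_add by fastforce
    then show ?thesis using up assms by simp
  next
    case False
    then have "h < p" using assms by simp
    then obtain k where "p = h + k + 1" using less_imp_Suc_add by fastforce
    then have "rank_jump h p \<in> gen_subgroup s" using up assms by simp
    moreover have "rank_jump p h = - rank_jump h p" using assms by (intro rank_jump_reverse) auto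
    ultimately show ?thesis using gen_subgroup_uminus by metis
  qed
qed

lemma jump_in_gen:
  assumes "finite A" "card A + 1 = n" "a \<notin> A" "b \<notin> A" "a \<noteq> b" shows "jump A a b \<in> gen_subgroup s"
  using jump_is_rank_jump[OF assms] rank_jump_in_gen by metis

lemma gauged_word_jump_gen:
  assumes u: "inj_on u {..<n}" and i: "i < n" and b: "b \<notin> u ` {..<n}"
  obtains v where "v \<in> gen_subgroup s" "gauged_word u v (u(i := b))"
proof (rule that)
  show "gauged_word u (jump (u ` ({..<n} - {i})) (u i) b) (u(i := b))"
    using b by (intro gauged_word_jump u i) auto
  have "card (u ` ({..<n} - {i})) = card ({..<n} - {i})"
    using u by (intro card_image) (auto simp: inj_on_diff)
  then show "jump (u ` ({..<n} - {i})) (u i) b \<in> gen_subgroup s"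
    using u i b by (intro jump_in_gen) (auto simp: inj_on_def)
qed

text \<open>A spare position \<open>c\<close> is used: token \<open>i\<close> steps aside to
  \<open>c\<close>, token \<open>j\<close> takes the place of \<open>i\<close>, and then
  \<open>i\<close> takes the place of \<open>j\<close>.\<close>

lemma gauged_word_swap:
  assumes u: "inj_on u {..<n}" and ij: "i < n" "j < n" "i \<noteq> j"
  obtains v where "v \<in> gen_subgroup s" "gauged_word u v (u(i := u j, j := u i))"
proof -
  obtain c where c: "c \<notin> u ` {..<n}" using ex_new_if_finite[of "u ` {..<n}"] infinite_UNIV_char_0 by auto
  let ?u1 = "u(i := c)" and ?u2 = "(u(i := c))(j := u i)"
  have ne: "u i \<noteq> u j" using u ij by (auto simp: inj_on_def)
  have eq: "u k = u l \<longleftrightarrow> k = l" if "k < n" "l < n" for k l using u that by (auto simp: inj_on_def)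
  have cu: "u k \<noteq> c" if "k < n" for k using c that by auto
  have inj1: "inj_on ?u1 {..<n}" using u c by (rule inj_on_fun_updI)
  have n1: "u i \<notin> ?u1 ` {..<n}"
  proof
    assume "u i \<in> ?u1 ` {..<n}"
    then obtain k where "k < n" "u i = ?u1 k" by blast
    then show False using eq[OF ij(1)] cu[OF ij(1)] by (cases "k = i") auto
  qed
  have inj2: "inj_on ?u2 {..<n}" using inj1 n1 by (rule inj_on_fun_updI)
  have n2: "u j \<notin> ?u2 ` {..<n}"
  proof
    assume "u j \<in> ?u2 ` {..<n}"
    then obtain k where "k < n" "u j = ?u2 k" by blast
    then show False using eq[OF ij(2)] cu[OF ij(2)] ne by (cases "k = j"; cases "k = i") auto
  qed
  obtain v1 where v1: "v1 \<in> gen_subgroup s" "gauged_word u v1 ?u1" using gauged_word_jump_gen[OF u ij(1) c] .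
  obtain v2 where v2: "v2 \<in> gen_subgroup s" "gauged_word ?u1 v2 ?u2" using gauged_word_jump_gen[OF inj1 ij(2) n1] .
  obtain v3 where v3: "v3 \<in> gen_subgroup s" "gauged_word ?u2 v3 (?u2(i := u j))" using gauged_word_jump_gen[OF inj2 ij(1) n2] .
  have "?u2(i := u j) = u(i := u j, j := u i)" using ij by auto
  then have "gauged_word u (v1 + v2 + v3) (u(i := u j, j := u i))"
    using gauged_word_trans[OF gauged_word_trans[OF v1(2) v2(2)] v3(2)] by simp
  moreover have "v1 + v2 + v3 \<in> gen_subgroup s" using v1 v2 v3 gen_subgroup_add by blast
  ultimately show ?thesis using that by blast
qed

lemma gauged_word_permutation:
  assumes "\<pi> permutes {..<n}"
  shows "\<exists>v\<in>gen_subgroup s. gauged_word real v (real \<circ> \<pi>)"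
  using assms finite_lessThan
proof (induction rule: permutes_induct)
  case id
  have "inj_on real {..<n}" by simp
  from gauged_word_refl[OF this] show ?case by (intro bexI[of _ 0]) simp_all
next
  case (swap a b p)
  then obtain v where v: "v \<in> gen_subgroup s" "gauged_word real v (real \<circ> p)" by blast
  define i j where "i = inv_into UNIV p a" and "j = inv_into UNIV p b"
  have p: "bij p" using swap permutes_bij by blast
  have pij: "p i = a" "p j = b" unfolding i_def j_def using p by (simp_all add: bij_is_surj surj_f_inv_f)
  have ij: "i < n" "j < n" "i \<noteq> j"
    using permutes_in_image[OF swap.hyps(4), of i] permutes_in_image[OF swap.hyps(4), of j] swap.hyps pij by auto
  have inj: "inj_on (real \<circ> p) {..<n}"
    using bij_is_inj[OF p] by (auto simp: inj_on_def inj_def)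
  obtain w where w: "w \<in> gen_subgroup s" "gauged_word (real \<circ> p) w ((real \<circ> p)(i := (real \<circ> p) j, j := (real \<circ> p) i))"
    using gauged_word_swap[OF inj ij] .
  have e: "(real \<circ> p)(i := (real \<circ> p) j, j := (real \<circ> p) i) = real \<circ> (Transposition.transpose a b \<circ> p)"
  proof
    fix k
    show "((real \<circ> p)(i := (real \<circ> p) j, j := (real \<circ> p) i)) k = (real \<circ> (Transposition.transpose a b \<circ> p)) k"
    proof -
      have "p k = a \<longleftrightarrow> k = i" "p k = b \<longleftrightarrow> k = j"
        using inj_eq[OF bij_is_inj[OF p], of k i] inj_eq[OF bij_is_inj[OF p], of k j] pij by simp_all
      then show ?thesis using pij ij(3) by (simp add: Transposition.transpose_def)
    qed
  qed
  have "gauged_word real (v + w) (real \<circ> (Transposition.transpose a b \<circ> p))"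
    using gauged_word_trans[OF v(2) w(2)] unfolding e .
  then show ?case using gen_subgroup_add[OF v(1) w(1)] by (rule bexI)
qed

lemma word_permutation:
  assumes "\<pi> permutes {..<n}"
  obtains v where "v \<in> gen_subgroup s" "word (pt \<circ> real) v (pt \<circ> real \<circ> \<pi>)"
proof -
  obtain v where v: "v \<in> gen_subgroup s" "gauged_word real v (real \<circ> \<pi>)" using gauged_word_permutation[OF assms] by blast
  have "(real \<circ> \<pi>) ` {..<n} = real ` {..<n}" using permutes_image[OF assms] by (simp only: image_comp[symmetric])
  then have "word (pt \<circ> real) v (pt \<circ> (real \<circ> \<pi>))" using v(2) gauge_base unfolding gauged_word_def by simp
  then show ?thesis using that v(1) by (simp add: comp_assoc)
qed

text \<open>The permutation of the labels is read off from \<open>g\<close> and undone by a word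
  with value in \<open>gen_subgroup s\<close>. What remains is a pure word, hence a sum of
  pushes.\<close>

lemma word_decomposition:
  assumes w: "word (pt \<circ> real) v g" and g: "g ` {..<n} = (pt \<circ> real) ` {..<n}"
  obtains x y where "x \<in> pushes (pt \<circ> real)" "y \<in> gen_subgroup s" "v = x + y"
proof -
  let ?f = "pt \<circ> real"
  have inj: "inj_on ?f {..<n}" "inj_on g {..<n}" using word_labelled[OF w] unfolding labelled_def by auto
  define \<pi> where "\<pi> i = (if i < n then inv_into {..<n} ?f (g i) else i)" for i
  have \<pi>f: "?f (\<pi> i) = g i" "\<pi> i < n" if "i < n" for i
  proof -
    have "g i \<in> ?f ` {..<n}" using g that by blast
    then show "?f (\<pi> i) = g i" "\<pi> i < n"
      using f_inv_into_f[of "g i" ?f "{..<n}"] inv_into_into[of "g i" ?f "{..<n}"] that unfolding \<pi>_def by auto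
  qed
  have "inj_on \<pi> {..<n}"
    using \<pi>f inj(2) by (metis inj_on_def lessThan_iff)
  moreover have "\<pi> ` {..<n} \<subseteq> {..<n}" using \<pi>f by auto
  ultimately have "bij_betw \<pi> {..<n} {..<n}"
    by (simp add: bij_betw_def endo_inj_surj)
  then have perm: "\<pi> permutes {..<n}" by (rule bij_imp_permutes) (simp add: \<pi>_def)
  have outside: "g i = ?f i" if "\<not> i < n" for i
    using w that
  proof (induction "pt \<circ> real" v g rule: word.induct)
    case (snoc v g j \<alpha>)
    then show ?case by auto
  qed simp
  have "g = pt \<circ> real \<circ> \<pi>"
  proof
    fix i show "g i = (pt \<circ> real \<circ> \<pi>) i"
      using \<pi>f[of i] outside[of i] unfolding \<pi>_def by (cases "i < n") auto
  qed
  moreover obtain y where y: "y \<in> gen_subgroup s" "word ?f y (?f \<circ> \<pi>)" using word_permutation[OF perm] .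
  ultimately have "word ?f (v + - y) ?f" using word_trans[OF word_reverse[OF y(2)]] w by simp
  then have "v + - y \<in> pushes ?f" by (rule pure_word_in_pushes)
  then show ?thesis using that[of "v + - y" y] y(1) by (simp add: add.assoc)
qed

text \<open>After the labels \<open>i\<close> and \<open>j\<close> are exchanged, the same loop with
  the same value is a push of token \<open>j\<close>. The word that performs the exchange transports
  it back to the standard labelling.\<close>

lemma push_set_transfer:
  assumes ij: "i < n" "j < n" and x: "x \<in> push_set (pt \<circ> real) i"
  shows "\<exists>y\<in>gen_subgroup s. y + x - y \<in> push_set (pt \<circ> real) j"
proof -
  let ?f = "pt \<circ> real" and ?\<pi> = "Transposition.transpose i j"
  have "?\<pi> permutes {..<n}" using ij by (intro permutes_swap_id) auto
  then obtain y where y: "y \<in> gen_subgroup s" "word ?f y (?f \<circ> ?\<pi>)" using word_permutation by blast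
  have "?\<pi> ` ({..<n} - {j}) = {..<n} - {i}"
    using ij by (auto simp: Transposition.transpose_def image_iff split: if_splits)
  then have "others (?f \<circ> ?\<pi>) j = others ?f i" unfolding others_def by (simp only: image_comp[symmetric])
  moreover have "(?f \<circ> ?\<pi>) j = ?f i" by simp
  ultimately have "x \<in> push_set (?f \<circ> ?\<pi>) j" using x unfolding push_set_def by simp
  from push_set_conj[OF word_reverse[OF y(2)] ij(2) this] show ?thesis
    using y(1) by (intro bexI[of _ y]) (simp_all add: diff_conv_add_uminus del: add_uminus_conv_diff)
qed

end

text \<open>A loop at the standard configuration: token \<open>q\<close> jumps over its neighbour to
  the spare position \<open>q + 3/2\<close>, the neighbour moves to \<open>q\<close>, and the first
  token moves on to \<open>q + 1\<close>. The last two jumps are between adjacent positions and have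
  value 0. The inner gauges cancel, and the outer ones belong to the standard configuration.\<close>

lemma half_twist_eq_moves:
  assumes q: "Suc q < n"
  defines "I \<equiv> real ` ({..<n} - {q, Suc q})"
  shows "half_twist q = move (pt ` insert (real (Suc q)) I) (chord q (q + 3/2)) +
     move (pt ` insert (q + 3/2) I) (chord (Suc q) q) + move (pt ` insert (real q) I) (chord (q + 3/2) (Suc q))"
  unfolding I_def
proof -
  let ?I = "real ` ({..<n} - {q, Suc q})" and ?c = "real q + 3/2"
  let ?A1 = "insert (real (Suc q)) ?I" and ?A2 = "insert ?c ?I" and ?A3 = "insert (real q) ?I"
  \<comment> \<open>The standard positions with \<open>q + 3/2\<close> inserted as position number
    \<open>q + 2\<close>.\<close>
  define x where "x i = (if i \<le> Suc q then real i else if i = q + 2 then ?c else real i - 1)" for i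
  have inc: "increasing (Suc n) x" unfolding increasing_def x_def by auto
  have c: "?c \<noteq> real i" for i
  proof
    assume "?c = real i"
    then have "2 * q + 3 = 2 * i" by linarith
    then show False by presburger
  qed
  have xS: "x ` ({..n} - {q, Suc q, q + 2}) = ?I"
  proof
    show "x ` ({..n} - {q, Suc q, q + 2}) \<subseteq> ?I"
    proof
      fix y assume "y \<in> x ` ({..n} - {q, Suc q, q + 2})"
      then obtain i where i: "i \<le> n" "i \<noteq> q" "i \<noteq> Suc q" "i \<noteq> q + 2" "y = x i" by auto
      show "y \<in> ?I"
      proof (cases "i < q")
        case True
        then have "y = real i" "i \<in> {..<n} - {q, Suc q}" using i q unfolding x_def by auto
        then show ?thesis by blast
      next
        case False
        then have "y = real (i - 1)" "i - 1 \<in> {..<n} - {q, Suc q}" using i q unfolding x_def by auto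
        then show ?thesis by blast
      qed
    qed
    show "?I \<subseteq> x ` ({..n} - {q, Suc q, q + 2})"
    proof
      fix y assume "y \<in> ?I"
      then obtain i where i: "i < n" "i \<noteq> q" "i \<noteq> Suc q" "y = real i" by auto
      show "y \<in> x ` ({..n} - {q, Suc q, q + 2})"
      proof (cases "i < q")
        case True
        then have "y = x i" "i \<in> {..n} - {q, Suc q, q + 2}" using i unfolding x_def by auto
        then show ?thesis by blast
      next
        case False
        then have "y = x (Suc i)" "Suc i \<in> {..n} - {q, Suc q, q + 2}" using i unfolding x_def by auto
        then show ?thesis by blast
      qed
    qed
  qed
  have xq: "x q = real q" "x (Suc q) = real (Suc q)" "x (q + 2) = ?c" unfolding x_def by auto
  have d1: "{..n} - {q, q + 2} = insert (Suc q) ({..n} - {q, Suc q, q + 2})"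
    and d2: "{..n} - {Suc q, q} = insert (q + 2) ({..n} - {q, Suc q, q + 2})"
    and d3: "{..n} - {q + 2, Suc q} = insert q ({..n} - {q, Suc q, q + 2})" using q by auto
  have A: "x ` ({..n} - {q, q + 2}) = ?A1" "x ` ({..n} - {Suc q, q}) = ?A2" "x ` ({..n} - {q + 2, Suc q}) = ?A3"
    unfolding d1 d2 d3 image_insert xS xq by simp_all
  have "jump ?A1 q ?c = half_twist q"
    using jump_eq_rank_jump[OF inc, of q "q + 2"] q unfolding A xq half_twist_def by simp
  moreover have "jump ?A2 (Suc q) q = 0"
    using jump_eq_rank_jump[OF inc, of "Suc q" q] rank_jump_reverse[of q "Suc q"] rank_jump_adjacent[of q] q
    unfolding A xq by simp
  moreover have "jump ?A3 ?c (Suc q) = 0"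
    using jump_eq_rank_jump[OF inc, of "q + 2" "Suc q"] rank_jump_reverse[of "Suc q" "q + 2"] rank_jump_adjacent[of "Suc q"] q
    unfolding A xq by simp
  moreover have full: "insert (real (Suc q)) ?A3 = real ` {..<n}" "insert (real q) ?A1 = real ` {..<n}"
  proof -
    have "insert (Suc q) (insert q ({..<n} - {q, Suc q})) = {..<n}" using q by auto
    then show "insert (real (Suc q)) ?A3 = real ` {..<n}" by (metis image_insert)
    then show "insert (real q) ?A1 = real ` {..<n}" by (simp only: insert_commute)
  qed
  ultimately have "half_twist q = jump ?A1 q ?c + jump ?A2 (Suc q) q + jump ?A3 ?c (Suc q)" by simp
  also have "\<dots> = gauge (insert (real q) ?A1) + (move (pt ` ?A1) (chord q ?c) + move (pt ` ?A2) (chord (Suc q) q) +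
      move (pt ` ?A3) (chord ?c (Suc q))) - gauge (insert (real (Suc q)) ?A3)"
    unfolding jump_def insert_commute[of "real q" ?c] insert_commute[of ?c "real (Suc q)"]
    by (simp add: diff_conv_add_uminus add.assoc del: add_uminus_conv_diff image_insert)
  also have "insert (real (Suc q)) ?A3 = real ` {..<n}" by (rule full(1))
  also have "insert (real q) ?A1 = real ` {..<n}" by (rule full(2))
  finally show "half_twist q = move (pt ` ?A1) (chord q ?c) + move (pt ` ?A2) (chord (Suc q) q) + move (pt ` ?A3) (chord ?c (Suc q))"
    by (simp add: gauge_base)
qed

text \<open>The half twist of tokens \<open>q\<close> and \<open>q + 1\<close>, with the token \<open>0\<close> displaced to \<open>x\<close>.\<close>

definition twist_moves :: "nat \<Rightarrow> 'a \<Rightarrow> 'f" where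
  "twist_moves q x = (let R = pt ` real ` ({1..<n} - {q, Suc q}) in
     move (insert x (insert (pt (Suc q)) R)) (chord q (q + 3/2)) +
     move (insert x (insert (pt (q + 3/2)) R)) (chord (Suc q) q) +
     move (insert x (insert (pt q) R)) (chord (q + 3/2) (Suc q)))"

lemma half_twist_eq_twist_moves:
  assumes q: "1 \<le> q" "Suc q < n" shows "half_twist q = twist_moves q (pt 0)"
proof -
  have "{..<n} - {q, Suc q} = insert 0 ({1..<n} - {q, Suc q})" using q by auto
  then have "real ` ({..<n} - {q, Suc q}) = insert 0 (real ` ({1..<n} - {q, Suc q}))" by simp
  then show ?thesis using half_twist_eq_moves[OF q(2)] unfolding twist_moves_def Let_def by (simp add: insert_commute)
qed

end

section \<open>Pushes and half twists\<close>

lemma carry_two: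
  fixes x :: "'g::group_add"
  assumes "x + v = v + y" "y + w = w + z" shows "x + (v + w) = v + w + z"
proof -
  have "x + (v + w) = v + (y + w)" using assms(1) by (simp flip: add.assoc)
  then show ?thesis unfolding assms(2) by (simp add: add.assoc)
qed

lemma carry_three:
  fixes x :: "'g::group_add"
  assumes "x + w1 = w0 + x'" "y + w2 = w1 + y'" "z + w3 = w2 + z'"
  shows "x + y + z + w3 = w0 + (x' + y' + z')"
proof -
  have "x + y + z + w3 = x + (y + (z + w3))" by (simp only: add.assoc)
  also have "\<dots> = x + (y + w2) + z'" unfolding assms(3) by (simp only: add.assoc)
  also have "\<dots> = (x + w1) + y' + z'" unfolding assms(2) by (simp only: add.assoc)
  finally show ?thesis unfolding assms(1) by (simp only: add.assoc)
qed

context surface_chart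
begin

text \<open>\<open>\<mu>\<close> is interchanged with the three moves in turn. In between, the two
  twisting tokens stand at different places, which gives the intermediate values
  \<open>?w\<close>.\<close>

lemma twist_moves_carry:
  assumes q: "1 \<le> q" "Suc q < n" and \<mu>: "track (pt ` real ` ({1..<n} - {q, Suc q})) \<mu>"
    and disj: "\<And>s t. s \<in> {0..1} \<Longrightarrow> t \<in> {0..1} \<Longrightarrow> \<mu> t \<noteq> chord q (q + 3/2) s \<and>
      \<mu> t \<noteq> chord (Suc q) q s \<and> \<mu> t \<noteq> chord (q + 3/2) (Suc q) s"
  shows "twist_moves q (\<mu> 0) + move (pt ` real ` {1..<n}) \<mu> = move (pt ` real ` {1..<n}) \<mu> + twist_moves q (\<mu> 1)"
proof -
  let ?I = "real ` ({1..<n} - {q, Suc q})"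
  define R where "R = pt ` ?I"
  let ?a = "real q" and ?b = "real (Suc q)" and ?c = "real q + 3/2"
  have I: "{1..<n} = insert q (insert (Suc q) ({1..<n} - {q, Suc q}))" using q by auto
  then have B: "pt ` real ` {1..<n} = insert (pt ?a) (insert (pt ?b) R)" unfolding R_def by (metis image_insert)
  have c: "?c \<noteq> real i" for i
  proof
    assume "?c = real i"
    then have "2 * q + 3 = 2 * i" by linarith
    then show False by presburger
  qed
  have cI: "?c \<notin> ?I" using c by auto
  have ab: "?a \<notin> ?I" "?b \<notin> ?I" by auto
  have cardI: "card ?I + 3 = n" using q by (simp add: card_image card_Diff_subset)
  have tokR: "tokens 2 (insert (pt x) R)" if "x \<notin> ?I" for x
  proof -
    have "tokens 3 (pt ` ?I)" by (rule tokens_pt[OF _ cardI]) simp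
    then have "tokens (Suc 2) R" unfolding R_def by (simp add: eval_nat_numeral)
    then show ?thesis using that unfolding R_def by (intro tokens_insert pt_in) auto
  qed
  have ends: "\<mu> t \<noteq> pt ?a \<and> \<mu> t \<noteq> pt ?b \<and> \<mu> t \<noteq> pt ?c" if "t \<in> {0..1}" for t
    using disj[of 0 t] disj[of 1 t] that by auto
  have tr: "track (insert (pt x) R) \<mu>" if "x = ?a \<or> x = ?b \<or> x = ?c" for x
    using \<mu> ends that unfolding track_insert R_def by auto
  have trc: "track (insert (pt z) R) (chord x y)" if "x \<notin> insert z ?I" "y \<notin> insert z ?I" for x y z
    using track_chord[OF that] unfolding R_def by simp
  let ?w = "\<lambda>x y. move (insert (pt x) (insert (pt y) R)) \<mu>"
  have step: "move (insert (\<mu> 0) (insert (pt z) R)) (chord x y) + ?w y z = ?w x z + move (insert (\<mu> 1) (insert (pt z) R)) (chord x y)"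
    if "z \<notin> ?I" "x \<notin> insert z ?I" "y \<notin> insert z ?I" "z = ?a \<or> z = ?b \<or> z = ?c"
      "\<And>s t. s \<in> {0..1} \<Longrightarrow> t \<in> {0..1} \<Longrightarrow> \<mu> t \<noteq> chord x y s" for x y z
    using move_commute[OF tokR[OF that(1)] trc[OF that(2,3)] tr[OF that(4)] that(5)[symmetric]] by simp
  have 1: "move (insert (\<mu> 0) (insert (pt ?b) R)) (chord ?a ?c) + ?w ?c ?b = ?w ?a ?b + move (insert (\<mu> 1) (insert (pt ?b) R)) (chord ?a ?c)"
    using disj cI c[of "Suc q"] ab by (intro step) auto
  have 2: "move (insert (\<mu> 0) (insert (pt ?c) R)) (chord ?b ?a) + ?w ?a ?c = ?w ?b ?c + move (insert (\<mu> 1) (insert (pt ?c) R)) (chord ?b ?a)"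
    using disj cI c[of q] c[of "Suc q"] ab by (intro step) auto
  have 3: "move (insert (\<mu> 0) (insert (pt ?a) R)) (chord ?c ?b) + ?w ?b ?a = ?w ?c ?a + move (insert (\<mu> 1) (insert (pt ?a) R)) (chord ?c ?b)"
    using disj cI c[of q] ab by (intro step) auto
  have comm: "?w x y = ?w y x" for x y by (simp add: insert_commute)
  show ?thesis
    unfolding twist_moves_def Let_def R_def[symmetric] B
    using carry_three[OF 1[unfolded comm[of ?c ?b]] 2 3[unfolded comm[of ?c ?a] comm[of ?b ?a]]] .
qed

lemma chord_in_disc:
  assumes "parabola a \<in> cball z r" "parabola b \<in> cball z r" "s \<in> {0..1}"
  shows "chord a b s \<in> \<kappa> ` cball z r"
  using closed_segment_subset[OF assms(1,2) convex_cball] assms(3) linepath_in_path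
  unfolding chord_def by fastforce

lemma cball_squares:
  assumes "0 \<le> r" "(Re w - Re z)\<^sup>2 + (Im w - Im z)\<^sup>2 \<le> r\<^sup>2" shows "w \<in> cball z r"
proof -
  have "dist z w = sqrt ((Re w - Re z)\<^sup>2 + (Im w - Im z)\<^sup>2)"
    by (simp add: dist_norm cmod_def power2_commute)
  then show ?thesis using assms by (simp add: real_le_lsqrt)
qed

lemma ball_Im: "w \<in> ball z r \<Longrightarrow> \<bar>Im w - Im z\<bar> < r"
  using abs_Im_le_cmod[of "w - z"] by (simp add: dist_norm norm_minus_commute)

lemma cball_Im: "w \<in> cball z r \<Longrightarrow> \<bar>Im w - Im z\<bar> \<le> r"
  using abs_Im_le_cmod[of "w - z"] by (simp add: dist_norm norm_minus_commute)

text \<open>The half twists of tokens 1, 2 and of tokens 3, 4 take place in disjoint discs \<open>E\<close> and \<open>F\<close>. While the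
  pushed token is outside \<open>E\<close> it can be carried past the former, while it is outside \<open>F\<close> past the latter,
  and outside both discs the two half twists agree.\<close>

lemma push_commutes_half_twist:
  assumes n: "5 \<le> n" and s: "half_twist 1 = s" "half_twist 3 = s" and x: "x \<in> push_set (pt \<circ> real) 0"
  shows "s + x = x + s"
proof -
  let ?B = "pt ` real ` {1..<n}"
  \<comment> \<open>The midpoints of the chords from 1 to 5/2 and from 3 to 9/2; the radii 3 and 6
    slightly exceed half their lengths. Heights separate everything: \<open>pt 0\<close> is at 0,
    \<open>E\<close> lies between 0.625 and 6.625, \<open>F\<close> between 8.625 and 20.625, and
    the tokens from 5 on are at height 25 or more. Radii 7/2 and 13/2 leave room for the
    annuli.\<close>
  let ?c = "Complex (7/4) (29/8)" and ?d = "Complex (15/4) (117/8)"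
  define E where "E = \<kappa> ` cball ?c 3"
  define F where "F = \<kappa> ` cball ?d 6"
  have imE: "\<bar>Im w - 29/8\<bar> \<le> 3" if "\<kappa> w \<in> E" for w using that cball_Im[of w ?c 3] unfolding E_def by auto
  have imF: "\<bar>Im w - 117/8\<bar> \<le> 6" if "\<kappa> w \<in> F" for w using that cball_Im[of w ?d 6] unfolding F_def by auto
  have pE: "parabola 1 \<in> cball ?c 3" "parabola 2 \<in> cball ?c 3" "parabola (5/2) \<in> cball ?c 3"
    by (rule cball_squares; simp add: parabola_def power2_eq_square)+
  have pF: "parabola 3 \<in> cball ?d 6" "parabola 4 \<in> cball ?d 6" "parabola (9/2) \<in> cball ?d 6"
    by (rule cball_squares; simp add: parabola_def power2_eq_square)+
  have EF: "E \<inter> F = {}"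
  proof (rule ccontr)
    assume "E \<inter> F \<noteq> {}"
    then obtain w where "\<kappa> w \<in> E" "\<kappa> w \<in> F" unfolding E_def by blast
    then show False using imE[of w] imF[of w] by linarith
  qed
  have closed: "closedin M E" "closedin M F"
    unfolding E_def F_def by (intro plane_chart_compact_closedin[OF Hausdorff chart] compact_cball)+
  have tokB: "tokens 1 ?B" using n by (intro tokens_pt) (auto simp: card_image)
  have chordE: "chord a b t \<in> E" if "a \<in> {1, 2, 5/2}" "b \<in> {1, 2, 5/2}" "t \<in> {0..1}" for a b t
    unfolding E_def using that pE by (intro chord_in_disc) blast+
  have chordF: "chord a b t \<in> F" if "a \<in> {3, 4, 9/2}" "b \<in> {3, 4, 9/2}" "t \<in> {0..1}" for a b t
    unfolding F_def using that pF by (intro chord_in_disc) blast+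
  have carryE: "twist_moves 1 (\<mu> 0) + move ?B \<mu> = move ?B \<mu> + twist_moves 1 (\<mu> 1)"
    if \<mu>: "track ?B \<mu>" "\<And>t. t \<in> {0..1} \<Longrightarrow> \<mu> t \<notin> E" for \<mu>
  proof (rule twist_moves_carry)
    show "track (pt ` real ` ({1..<n} - {1, Suc 1})) \<mu>" by (rule track_mono[OF \<mu>(1)]) auto
    fix u t :: real assume ut: "u \<in> {0..1}" "t \<in> {0..1}"
    show "\<mu> t \<noteq> chord (real 1) (real 1 + 3/2) u \<and> \<mu> t \<noteq> chord (real (Suc 1)) (real 1) u \<and>
       \<mu> t \<noteq> chord (real 1 + 3/2) (real (Suc 1)) u"
      using \<mu>(2)[OF ut(2)] chordE[of 1 "5/2" u] chordE[of 2 1 u] chordE[of "5/2" 2 u] ut(1) by auto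
  qed (use n in auto)
  have carryF: "twist_moves 3 (\<mu> 0) + move ?B \<mu> = move ?B \<mu> + twist_moves 3 (\<mu> 1)"
    if \<mu>: "track ?B \<mu>" "\<And>t. t \<in> {0..1} \<Longrightarrow> \<mu> t \<notin> F" for \<mu>
  proof (rule twist_moves_carry)
    show "track (pt ` real ` ({1..<n} - {3, Suc 3})) \<mu>" by (rule track_mono[OF \<mu>(1)]) auto
    fix u t :: real assume ut: "u \<in> {0..1}" "t \<in> {0..1}"
    show "\<mu> t \<noteq> chord (real 3) (real 3 + 3/2) u \<and> \<mu> t \<noteq> chord (real (Suc 3)) (real 3) u \<and>
       \<mu> t \<noteq> chord (real 3 + 3/2) (real (Suc 3)) u"
      using \<mu>(2)[OF ut(2)] chordF[of 3 "9/2" u] chordF[of 4 3 u] chordF[of "9/2" 4 u] ut(1) by auto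
  qed (use n in auto)
  have T0: "twist_moves 1 (pt 0) = s" "twist_moves 3 (pt 0) = s"
    using half_twist_eq_twist_moves[of 1] half_twist_eq_twist_moves[of 3] s n by auto
  let ?D = "pt ` real ` {5..<n}"
  have sub1: "subsurface M (topspace M - ?D)" by (rule subsurface_remove_finite[OF _ surface]) simp
  have "\<kappa> ` ball ?c (7/2) \<subseteq> topspace M - ?D"
  proof
    fix y assume "y \<in> \<kappa> ` ball ?c (7/2)"
    then obtain w where w: "w \<in> ball ?c (7/2)" "y = \<kappa> w" by blast
    have "y \<notin> ?D"
    proof
      assume "y \<in> ?D"
      then obtain j where j: "5 \<le> j" "\<kappa> w = pt (real j)" unfolding w(2) by auto
      then have "Im w = (real j)\<^sup>2" by (simp add: pt_def parabola_def)
      moreover have "(real j)\<^sup>2 \<ge> 5\<^sup>2" using j by (intro power_mono) auto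
      ultimately show False using ball_Im[OF w(1)] by (simp add: power2_eq_square)
    qed
    then show "y \<in> topspace M - ?D" using w plane_chartD(4)[OF chart] by auto
  qed
  then have sub2: "subsurface M (topspace M - ?D - E)"
    unfolding E_def by (intro subsurface_remove_cball[OF sub1 chart]) auto
  have "\<kappa> ` ball ?d (13/2) \<subseteq> topspace M - ?D - E"
  proof
    fix y assume "y \<in> \<kappa> ` ball ?d (13/2)"
    then obtain w where w: "w \<in> ball ?d (13/2)" "y = \<kappa> w" by blast
    have "y \<notin> ?D"
    proof
      assume "y \<in> ?D"
      then obtain j where j: "5 \<le> j" "\<kappa> w = pt (real j)" unfolding w(2) by auto
      then have "Im w = (real j)\<^sup>2" by (simp add: pt_def parabola_def)
      moreover have "(real j)\<^sup>2 \<ge> 5\<^sup>2" using j by (intro power_mono) auto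
      ultimately show False using ball_Im[OF w(1)] by (simp add: power2_eq_square)
    qed
    moreover have "y \<notin> E" using imE[of w] ball_Im[OF w(1)] unfolding w(2) by auto
    ultimately show "y \<in> topspace M - ?D - E" using w plane_chartD(4)[OF chart] by auto
  qed
  then have sub3: "subsurface M (topspace M - ?D - E - F)"
    unfolding F_def by (intro subsurface_remove_cball[OF sub2 chart]) auto
  have pt0: "pt 0 \<in> topspace M - ?D - E - F"
  proof -
    have "pt 0 \<notin> E" using imE[of "parabola 0"] unfolding pt_def by (auto simp: parabola_def)
    moreover have "pt 0 \<notin> F" using imF[of "parabola 0"] unfolding pt_def by (auto simp: parabola_def)
    moreover have "pt 0 \<notin> ?D" by auto
    ultimately show ?thesis using pt_in by auto
  qed
  have B: "?B \<subseteq> ?D \<union> E \<union> F"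
  proof -
    have "{1..<n} \<subseteq> {5..<n} \<union> {1, 2} \<union> {3, 4}" by auto
    then have "?B \<subseteq> ?D \<union> pt ` real ` {1, 2} \<union> pt ` real ` {3, 4}" by (metis image_Un image_mono)
    moreover have "pt ` real ` {1, 2} \<subseteq> E" "pt ` real ` {3, 4} \<subseteq> F"
      using chordE[of 1 2 0] chordE[of 1 2 1] chordF[of 3 4 0] chordF[of 3 4 1] by auto
    ultimately show ?thesis by blast
  qed
  \<comment> \<open>At \<open>pt 0\<close> both half twists equal \<open>s\<close>. Removing the two
    discs leaves the surface connected, so the token can travel from there to any \<open>y\<close>
    outside them, and both half twists are carried along the same path.\<close>
  have same: "twist_moves 1 y = twist_moves 3 y" if y: "y \<in> topspace M - ?B" "y \<notin> E" "y \<notin> F" for y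
  proof -
    have "y \<notin> ?D" using y(1) n by auto
    then have "y \<in> topspace M - ?D - E - F" using y by auto
    then obtain p where p: "pathin M p" "p 0 = pt 0" "p 1 = y" "\<And>t. t \<in> {0..1} \<Longrightarrow> p t \<in> topspace M - ?D - E - F"
      by (rule subsurface_path[OF sub3 pt0]) blast
    have "track ?B p" unfolding track_def using p(1,4) B by blast
    then have "s + move ?B p = move ?B p + twist_moves 1 y" "s + move ?B p = move ?B p + twist_moves 3 y"
      using carryE[of p] carryF[of p] p T0 by auto
    then show ?thesis by (metis add_left_cancel)
  qed
  have "others (pt \<circ> real) 0 = ?B"
  proof -
    have "{..<n} - {0} = {1..<n}" by auto
    then show ?thesis unfolding others_def by (simp only: image_comp)
  qed
  then obtain \<alpha> where \<alpha>: "track ?B \<alpha>" "\<alpha> 0 = pt 0" "\<alpha> 1 = pt 0" "x = move ?B \<alpha>"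
    using x unfolding push_set_def by auto
  \<comment> \<open>The element carried along the push. By \<open>same\<close> it equals
    \<open>twist_moves 3\<close> everywhere outside \<open>F\<close>, and by definition
    \<open>twist_moves 1\<close> everywhere outside \<open>E\<close>, so near each point of the loop
    one description is available.\<close>
  define z where "z y = (if y \<in> E then twist_moves 3 y else twist_moves 1 y)" for y
  define P where "P a b \<longleftrightarrow> z (\<alpha> a) + move ?B (subpath_of \<alpha> a b) = move ?B (subpath_of \<alpha> a b) + z (\<alpha> b)" for a b
  have "P 0 1"
  proof (rule interval_induct)
    fix a b c :: real assume *: "P a b" "P b c" "0 \<le> a" "a \<le> b" "b \<le> c" "c \<le> 1"
    then have "move ?B (subpath_of \<alpha> a b) + move ?B (subpath_of \<alpha> b c) = move ?B (subpath_of \<alpha> a c)"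
      by (intro move_subpath_add[OF tokB \<alpha>(1)]) auto
    then show "P a c" using carry_two[OF *(1,2)[unfolded P_def]] unfolding P_def by simp
  next
    fix t :: real assume t: "t \<in> {0..1}"
    have in': "\<alpha> r \<in> topspace M - ?B" if "r \<in> {0..1}" for r using track_in[OF \<alpha>(1) that] .
    show "\<exists>d>0. \<forall>a\<in>{0..1}. \<forall>b\<in>{0..1}. a \<le> t \<longrightarrow> t \<le> b \<longrightarrow> \<bar>a - t\<bar> < d \<longrightarrow> \<bar>b - t\<bar> < d \<longrightarrow> P a b"
    proof (cases "\<alpha> t \<in> E")
      case False
      have "openin M (topspace M - E)" using closed by (simp add: openin_diff)
      moreover have "\<alpha> t \<in> topspace M - E" using False in'[OF t] by simp
      ultimately obtain d where d: "d > 0" "\<And>r. r \<in> {0..1} \<Longrightarrow> \<bar>r - t\<bar> < d \<Longrightarrow> \<alpha> r \<in> topspace M - E"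
        using pathin_local[OF track_path[OF \<alpha>(1)] t] by blast
      have "P a b" if ab: "a\<in>{0..1}" "b\<in>{0..1}" "a \<le> t" "t \<le> b" "\<bar>a - t\<bar> < d" "\<bar>b - t\<bar> < d" for a b
      proof -
        have "subpath_of \<alpha> a b r \<notin> E" if r: "r \<in> {0..1}" for r
        proof -
          obtain q where "q \<in> {0..1}" "\<bar>q - t\<bar> < d" "subpath_of \<alpha> a b r = \<alpha> q" by (rule subpath_of_near[OF ab r])
          then show ?thesis using d(2)[of q] by auto
        qed
        from carryE[OF track_subpath[OF \<alpha>(1) ab(1,2)] this] show ?thesis
          using d(2)[of a] d(2)[of b] ab unfolding P_def z_def by simp
      qed
      then show ?thesis using d(1) by blast
    next
      case True
      have "openin M (topspace M - F)" using closed by (simp add: openin_diff)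
      moreover have "\<alpha> t \<in> topspace M - F" using True EF in'[OF t] by auto
      ultimately obtain d where d: "d > 0" "\<And>r. r \<in> {0..1} \<Longrightarrow> \<bar>r - t\<bar> < d \<Longrightarrow> \<alpha> r \<in> topspace M - F"
        using pathin_local[OF track_path[OF \<alpha>(1)] t] by blast
      have zF: "z y = twist_moves 3 y" if "y \<in> topspace M - ?B" "y \<notin> F" for y
        using same[OF that(1) _ that(2)] unfolding z_def by auto
      have "P a b" if ab: "a\<in>{0..1}" "b\<in>{0..1}" "a \<le> t" "t \<le> b" "\<bar>a - t\<bar> < d" "\<bar>b - t\<bar> < d" for a b
      proof -
        have "subpath_of \<alpha> a b r \<notin> F" if r: "r \<in> {0..1}" for r
        proof -
          obtain q where "q \<in> {0..1}" "\<bar>q - t\<bar> < d" "subpath_of \<alpha> a b r = \<alpha> q" by (rule subpath_of_near[OF ab r])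
          then show ?thesis using d(2)[of q] by auto
        qed
        from carryF[OF track_subpath[OF \<alpha>(1) ab(1,2)] this] show ?thesis
          using d(2)[of a] d(2)[of b] ab zF[OF in'[OF ab(1)]] zF[OF in'[OF ab(2)]] unfolding P_def by simp
      qed
      then show ?thesis using d(1) by blast
    qed
  qed
  moreover have "z (pt 0) = s" using T0 pt0 unfolding z_def by auto
  ultimately show ?thesis using \<alpha> unfolding P_def by simp
qed

end

section \<open>Exchanging two points in a chart\<close>

lemma plane_chart_lift:
  assumes "plane_chart M \<kappa>" "pathin M \<alpha>" "\<And>t. t \<in> {0..1} \<Longrightarrow> \<alpha> t \<in> range \<kappa>"
  shows "continuous_on {0..1} (\<lambda>t. inv_into UNIV \<kappa> (\<alpha> t))"
proof -
  have "continuous_map (top_of_set {0..1}) (subtopology M (range \<kappa>)) \<alpha>"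
    using assms(2,3) unfolding continuous_map_in_subtopology by (auto simp: pathin_iff)
  from continuous_map_compose[OF this plane_chart_inverse[OF assms(1)]] show ?thesis by (simp add: o_def)
qed

text \<open>A pair \<open>(z, w)\<close> describes the two points \<open>z\<close> and \<open>z + exp w\<close>. This turns the pairs of distinct points of the
  plane into a convex parameter space, where exchanging the two points is \<open>rotate_pair\<close>.\<close>

definition rotate_pair :: "complex \<times> complex \<Rightarrow> complex \<times> complex" where
  "rotate_pair p = (fst p + exp (snd p), snd p + \<i> * pi)"

context surface_conf
begin

text \<open>The ends only have to agree as sets, so motions that return both tokens are covered as
  well as exchanges.\<close>

definition trivial_swaps :: "'a set \<Rightarrow> 'a set \<Rightarrow> bool" where
  "trivial_swaps W C \<longleftrightarrow> (\<forall>a b. pathin M a \<and> pathin M b \<and> (\<forall>t\<in>{0..1}. a t \<in> W \<and> b t \<in> W \<and> a t \<noteq> b t) \<and>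
     {a 0, b 0} = {a 1, b 1} \<longrightarrow> \<Phi> (\<lambda>t. insert (a t) (insert (b t) C)) = 0)"

lemma trivial_swapsD:
  assumes "trivial_swaps W C" "pathin M a" "pathin M b"
    "\<And>t. t \<in> {0..1} \<Longrightarrow> a t \<in> W" "\<And>t. t \<in> {0..1} \<Longrightarrow> b t \<in> W" "\<And>t. t \<in> {0..1} \<Longrightarrow> a t \<noteq> b t"
    "{a 0, b 0} = {a 1, b 1}"
  shows "\<Phi> (\<lambda>t. insert (a t) (insert (b t) C)) = 0"
  using assms unfolding trivial_swaps_def by blast

lemma trivial_swaps_mono: "trivial_swaps W C \<Longrightarrow> V \<subseteq> W \<Longrightarrow> trivial_swaps V C"
  unfolding trivial_swaps_def by blast

context
  fixes \<kappa> :: "complex \<Rightarrow> 'a" and C :: "'a set"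
  assumes \<kappa>: "plane_chart M \<kappa>" and C: "tokens 2 C" "C \<inter> range \<kappa> = {}"
begin

definition chart_pair :: "complex \<times> complex \<Rightarrow> 'a set" where
  "chart_pair p = insert (\<kappa> (fst p)) (insert (\<kappa> (fst p + exp (snd p))) C)"

definition pair_move :: "complex \<times> complex \<Rightarrow> complex \<times> complex \<Rightarrow> 'f" where
  "pair_move p q = \<Phi> (chart_pair \<circ> linepath p q)"

lemma chart_pair_continuous: "continuous_map (top_of_set UNIV) (uconf n M) chart_pair"
  unfolding chart_pair_def
proof (rule insert2_continuous)
  have c: "continuous_map (top_of_set UNIV) M (\<lambda>p. \<kappa> (f p))" if "continuous_on UNIV f" for f :: "complex \<times> complex \<Rightarrow> complex"
  proof -
    have "continuous_map (top_of_set UNIV) euclidean f" using that by simp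
    from continuous_map_compose[OF this plane_chartD(1)[OF \<kappa>]] show ?thesis by (simp add: o_def)
  qed
  show "continuous_map (top_of_set UNIV) M (\<lambda>p :: complex \<times> complex. \<kappa> (fst p))"
    by (rule c[of fst]) (intro continuous_intros)
  show "continuous_map (top_of_set UNIV) M (\<lambda>p. \<kappa> (fst p + exp (snd p)))"
    by (rule c[of "\<lambda>p. fst p + exp (snd p)"]) (intro continuous_intros)
qed (use C plane_chartD(3)[OF \<kappa>] in \<open>auto simp: tokens_def inj_eq\<close>)

lemma pair_move_path:
  assumes "path \<gamma>" shows "\<Phi> (chart_pair \<circ> \<gamma>) = pair_move (\<gamma> 0) (\<gamma> 1)"
  unfolding pair_move_def
  by (rule convex[OF convex_UNIV chart_pair_continuous]) (use assms in \<open>auto simp: linepath_0' linepath_1'\<close>)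

lemma pair_move_add: "pair_move p q + pair_move q r = pair_move p r"
  unfolding pair_move_def by (rule line_add[OF convex_UNIV chart_pair_continuous]) auto

lemma pair_move_refl: "pair_move p p = 0"
  unfolding pair_move_def by (rule line_refl[OF chart_pair_continuous]) simp

lemma chart_pair_rotate: "chart_pair (rotate_pair p) = chart_pair p"
proof -
  have "exp (snd p + \<i> * pi) = - exp (snd p)" by (simp add: exp_add)
  then show ?thesis unfolding chart_pair_def rotate_pair_def by (simp add: insert_commute)
qed

lemma pair_move_rotate: "pair_move (rotate_pair p) (rotate_pair q) = pair_move p q"
proof -
  have "path (rotate_pair \<circ> linepath p q)"
    unfolding rotate_pair_def[abs_def] path_def o_def linepath_def by (intro continuous_intros)
  from pair_move_path[OF this] have "\<Phi> (chart_pair \<circ> (rotate_pair \<circ> linepath p q)) = pair_move (rotate_pair p) (rotate_pair q)"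
    by (simp add: linepath_0' linepath_1')
  moreover have "chart_pair \<circ> (rotate_pair \<circ> linepath p q) = chart_pair \<circ> linepath p q"
    by (simp add: fun_eq_iff chart_pair_rotate)
  ultimately show ?thesis unfolding pair_move_def by simp
qed

context
  fixes p0 :: "complex \<times> complex"
  assumes p0: "pair_move p0 (rotate_pair p0) = 0"
begin

text \<open>\<open>rotate_pair\<close> changes no configuration, so a path from \<open>p\<close> to
  \<open>p0\<close> and its rotated copy have the same value; the half turns at \<open>p\<close> and
  \<open>p0\<close> are conjugate.\<close>

lemma half_turn_zero: "pair_move p (rotate_pair p) = 0"
proof -
  have "pair_move p (rotate_pair p) = pair_move p p0 + pair_move p0 (rotate_pair p0) + pair_move (rotate_pair p0) (rotate_pair p)"
    by (simp add: pair_move_add)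
  also have "\<dots> = 0" unfolding p0 pair_move_rotate by (simp add: pair_move_add pair_move_refl)
  finally show ?thesis .
qed

text \<open>Two half turns return \<open>z\<close> to its place and add \<open>2 * pi * \<i>\<close>
  to the logarithm.\<close>

lemma full_turn_zero: "pair_move (z, w) (z, w + complex_of_real (of_int (2 * k) * pi) * \<i>) = 0"
proof -
  define turn where "turn k = complex_of_real (of_int (2 * k) * pi) * \<i>" for k :: int
  have turn: "turn (k + 1) = turn k + 2 * pi * \<i>" for k
    unfolding turn_def by (simp add: algebra_simps)
  have one: "pair_move (z, v) (z, v + 2 * pi * \<i>) = 0" for v
  proof -
    have "rotate_pair (rotate_pair (z, v)) = (z, v + 2 * pi * \<i>)"
      unfolding rotate_pair_def by (simp add: exp_add)
    then show ?thesis using half_turn_zero[of "(z, v)"] half_turn_zero[of "rotate_pair (z, v)"]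
        pair_move_add[of "(z, v)" "rotate_pair (z, v)" "rotate_pair (rotate_pair (z, v))"] by simp
  qed
  have step: "pair_move (z, w) (z, w + turn k) = pair_move (z, w) (z, w + turn (k + 1))" for k
    using pair_move_add[of "(z, w)" "(z, w + turn k)" "(z, w + turn (k + 1))"] one[of "w + turn k"]
    by (simp add: turn add.assoc)
  have "pair_move (z, w) (z, w + turn k) = 0"
  proof (induction k rule: int_induct[where k=0])
    case base then show ?case by (simp add: pair_move_refl turn_def)
  next
    case (step1 i) then show ?case using step[of i] by simp
  next
    case (step2 i) then show ?case using step[of "i - 1"] by simp
  qed
  then show ?thesis unfolding turn_def .
qed

text \<open>A continuous logarithm of the difference lifts the motion to the parameter space. Since
  the ends agree as sets, the ends of the lift differ by full turns and at most one half
  turn.\<close>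

lemma half_turn_trivial_swaps: "trivial_swaps (range \<kappa>) C"
  unfolding trivial_swaps_def
proof (intro allI impI, elim conjE)
  fix a b assume ab: "pathin M a" "pathin M b" "\<forall>t\<in>{0..1}. a t \<in> range \<kappa> \<and> b t \<in> range \<kappa> \<and> a t \<noteq> b t"
    and ends: "{a 0, b 0} = {a 1, b 1}"
  define A B where "A t = inv_into UNIV \<kappa> (a t)" and "B t = inv_into UNIV \<kappa> (b t)" for t
  have AB: "\<kappa> (A t) = a t" "\<kappa> (B t) = b t" if "t \<in> {0..1}" for t
    using ab(3) that unfolding A_def B_def by (auto simp: f_inv_into_f)
  have cA: "continuous_on {0..1} A" and cB: "continuous_on {0..1} B"
    unfolding A_def B_def using ab by (auto intro!: plane_chart_lift[OF \<kappa>])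
  have ne: "B t - A t \<noteq> 0" if "t \<in> {0..1}" for t using AB[OF that] ab(3) that by auto
  obtain w where w: "continuous_on {0..1} w" "\<And>t. t \<in> {0..1} \<Longrightarrow> B t - A t = exp (w t)"
    by (rule continuous_logarithm_on_contractible[of "{0..1}" "\<lambda>t. B t - A t"])
      (use ne cA cB in \<open>auto intro!: continuous_intros convex_imp_contractible\<close>)
  let ?\<gamma> = "\<lambda>t. (A t, w t)"
  have \<gamma>: "path ?\<gamma>" unfolding path_def by (intro continuous_intros cA w)
  have eq: "insert (a t) (insert (b t) C) = (chart_pair \<circ> ?\<gamma>) t" if "t \<in> {0..1}" for t
    using AB[OF that] w(2)[OF that, symmetric] by (simp add: chart_pair_def)
  have "\<Phi> (\<lambda>t. insert (a t) (insert (b t) C)) = \<Phi> (chart_pair \<circ> ?\<gamma>)"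
    by (rule cong[symmetric, OF pathin_compose_path[OF chart_pair_continuous \<gamma>]]) (simp_all only: eq subset_UNIV)
  also have "\<dots> = pair_move (A 0, w 0) (A 1, w 1)" by (rule pair_move_path[OF \<gamma>])
  also have "\<dots> = 0"
  proof -
    have "{A 0, B 0} = {A 1, B 1}" unfolding A_def B_def using arg_cong[OF ends, of "(`) (inv_into UNIV \<kappa>)"] by simp
    then consider "A 1 = A 0" "B 1 = B 0" | "A 1 = B 0" "B 1 = A 0" by (auto simp: doubleton_eq_iff)
    then show ?thesis
    proof cases
      case 1
      then have "exp (w 1) = exp (w 0)" using w(2)[of 0] w(2)[of 1] by simp
      then obtain k :: int where "w 1 = w 0 + complex_of_real (of_int (2 * k) * pi) * \<i>" unfolding exp_eq by blast
      then show ?thesis using full_turn_zero[of "A 0" "w 0" k] 1 by simp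
    next
      case 2
      then have "exp (w 1) = exp (w 0 + \<i> * pi)" using w(2)[of 0] w(2)[of 1] by (simp add: exp_add algebra_simps)
      then obtain k :: int where k: "w 1 = w 0 + \<i> * pi + complex_of_real (of_int (2 * k) * pi) * \<i>" unfolding exp_eq by blast
      have "rotate_pair (A 0, w 0) = (A 1, w 0 + \<i> * pi)"
        using 2 w(2)[of 0] unfolding rotate_pair_def by (simp add: algebra_simps)
      then show ?thesis using half_turn_zero[of "(A 0, w 0)"] full_turn_zero[of "A 1" "w 0 + \<i> * pi" k] 
          pair_move_add[of "(A 0, w 0)" "(A 1, w 0 + \<i> * pi)" "(A 1, w 1)"] k by simp
    qed
  qed
  finally show "\<Phi> (\<lambda>t. insert (a t) (insert (b t) C)) = 0" .
qed

end

end

text \<open>A third token moves along \<open>e\<close> outside \<open>W\<close> while the two tokens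
  move inside. Its motion appears on two opposite sides of the square with the same value, because
  the pair ends where it began.\<close>

lemma trivial_swaps_carry:
  assumes D: "tokens 3 D" and e: "track D e" "\<And>t. t \<in> {0..1} \<Longrightarrow> e t \<notin> W" and W: "W \<inter> D = {}"
    and triv: "trivial_swaps W (insert (e 0) D)"
  shows "trivial_swaps W (insert (e 1) D)"
  unfolding trivial_swaps_def
proof (intro allI impI, elim conjE)
  fix a b assume ab: "pathin M a" "pathin M b" "\<forall>t\<in>{0..1}. a t \<in> W \<and> b t \<in> W \<and> a t \<noteq> b t"
    and ends: "{a 0, b 0} = {a 1, b 1}"
  define g where "g i x = (if i = 0 then e (fst x) else if i = 1 then a (snd x) else b (snd x))"
    for i :: nat and x :: "real \<times> real"
  have "continuous_map (top_of_set unit_square) (uconf n M) (\<lambda>x. (\<lambda>i. g i x) ` {0, 1, 2} \<union> D)"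
  proof (rule conf_continuous_const)
    show "card {0, 1, 2::nat} + card D = n" "finite D" "D \<subseteq> topspace M" using D unfolding tokens_def by auto
    have "continuous_map (top_of_set unit_square) (top_of_set {0..1}) fst" by (auto intro!: continuous_intros)
    from continuous_map_compose[OF this, of M e] e(1)
    have 1: "continuous_map (top_of_set unit_square) M (\<lambda>x. e (fst x))" by (simp add: track_def pathin_iff o_def)
    then show "continuous_map (top_of_set unit_square) M (g i)" for i
      using continuous_map_from_snd[OF ab(1), of "{0..1}"] continuous_map_from_snd[OF ab(2), of "{0..1}"]
      unfolding g_def[abs_def] by (cases "i = 0"; cases "i = 1") simp_all
    fix x :: "real \<times> real" assume "x \<in> topspace (top_of_set unit_square)"
    then have x: "fst x \<in> {0..1}" "snd x \<in> {0..1}" by auto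
    have W': "a (snd x) \<in> W" "b (snd x) \<in> W" "a (snd x) \<noteq> b (snd x)" using ab(3) x by auto
    have ne: "e (fst x) \<noteq> a (snd x)" "e (fst x) \<noteq> b (snd x)" using W' e(2)[OF x(1)] by auto
    show "inj_on (\<lambda>i. g i x) {0, 1, 2}" using W' ne unfolding g_def by (simp add: inj_on_def eq_commute)
    show "g i x \<notin> D" for i using W' W track_in[OF e(1) x(1)] unfolding g_def by auto
  qed simp
  from square[OF this] have sq: "\<Phi> (\<lambda>s. insert (e s) (insert (a 0) (insert (b 0) D))) + \<Phi> (\<lambda>t. insert (e 1) (insert (a t) (insert (b t) D))) =
      \<Phi> (\<lambda>t. insert (e 0) (insert (a t) (insert (b t) D))) + \<Phi> (\<lambda>s. insert (e s) (insert (a 1) (insert (b 1) D)))"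
    by (simp add: g_def insert_commute)
  have "\<Phi> (\<lambda>t. insert (a t) (insert (b t) (insert (e 0) D))) = 0"
    using trivial_swapsD[OF triv ab(1,2)] ab(3) ends by blast
  then have "\<Phi> (\<lambda>t. insert (e 0) (insert (a t) (insert (b t) D))) = 0" by (simp add: insert_commute)
  moreover have "insert (a 1) (insert (b 1) D) = insert (a 0) (insert (b 0) D)"
  proof -
    have "{a 1, b 1} \<union> D = {a 0, b 0} \<union> D" using ends by simp
    then show ?thesis by (simp only: Un_insert_left Un_empty_left)
  qed
  ultimately show "\<Phi> (\<lambda>t. insert (a t) (insert (b t) (insert (e 1) D))) = 0"
    using sq add_left_cancel[of "\<Phi> (\<lambda>s. insert (e s) (insert (a 0) (insert (b 0) D)))" _ 0]
    by (simp add: insert_commute)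
qed

text \<open>Tokens are relocated one at a time outside the disc. The annulus up to \<open>R\<close>
  is free of tokens and keeps the complement of the disc connected.\<close>

lemma trivial_swaps_change:
  assumes chart: "plane_chart M \<kappa>" and r: "0 \<le> r" "r < R"
    and C: "tokens 2 C" "C \<inter> \<kappa> ` ball 0 R = {}" and C': "tokens 2 C'" "C' \<inter> \<kappa> ` ball 0 R = {}"
    and triv: "trivial_swaps (\<kappa> ` cball 0 r) C"
  shows "trivial_swaps (\<kappa> ` cball 0 r) C'"
  using C' 
proof (induction "card (C' - C)" arbitrary: C')
  case 0
  have fin: "finite C'" "finite C" "card C' = card C" using 0 C unfolding tokens_def by auto
  then have "C' \<subseteq> C" using 0 by simp
  then have "C' = C" using fin card_subset_eq by metis
  then show ?case using triv by simp
next
  case (Suc k)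
  let ?W = "\<kappa> ` cball 0 r"
  have fin: "finite C'" "finite C" "card C' = card C" using Suc C unfolding tokens_def by auto
  obtain y where y: "y \<in> C'" "y \<notin> C" using Suc(2) by (metis card.empty DiffE Suc_neq_Zero ex_in_conv)
  have "card (C - C') = card (C' - C)" using fin by (simp add: card_Diff_subset_Int Int_commute)
  then obtain x where x: "x \<in> C" "x \<notin> C'" using Suc(2) by (metis card.empty DiffE Suc_neq_Zero ex_in_conv)
  let ?D = "C' - {y}"
  have "card C' = Suc (card ?D)" using y(1) fin(1) by (metis card_Suc_Diff1)
  then have D: "tokens 3 ?D" using Suc(3) unfolding tokens_def by auto
  have xM: "x \<in> topspace M" "y \<in> topspace M" using C Suc(3) x y unfolding tokens_def by auto
  have "tokens 2 (insert x ?D)" using D x xM tokens_insert[of 2 ?D x] by (simp add: eval_nat_numeral)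
  moreover have "insert x ?D \<inter> \<kappa> ` ball 0 R = {}" using x C Suc(4) by auto
  moreover have "k = card (insert x ?D - C)"
  proof -
    have "insert x ?D - C = (C' - C) - {y}" using x by auto
    then show ?thesis using Suc(2) y fin by simp
  qed
  ultimately have t: "trivial_swaps ?W (insert x ?D)" using Suc(1) by blast
  have sub: "subsurface M (topspace M - ?D)" using fin by (intro subsurface_remove_finite[OF _ surface]) simp
  have "\<kappa> ` ball 0 R \<subseteq> topspace M - ?D" using Suc(4) plane_chartD(4)[OF chart] by auto
  then have sub2: "subsurface M (topspace M - ?D - ?W)" by (rule subsurface_remove_cball[OF sub chart _ r])
  have W: "?W \<subseteq> \<kappa> ` ball 0 R" using r by (intro image_mono) auto
  have "x \<in> topspace M - ?D - ?W" "y \<in> topspace M - ?D - ?W" using x y xM C(2) Suc(4) W by blast+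
  then obtain e where e: "pathin M e" "e 0 = x" "e 1 = y" "\<And>t. t \<in> {0..1} \<Longrightarrow> e t \<in> topspace M - ?D - ?W"
    by (rule subsurface_path[OF sub2]) blast
  have "trivial_swaps ?W (insert (e 1) ?D)"
  proof (rule trivial_swaps_carry[OF D])
    show "track ?D e" using e unfolding track_def by blast
    show "e u \<notin> ?W" if "u \<in> {0..1}" for u using e(4)[OF that] by blast
    show "?W \<inter> ?D = {}" using Suc(4) W by blast
    show "trivial_swaps ?W (insert (e 0) ?D)" using t e(2) by simp
  qed
  then show ?case using e y by (simp add: insert_absorb)
qed

end

text \<open>An embedding of the plane that cuts off the tokens 2, 3, ... on the parabola; being monotone in both
  coordinates it keeps track of the quadrant of a difference vector.\<close>

definition half_plane :: "complex \<Rightarrow> complex" where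
  "half_plane w = Complex (Re w) (3 - exp (- Im w))"

definition half_plane_inverse :: "complex \<Rightarrow> complex" where
  "half_plane_inverse v = Complex (Re v) (- ln (3 - Im v))"

lemma half_plane_inverse [simp]: "half_plane_inverse (half_plane w) = w" "Im v < 3 \<Longrightarrow> half_plane (half_plane_inverse v) = v"
  by (simp_all add: half_plane_def half_plane_inverse_def)

lemma continuous_half_plane: "continuous_on S half_plane"
  unfolding half_plane_def[abs_def] Complex_eq by (intro continuous_intros)

lemma continuous_half_plane_inverse: "(\<And>v. v \<in> S \<Longrightarrow> Im v < 3) \<Longrightarrow> continuous_on S half_plane_inverse"
  unfolding half_plane_inverse_def[abs_def] Complex_eq by (intro continuous_intros) fastforce

lemma range_half_plane: "range half_plane = {v. Im v < 3}"
proof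
  show "{v. Im v < 3} \<subseteq> range half_plane" by (metis (mono_tags) half_plane_inverse(2) mem_Collect_eq rangeI subsetI)
qed (auto simp: half_plane_def)

lemma plane_chart_half_plane:
  assumes "plane_chart M \<kappa>" shows "plane_chart M (\<kappa> \<circ> half_plane)"
proof (rule plane_chart_compose[OF assms continuous_half_plane])
  show "inj half_plane" by (rule inj_on_inverseI[of _ half_plane_inverse]) simp
  show "open (half_plane ` U)" if "open U" for U
  proof (rule open_image_bij_inverse[OF _ _ _ _ _ that])
    show "open {v. Im v < 3}" by (simp add: open_halfspace_Im_lt)
    show "continuous_on {v. Im v < 3} half_plane_inverse" by (rule continuous_half_plane_inverse) simp
  qed (use range_half_plane in auto)
qed

context surface_chart
begin

context
  assumes two: "2 \<le> n"
begin

lemma half_plane_tokens: "tokens 2 (pt ` real ` {2..<n})" "pt ` real ` {2..<n} \<inter> \<kappa> ` {v. Im v < 4} = {}"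
proof -
  show "tokens 2 (pt ` real ` {2..<n})" using two by (intro tokens_pt) (auto simp: card_image)
  have "Im (parabola (real i)) \<ge> 4" if "i \<in> {2..<n}" for i
    using power_mono[of 2 "real i" 2] that by (simp add: parabola_def)
  then show "pt ` real ` {2..<n} \<inter> \<kappa> ` {v. Im v < 4} = {}" unfolding pt_def by fastforce
qed

definition pair_lift :: "complex \<Rightarrow> complex \<Rightarrow> complex \<times> complex" where
  "pair_lift a b = (half_plane_inverse a, Ln (half_plane_inverse b - half_plane_inverse a))"

lemma half_plane_chart:
  "plane_chart M (\<kappa> \<circ> half_plane)" "pt ` real ` {2..<n} \<inter> range (\<kappa> \<circ> half_plane) = {}"
proof -
  have "range (\<kappa> \<circ> half_plane) = \<kappa> ` {v. Im v < 3}" by (simp only: image_comp[symmetric] range_half_plane)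
  moreover have "\<kappa> ` {v. Im v < 3} \<subseteq> \<kappa> ` {v. Im v < 4}" by (intro image_mono) auto
  ultimately show "pt ` real ` {2..<n} \<inter> range (\<kappa> \<circ> half_plane) = {}" using half_plane_tokens(2) by blast
qed (rule plane_chart_half_plane[OF chart])

abbreviation "half_pair_move \<equiv> pair_move (\<kappa> \<circ> half_plane) (pt ` real ` {2..<n})"

text \<open>The condition on equal heights keeps the difference vector off the branch cut of
  \<open>Ln\<close>, so \<open>pair_lift\<close> lifts the motion continuously and only its ends
  count.\<close>

lemma two_token_move:
  assumes c: "continuous_on {0..1} a" "continuous_on {0..1} b"
    and im: "\<And>t. t \<in> {0..1} \<Longrightarrow> Im (a t) < 3" "\<And>t. t \<in> {0..1} \<Longrightarrow> Im (b t) < 3"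
    and re: "\<And>t. t \<in> {0..1} \<Longrightarrow> Im (a t) = Im (b t) \<Longrightarrow> Re (a t) < Re (b t)"
  shows "\<Phi> (\<lambda>t. insert (\<kappa> (a t)) (insert (\<kappa> (b t)) (pt ` real ` {2..<n}))) =
    half_pair_move (pair_lift (a 0) (b 0)) (pair_lift (a 1) (b 1))"
proof -
  let ?C = "pt ` real ` {2..<n}" and ?g = half_plane_inverse
  let ?cp = "chart_pair (\<kappa> \<circ> half_plane) ?C"
  let ?l = "\<lambda>t. pair_lift (a t) (b t)"
  have cg: "continuous_on {0..1} (\<lambda>t. ?g (f t))" if "continuous_on {0..1} f" "\<And>t. t \<in> {0..1} \<Longrightarrow> Im (f t) < 3" for f
    by (rule continuous_on_compose2[OF continuous_half_plane_inverse[of "f ` {0..1}"] that(1)]) (use that(2) in auto)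
  have slit: "?g (b t) - ?g (a t) \<notin> \<real>\<^sub>\<le>\<^sub>0" if "t \<in> {0..1}" for t
  proof
    assume "?g (b t) - ?g (a t) \<in> \<real>\<^sub>\<le>\<^sub>0"
    then have "Re (b t) \<le> Re (a t)" "ln (3 - Im (a t)) = ln (3 - Im (b t))"
      by (auto simp: complex_nonpos_Reals_iff half_plane_inverse_def)
    then have "Re (b t) \<le> Re (a t)" "Im (a t) = Im (b t)" using im[OF that] by auto
    then show False using re[OF that] by linarith
  qed
  have p: "path ?l"
    unfolding path_def pair_lift_def using slit by (intro continuous_intros cg c im) auto
  have "insert (\<kappa> (a t)) (insert (\<kappa> (b t)) ?C) = (?cp \<circ> ?l) t" if t: "t \<in> {0..1}" for t
  proof -
    have "exp (Ln (?g (b t) - ?g (a t))) = ?g (b t) - ?g (a t)" using slit[OF t] by (intro exp_Ln) auto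
    then show ?thesis using im[OF t]
      by (simp add: chart_pair_def[OF half_plane_chart(1) half_plane_tokens(1) half_plane_chart(2)] pair_lift_def)
  qed
  then have "\<Phi> (\<lambda>t. insert (\<kappa> (a t)) (insert (\<kappa> (b t)) ?C)) = \<Phi> (?cp \<circ> ?l)"
    by (intro cong[symmetric] pathin_compose_path[OF chart_pair_continuous[OF half_plane_chart(1) half_plane_tokens(1) half_plane_chart(2)] p]) auto
  also have "\<dots> = half_pair_move (?l 0) (?l 1)"
    by (rule pair_move_path[OF half_plane_chart(1) half_plane_tokens(1) half_plane_chart(2) p])
  finally show ?thesis .
qed

text \<open>None of the three moves lets the difference vector meet the branch cut, and together
  they exchange the tokens. In the parameter space the half twist is therefore a half turn run
  backwards. This settles the standing tokens on the parabola; \<open>trivial_swaps_change\<close>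
  passes to \<open>C\<close>.\<close>

lemma half_twist_trivial_swaps:
  assumes zero: "half_twist 0 = 0" and C: "tokens 2 C" "C \<inter> range \<kappa> = {}"
  shows "trivial_swaps (\<kappa> ` cball 0 1) C"
proof -
  let ?C = "pt ` real ` {2..<n}"
  note chartC = half_plane_chart(1) half_plane_tokens(1) half_plane_chart(2)
  \<comment> \<open>Heights 0, 1 and 9/4 are below the bound 3 of the half plane, while the standing
    tokens have height at least 4.\<close>
  let ?p0 = "parabola 0" and ?p1 = "parabola 1" and ?p2 = "parabola (3/2)"
  have e: "{..<n} - {0, Suc 0} = {2..<n}" by auto
  have "half_twist 0 = \<Phi> (\<lambda>t. insert (\<kappa> (linepath ?p0 ?p2 t)) (insert (\<kappa> ?p1) ?C)) +
      \<Phi> (\<lambda>t. insert (\<kappa> ?p2) (insert (\<kappa> (linepath ?p1 ?p0 t)) ?C)) +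
      \<Phi> (\<lambda>t. insert (\<kappa> (linepath ?p2 ?p1 t)) (insert (\<kappa> ?p0) ?C))"
    using half_twist_eq_moves[of 0] two unfolding e move_def chord_def by (simp add: pt_def insert_commute)
  moreover have "\<Phi> (\<lambda>t. insert (\<kappa> (linepath ?p0 ?p2 t)) (insert (\<kappa> ?p1) ?C)) = half_pair_move (pair_lift ?p0 ?p1) (pair_lift ?p2 ?p1)"
  proof -
    have *: "Re (linepath ?p0 ?p2 t) = 3/2 * t" "Im (linepath ?p0 ?p2 t) = 9/4 * t" for t
      by (simp_all add: linepath_def parabola_def power2_eq_square)
    show ?thesis
      using two_token_move[of "linepath ?p0 ?p2" "\<lambda>t. ?p1"] by (simp add: * parabola_def[of 1] linepath_0' linepath_1' continuous_on_linepath)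
  qed
  moreover have "\<Phi> (\<lambda>t. insert (\<kappa> ?p2) (insert (\<kappa> (linepath ?p1 ?p0 t)) ?C)) = half_pair_move (pair_lift ?p2 ?p1) (pair_lift ?p2 ?p0)"
  proof -
    have *: "Re (linepath ?p1 ?p0 t) = 1 - t" "Im (linepath ?p1 ?p0 t) = 1 - t" for t
      by (simp_all add: linepath_def parabola_def)
    show ?thesis
      using two_token_move[of "\<lambda>t. ?p2" "linepath ?p1 ?p0"]
      by (simp add: * parabola_def[of "3/2"] linepath_0' linepath_1' continuous_on_linepath power2_eq_square)
  qed
  moreover have "\<Phi> (\<lambda>t. insert (\<kappa> (linepath ?p2 ?p1 t)) (insert (\<kappa> ?p0) ?C)) = half_pair_move (pair_lift ?p2 ?p0) (pair_lift ?p1 ?p0)"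
  proof -
    have *: "Re (linepath ?p2 ?p1 t) = 3/2 - t/2" "Im (linepath ?p2 ?p1 t) = 9/4 - 5/4 * t" for t
      by (simp_all add: linepath_def parabola_def power2_eq_square algebra_simps)
    show ?thesis
      using two_token_move[of "linepath ?p2 ?p1" "\<lambda>t. ?p0"]
      by (simp add: * parabola_def[of 0] linepath_0' linepath_1' continuous_on_linepath)
  qed
  ultimately have z: "half_pair_move (pair_lift ?p0 ?p1) (pair_lift ?p1 ?p0) = 0"
    using zero by (simp add: pair_move_add[OF chartC])
  define q where "q = pair_lift ?p1 ?p0"
  let ?D = "half_plane_inverse ?p0 - half_plane_inverse ?p1"
  have D: "Im ?D < 0" "?D \<noteq> 0"
    by (simp_all add: half_plane_inverse_def parabola_def complex_eq_iff)
  \<comment> \<open>The imaginary part of \<open>?D\<close> is negative, which decides the sign of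
    the half turn in \<open>Ln_minus\<close>.\<close>
  then have "Ln (- ?D) = Ln ?D + \<i> * pi" using Ln_minus[OF D(2)] by simp
  then have "pair_lift ?p0 ?p1 = rotate_pair q"
    using D(2) unfolding q_def pair_lift_def rotate_pair_def by simp
  then have "half_pair_move q (rotate_pair q) = 0"
    using z pair_move_add[OF chartC, of q "rotate_pair q" q] pair_move_refl[OF chartC, of q] unfolding q_def[symmetric] by simp
  then have "trivial_swaps (range (\<kappa> \<circ> half_plane)) ?C" by (rule half_turn_trivial_swaps[OF chartC])
  moreover have "\<kappa> ` cball 0 1 \<subseteq> range (\<kappa> \<circ> half_plane)"
  proof -
    have "range (\<kappa> \<circ> half_plane) = \<kappa> ` {v. Im v < 3}" by (simp only: image_comp[symmetric] range_half_plane)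
    moreover have "cball 0 1 \<subseteq> {v. Im v < 3}" using cball_Im[of _ 0 1] by force
    ultimately show ?thesis by blast
  qed
  ultimately have t: "trivial_swaps (\<kappa> ` cball 0 1) ?C" by (rule trivial_swaps_mono)
  \<comment> \<open>The disc of radius 2 stays below height 4, at which the standing tokens
    begin.\<close>
  have ball: "ball 0 2 \<subseteq> {v. Im v < 4}" using ball_Im[of _ 0 2] by force
  show ?thesis
  proof (rule trivial_swaps_change[OF chart _ _ half_plane_tokens(1) _ C(1) _ t, of 2])
    show "?C \<inter> \<kappa> ` ball 0 2 = {}" using half_plane_tokens(2) image_mono[OF ball, of \<kappa>] by blast
    show "C \<inter> \<kappa> ` ball 0 2 = {}" using C(2) by blast
  qed auto
qed

end

end

section \<open>Crossing moves\<close>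

lemma pathin_image_closedin:
  assumes "Hausdorff_space M" "pathin M p" shows "closedin M (p ` {0..1})"
proof -
  have "compactin (top_of_set {0..1::real}) {0..1}" by (simp add: compactin_subtopology)
  then have "compactin M (p ` {0..1})"
    using image_compactin assms(2) unfolding pathin_iff by blast
  then show ?thesis using compactin_imp_closedin[OF assms(1)] by blast
qed

lemma pass_two:
  fixes x :: "'g::group_add"
  assumes "x + e2 = e1 + x'" "y + e3 = e2 + y'" shows "x + y + e3 = e1 + (x' + y')"
proof -
  have "x + y + e3 = (x + e2) + y'" unfolding add.assoc assms(2) ..
  then show ?thesis unfolding assms(1) by (simp only: add.assoc)
qed

text \<open>Nowhere dense sets. In contrast to having empty interior, this property passes to finite
  unions, hence to paths composed of thin pieces.\<close>

definition thin :: "'a topology \<Rightarrow> 'a set \<Rightarrow> bool" where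
  "thin M N \<longleftrightarrow> (\<forall>V. openin M V \<and> V \<noteq> {} \<longrightarrow> (\<exists>U. openin M U \<and> U \<noteq> {} \<and> U \<subseteq> V \<and> U \<inter> N = {}))"

lemma thin_Un: "thin M A \<Longrightarrow> thin M B \<Longrightarrow> thin M (A \<union> B)"
proof -
  assume A: "thin M A" and B: "thin M B"
  show ?thesis unfolding thin_def
  proof (intro allI impI)
    fix V assume "openin M V \<and> V \<noteq> {}"
    then obtain U where U: "openin M U" "U \<noteq> {}" "U \<subseteq> V" "U \<inter> A = {}" using A unfolding thin_def by meson
    then obtain U' where "openin M U'" "U' \<noteq> {}" "U' \<subseteq> U" "U' \<inter> B = {}" using B unfolding thin_def by meson
    then show "\<exists>U. openin M U \<and> U \<noteq> {} \<and> U \<subseteq> V \<and> U \<inter> (A \<union> B) = {}"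
      using U by (intro exI[of _ U']) blast
  qed
qed

lemma thin_mono: "thin M A \<Longrightarrow> B \<subseteq> A \<Longrightarrow> thin M B"
  unfolding thin_def by (meson disjoint_iff subset_eq)

lemma thin_point: "thin M N \<Longrightarrow> openin M V \<Longrightarrow> V \<noteq> {} \<Longrightarrow> \<exists>x\<in>V. x \<notin> N"
  unfolding thin_def by (metis disjoint_iff ex_in_conv subsetD)

lemma thin_chart_segment:
  assumes "plane_chart M \<kappa>" shows "thin M (\<kappa> ` closed_segment z w)"
  unfolding thin_def
proof (intro allI impI)
  fix V assume V: "openin M V \<and> V \<noteq> {}"
  show "\<exists>U. openin M U \<and> U \<noteq> {} \<and> U \<subseteq> V \<and> U \<inter> \<kappa> ` closed_segment z w = {}"
  proof (cases "V \<inter> range \<kappa> = {}")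
    case True
    then show ?thesis using V by (intro exI[of _ V]) blast
  next
    case False
    let ?O = "{u. \<kappa> u \<in> V}"
    have O: "open ?O" "?O \<noteq> {}" using plane_chart_open_vimage[OF assms] V False by auto
    have "interior (closed_segment z w) = {}" by (rule interior_closed_segment_ge2) simp
    then have "\<not> ?O \<subseteq> closed_segment z w" using O interior_maximal[of ?O "closed_segment z w"] by auto
    then have "?O - closed_segment z w \<noteq> {}" by blast
    moreover have "open (?O - closed_segment z w)" using O by (intro open_Diff) auto
    ultimately show ?thesis
      using plane_chartD(2)[OF assms] plane_chartD(3)[OF assms]
      by (intro exI[of _ "\<kappa> ` (?O - closed_segment z w)"]) (auto simp: inj_eq)
  qed
qed

lemma path_homotopic_subpath:
  assumes "pathin X p" "a \<in> {0..1}" "b \<in> {0..1}" "c \<in> {0..1}"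
  shows "path_homotopic X (subpath_of p a c) (path_concat (subpath_of p a b) (subpath_of p b c))"
proof -
  have sub: "closed_segment a b \<subseteq> {0..1}" "closed_segment b c \<subseteq> {0..1}" "closed_segment a c \<subseteq> {0..1}"
    using assms by (simp_all add: closed_segment_subset)
  have "path_concat (subpath_of p a b) (subpath_of p b c) = p \<circ> (linepath a b +++ linepath b c)"
    by (auto simp: path_concat_def subpath_of_def joinpaths_def)
  moreover have "path_homotopic X (p \<circ> linepath a c) (p \<circ> (linepath a b +++ linepath b c))"
    using assms(1) sub subset_path_image_join[of "linepath a b" "{0..1}" "linepath b c"]
    by (intro path_homotopic_convex[where K="{0..1}"]) (auto simp: pathin_iff joinpaths_ends' linepath_0' linepath_1')
  ultimately show ?thesis unfolding subpath_of_def by simp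
qed

context surface_conf
begin

text \<open>Short pieces of the path are straightened in charts that avoid \<open>D\<close>; a
  segment is nowhere dense in the plane.\<close>

lemma thin_track:
  assumes D: "finite D" "D \<subseteq> topspace M" and \<alpha>: "track D \<alpha>"
  obtains \<alpha>' where "path_homotopic (subtopology M (topspace M - D)) \<alpha> \<alpha>'" "thin M (\<alpha>' ` {0..1})"
proof -
  let ?N = "subtopology M (topspace M - D)"
  have \<alpha>N: "pathin ?N \<alpha>" using \<alpha> track_in[OF \<alpha>] unfolding track_def pathin_subtopology by blast
  define P where "P a b \<longleftrightarrow> (\<exists>\<alpha>'. path_homotopic ?N (subpath_of \<alpha> a b) \<alpha>' \<and> thin M (\<alpha>' ` {0..1}))" for a b
  have "P 0 1"
  proof (rule interval_induct)
    fix a b c :: real assume *: "P a b" "P b c" "0 \<le> a" "a \<le> b" "b \<le> c" "c \<le> 1"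
    obtain p where p: "path_homotopic ?N (subpath_of \<alpha> a b) p" "thin M (p ` {0..1})" using *(1) unfolding P_def by blast
    obtain q where q: "path_homotopic ?N (subpath_of \<alpha> b c) q" "thin M (q ` {0..1})" using *(2) unfolding P_def by blast
    have "path_homotopic ?N (subpath_of \<alpha> a c) (path_concat p q)"
      by (rule path_homotopic_trans[OF path_homotopic_subpath[OF \<alpha>N] path_homotopic_concat[OF p(1) q(1)]]) (use * in auto)
    moreover have "path_concat p q ` {0..1} \<subseteq> p ` {0..1} \<union> q ` {0..1}" unfolding path_concat_def by auto
    then have "thin M (path_concat p q ` {0..1})" using thin_mono[OF thin_Un[OF p(2) q(2)]] by blast
    ultimately show "P a c" unfolding P_def by blast
  next
    fix t :: real assume t: "t \<in> {0..1}"
    have "openin M (topspace M - D)"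
      using D closedin_Hausdorff_finite[OF Hausdorff] by (simp add: openin_diff)
    then obtain \<kappa> where \<kappa>: "plane_chart M \<kappa>" "\<kappa> 0 = \<alpha> t" "range \<kappa> \<subseteq> topspace M - D"
      using subsurface_chart[OF surface _ track_in[OF \<alpha> t]] by blast
    have "openin M (range \<kappa>)" using plane_chartD(2)[OF \<kappa>(1)] by simp
    moreover have "\<alpha> t \<in> range \<kappa>" using \<kappa>(2) by (metis rangeI)
    ultimately obtain d where d: "d > 0" "\<And>s. s \<in> {0..1} \<Longrightarrow> \<bar>s - t\<bar> < d \<Longrightarrow> \<alpha> s \<in> range \<kappa>"
      using pathin_local[OF track_path[OF \<alpha>] t] by blast
    have "P a b" if ab: "a\<in>{0..1}" "b\<in>{0..1}" "a \<le> t" "t \<le> b" "\<bar>a - t\<bar> < d" "\<bar>b - t\<bar> < d" for a b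
    proof -
      let ?p = "subpath_of \<alpha> a b"
      let ?l = "\<lambda>s. inv_into UNIV \<kappa> (?p s)"
      have p: "pathin M ?p" using pathin_subpath_of[OF track_path[OF \<alpha>] ab(1,2)] .
      have in': "?p s \<in> range \<kappa>" if s: "s \<in> {0..1}" for s
      proof -
        obtain r where "r \<in> {0..1}" "\<bar>r - t\<bar> < d" "?p s = \<alpha> r" by (rule subpath_of_near[OF ab s])
        then show ?thesis using d(2)[of r] by simp
      qed
      have l: "path ?l" unfolding path_def by (rule plane_chart_lift[OF \<kappa>(1) p in'])
      have cont: "continuous_map (top_of_set UNIV) ?N \<kappa>"
        using plane_chartD(1)[OF \<kappa>(1)] \<kappa>(3) by (simp add: continuous_map_in_subtopology image_subset_iff)
      have "path_homotopic ?N (\<kappa> \<circ> ?l) (\<kappa> \<circ> linepath (?l 0) (?l 1))"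
        using l by (intro path_homotopic_convex[OF convex_UNIV cont]) (auto simp: linepath_0' linepath_1')
      moreover have "path_homotopic ?N ?p (\<kappa> \<circ> ?l)"
        using in' pathin_subpath_of[OF \<alpha>N ab(1,2)] by (intro path_homotopic_equal) (auto simp: f_inv_into_f)
      moreover have "(\<kappa> \<circ> linepath (?l 0) (?l 1)) ` {0..1} = \<kappa> ` closed_segment (?l 0) (?l 1)"
        by (simp only: image_comp[symmetric] linepath_image_01)
      then have "thin M ((\<kappa> \<circ> linepath (?l 0) (?l 1)) ` {0..1})" using thin_chart_segment[OF \<kappa>(1)] by simp
      ultimately show ?thesis unfolding P_def using path_homotopic_trans by blast
    qed
    then show "\<exists>d>0. \<forall>a\<in>{0..1}. \<forall>b\<in>{0..1}. a \<le> t \<longrightarrow> t \<le> b \<longrightarrow> \<bar>a - t\<bar> < d \<longrightarrow> \<bar>b - t\<bar> < d \<longrightarrow> P a b"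
      using d(1) by blast
  qed
  then show ?thesis using that unfolding P_def subpath_of_whole by blast
qed

section \<open>Good charts and crossings inside them\<close>

definition good_chart :: "'a set \<Rightarrow> (complex \<Rightarrow> 'a) \<Rightarrow> bool" where
  "good_chart C \<kappa> \<longleftrightarrow> plane_chart M \<kappa> \<and> C \<inter> range \<kappa> = {} \<and> trivial_swaps (range \<kappa>) C"

text \<open>The hypothesis concerns the unit disc of a chart. Squeezing the plane into that disc
  yields a chart whose whole range has trivial swaps.\<close>

lemma good_chart_exists:
  assumes triv: "\<And>\<kappa>. plane_chart M \<kappa> \<Longrightarrow> C \<inter> range \<kappa> = {} \<Longrightarrow> trivial_swaps (\<kappa> ` cball 0 1) C"
    and C: "finite C" "C \<subseteq> topspace M" and q: "openin M U" "q \<in> U" "q \<notin> C"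
  obtains \<kappa> where "good_chart C \<kappa>" "\<kappa> 0 = q" "range \<kappa> \<subseteq> U"
proof -
  have "openin M (U - C)" using q C closedin_Hausdorff_finite[OF Hausdorff] by (simp add: openin_diff)
  then obtain \<kappa> where \<kappa>: "plane_chart M \<kappa>" "\<kappa> 0 = q" "range \<kappa> \<subseteq> U - C"
    using subsurface_chart[OF surface, of "U - C" q] q by blast
  let ?f = "\<lambda>w::complex. 0 + (1 / (1 + cmod w)) *\<^sub>R w"
  note f = squeeze_plane[OF zero_less_one, where z=0]
  have "trivial_swaps (\<kappa> ` cball 0 1) C" using triv[OF \<kappa>(1)] \<kappa>(3) by blast
  moreover have sub: "range (\<kappa> \<circ> ?f) \<subseteq> \<kappa> ` cball 0 1"
    using f(4) by (auto simp: image_subset_iff intro!: imageI less_imp_le)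
  ultimately have "trivial_swaps (range (\<kappa> \<circ> ?f)) C" by (rule trivial_swaps_mono)
  moreover have "plane_chart M (\<kappa> \<circ> ?f)" by (rule plane_chart_compose[OF \<kappa>(1) f(1,2,3)])
  moreover have "range (\<kappa> \<circ> ?f) \<subseteq> U - C" using \<kappa>(3) by auto
  ultimately show ?thesis using that[of "\<kappa> \<circ> ?f"] \<kappa>(2) unfolding good_chart_def by auto
qed

lemma chart_path_avoiding:
  assumes \<kappa>: "plane_chart M \<kappa>" and c: "c \<in> range \<kappa>" "c' \<in> range \<kappa>" "c \<noteq> x" "c' \<noteq> x"
  obtains \<mu> where "pathin M \<mu>" "\<mu> 0 = c" "\<mu> 1 = c'" "\<And>t. t \<in> {0..1} \<Longrightarrow> \<mu> t \<in> range \<kappa> \<and> \<mu> t \<noteq> x"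
proof -
  obtain z z' where z: "c = \<kappa> z" "c' = \<kappa> z'" using c by blast
  have "path_connected {w. \<kappa> w \<noteq> x}"
  proof (cases "x \<in> range \<kappa>")
    case True
    then obtain u where "x = \<kappa> u" by blast
    then have "{w. \<kappa> w \<noteq> x} = - {u}" using plane_chartD(3)[OF \<kappa>] by (auto simp: inj_eq)
    then show ?thesis using path_connected_punctured_universe[of u] by simp
  next
    case False
    then have "{w. \<kappa> w \<noteq> x} = UNIV" by auto
    then show ?thesis by (simp add: convex_imp_path_connected)
  qed
  then obtain g where g: "path g" "path_image g \<subseteq> {w. \<kappa> w \<noteq> x}" "pathstart g = z" "pathfinish g = z'"
    using z c(3,4) unfolding path_connected_def by blast
  have "continuous_map (top_of_set UNIV) M \<kappa>" using plane_chartD(1)[OF \<kappa>] by simp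
  then have "pathin M (\<kappa> \<circ> g)" by (rule pathin_compose_path[OF _ g(1)]) simp
  moreover have "\<kappa> (g t) \<noteq> x" if "t \<in> {0..1}" for t using g(2) that unfolding path_image_def by blast
  ultimately show ?thesis
    using that[of "\<kappa> \<circ> g"] g(3,4) z unfolding pathstart_def pathfinish_def by auto
qed

context
  fixes C :: "'a set"
  assumes C: "tokens 2 C"
begin

lemma tokens_C_insert: "x \<in> topspace M \<Longrightarrow> x \<notin> C \<Longrightarrow> tokens 1 (insert x C)"
  using tokens_insert[of 1 C x] C by (simp add: numeral_2_eq_2)

text \<open>If \<open>x\<close> is in the chart, the two paths form a loop which together with the
  standing \<open>x\<close> is a swap of value 0. If \<open>x\<close> is outside, the whole plane
  serves as convex parameter space.\<close>

lemma good_chart_move_eq: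
  assumes \<kappa>: "good_chart C \<kappa>" and x: "x \<in> topspace M" "x \<notin> C"
    and \<mu>: "track (insert x C) \<mu>" "\<And>t. t \<in> {0..1} \<Longrightarrow> \<mu> t \<in> range \<kappa>"
    and \<eta>: "track (insert x C) \<eta>" "\<And>t. t \<in> {0..1} \<Longrightarrow> \<eta> t \<in> range \<kappa>"
    and ends: "\<mu> 0 = \<eta> 0" "\<mu> 1 = \<eta> 1"
  shows "move (insert x C) \<mu> = move (insert x C) \<eta>"
proof -
  have \<kappa>': "plane_chart M \<kappa>" "C \<inter> range \<kappa> = {}" "trivial_swaps (range \<kappa>) C" using \<kappa> unfolding good_chart_def by auto
  have tx: "tokens 1 (insert x C)" using tokens_C_insert[OF x] .
  show ?thesis
  proof (cases "x \<in> range \<kappa>")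
    case True
    let ?l = "path_concat \<mu> (path_reverse \<eta>)"
    have tr: "track (insert x C) ?l" using \<mu> \<eta> ends by (intro track_concat track_reverse) auto
    have "move (insert x C) ?l = 0"
      unfolding move_def
    proof (rule trivial_swapsD[OF \<kappa>'(3), of ?l "\<lambda>_. x"])
      show "pathin M ?l" using tr track_path by blast
      show "pathin M (\<lambda>_. x)" using x by simp
      show "?l t \<in> range \<kappa>" if "t \<in> {0..1}" for t
        using \<mu>(2)[of "2 * t"] \<eta>(2)[of "1 - (2 * t - 1)"] that by (auto simp: path_concat_def path_reverse_def)
      show "?l t \<noteq> x" if "t \<in> {0..1}" for t using tr that unfolding track_insert by blast
    qed (use True ends in auto)
    moreover have "move (insert x C) ?l = move (insert x C) \<mu> + - move (insert x C) \<eta>"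
      using move_concat[OF tx \<mu>(1) track_reverse[OF \<eta>(1)]] move_reverse[OF tx \<eta>(1)] ends by simp
    ultimately show ?thesis by (simp add: eq_neg_iff_add_eq_0[symmetric])
  next
    case False
    let ?m = "\<lambda>t. inv_into UNIV \<kappa> (\<mu> t)" and ?e = "\<lambda>t. inv_into UNIV \<kappa> (\<eta> t)"
    have "move (insert x C) (\<kappa> \<circ> ?m) = move (insert x C) (\<kappa> \<circ> ?e)"
    proof (rule move_convex[OF tx convex_UNIV])
      show "continuous_map (top_of_set UNIV) M \<kappa>" using plane_chartD(1)[OF \<kappa>'(1)] by simp
      show "path ?m" "path ?e" unfolding path_def
        using \<mu> \<eta> track_path by (auto intro!: plane_chart_lift[OF \<kappa>'(1)])
    qed (use \<kappa>'(2) False ends in auto)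
    moreover have "move (insert x C) \<mu> = move (insert x C) (\<kappa> \<circ> ?m)" "move (insert x C) \<eta> = move (insert x C) (\<kappa> \<circ> ?e)"
      using \<mu>(2) \<eta>(2) by (auto intro!: move_cong[OF tx \<mu>(1)] move_cong[OF tx \<eta>(1)] simp: f_inv_into_f)
    ultimately show ?thesis by simp
  qed
qed

text \<open>\<open>\<alpha>\<close> may run through \<open>\<mu>\<close>. For each time
  \<open>t\<close> some path in the chart with the ends of \<open>\<mu>\<close> avoids
  \<open>\<alpha> t\<close>, and by compactness also nearby positions of \<open>\<alpha>\<close>;
  with these the interchange is legitimate. Where two such replacements are both allowed they have
  the same value, so the local relations fit together.\<close>

lemma good_chart_cross:
  assumes \<kappa>: "good_chart C \<kappa>" and \<mu>: "track C \<mu>" "\<And>t. t \<in> {0..1} \<Longrightarrow> \<mu> t \<in> range \<kappa>"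
    and \<alpha>: "track C \<alpha>" "\<And>t. t \<in> {0..1} \<Longrightarrow> \<alpha> t \<noteq> \<mu> 0 \<and> \<alpha> t \<noteq> \<mu> 1"
    and ends: "\<And>t. t \<in> {0..1} \<Longrightarrow> \<mu> t \<noteq> \<alpha> 0 \<and> \<mu> t \<noteq> \<alpha> 1"
  shows "move (insert (\<mu> 0) C) \<alpha> + move (insert (\<alpha> 1) C) \<mu> = move (insert (\<alpha> 0) C) \<mu> + move (insert (\<mu> 1) C) \<alpha>"
proof -
  let ?c = "\<mu> 0" and ?c' = "\<mu> 1"
  have \<kappa>': "plane_chart M \<kappa>" "C \<inter> range \<kappa> = {}" using \<kappa> unfolding good_chart_def by auto
  define cp where "cp x \<eta> \<longleftrightarrow> track (insert x C) \<eta> \<and> (\<forall>t\<in>{0..1}. \<eta> t \<in> range \<kappa>) \<and> \<eta> 0 = ?c \<and> \<eta> 1 = ?c'" for x \<eta>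
  have cp_eq: "move (insert x C) \<eta> = move (insert x C) \<eta>'" if "cp x \<eta>" "cp x \<eta>'" "x \<in> topspace M - C" for x \<eta> \<eta>'
    using that unfolding cp_def by (intro good_chart_move_eq[OF \<kappa>]) auto
  have cp_ex: "\<exists>\<eta>. cp (\<alpha> t) \<eta>" if t: "t \<in> {0..1}" for t
  proof -
    have "?c \<in> range \<kappa>" "?c' \<in> range \<kappa>" "?c \<noteq> \<alpha> t" "?c' \<noteq> \<alpha> t" using \<mu>(2) \<alpha>(2)[OF t] by (auto dest: sym)
    then obtain \<eta> where "pathin M \<eta>" "\<eta> 0 = ?c" "\<eta> 1 = ?c'" "\<And>s. s \<in> {0..1} \<Longrightarrow> \<eta> s \<in> range \<kappa> \<and> \<eta> s \<noteq> \<alpha> t"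
      by (rule chart_path_avoiding[OF \<kappa>'(1)]) blast
    then show ?thesis using \<kappa>'(2) unfolding cp_def track_def by blast
  qed
  have tc: "tokens 1 (insert ?c C)" "tokens 1 (insert ?c' C)"
    using track_in[OF \<mu>(1), of 0] track_in[OF \<mu>(1), of 1] by (auto intro!: tokens_C_insert simp del: One_nat_def)
  have tr: "track (insert ?c C) \<alpha>" "track (insert ?c' C) \<alpha>" using \<alpha> unfolding track_insert by auto
  define P where "P a b \<longleftrightarrow> (\<forall>\<eta> \<eta>'. cp (\<alpha> a) \<eta> \<longrightarrow> cp (\<alpha> b) \<eta>' \<longrightarrow>
    move (insert ?c C) (subpath_of \<alpha> a b) + move (insert (\<alpha> b) C) \<eta>' =
    move (insert (\<alpha> a) C) \<eta> + move (insert ?c' C) (subpath_of \<alpha> a b))" for a b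
  have "P 0 1"
  proof (rule interval_induct)
    fix a b c :: real assume *: "P a b" "P b c" "0 \<le> a" "a \<le> b" "b \<le> c" "c \<le> 1"
    obtain \<eta>b where b: "cp (\<alpha> b) \<eta>b" using cp_ex[of b] * by auto
    have "move (insert y C) (subpath_of \<alpha> a b) + move (insert y C) (subpath_of \<alpha> b c) = move (insert y C) (subpath_of \<alpha> a c)"
      if "y = ?c \<or> y = ?c'" for y
      using that tc tr * by (intro move_subpath_add) auto
    note add = this[of ?c, OF disjI1[OF refl]] this[of ?c', OF disjI2[OF refl]]
    show "P a c"
      unfolding P_def
    proof (intro allI impI)
      fix \<eta> \<eta>' assume "cp (\<alpha> a) \<eta>" "cp (\<alpha> c) \<eta>'"
      from pass_two[OF *(1)[unfolded P_def, rule_format, OF this(1) b] *(2)[unfolded P_def, rule_format, OF b this(2)]]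
      show "move (insert ?c C) (subpath_of \<alpha> a c) + move (insert (\<alpha> c) C) \<eta>' =
        move (insert (\<alpha> a) C) \<eta> + move (insert ?c' C) (subpath_of \<alpha> a c)" unfolding add .
    qed
  next
    fix t :: real assume t: "t \<in> {0..1}"
    obtain \<eta> where \<eta>: "cp (\<alpha> t) \<eta>" using cp_ex[OF t] by blast
    then have \<eta>t: "track (insert (\<alpha> t) C) \<eta>" "pathin M \<eta>" "track C \<eta>" unfolding cp_def track_def by auto
    have "openin M (topspace M - \<eta> ` {0..1})" using pathin_image_closedin[OF Hausdorff \<eta>t(2)] by (simp add: openin_diff)
    moreover have "\<alpha> t \<in> topspace M - \<eta> ` {0..1}" using track_in[OF \<alpha>(1) t] \<eta>t(1) unfolding track_insert by auto
    ultimately obtain d where d: "d > 0" "\<And>s. s \<in> {0..1} \<Longrightarrow> \<bar>s - t\<bar> < d \<Longrightarrow> \<alpha> s \<in> topspace M - \<eta> ` {0..1}"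
      using pathin_local[OF track_path[OF \<alpha>(1)] t] by blast
    have "P a b" if ab: "a\<in>{0..1}" "b\<in>{0..1}" "a \<le> t" "t \<le> b" "\<bar>a - t\<bar> < d" "\<bar>b - t\<bar> < d" for a b
    proof -
      have av: "subpath_of \<alpha> a b s \<noteq> \<eta> r" if sr: "s \<in> {0..1}" "r \<in> {0..1}" for s r
      proof -
        obtain q where "q \<in> {0..1}" "\<bar>q - t\<bar> < d" "subpath_of \<alpha> a b s = \<alpha> q" by (rule subpath_of_near[OF ab sr(1)])
        then show ?thesis using d(2)[of q] sr(2) by auto
      qed
      have "\<eta> r \<noteq> \<alpha> a" "\<eta> r \<noteq> \<alpha> b" if "r \<in> {0..1}" for r using av[of 0 r] av[of 1 r] that by auto
      then have "cp (\<alpha> a) \<eta>" "cp (\<alpha> b) \<eta>" using \<eta> unfolding cp_def track_insert by blast+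
      then have "move (insert (\<alpha> a) C) \<eta>' = move (insert (\<alpha> a) C) \<eta>" "move (insert (\<alpha> b) C) \<eta>'' = move (insert (\<alpha> b) C) \<eta>"
        if "cp (\<alpha> a) \<eta>'" "cp (\<alpha> b) \<eta>''" for \<eta>' \<eta>''
        using cp_eq that track_in[OF \<alpha>(1)] ab(1,2) by blast+
      moreover have "move (insert (\<eta> 0) C) (subpath_of \<alpha> a b) + move (insert (subpath_of \<alpha> a b 1) C) \<eta> =
          move (insert (subpath_of \<alpha> a b 0) C) \<eta> + move (insert (\<eta> 1) C) (subpath_of \<alpha> a b)"
        by (rule move_commute[OF C track_subpath[OF \<alpha>(1) ab(1,2)] \<eta>t(3) av])
      ultimately show ?thesis using \<eta> unfolding P_def cp_def by simp
    qed
    then show "\<exists>d>0. \<forall>a\<in>{0..1}. \<forall>b\<in>{0..1}. a \<le> t \<longrightarrow> t \<le> b \<longrightarrow> \<bar>a - t\<bar> < d \<longrightarrow> \<bar>b - t\<bar> < d \<longrightarrow> P a b"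
      using d(1) by blast
  qed
  moreover have "cp (\<alpha> 0) \<mu>" "cp (\<alpha> 1) \<mu>" using \<mu> ends unfolding cp_def track_insert by auto
  ultimately show ?thesis unfolding P_def subpath_of_whole by blast
qed

end

end

lemma conj_shift:
  fixes a :: "'g::group_add"
  assumes "v + (- a + e + b) = (- a + e + b) + w"
  shows "(a + v - a) + e = e + (b + w - b)"
proof -
  have "(a + v - a) + e = a + (v + (- a + e + b)) - b"
    by (simp add: diff_conv_add_uminus add.assoc del: add_uminus_conv_diff)
  also have "\<dots> = e + (b + w - b)"
    unfolding assms by (simp add: diff_conv_add_uminus add.assoc del: add_uminus_conv_diff)
  finally show ?thesis .
qed

lemma carry_between:
  fixes x :: "'g::group_add"
  assumes "x + s = s + y" "x + u = u + z" "s + e = u" shows "y + e = e + z"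
proof -
  have "s + (y + e) = s + (e + z)" using assms by (metis add.assoc)
  then show ?thesis by simp
qed

context surface_conf
begin

context
  fixes C :: "'a set" and \<alpha> :: "real \<Rightarrow> 'a" and a :: 'a
  assumes C: "tokens 2 C" and \<alpha>: "track C \<alpha>" "\<alpha> 0 = a" "\<alpha> 1 = a" "thin M (\<alpha> ` {0..1})"
    and good: "\<And>U q. openin M U \<Longrightarrow> q \<in> U \<Longrightarrow> q \<notin> C \<Longrightarrow> \<exists>\<kappa>. good_chart C \<kappa> \<and> \<kappa> 0 = q \<and> range \<kappa> \<subseteq> U"
begin

text \<open>For \<open>c\<close> off the thin loop \<open>\<alpha>\<close> the value of \<open>\<alpha>\<close> with a second token at \<open>c\<close> makes sense; for other points it is
  pulled back along a path inside a good chart. The result is locally constant along the moves of the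
  second token.\<close>

definition chart_track :: "(complex \<Rightarrow> 'a) \<Rightarrow> (real \<Rightarrow> 'a) \<Rightarrow> bool" where
  "chart_track \<kappa> \<eta> \<longleftrightarrow> good_chart C \<kappa> \<and> a \<notin> range \<kappa> \<and> pathin M \<eta> \<and> (\<forall>t\<in>{0..1}. \<eta> t \<in> range \<kappa>)"

definition pulled_back :: "(real \<Rightarrow> 'a) \<Rightarrow> 'f" where
  "pulled_back \<eta> = move (insert a C) \<eta> + move (insert (\<eta> 1) C) \<alpha> - move (insert a C) \<eta>"

definition pulled_value :: "'a \<Rightarrow> 'f \<Rightarrow> bool" where
  "pulled_value y x \<longleftrightarrow> (\<exists>\<kappa> \<eta>. chart_track \<kappa> \<eta> \<and> \<eta> 0 = y \<and> \<eta> 1 \<notin> \<alpha> ` {0..1} \<and> x = pulled_back \<eta>)"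

lemma a_in: "a \<in> topspace M" "a \<notin> C" using track_in[OF \<alpha>(1), of 0] \<alpha>(2) by auto

lemma tokens_a: "tokens 1 (insert a C)" by (rule tokens_C_insert[OF C a_in])

lemma chart_trackD:
  assumes "chart_track \<kappa> \<eta>"
  shows "good_chart C \<kappa>" "plane_chart M \<kappa>" "a \<notin> range \<kappa>" "C \<inter> range \<kappa> = {}" "openin M (range \<kappa>)"
    "track (insert a C) \<eta>" "track C \<eta>" "\<And>t. t \<in> {0..1} \<Longrightarrow> \<eta> t \<in> range \<kappa>"
  using assms plane_chartD(2)[of M \<kappa> UNIV] unfolding chart_track_def good_chart_def track_def by auto

lemma chart_track_concat: "chart_track \<kappa> p \<Longrightarrow> chart_track \<kappa> q \<Longrightarrow> p 1 = q 0 \<Longrightarrow> chart_track \<kappa> (path_concat p q)"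
  unfolding chart_track_def by (auto simp: pathin_path_concat) (auto simp: path_concat_def)

lemma chart_track_reverse: "chart_track \<kappa> p \<Longrightarrow> chart_track \<kappa> (path_reverse p)"
  unfolding chart_track_def by (auto simp: pathin_reverse) (auto simp: path_reverse_def)

lemma chart_track_const: "chart_track \<kappa> p \<Longrightarrow> y \<in> range \<kappa> \<Longrightarrow> chart_track \<kappa> (\<lambda>_. y)"
  unfolding chart_track_def good_chart_def using plane_chartD(4) by auto

text \<open>The reference points \<open>\<eta> 1\<close> and \<open>\<eta>' 1\<close> are joined
  inside the chart by the reverse of \<open>\<eta>\<close>, then \<open>e\<close>, then
  \<open>\<eta>'\<close>. This path may meet \<open>\<alpha>\<close>, but its ends do not, and the
  base point \<open>a\<close> is outside the chart, so \<open>good_chart_cross\<close>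
  applies.\<close>

lemma pulled_back_flat:
  assumes \<eta>: "chart_track \<kappa> \<eta>" "\<eta> 1 \<notin> \<alpha> ` {0..1}" and \<eta>': "chart_track \<kappa> \<eta>'" "\<eta>' 1 \<notin> \<alpha> ` {0..1}"
    and e: "chart_track \<kappa> e" "e 0 = \<eta> 0" "e 1 = \<eta>' 0"
  shows "pulled_back \<eta> + move (insert a C) e = move (insert a C) e + pulled_back \<eta>'"
proof -
  let ?d = "path_concat (path_concat (path_reverse \<eta>) e) \<eta>'"
  have d: "chart_track \<kappa> ?d" using assms by (intro chart_track_concat chart_track_reverse) auto
  have "move (insert (?d 0) C) \<alpha> + move (insert (\<alpha> 1) C) ?d = move (insert (\<alpha> 0) C) ?d + move (insert (?d 1) C) \<alpha>"
  proof (rule good_chart_cross[OF C chart_trackD(1,7)[OF d]])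
    show "track C \<alpha>" by (rule \<alpha>(1))
    show "?d t \<in> range \<kappa>" if "t \<in> {0..1}" for t by (rule chart_trackD(8)[OF d that])
    show "\<alpha> t \<noteq> ?d 0 \<and> \<alpha> t \<noteq> ?d 1" if "t \<in> {0..1}" for t using \<eta>(2) \<eta>'(2) imageI[OF that, of \<alpha>] by auto
    show "?d t \<noteq> \<alpha> 0 \<and> ?d t \<noteq> \<alpha> 1" if "t \<in> {0..1}" for t
      using chart_trackD(8)[OF d that] chart_trackD(3)[OF d] \<alpha>(2,3) by metis
  qed
  moreover have "move (insert a C) ?d = - move (insert a C) \<eta> + move (insert a C) e + move (insert a C) \<eta>'"
    using chart_trackD(6) assms
    by (simp add: move_concat[OF tokens_a] move_reverse[OF tokens_a] track_reverse track_concat)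
  ultimately show ?thesis unfolding pulled_back_def using conj_shift \<alpha>(2,3) by simp
qed

lemma thin_chart_point:
  assumes "plane_chart M \<kappa>" obtains c where "c \<in> range \<kappa>" "c \<notin> \<alpha> ` {0..1}"
  using thin_point[OF \<alpha>(4), of "range \<kappa>"] plane_chartD(2)[OF assms, of UNIV] by auto

lemma chart_track_to_thin:
  assumes \<kappa>: "good_chart C \<kappa>" "a \<notin> range \<kappa>" and V: "openin M V" "y \<in> V" "V \<subseteq> range \<kappa>"
  obtains \<eta> where "chart_track \<kappa> \<eta>" "\<And>t. t \<in> {0..1} \<Longrightarrow> \<eta> t \<in> V" "\<eta> 0 = y" "\<eta> 1 \<notin> \<alpha> ` {0..1}"
proof -
  obtain \<kappa>' where k: "plane_chart M \<kappa>'" "\<kappa>' 0 = y" "range \<kappa>' \<subseteq> V" using subsurface_chart[OF surface V(1,2)] .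
  obtain c where c: "c \<in> range \<kappa>'" "c \<notin> \<alpha> ` {0..1}" using thin_chart_point[OF k(1)] .
  have "y \<in> range \<kappa>'" "y \<noteq> a" "c \<noteq> a" using k V \<kappa>(2) c(1) by (metis rangeI, blast, blast)
  then obtain \<eta> where "pathin M \<eta>" "\<eta> 0 = y" "\<eta> 1 = c" "\<And>t. t \<in> {0..1} \<Longrightarrow> \<eta> t \<in> range \<kappa>' \<and> \<eta> t \<noteq> a"
    using chart_path_avoiding[OF k(1) _ c(1)] by blast
  then show ?thesis using that[of \<eta>] \<kappa> V(3) k(3) c(2) unfolding chart_track_def by blast
qed

text \<open>The value at \<open>y'\<close> may have been formed in another chart
  \<open>\<kappa>'\<close>. A path \<open>\<theta>\<close> inside both charts from \<open>y'\<close>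
  to a point off \<open>\<alpha>\<close> compares the two.\<close>

lemma pulled_value_carry:
  assumes x: "chart_track \<kappa> \<eta>" "\<eta> 1 \<notin> \<alpha> ` {0..1}" and x': "pulled_value y' x'"
    and e: "chart_track \<kappa> e" "e 0 = \<eta> 0" "e 1 = y'"
  shows "pulled_back \<eta> + move (insert a C) e = move (insert a C) e + x'"
proof -
  obtain \<kappa>' \<eta>' where p: "chart_track \<kappa>' \<eta>'" "\<eta>' 0 = y'" "\<eta>' 1 \<notin> \<alpha> ` {0..1}" "x' = pulled_back \<eta>'"
    using x' unfolding pulled_value_def by blast
  let ?V = "range \<kappa> \<inter> range \<kappa>'"
  have y': "y' \<in> ?V" using chart_trackD(8)[OF p(1), of 0] chart_trackD(8)[OF e(1), of 1] p(2) e(3) by simp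
  have "openin M ?V" using chart_trackD(5)[OF x(1)] chart_trackD(5)[OF p(1)] by blast
  then obtain \<theta> where \<theta>: "chart_track \<kappa> \<theta>" "\<And>t. t \<in> {0..1} \<Longrightarrow> \<theta> t \<in> ?V" "\<theta> 0 = y'" "\<theta> 1 \<notin> \<alpha> ` {0..1}"
    by (rule chart_track_to_thin[OF chart_trackD(1,3)[OF x(1)] _ y']) auto
  have \<theta>': "chart_track \<kappa>' \<theta>" using \<theta>(1,2) p(1) unfolding chart_track_def by blast
  have c: "chart_track \<kappa>' (\<lambda>_. y')" using chart_track_const[OF p(1)] y' by blast
  have "move (insert a C) (\<lambda>_. y') = 0"
    using track_in[OF chart_trackD(6)[OF c], of 0] by (intro move_const[OF tokens_a]) auto
  then have "x' = pulled_back \<theta>"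
    using pulled_back_flat[OF p(1,3) \<theta>' \<theta>(4) c p(2)[symmetric] \<theta>(3)[symmetric]] p(4) by simp
  then show ?thesis using pulled_back_flat[OF x \<theta>(1,4) e(1,2) trans[OF e(3) \<theta>(3)[symmetric]]] by (simp only:)
qed

lemma good_chart_off:
  assumes "y \<in> topspace M" "y \<notin> C" "y \<noteq> a"
  obtains \<kappa> where "good_chart C \<kappa>" "\<kappa> 0 = y" "a \<notin> range \<kappa>"
proof -
  have "openin M (topspace M - {a})"
    using closedin_Hausdorff_finite[OF Hausdorff, of "{a}"] a_in by (simp add: openin_diff)
  from good[OF this, of y] assms obtain \<kappa> where "good_chart C \<kappa>" "\<kappa> 0 = y" "range \<kappa> \<subseteq> topspace M - {a}" by blast
  then show ?thesis using that by blast
qed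

lemma pulled_value_exists:
  assumes "y \<in> topspace M" "y \<notin> C" "y \<noteq> a"
  obtains \<kappa> \<eta> where "chart_track \<kappa> \<eta>" "\<eta> 0 = y" "\<eta> 1 \<notin> \<alpha> ` {0..1}" "pulled_value y (pulled_back \<eta>)"
proof -
  obtain \<kappa> where k: "good_chart C \<kappa>" "\<kappa> 0 = y" "a \<notin> range \<kappa>" using good_chart_off[OF assms] .
  have "openin M (range \<kappa>)" using k(1) plane_chartD(2)[of M \<kappa> UNIV] unfolding good_chart_def by simp
  moreover have "y \<in> range \<kappa>" using k(2) by (metis rangeI)
  ultimately obtain \<eta> where "chart_track \<kappa> \<eta>" "\<eta> 0 = y" "\<eta> 1 \<notin> \<alpha> ` {0..1}"
    by (rule chart_track_to_thin[OF k(1,3)]) auto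
  then show ?thesis using that unfolding pulled_value_def by blast
qed

lemma pulled_value_off:
  assumes "y \<in> topspace M" "y \<notin> C" "y \<notin> \<alpha> ` {0..1}"
  shows "pulled_value y (move (insert y C) \<alpha>)"
proof -
  have "a \<in> \<alpha> ` {0..1}" using \<alpha>(2) by force
  then have "y \<noteq> a" using assms(3) by metis
  then obtain \<kappa> where k: "good_chart C \<kappa>" "\<kappa> 0 = y" "a \<notin> range \<kappa>" using good_chart_off assms by blast
  have "chart_track \<kappa> (\<lambda>_. y)" unfolding chart_track_def using k assms(1) by auto
  moreover have "pulled_back (\<lambda>_. y) = move (insert y C) \<alpha>"
    unfolding pulled_back_def using move_const[OF tokens_a, of y] assms \<open>y \<noteq> a\<close> by simp
  ultimately show ?thesis unfolding pulled_value_def using assms(3) by (intro exI[of _ \<kappa>] exI[of _ "\<lambda>_. y"]) simp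
qed

text \<open>Moving the second token conjugates the pulled-back values by its own moves, first
  locally and then along all of \<open>\<mu>\<close>. At the two ends of \<open>\<mu>\<close>, off
  the loop, they are genuine values of \<open>\<alpha>\<close>.\<close>

lemma thin_loop_cross:
  assumes \<mu>: "track (insert a C) \<mu>" "\<mu> 0 \<notin> \<alpha> ` {0..1}" "\<mu> 1 \<notin> \<alpha> ` {0..1}"
  shows "move (insert (\<mu> 0) C) \<alpha> + move (insert a C) \<mu> = move (insert a C) \<mu> + move (insert (\<mu> 1) C) \<alpha>"
proof -
  let ?m = "\<lambda>s t. move (insert a C) (subpath_of \<mu> s t)"
  define P where "P s t \<longleftrightarrow> (\<forall>x x'. pulled_value (\<mu> s) x \<longrightarrow> pulled_value (\<mu> t) x' \<longrightarrow> x + ?m s t = ?m s t + x')" for s t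
  have in': "\<mu> t \<in> topspace M" "\<mu> t \<notin> C" "\<mu> t \<noteq> a" if "t \<in> {0..1}" for t using track_in[OF \<mu>(1) that] by auto
  have add: "?m p q + ?m q r = ?m p r" if "p \<in> {0..1}" "q \<in> {0..1}" "r \<in> {0..1}" for p q r
    using move_subpath_add[OF tokens_a \<mu>(1) that] .
  have "P 0 1"
  proof (rule interval_induct)
    fix p q r :: real assume *: "P p q" "P q r" "0 \<le> p" "p \<le> q" "q \<le> r" "r \<le> 1"
    then have "q \<in> {0..1}" by auto
    then obtain \<eta> where \<eta>: "pulled_value (\<mu> q) (pulled_back \<eta>)" using pulled_value_exists[OF in'] by blast
    have sum: "?m p q + ?m q r = ?m p r" using * by (intro add) auto
    show "P p r"
      unfolding P_def
    proof (intro allI impI)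
      fix x x' assume "pulled_value (\<mu> p) x" "pulled_value (\<mu> r) x'"
      from carry_two[OF *(1)[unfolded P_def, rule_format, OF this(1) \<eta>] *(2)[unfolded P_def, rule_format, OF \<eta> this(2)]]
      show "x + ?m p r = ?m p r + x'" unfolding sum .
    qed
  next
    fix t :: real assume t: "t \<in> {0..1}"
    obtain \<kappa> \<eta> where \<eta>: "chart_track \<kappa> \<eta>" "\<eta> 0 = \<mu> t" "\<eta> 1 \<notin> \<alpha> ` {0..1}" "pulled_value (\<mu> t) (pulled_back \<eta>)"
      using pulled_value_exists[OF in'[OF t]] .
    have "\<mu> t \<in> range \<kappa>" using chart_trackD(8)[OF \<eta>(1), of 0] \<eta>(2) by simp
    then obtain d where d: "d > 0" "\<And>s. s \<in> {0..1} \<Longrightarrow> \<bar>s - t\<bar> < d \<Longrightarrow> \<mu> s \<in> range \<kappa>"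
      using pathin_local[OF track_path[OF \<mu>(1)] t chart_trackD(5)[OF \<eta>(1)]] by blast
    have flat: "pulled_back \<eta> + ?m t s = ?m t s + x" if s: "s \<in> {0..1}" "\<bar>s - t\<bar> < d" and x: "pulled_value (\<mu> s) x" for s x
    proof (rule pulled_value_carry[OF \<eta>(1,3) x])
      have "subpath_of \<mu> t s u \<in> range \<kappa>" if u: "u \<in> {0..1}" for u
      proof -
        have l: "linepath t s u \<in> closed_segment t s" using u linepath_in_path by blast
        then have "\<bar>linepath t s u - t\<bar> < d" using s(2) unfolding closed_segment_eq_real_ivl by (auto split: if_splits)
        moreover have "linepath t s u \<in> {0..1}" using l closed_segment_subset[of t "{0..1}" s] t s(1) by auto
        ultimately show ?thesis using d(2) unfolding subpath_of_def by simp
      qed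
      then show "chart_track \<kappa> (subpath_of \<mu> t s)"
        using \<eta>(1) pathin_subpath_of[OF track_path[OF \<mu>(1)] t s(1)] unfolding chart_track_def by blast
    qed (use \<eta> in auto)
    have "P p q" if pq: "p\<in>{0..1}" "q\<in>{0..1}" "p \<le> t" "t \<le> q" "\<bar>p - t\<bar> < d" "\<bar>q - t\<bar> < d" for p q
      unfolding P_def using carry_between[OF flat[OF pq(1,5)] flat[OF pq(2,6)] add[OF t pq(1,2)]] by blast
    then show "\<exists>d>0. \<forall>p\<in>{0..1}. \<forall>q\<in>{0..1}. p \<le> t \<longrightarrow> t \<le> q \<longrightarrow> \<bar>p - t\<bar> < d \<longrightarrow> \<bar>q - t\<bar> < d \<longrightarrow> P p q"
      using d(1) by blast
  qed
  moreover have "pulled_value (\<mu> 0) (move (insert (\<mu> 0) C) \<alpha>)" "pulled_value (\<mu> 1) (move (insert (\<mu> 1) C) \<alpha>)"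
    using pulled_value_off[OF in'(1,2)] \<mu>(2,3) by auto
  ultimately show ?thesis unfolding P_def subpath_of_whole by blast
qed

end

text \<open>A homotopy that avoids \<open>b\<close> makes \<open>\<alpha>\<close> thin. The ends of
  \<open>\<mu>\<close> are then off the loop, while \<open>\<mu>\<close> itself may cross
  it.\<close>

lemma moves_commute:
  assumes C: "tokens 2 C"
    and triv: "\<And>\<kappa>. plane_chart M \<kappa> \<Longrightarrow> C \<inter> range \<kappa> = {} \<Longrightarrow> trivial_swaps (\<kappa> ` cball 0 1) C"
    and \<alpha>: "track (insert b C) \<alpha>" "\<alpha> 0 = a" "\<alpha> 1 = a" and \<mu>: "track (insert a C) \<mu>" "\<mu> 0 = b" "\<mu> 1 = b"
  shows "move (insert b C) \<alpha> + move (insert a C) \<mu> = move (insert a C) \<mu> + move (insert b C) \<alpha>"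
proof -
  have Cf: "finite C" "C \<subseteq> topspace M" using C unfolding tokens_def by auto
  have b: "b \<in> topspace M" "b \<notin> C" using track_in[OF \<mu>(1), of 0] \<mu>(2) by auto
  obtain \<alpha>' where a': "path_homotopic (subtopology M (topspace M - insert b C)) \<alpha> \<alpha>'" "thin M (\<alpha>' ` {0..1})"
    using thin_track[OF _ _ \<alpha>(1)] Cf b by auto
  have tr: "track (insert b C) \<alpha>'" by (rule track_homotopic(2)[OF a'(1)])
  then have "track C \<alpha>'" "b \<notin> \<alpha>' ` {0..1}" unfolding track_insert by auto
  moreover have "\<alpha>' 0 = a" "\<alpha>' 1 = a" using path_homotopic_imp(3,4)[OF a'(1)] \<alpha> by simp_all
  moreover have "\<exists>\<kappa>. good_chart C \<kappa> \<and> \<kappa> 0 = q \<and> range \<kappa> \<subseteq> U" if "openin M U" "q \<in> U" "q \<notin> C" for U q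
    using good_chart_exists[OF triv Cf that] by blast
  ultimately have "move (insert (\<mu> 0) C) \<alpha>' + move (insert a C) \<mu> = move (insert a C) \<mu> + move (insert (\<mu> 1) C) \<alpha>'"
    using a'(2) \<mu> by (intro thin_loop_cross[OF C]) auto
  moreover have "move (insert b C) \<alpha> = move (insert b C) \<alpha>'"
    by (rule move_homotopic[OF tokens_C_insert[OF C b] a'(1)])
  ultimately show ?thesis using \<mu>(2,3) by simp
qed

end

section \<open>Functors with a full image\<close>

context surface_conf
begin

text \<open>The properties of a symmetric group that enter the argument. Surjectivity is demanded at
  every configuration because the standard configurations of different charts serve as base
  points.\<close>

definition full_image :: "'f set \<Rightarrow> bool" where
  "full_image S \<longleftrightarrow> add_subgroup S \<and> finite S \<and> card S \<le> fact (n - 1) \<and> center_in S \<subseteq> {0} \<and>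
     (\<forall>\<gamma>. pathin (uconf n M) \<gamma> \<longrightarrow> \<Phi> \<gamma> \<in> S) \<and>
     (\<forall>B\<in>topspace (uconf n M). \<forall>x\<in>S. \<exists>\<gamma>\<in>loops_at (uconf n M) B. \<Phi> \<gamma> = x)"

lemma full_imageD:
  assumes "full_image S"
  shows "add_subgroup S" "finite S" "card S \<le> fact (n - 1)" "center_in S \<subseteq> {0}"
    "pathin (uconf n M) \<gamma> \<Longrightarrow> \<Phi> \<gamma> \<in> S"
    "B \<in> topspace (uconf n M) \<Longrightarrow> x \<in> S \<Longrightarrow> \<exists>\<gamma>\<in>loops_at (uconf n M) B. \<Phi> \<gamma> = x"
  using assms unfolding full_image_def by simp_all

end

context surface_chart
begin

context
  assumes n: "5 \<le> n"
begin

lemma labelled_base: "labelled (pt \<circ> real)"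
  by (rule labelled_pt) simp

lemma full_image_value:
  assumes S: "full_image S" and x: "x \<in> S"
  obtains g where "word (pt \<circ> real) x g" "g ` {..<n} = (pt \<circ> real) ` {..<n}"
proof -
  let ?f = "pt \<circ> real"
  have "?f ` {..<n} \<in> topspace (uconf n M)"
    using labelled_base card_image[of ?f "{..<n}"] unfolding labelled_def topspace_uconf by simp
  from full_imageD(6)[OF S this x] obtain \<gamma> where \<gamma>: "\<gamma> \<in> loops_at (uconf n M) (?f ` {..<n})" "\<Phi> \<gamma> = x" ..
  then have "pathin (uconf n M) \<gamma>" "?f ` {..<n} = \<gamma> 0" "\<gamma> 1 = ?f ` {..<n}" unfolding loops_at_def by auto
  from path_word[OF this(1) labelled_base this(2)] this(3) show ?thesis using that \<gamma>(2) by metis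
qed

lemma half_twist_zero:
  assumes S: "full_image S" and i: "i < n - 1" shows "half_twist i = 0"
proof -
  note S' = full_imageD[OF S]
  have in_S: "half_twist k \<in> S" if k: "k < n - 1" for k
  proof -
    let ?I = "real ` ({..<n} - {k, Suc k})"
    have c: "real k + 3/2 \<noteq> real j" for j
    proof
      assume "real k + 3/2 = real j"
      then have "2 * k + 3 = 2 * j" by linarith
      then show False by presburger
    qed
    have mv: "move (pt ` insert x ?I) (chord y z) \<in> S" if "x \<notin> ?I" "y \<notin> insert x ?I" "z \<notin> insert x ?I" for x y z
    proof -
      have "tokens 1 (pt ` insert x ?I)" using that(1) k by (intro tokens_pt) (auto simp: card_image card_Diff_subset)
      from move_pathin[OF this track_chord[OF that(2,3)]] show ?thesis unfolding move_def by (rule S'(5))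
    qed
    have "half_twist k = move (pt ` insert (real (Suc k)) ?I) (chord k (k + 3/2)) +
     move (pt ` insert (k + 3/2) ?I) (chord (Suc k) k) + move (pt ` insert (real k) ?I) (chord (k + 3/2) (Suc k))"
      using k by (intro half_twist_eq_moves) simp
    moreover have "move (pt ` insert (real (Suc k)) ?I) (chord k (k + 3/2)) \<in> S"
      using c[of "Suc k"] c by (intro mv) auto
    moreover have "move (pt ` insert (k + 3/2) ?I) (chord (Suc k) k) \<in> S"
      using c[of "Suc k"] c[of k] c by (intro mv) auto
    moreover have "move (pt ` insert (real k) ?I) (chord (k + 3/2) (Suc k)) \<in> S"
      using c[of k] c by (intro mv) auto
    ultimately show ?thesis using S'(1) unfolding add_subgroup_def by simp
  qed
  define s where "s = half_twist 0"
  \<comment> \<open>The counting argument with \<open>N = n - 1\<close> generators in a group of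
    order at most \<open>fact N\<close>.\<close>
  have s: "half_twist k = s" if "k < n - 1" for k
    unfolding s_def using that n
    by (intro braid_relations.all_eq_of_card_le_fact[OF braid_relations_half_twist S'(1,2) in_S _ S'(3)]) auto
  let ?f = "pt \<circ> real"
  \<comment> \<open>Pushes of token \<open>k\<close> are conjugate to pushes of token 0 by some
    \<open>y\<close> in \<open>gen_subgroup s\<close>, and \<open>y\<close> commutes with
    \<open>s\<close>.\<close>
  have push: "x + s = s + x" if x: "x \<in> push_set ?f k" and k: "k < n" for x k
  proof -
    have "\<exists>y\<in>gen_subgroup s. y + x - y \<in> push_set ?f 0" using n by (intro push_set_transfer[OF s k _ x]) auto
    then obtain y where y: "y \<in> gen_subgroup s" "y + x - y \<in> push_set ?f 0" by blast
    have "y + s = s + y" using y(1) by (rule gen_subgroup_commute) simp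
    moreover have "(y + x - y) + s = s + (y + x - y)"
      using push_commutes_half_twist[OF n s s y(2)] n by simp
    ultimately have "(- y + (y + x - y) + y) + s = s + (- y + (y + x - y) + y)"
      by (intro add_commute_add add_commute_uminus[of y s, symmetric, symmetric]) (auto intro: add_commute_uminus)
    then show ?thesis by (simp add: diff_conv_add_uminus add.assoc del: add_uminus_conv_diff)
  qed
  have pushes: "x + s = s + x" if "x \<in> pushes ?f" for x
    using that
  proof (induction rule: pushes.induct)
    case (add x k \<alpha>)
    then have "move (others ?f k) \<alpha> \<in> push_set ?f k" unfolding push_set_def by blast
    then show ?case using add push by (intro add_commute_add) auto
  qed simp
  have "s + x = x + s" if x: "x \<in> S" for x
  proof -
    obtain g where "word ?f x g" "g ` {..<n} = ?f ` {..<n}" using full_image_value[OF S x] .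
    then obtain p y where py: "p \<in> pushes ?f" "y \<in> gen_subgroup s" "x = p + y"
      using word_decomposition[OF s] by metis
    have "y + s = s + y" using py(2) by (rule gen_subgroup_commute) simp
    then show ?thesis using add_commute_add[OF pushes[OF py(1)]] py(3) by metis
  qed
  then have "s \<in> center_in S" using in_S[of 0] n unfolding center_in_def s_def by auto
  then show ?thesis using s[OF i] S'(4) by auto
qed

text \<open>With trivial half twists the conjugation in \<open>push_set_transfer\<close> disappears,
  so pushes of all tokens take the same values, and concatenating loops turns a sum of pushes into a
  single push of token \<open>i\<close>.\<close>

lemma full_image_push_set:
  assumes S: "full_image S" and x: "x \<in> S" and i: "i < n" shows "x \<in> push_set (pt \<circ> real) i"
proof -
  let ?f = "pt \<circ> real"
  have s: "half_twist k = 0" if "k < n - 1" for k using half_twist_zero[OF S that] .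
  have transfer: "x \<in> push_set ?f i" if x: "x \<in> push_set ?f k" and k: "k < n" for x k
    using push_set_transfer[OF s k i x] by (simp add: gen_subgroup_of_zero)
  have t: "tokens 1 (others ?f i)" by (rule tokens_others[OF labelled_base i])
  have pushes: "x \<in> push_set ?f i" if "x \<in> pushes ?f" for x
    using that
  proof (induction rule: pushes.induct)
    case zero
    have f: "?f i \<in> topspace M - others ?f i" by (rule labelled_in[OF labelled_base i])
    then have "track (others ?f i) (\<lambda>_. ?f i)" unfolding track_def by simp
    moreover have "0 = move (others ?f i) (\<lambda>_. ?f i)" using move_const[OF t f] by simp
    ultimately show ?case unfolding push_set_def by blast
  next
    case (add x k \<alpha>)
    then have "move (others ?f k) \<alpha> \<in> push_set ?f k" unfolding push_set_def by blast
    then have "move (others ?f k) \<alpha> \<in> push_set ?f i" using transfer add(2) by blast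
    then obtain q where q: "track (others ?f i) q" "q 0 = ?f i" "q 1 = ?f i" "move (others ?f k) \<alpha> = move (others ?f i) q"
      unfolding push_set_def by blast
    obtain p where p: "track (others ?f i) p" "p 0 = ?f i" "p 1 = ?f i" "x = move (others ?f i) p"
      using add.IH unfolding push_set_def by blast
    have "track (others ?f i) (path_concat p q)" using p q by (intro track_concat) auto
    moreover have "x + move (others ?f k) \<alpha> = move (others ?f i) (path_concat p q)"
      using move_concat[OF t p(1) q(1)] p q by simp
    ultimately show ?case unfolding push_set_def using p(2) q(3) by (intro CollectI exI[of _ "path_concat p q"]) simp
  qed
  obtain g where "word ?f x g" "g ` {..<n} = ?f ` {..<n}" using full_image_value[OF S x] .
  then obtain p y where py: "p \<in> pushes ?f" "y \<in> gen_subgroup 0" "x = p + y"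
    using word_decomposition[OF s] by metis
  then show ?thesis using pushes by (simp add: gen_subgroup_of_zero)
qed

end

end

context surface_conf
begin

theorem full_image_abelian:
  assumes n: "5 \<le> n" and S: "full_image S" and xy: "x \<in> S" "y \<in> S"
  shows "x + y = y + x"
proof -
  have sc: "surface_chart M n \<Phi> \<kappa>" if "plane_chart M \<kappa>" for \<kappa> by unfold_locales (rule that)
  obtain q where "q \<in> topspace M" using surface unfolding subsurface_def by blast
  then obtain \<kappa> where \<kappa>: "plane_chart M \<kappa>" using surface unfolding subsurface_def by blast
  interpret surface_chart M n \<Phi> \<kappa> by (rule sc[OF \<kappa>])
  let ?f = "pt \<circ> real" and ?C = "others2 (pt \<circ> real) 0 1"
  have C: "tokens 2 ?C" using n by (intro tokens_others2[OF labelled_base[OF n]]) auto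
  have o: "others ?f 0 = insert (?f 1) ?C" "others ?f 1 = insert (?f 0) ?C"
    using n others_split[of 0 1 ?f] others_split[of 1 0 ?f] others2_comm[of ?f 1 0] by auto
  \<comment> \<open>Half twists are trivial in every chart \<open>\<kappa>'\<close>, not only in the
    one that carries the standard configuration.\<close>
  have triv: "trivial_swaps (\<kappa>' ` cball 0 1) ?C" if k: "plane_chart M \<kappa>'" "?C \<inter> range \<kappa>' = {}" for \<kappa>'
    using surface_chart.half_twist_trivial_swaps[OF sc[OF k(1)] _ surface_chart.half_twist_zero[OF sc[OF k(1)] n S] C k(2)] n by simp
  obtain \<alpha> where \<alpha>: "track (insert (?f 1) ?C) \<alpha>" "\<alpha> 0 = ?f 0" "\<alpha> 1 = ?f 0" "x = move (insert (?f 1) ?C) \<alpha>"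
    using full_image_push_set[OF n S xy(1), of 0] n unfolding push_set_def o by auto
  obtain \<mu> where \<mu>: "track (insert (?f 0) ?C) \<mu>" "\<mu> 0 = ?f 1" "\<mu> 1 = ?f 1" "y = move (insert (?f 0) ?C) \<mu>"
    using full_image_push_set[OF n S xy(2), of 1] n unfolding push_set_def o by auto
  show ?thesis using moves_commute[OF C triv \<alpha>(1-3) \<mu>(1-3)] \<alpha>(4) \<mu>(4) by simp
qed

end

section \<open>Symmetric groups and fundamental groups\<close>

text \<open>The zero functor makes the lemmas on paths of tokens, such as
  \<open>track_exists\<close> and \<open>move_pathin\<close>, available where no homomorphism is
  given.\<close>

lemma trivial_surface_conf:
  assumes "subsurface M (topspace M)" shows "surface_conf M n (\<lambda>_. 0 :: int)"
  by unfold_locales (use assms in auto)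

lemma uconf_path_connected:
  assumes M: "subsurface M (topspace M)" shows "path_connected_space (uconf n M)"
proof -
  interpret surface_conf M n "\<lambda>_. 0 :: int" by (rule trivial_surface_conf[OF M])
  have "\<exists>\<gamma>. pathin (uconf n M) \<gamma> \<and> \<gamma> 0 = A \<and> \<gamma> 1 = B"
    if A: "A \<in> topspace (uconf n M)" and B: "B \<in> topspace (uconf n M)" for A B
    using B
  proof (induction "card (B - A)" arbitrary: B)
    case 0
    have fin: "finite B" "finite A" "card B = card A" using 0 A unfolding topspace_uconf by auto
    then have "B = A" using 0 card_subset_eq[of A B] by simp
    then show ?case using A by (intro exI[of _ "\<lambda>_. A"]) simp
  next
    case (Suc k)
    have fin: "finite B" "finite A" "card B = card A" "B \<subseteq> topspace M" "A \<subseteq> topspace M"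
      using Suc(3) A unfolding topspace_uconf by auto
    obtain y where y: "y \<in> B" "y \<notin> A" using Suc(2) by (metis card.empty DiffE Suc_neq_Zero ex_in_conv)
    have "card (A - B) = card (B - A)" using fin by (simp add: card_Diff_subset_Int Int_commute)
    then obtain x where x: "x \<in> A" "x \<notin> B" using Suc(2) by (metis card.empty DiffE Suc_neq_Zero ex_in_conv)
    let ?C = "B - {y}"
    have "card B = Suc (card ?C)" using y(1) fin(1) by (metis card_Suc_Diff1)
    then have C: "tokens 1 ?C" using Suc(3) unfolding tokens_def topspace_uconf by auto
    obtain e where e: "track ?C e" "e 0 = x" "e 1 = y"
      by (rule track_exists[of ?C x y]) (use fin x y in auto)
    have p: "pathin (uconf n M) (\<lambda>t. insert (e t) ?C)" by (rule move_pathin[OF C e(1)])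
    have "insert x ?C - A = (B - A) - {y}" using x by auto
    then have "k = card (insert x ?C - A)" using Suc(2) y fin by simp
    moreover have "insert x ?C \<in> topspace (uconf n M)" using pathin_in[OF p, of 0] e(2) by simp
    ultimately obtain \<gamma> where \<gamma>: "pathin (uconf n M) \<gamma>" "\<gamma> 0 = A" "\<gamma> 1 = insert x ?C" using Suc(1) by blast
    have "pathin (uconf n M) (path_concat \<gamma> (\<lambda>t. insert (e t) ?C))" using \<gamma> p e(2) by (intro pathin_path_concat) auto
    moreover have "insert (e 1) ?C = B" using e(3) y by auto
    ultimately show ?case using \<gamma>(2) by (intro exI[of _ "path_concat \<gamma> (\<lambda>t. insert (e t) ?C)"]) simp
  qed
  then show ?thesis unfolding path_connected_space_def by blast
qed

text \<open>Three moves through a spare point \<open>z\<close>: from \<open>x\<close> to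
  \<open>z\<close>, from \<open>y\<close> to \<open>x\<close>, from \<open>z\<close> to
  \<open>y\<close>. The strands are concatenations of these tracks with constant paths.\<close>

lemma transposition_monodromy:
  assumes M: "subsurface M (topspace M)" and Q: "Q \<in> topspace (uconf n M)" and xy: "x \<in> Q" "y \<in> Q" "x \<noteq> y"
  shows "\<exists>\<gamma>\<in>loops_at (uconf n M) Q. sym_apply (monodromy M Q \<gamma>) = Transposition.transpose x y"
proof -
  interpret surface_conf M n "\<lambda>_. 0 :: int" by (rule trivial_surface_conf[OF M])
  have Q': "finite Q" "Q \<subseteq> topspace M" "card Q = n" using Q unfolding topspace_uconf by auto
  obtain z where z: "z \<in> topspace M - Q" using fresh_point[OF Q'(1)] .
  let ?C = "Q - {x, y}"
  have Qe: "Q = insert x (insert y ?C)" using xy by auto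
  then have "card Q = Suc (Suc (card ?C))" using xy Q'(1) by (metis card_insert_disjoint finite_Diff insertE Diff_iff insert_iff finite_insert)
  then have C: "tokens 2 ?C" using Q' unfolding tokens_def by auto
  have tok: "tokens 1 (insert u ?C)" if "u \<in> topspace M" "u \<notin> ?C" for u using tokens_C_insert[OF C that] .
  have in': "x \<in> topspace M" "y \<in> topspace M" "z \<in> topspace M" "z \<noteq> x" "z \<noteq> y" "z \<notin> ?C" using xy Q' z by auto
  obtain \<alpha> where \<alpha>: "track (insert y ?C) \<alpha>" "\<alpha> 0 = x" "\<alpha> 1 = z"
    by (rule track_exists[of "insert y ?C" x z]) (use in' xy Q' in auto)
  obtain \<beta> where \<beta>: "track (insert z ?C) \<beta>" "\<beta> 0 = y" "\<beta> 1 = x"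
    by (rule track_exists[of "insert z ?C" y x]) (use in' xy Q' in auto)
  obtain \<delta> where \<delta>: "track (insert x ?C) \<delta>" "\<delta> 0 = z" "\<delta> 1 = y"
    by (rule track_exists[of "insert x ?C" z y]) (use in' xy Q' in auto)
  let ?a = "\<lambda>t. insert (\<alpha> t) (insert y ?C)" and ?b = "\<lambda>t. insert (\<beta> t) (insert z ?C)" and ?d = "\<lambda>t. insert (\<delta> t) (insert x ?C)"
  let ?\<gamma> = "path_concat (path_concat ?a ?b) ?d"
  have p: "pathin (uconf n M) ?a" "pathin (uconf n M) ?b" "pathin (uconf n M) ?d"
    by (rule move_pathin[OF tok \<alpha>(1)] move_pathin[OF tok \<beta>(1)] move_pathin[OF tok \<delta>(1)]; use in' in simp)+
  have \<gamma>: "pathin (uconf n M) ?\<gamma>" "?\<gamma> 0 = Q" "?\<gamma> 1 = Q"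
  proof -
    have j: "?a 1 = ?b 0" "path_concat ?a ?b 1 = ?d 0" using \<alpha> \<beta> \<delta> by (simp_all add: insert_commute)
    show "pathin (uconf n M) ?\<gamma>" by (intro pathin_path_concat p j)
    show "?\<gamma> 0 = Q" using \<alpha>(2) Qe[symmetric] by simp
    show "?\<gamma> 1 = Q" using \<delta>(3) Qe[symmetric] by (simp add: insert_commute)
  qed
  then have loop: "?\<gamma> \<in> loops_at (uconf n M) Q" unfolding loops_at_def by simp
  have strands: "strand M ?a \<alpha>" "strand M ?b \<beta>" "strand M ?d \<delta>"
    using track_path \<alpha> \<beta> \<delta> unfolding strand_def by auto
  have const: "strand M \<zeta> (\<lambda>_. u)" if "u \<in> topspace M" "\<And>t. u \<in> \<zeta> t" for \<zeta> u
    using that unfolding strand_def by simp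
  have "monodromy_fun M Q ?\<gamma> u = Transposition.transpose x y u" for u
  proof -
    consider "u = x" | "u = y" | "u \<in> ?C" | "u \<notin> Q" using Qe by blast
    then show ?thesis
    proof cases
      case 1
      have "strand M ?\<gamma> (path_concat (path_concat \<alpha> (\<lambda>_. z)) \<delta>)"
        using strands \<alpha> \<delta> in' by (intro strand_concat const) auto
      from monodromy_fun_strand[OF Hausdorff \<gamma>(1,2) this] show ?thesis using 1 \<alpha> \<delta> by simp
    next
      case 2
      have "strand M ?\<gamma> (path_concat (path_concat (\<lambda>_. y) \<beta>) (\<lambda>_. x))"
        using strands \<beta> in' by (intro strand_concat const) auto
      from monodromy_fun_strand[OF Hausdorff \<gamma>(1,2) this] show ?thesis using 2 by simp
    next
      case 3
      then have "strand M ?\<gamma> (path_concat (path_concat (\<lambda>_. u) (\<lambda>_. u)) (\<lambda>_. u))"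
        using Q' by (intro strand_concat const) auto
      from monodromy_fun_strand[OF Hausdorff \<gamma>(1,2) this] show ?thesis using 3
        by (simp add: Transposition.transpose_def)
    next
      case 4
      then show ?thesis using xy unfolding monodromy_fun_def by (auto simp: Transposition.transpose_def)
    qed
  qed
  then show ?thesis using loop sym_apply_monodromy[OF Hausdorff loop] by (intro bexI[OF _ loop]) auto
qed

lemma monodromy_surjective:
  assumes M: "subsurface M (topspace M)" and Q: "Q \<in> topspace (uconf n M)" and \<sigma>: "\<sigma> \<in> sym_on Q"
  shows "\<exists>\<gamma>\<in>loops_at (uconf n M) Q. monodromy M Q \<gamma> = \<sigma>"
proof -
  have H: "Hausdorff_space M" using M unfolding subsurface_def by simp
  have fin: "finite Q" using Q unfolding topspace_uconf by auto
  have "\<exists>\<gamma>\<in>loops_at (uconf n M) Q. sym_apply (monodromy M Q \<gamma>) = p" if "p permutes Q" for p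
    using that fin
  proof (induction rule: permutes_induct)
    case id
    have c: "(\<lambda>_. Q) \<in> loops_at (uconf n M) Q" using Q unfolding loops_at_def by simp
    have "monodromy_fun M Q (\<lambda>_. Q) u = u" for u
    proof (cases "u \<in> Q")
      case True
      have "strand M (\<lambda>_. Q) (\<lambda>_. u)" using True Q unfolding strand_def topspace_uconf by auto
      from monodromy_fun_strand[OF H _ _ this, of n Q] show ?thesis using Q by simp
    qed (simp add: monodromy_fun_def)
    then show ?case using sym_apply_monodromy[OF H c] by (intro bexI[OF _ c]) auto
  next
    case (swap a b p)
    obtain \<gamma> where \<gamma>: "\<gamma> \<in> loops_at (uconf n M) Q" "sym_apply (monodromy M Q \<gamma>) = p" using swap by blast
    obtain \<delta> where \<delta>: "\<delta> \<in> loops_at (uconf n M) Q" "sym_apply (monodromy M Q \<delta>) = Transposition.transpose a b"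
      using transposition_monodromy[OF M Q] swap by blast
    have "path_concat \<gamma> \<delta> \<in> loops_at (uconf n M) Q" using \<gamma>(1) \<delta>(1) unfolding loops_at_def by (simp add: pathin_path_concat)
    moreover have "sym_apply (monodromy M Q (path_concat \<gamma> \<delta>)) = Transposition.transpose a b \<circ> p"
      using monodromy_concat[OF H \<gamma>(1) \<delta>(1)] \<gamma>(2) \<delta>(2) by (simp add: plus_sym.rep_eq)
    ultimately show ?case by blast
  qed
  then obtain \<gamma> where "\<gamma> \<in> loops_at (uconf n M) Q" "sym_apply (monodromy M Q \<gamma>) = sym_apply \<sigma>"
    using \<sigma> unfolding sym_on_def by blast
  then show ?thesis by (intro bexI[of _ \<gamma>]) (simp_all add: sym_apply_inject)
qed

lemma sym_on_subgroup: "add_subgroup (sym_on Q)"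
  unfolding add_subgroup_def sym_on_def
  by (auto simp: zero_sym.rep_eq plus_sym.rep_eq uminus_sym.rep_eq permutes_id permutes_compose permutes_inv)

lemma center_sym_on:
  assumes "finite Q" "3 \<le> card Q" shows "center_in (sym_on Q) \<subseteq> {0}"
proof
  fix a assume a: "a \<in> center_in (sym_on Q)"
  let ?f = "sym_apply a"
  have f: "?f permutes Q" using a unfolding center_in_def sym_on_def by simp
  have "?f x = x" for x
  proof (rule ccontr)
    assume ne: "?f x \<noteq> x"
    then have x: "x \<in> Q" using f permutes_not_in by metis
    then have fx: "?f x \<in> Q" using permutes_in_image[OF f] by simp
    \<comment> \<open>Here \<open>3 \<le> card Q\<close> gives a third point \<open>z\<close>. The
      transposition of \<open>?f x\<close> and \<open>z\<close> fixes \<open>x\<close> but moves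
      \<open>?f x\<close>, so it does not commute with \<open>?f\<close>.\<close>
    have "\<not> Q \<subseteq> {x, ?f x}" using card_mono[of "{x, ?f x}" Q] assms(2) by (auto simp: card_insert_if split: if_splits)
    then obtain z where z: "z \<in> Q" "z \<noteq> x" "z \<noteq> ?f x" by blast
    let ?t = "Transposition.transpose (?f x) z"
    have t: "?t permutes Q" using fx z by (intro permutes_swap_id) auto
    then have "sym_apply (Sym ?t) = ?t" by (intro Sym_inverse) (simp add: permutes_bij)
    moreover have "Sym ?t \<in> sym_on Q" using t calculation unfolding sym_on_def by simp
    then have "sym_apply (a + Sym ?t) = sym_apply (Sym ?t + a)" using a unfolding center_in_def by simp
    ultimately have "?t (?f x) = ?f (?t x)" by (simp add: plus_sym.rep_eq fun_eq_iff del: Transposition.transpose_apply_first)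
    moreover have "?t (?f x) = z" "?t x = x" using ne z by (auto simp: Transposition.transpose_def)
    ultimately show False using z by simp
  qed
  then have "?f = sym_apply 0" by (auto simp: zero_sym.rep_eq)
  then show "a \<in> {0}" by (simp add: sym_apply_inject)
qed

section \<open>Loop classes and the fundamental group\<close>

definition loop_class :: "'a topology \<Rightarrow> 'a \<Rightarrow> (real \<Rightarrow> 'a) \<Rightarrow> (real \<Rightarrow> 'a) set" where
  "loop_class X x p = loop_homotopy X x `` {p}"

lemma loop_class_iff: "q \<in> loop_class X x p \<longleftrightarrow> p \<in> loops_at X x \<and> path_homotopic X p q"
proof -
  have "q \<in> loops_at X x" if "p \<in> loops_at X x" "path_homotopic X p q"
    using that path_homotopic_imp[OF that(2)] unfolding loops_at_def by simp
  then show ?thesis unfolding loop_class_def loop_homotopy_def path_homotopic_def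
    by (auto simp: loops_at_def)
qed

lemma loop_class_self: "p \<in> loops_at X x \<Longrightarrow> p \<in> loop_class X x p"
  unfolding loop_class_iff loops_at_def by (simp add: path_homotopic_refl)

lemma loop_class_loops: "q \<in> loop_class X x p \<Longrightarrow> q \<in> loops_at X x"
  unfolding loop_class_iff loops_at_def using path_homotopic_imp by fastforce

lemma loop_class_eq:
  assumes "q \<in> loop_class X x p" shows "loop_class X x q = loop_class X x p"
proof -
  have "p \<in> loops_at X x" "q \<in> loops_at X x" "path_homotopic X p q"
    using assms loop_class_loops[OF assms] unfolding loop_class_iff by auto
  then show ?thesis
    using path_homotopic_trans path_homotopic_sym unfolding set_eq_iff loop_class_iff by metis
qed

lemma fundamental_group_carrier: "carrier (fundamental_group X x) = loop_class X x ` loops_at X x"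
  unfolding fundamental_group_def quotient_def loop_class_def by auto

lemma loops_concat: "p \<in> loops_at X x \<Longrightarrow> q \<in> loops_at X x \<Longrightarrow> path_concat p q \<in> loops_at X x"
  unfolding loops_at_def by (simp add: pathin_path_concat)

lemma fundamental_group_mult:
  assumes p: "p \<in> loops_at X x" and q: "q \<in> loops_at X x"
  shows "loop_class X x p \<otimes>\<^bsub>fundamental_group X x\<^esub> loop_class X x q = loop_class X x (path_concat p q)"
proof -
  have "loop_class X x (path_concat r s) = loop_class X x (path_concat p q)"
    if "r \<in> loop_class X x p" "s \<in> loop_class X x q" for r s
  proof (rule loop_class_eq)
    have "path_homotopic X (path_concat p q) (path_concat r s)"
      using that p q unfolding loop_class_iff loops_at_def by (intro path_homotopic_concat) auto
    then show "path_concat r s \<in> loop_class X x (path_concat p q)"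
      unfolding loop_class_iff using loops_concat[OF p q] by simp
  qed
  moreover have "p \<in> loop_class X x p" "q \<in> loop_class X x q" using loop_class_self[OF p] loop_class_self[OF q] by auto
  moreover have "loop_class X x p \<otimes>\<^bsub>fundamental_group X x\<^esub> loop_class X x q =
      (\<Union>r\<in>loop_class X x p. \<Union>s\<in>loop_class X x q. loop_class X x (path_concat r s))"
    unfolding fundamental_group_def loop_class_def by simp
  ultimately show ?thesis by blast
qed

lemma no_abelian_small_image:
  assumes n: "5 \<le> n" "m < n" "3 \<le> m" and M: "subsurface M (topspace M)" and P: "P \<in> topspace (uconf n M)"
    and Q: "finite Q" "card Q = m"
    and add: "\<And>p q. p \<in> loops_at (uconf n M) P \<Longrightarrow> q \<in> loops_at (uconf n M) P \<Longrightarrow> \<phi> (path_concat p q) = \<phi> p + \<phi> q"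
    and hom: "\<And>p q. p \<in> loops_at (uconf n M) P \<Longrightarrow> path_homotopic (uconf n M) p q \<Longrightarrow> \<phi> p = \<phi> q"
  shows "\<phi> ` loops_at (uconf n M) P \<noteq> sym_on Q"
proof
  let ?X = "uconf n M"
  assume image: "\<phi> ` loops_at ?X P = sym_on Q"
  have conn: "path_connected_space ?X" by (rule uconf_path_connected[OF M])
  obtain \<Phi> where \<Phi>: "path_functor ?X \<Phi>" "\<And>p. p \<in> loops_at ?X P \<Longrightarrow> \<Phi> p = \<phi> p"
    "\<And>p. pathin ?X p \<Longrightarrow> \<exists>q\<in>loops_at ?X P. \<Phi> p = \<phi> q"
    by (rule path_functor_extension[OF conn P, of \<phi>]) (use add hom in auto)
  interpret path_functor ?X \<Phi> by (rule \<Phi>(1))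
  interpret surface_conf M n \<Phi> by unfold_locales (rule M)
  have sub: "add_subgroup (sym_on Q)" by (rule sym_on_subgroup)
  have center: "center_in (sym_on Q) \<subseteq> {0}" using Q n by (intro center_sym_on) auto
  have card: "finite (sym_on Q)" "card (sym_on Q) = fact m" using sym_on_card[OF Q(1)] Q(2) by auto
  have in_sym: "\<Phi> \<gamma> \<in> sym_on Q" if "pathin ?X \<gamma>" for \<gamma> using \<Phi>(3)[OF that] image by auto
  have "full_image (sym_on Q)"
    unfolding full_image_def
  proof (intro conjI ballI allI impI)
    show "card (sym_on Q) \<le> fact (n - 1)" unfolding card using n by (intro fact_mono) auto
    fix B x assume B: "B \<in> topspace ?X" and x: "x \<in> sym_on Q"
    \<comment> \<open>Surjectivity is carried from \<open>P\<close> to \<open>B\<close> by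
      conjugation with a path between them.\<close>
    obtain c where c: "pathin ?X c" "c 0 = P" "c 1 = B" using conn P B unfolding path_connected_space_def by blast
    have "\<Phi> c + x - \<Phi> c \<in> sym_on Q"
      using sub in_sym[OF c(1)] x add_subgroup_diff[OF sub] unfolding add_subgroup_def by blast
    then obtain p where p: "p \<in> loops_at ?X P" "\<Phi> p = \<Phi> c + x - \<Phi> c" using image \<Phi>(2) by (metis imageE)
    let ?l = "path_concat (path_reverse c) (path_concat p c)"
    have p': "pathin ?X p" "p 0 = P" "p 1 = P" using p(1) unfolding loops_at_def by auto
    have "?l \<in> loops_at ?X B" using c p' unfolding loops_at_def by (simp add: pathin_path_concat pathin_reverse)
    moreover have "\<Phi> ?l = x"
      using c p' p(2) by (simp add: concat reverse pathin_path_concat pathin_reverse)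
    ultimately show "\<exists>\<gamma>\<in>loops_at ?X B. \<Phi> \<gamma> = x" by blast
  qed (use sub card center in_sym in auto)
  \<comment> \<open>A commutative group is its own centre, here trivial, whereas the symmetric group
    has order at least 6.\<close>
  from full_image_abelian[OF n(1) this] have "sym_on Q \<subseteq> {0}" using center unfolding center_in_def by blast
  then have "card (sym_on Q) \<le> 1" using card_mono[of "{0}" "sym_on Q"] by simp
  moreover have "fact 3 \<le> (fact m :: nat)" by (rule fact_mono[OF n(3)])
  ultimately show False unfolding card by (simp add: fact_numeral)
qed

theorem corollary1p4:
  fixes n m g h :: nat
    and \<Sigma>\<^sub>g :: "'a topology" and \<Sigma>\<^sub>h :: "'b topology"
    and P :: "'a set" and Q :: "'b set"
  assumes "n \<ge> 5" and "m \<ge> 3" and "n > m"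
    and "closed_oriented_surface g \<Sigma>\<^sub>g" and "closed_oriented_surface h \<Sigma>\<^sub>h"
    and "P \<in> topspace (uconf n \<Sigma>\<^sub>g)" and "Q \<in> topspace (uconf m \<Sigma>\<^sub>h)"
  shows "\<not> (\<exists>f \<in> hom (surface_braid_group n \<Sigma>\<^sub>g P) (surface_braid_group m \<Sigma>\<^sub>h Q).
               f ` carrier (surface_braid_group n \<Sigma>\<^sub>g P) = carrier (surface_braid_group m \<Sigma>\<^sub>h Q))"
proof
  let ?X = "uconf n \<Sigma>\<^sub>g" and ?Y = "uconf m \<Sigma>\<^sub>h"
  let ?G = "fundamental_group ?X P" and ?H = "fundamental_group ?Y Q"
  let ?c = "loop_class ?X P" and ?d = "loop_class ?Y Q"
  assume "\<exists>f \<in> hom (surface_braid_group n \<Sigma>\<^sub>g P) (surface_braid_group m \<Sigma>\<^sub>h Q).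
               f ` carrier (surface_braid_group n \<Sigma>\<^sub>g P) = carrier (surface_braid_group m \<Sigma>\<^sub>h Q)"
  then obtain f where f: "f \<in> hom ?G ?H" and surj: "f ` carrier ?G = carrier ?H"
    unfolding surface_braid_group_def by blast
  have M: "subsurface \<Sigma>\<^sub>g (topspace \<Sigma>\<^sub>g)" and N: "subsurface \<Sigma>\<^sub>h (topspace \<Sigma>\<^sub>h)"
    using assms closed_oriented_surface_subsurface by blast+
  have HN: "Hausdorff_space \<Sigma>\<^sub>h" using N unfolding subsurface_def by simp
  \<comment> \<open>\<open>f\<close> acts on classes of loops while the monodromy acts on loops, so
    a representative of each image class is chosen; by \<open>mon\<close> its monodromy depends only
    on the class.\<close>
  define \<rho> where "\<rho> p = (SOME r. r \<in> f (?c p))" for p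
  have \<rho>: "\<rho> p \<in> loops_at ?Y Q" "f (?c p) = ?d (\<rho> p)" if p: "p \<in> loops_at ?X P" for p
  proof -
    have "f (?c p) \<in> carrier ?H" using p surj unfolding fundamental_group_carrier by blast
    then obtain r where r: "r \<in> loops_at ?Y Q" "f (?c p) = ?d r" unfolding fundamental_group_carrier by blast
    then have "r \<in> f (?c p)" using loop_class_self by metis
    then have "\<rho> p \<in> f (?c p)" unfolding \<rho>_def by (rule someI[of "\<lambda>r. r \<in> f (?c p)"])
    then have "\<rho> p \<in> ?d r" using r(2) by simp
    from loop_class_loops[OF this] loop_class_eq[OF this] show "\<rho> p \<in> loops_at ?Y Q" "f (?c p) = ?d (\<rho> p)"
      using r(2) by simp_all
  qed
  have mon: "monodromy \<Sigma>\<^sub>h Q r = monodromy \<Sigma>\<^sub>h Q s" if "r \<in> loops_at ?Y Q" "s \<in> loops_at ?Y Q" "?d r = ?d s" for r s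
  proof -
    have "s \<in> ?d r" using loop_class_self[OF that(2)] that(3) by simp
    then have "path_homotopic ?Y r s" unfolding loop_class_iff by simp
    then show ?thesis by (rule monodromy_homotopic[OF HN that(1)])
  qed
  let ?\<phi> = "\<lambda>p. monodromy \<Sigma>\<^sub>h Q (\<rho> p)"
  have add: "?\<phi> (path_concat p q) = ?\<phi> p + ?\<phi> q" if p: "p \<in> loops_at ?X P" and q: "q \<in> loops_at ?X P" for p q
  proof -
    have "f (?c (path_concat p q)) = f (?c p \<otimes>\<^bsub>?G\<^esub> ?c q)" using fundamental_group_mult[OF p q] by simp
    also have "\<dots> = f (?c p) \<otimes>\<^bsub>?H\<^esub> f (?c q)"
      using p q by (intro hom_mult[OF f]) (auto simp: fundamental_group_carrier)
    also have "\<dots> = ?d (path_concat (\<rho> p) (\<rho> q))" using \<rho>[OF p] \<rho>[OF q] fundamental_group_mult by metis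
    finally have "?d (\<rho> (path_concat p q)) = ?d (path_concat (\<rho> p) (\<rho> q))" using \<rho>(2)[OF loops_concat[OF p q]] by simp
    then show ?thesis
      using mon[OF \<rho>(1)[OF loops_concat[OF p q]] loops_concat[OF \<rho>(1)[OF p] \<rho>(1)[OF q]]]
        monodromy_concat[OF HN \<rho>(1)[OF p] \<rho>(1)[OF q]] by simp
  qed
  have hom: "?\<phi> p = ?\<phi> q" if p: "p \<in> loops_at ?X P" and pq: "path_homotopic ?X p q" for p q
  proof -
    have "q \<in> ?c p" unfolding loop_class_iff using p pq by simp
    then have "?c q = ?c p" by (rule loop_class_eq)
    then show ?thesis unfolding \<rho>_def by simp
  qed
  have "?\<phi> ` loops_at ?X P = sym_on Q"
  proof
    show "?\<phi> ` loops_at ?X P \<subseteq> sym_on Q" using monodromy_in[OF HN] \<rho>(1) by blast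
    show "sym_on Q \<subseteq> ?\<phi> ` loops_at ?X P"
    proof
      fix \<sigma> assume "\<sigma> \<in> sym_on Q"
      then obtain r where r: "r \<in> loops_at ?Y Q" "monodromy \<Sigma>\<^sub>h Q r = \<sigma>" using monodromy_surjective[OF N assms(7)] by blast
      then have "?d r \<in> carrier ?H" unfolding fundamental_group_carrier by blast
      then have "?d r \<in> f ` carrier ?G" unfolding surj .
      then obtain p where p: "p \<in> loops_at ?X P" "?d r = f (?c p)" unfolding fundamental_group_carrier by blast
      then have "?\<phi> p = \<sigma>" using mon[OF \<rho>(1)[OF p(1)] r(1)] \<rho>(2)[OF p(1)] r(2) by simp
      then show "\<sigma> \<in> ?\<phi> ` loops_at ?X P" using p(1) by blast
    qed
  qed
  moreover have "finite Q" "card Q = m" using assms(7) unfolding topspace_uconf by auto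
  ultimately show False
    using no_abelian_small_image[OF assms(1,3,2) M assms(6), of Q ?\<phi>] add hom by blast
qed

end
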